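(* Let the system data (no input delays), the functions $g_i(\cdot)=[\phi_i^\top\ \varphi_i^\top\ f_i^\top]^\top$ and matrices $M_i$, $\widehat A_i,\widehat C_i$ ($i\in\mathbb N_\nu$), the matrices $\Gamma_i,\mathfrak H_i,\mathfrak E_i,\mathfrak F_i$ and their Cholesky factors, and the supply rate function $\mathsf s$ with parameters $\widetilde J,J_1,J_2,J_3$ be given as described in the context. Suppose there exist $P_1\in\mathbb S^n$, $P_2\in\mathbb R^{n\times dn}$, $P_3\in\mathbb S^{dn}$, $Q_i,R_i\in\mathbb S^n$ ($i\in\mathbb N_\nu$), $K_0\in\mathbb R^{p\times n}$, $K_i\in\mathbb R^{p\times n}$ and $\mathcal K_i\in\mathbb R^{p\times\kappa_in}$ ($i\in\mathbb N_\nu$) such that $$\begin{bmatrix}P_1&P_2\\ *&P_3\end{bmatrix}+\Big[\mathsf O_n\oplus\big(\mathrm{diag}_{i=1}^{\nu}\, I_{d_i}\otimes Q_i\big)\Big]\succ 0,$$ $$\mathbf Q=\mathrm{diag}_{i=1}^{\nu}Q_i\succ0,\qquad \mathbf R=\mathrm{diag}_{i=1}^{\nu}R_i\succ 0,$$ $$\mathrm{Sy}\big[\mathbf P^\top\boldsymbol\Pi\big]+\boldsymbol\Phi(P_2,P_3,\mathbf Q,\mathbf R,\boldsymbol\Sigma)\prec0,$$ where $$\mathbf P=\big[P_1\ \ \mathsf O_{n,\nu n}\ \ P_2\widehat I\ \ \mathsf O_{n,(\mu n+q+m)}\big],\quad \boldsymbol\Pi=[\boldsymbol\Omega\ \ \mathsf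 O_{n,m}],\quad \boldsymbol\Omega=\mathbf A+B_0\boldsymbol K,\quad \boldsymbol\Sigma=\mathbf C+\mathfrak B_0\boldsymbol K,$$ $$\boldsymbol K=\big[\mathrm{Row}_{i=0}^\nu K_i\ \ \mathrm{Row}_{i=1}^\nu\mathcal K_i(T_i\otimes I_n)\ \ \mathrm{Row}_{i=1}^\nu\mathcal K_i(\widetilde T_i\otimes I_n)\ \ \mathsf O_{p,q}\big],$$ with $\widehat I$ and the map $\boldsymbol\Phi$ defined in the context. Then the closed-loop system with controller parameters $K_0,K_i,\mathcal K_i$ (defined in the context) with supply rate $\mathsf s$ is dissipative, and the trivial solution of the closed-loop system with $w(t)\equiv\mathbf 0_q$ is exponentially stable. Moreover, the number of scalar unknowns in these conditions is $(0.5d^2+d+\nu+0.5)n^2+(0.5d+0.5+\nu+\beta p)n$.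
   Context: **Notation.** $\mathbb N_\nu=\{1,\dots,\nu\}$; $\mathbb S^n$: real symmetric $n\times n$ matrices; $\mathrm{Sy}(X)=X+X^\top$; $X\oplus Y$ is the block-diagonal matrix with blocks $X,Y$ and $\mathrm{diag}_{i=1}^\nu X_i=X_1\oplus\dots\oplus X_\nu$ (blocks may be rectangular); $\otimes$ is the Kronecker product; $\mathrm{Row}_{i=a}^{b}X_i=[X_a\cdots X_b]$ and $\mathrm{Col}_{i=a}^{b}X_i=[X_a^\top\cdots X_b^\top]^\top$; $*$ denotes a block determined by symmetry; $\mathsf O_{n,m}$ is the $n\times m$ zero matrix, $\mathsf O_n=\mathsf O_{n,n}$, $\mathbf 0_n$ the $n\times1$ zero vector. Matrix products bind tighter than $\otimes$, which binds tighter than $\oplus,\mathrm{diag}$. Empty matrices (zero rows or columns) are allowed, with the usual conventions; blocks of zero size are absent. $L^2(\mathcal X;\cdot)$ is the space of measurable square-integrable functions; $W^{1,2}(\mathcal X;\mathbb R^d)$ is the space of $L^2$ functions with weak derivative in $L^2$ (evaluated pointwise via the continuous representative). **Data.** $n,m,p,q,\nu\in\mathbb N$; $0=r_0<r_1<\dots<r_\nu=r$; $\mathcal J=[-r,0]$; $\mathcal I_i=[-r_i,-r_{i-1}]$; $t_0\in\mathbb R$. Constant matrices $A_i\in\mathbb R^{n\times n}$, $C_i\in\mathbb R^{m\times n}$ ($i=0,\dots,\nu$), $B_0\in\mathbb R^{n\times p}$, $\mathfrak B_0\in\mathbb R^{m\times p}$, $D_1\in\mathbb R^{n\times q}$, $D_2\in\mathbb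 R^{m\times q}$, and kernels $\widetilde A_i\in L^2(\mathcal I_i;\mathbb R^{n\times n})$, $\widetilde C_i\in L^2(\mathcal I_i;\mathbb R^{m\times n})$ ($i\in\mathbb N_\nu$). The open-loop system (no input delays) is, for almost all $t\ge t_0$, $\dot x(t)=\sum_{i=0}^\nu A_ix(t-r_i)+\sum_{i=1}^\nu\int_{\mathcal I_i}\widetilde A_i(\tau)x(t+\tau)\mathrm d\tau+B_0u(t)+D_1w(t)$, $z(t)=\sum_{i=0}^\nu C_ix(t-r_i)+\sum_{i=1}^\nu\int_{\mathcal I_i}\widetilde C_i(\tau)x(t+\tau)\mathrm d\tau+\mathfrak B_0u(t)+D_2w(t)$. **Kernel decomposition.** For each $i\in\mathbb N_\nu$ let $d_i\in\mathbb N$, $\delta_i,\mu_i\in\mathbb N\cup\{0\}$, $\varkappa_i=d_i+\delta_i$, $\kappa_i=d_i+\delta_i+\mu_i$, and $f_i\in W^{1,2}(\mathcal I_i;\mathbb R^{d_i})$, $\varphi_i\in L^2(\mathcal I_i;\mathbb R^{\delta_i})$, $\phi_i\in L^2(\mathcal I_i;\mathbb R^{\mu_i})$, $h_i=\begin{bmatrix}\varphi_i\\ f_i\end{bmatrix}$, $g_i=\begin{bmatrix}\phi_i\\ h_i\end{bmatrix}$, $M_i\in\mathbb R^{d_i\times\varkappa_i}$ satisfy $\frac{\mathrm d f_i(\tau)}{\mathrm d\tau}=M_ih_i(\tau)$ (weak derivative) and $\int_{\mathcal I_i}g_i(\tau)g_i^\top(\tau)\,\mathrm d\tau\succ0$,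 and let $\widehat A_i\in\mathbb R^{n\times\kappa_in}$, $\widehat C_i\in\mathbb R^{m\times\kappa_in}$ satisfy on $\mathcal I_i$: $\widetilde A_i(\tau)=\widehat A_i(g_i(\tau)\otimes I_n)$, $\widetilde C_i(\tau)=\widehat C_i(g_i(\tau)\otimes I_n)$. Put $\mathfrak F_i=\int_{\mathcal I_i}f_if_i^\top\mathrm d\tau$, $\mathfrak H_i=\int_{\mathcal I_i}h_ih_i^\top\mathrm d\tau$, $\Gamma_i=\int_{\mathcal I_i}\phi_ih_i^\top\mathrm d\tau$, $\varepsilon_i(\tau)=\phi_i(\tau)-\Gamma_i\mathfrak H_i^{-1}h_i(\tau)$, $\mathfrak E_i=\int_{\mathcal I_i}\varepsilon_i\varepsilon_i^\top\mathrm d\tau$; these Gram matrices are positive definite, with lower-triangular Cholesky factorizations $\mathfrak F_i=\mathfrak L_{f_i}\mathfrak L_{f_i}^\top$, $\mathfrak H_i=\mathfrak L_{h_i}\mathfrak L_{h_i}^\top$, $\mathfrak E_i=\mathfrak L_{\varepsilon_i}\mathfrak L_{\varepsilon_i}^\top$. Put $T_i=\begin{bmatrix}\Gamma_i\mathfrak H_i^{-1}\\ I_{\varkappa_i}\end{bmatrix}\mathfrak L_{h_i}$, $\widetilde T_i=\begin{bmatrix}I_{\mu_i}\\ \mathsf O_{\varkappa_i,\mu_i}\end{bmatrix}\mathfrak L_{\varepsilon_i}$. Let $d=\sum_i d_i$, $\varkappa=\sum_i\varkappa_i$, $\mu=\sum_i\mu_i$, $\kappa=\sum_i\kappa_i$,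 $\beta=1+\nu+\kappa$. **Closed-loop system with controller parameters $K_0,K_i,\mathcal K_i$.** The controller is $u(t)=\sum_{i=0}^\nu K_ix(t-r_i)+\sum_{i=1}^\nu\int_{\mathcal I_i}\widetilde K_i(\tau)x(t+\tau)\mathrm d\tau$ with $\widetilde K_i(\tau)=\mathcal K_i(g_i(\tau)\otimes I_n)$. The closed loop is, equivalently, $\dot x(t)=(\mathbf A+B_0\boldsymbol K)\vartheta(t)$, $z(t)=(\mathbf C+\mathfrak B_0\boldsymbol K)\vartheta(t)$ for almost all $t\ge t_0$, with $x(t_0+\theta)=\psi(\theta)$ for $\theta\in\mathcal J$, $\psi\in C(\mathcal J;\mathbb R^n)$, disturbance $w\in L^2(\mathbb R_{\ge t_0};\mathbb R^q)$, solutions absolutely continuous for $t\ge t_0$ (Carathéodory sense), where $\mathbf A=[\mathrm{Row}_{i=0}^\nu A_i\ \ \mathrm{Row}_{i=1}^\nu\widehat A_i(T_i\otimes I_n)\ \ \mathrm{Row}_{i=1}^\nu\widehat A_i(\widetilde T_i\otimes I_n)\ \ D_1]$, $\mathbf C=[\mathrm{Row}_{i=0}^\nu C_i\ \ \mathrm{Row}_{i=1}^\nu\widehat C_i(T_i\otimes I_n)\ \ \mathrm{Row}_{i=1}^\nu\widehat C_i(\widetilde T_i\otimes I_n)\ \ D_2]$, $\boldsymbol K=[\mathrm{Row}_{i=0}^\nu K_i\ \ \mathrm{Row}_{i=1}^\nu\mathcal K_i(T_i\otimes I_n)\ \ \mathrm{Row}_{i=1}^\nu\mathcal K_i(\widetilde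 T_i\otimes I_n)\ \ \mathsf O_{p,q}]$, $\vartheta(t)=\mathrm{Col}\big(\mathrm{Col}_{i=0}^\nu x(t-r_i),\ \mathrm{Col}_{i=1}^\nu\int_{\mathcal I_i}(\mathfrak L_{h_i}^{-1}h_i(\tau)\otimes I_n)x(t+\tau)\mathrm d\tau,\ \mathrm{Col}_{i=1}^\nu\int_{\mathcal I_i}(\mathfrak L_{\varepsilon_i}^{-1}\varepsilon_i(\tau)\otimes I_n)x(t+\tau)\mathrm d\tau,\ w(t)\big)$. **Supply rate.** $\mathsf s(z,w)=\begin{bmatrix}z\\ w\end{bmatrix}^\top\begin{bmatrix}\widetilde J^\top J_1^{-1}\widetilde J&J_2\\ *&J_3\end{bmatrix}\begin{bmatrix}z\\ w\end{bmatrix}$ with $\widetilde J\in\mathbb R^{m\times m}$, $J_1\in\mathbb S^m$, $J_1^{-1}\prec0$, $\widetilde J^\top J_1^{-1}\widetilde J\preceq 0$, $J_2\in\mathbb R^{m\times q}$, $J_3\in\mathbb S^q$. **Auxiliary matrices.** $\widehat I=\big(\mathrm{diag}_{i=1}^\nu \mathfrak L_{f_i}^{-1}[\mathsf O_{d_i,\delta_i}\ \ I_{d_i}]\,\mathfrak L_{h_i}\big)\otimes I_n$; $\Lambda=\mathrm{diag}_{i=1}^\nu (r_i-r_{i-1})I_n$; $\mathbf M=\big[\mathrm{diag}_{i=1}^\nu\mathfrak L_{f_i}^{-1}f_i(-r_{i-1})\ \ \mathbf 0_d\ \ \mathsf O_{d,\varkappa}\big]-\big[\mathbf 0_d\ \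 \mathrm{diag}_{i=1}^\nu\mathfrak L_{f_i}^{-1}f_i(-r_i)\ \ \mathrm{diag}_{i=1}^\nu\mathfrak L_{f_i}^{-1}M_i\mathfrak L_{h_i}\big]$. For $P_2\in\mathbb R^{n\times dn}$, $P_3\in\mathbb S^{dn}$, $\mathbf Q=\mathrm{diag}_{i=1}^\nu Q_i$, $\mathbf R=\mathrm{diag}_{i=1}^\nu R_i$ with $Q_i,R_i\in\mathbb S^n$, and $\boldsymbol\Sigma\in\mathbb R^{m\times(\beta n+q)}$, $$\Xi(\mathbf Q,\mathbf R)=\big[(\mathbf Q+\mathbf R\Lambda)\oplus\mathsf O_n\oplus\mathsf O_{\kappa n}\oplus\mathsf O_q\big]-\big[\mathsf O_n\oplus\mathbf Q\oplus(\mathrm{diag}_{i=1}^\nu I_{\varkappa_i}\otimes R_i)\oplus(\mathrm{diag}_{i=1}^\nu I_{\mu_i}\otimes R_i)\oplus J_3\big],$$ $$\boldsymbol\Phi(P_2,P_3,\mathbf Q,\mathbf R,\boldsymbol\Sigma)=\mathrm{Sy}\left(\begin{bmatrix}P_2\\ \mathsf O_{\nu n,dn}\\ \widehat I^\top P_3\\ \mathsf O_{(\mu n+q+m),dn}\end{bmatrix}\big[\mathbf M\otimes I_n\ \ \mathsf O_{dn,(\mu n+q+m)}\big]+\begin{bmatrix}\mathsf O_{(\beta n),m}\\ -J_2^\top\\ \widetilde J\end{bmatrix}\big[\boldsymbol\Sigma\ \ \mathsf O_m\big]\right)+[\Xi(\mathbf Q,\mathbf R)\oplus J_1].$$ **Dissipativity.**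 The closed-loop system with supply rate $\mathsf s$ is dissipative if there is $\mathsf v\in C^1(C(\mathcal J;\mathbb R^n);\mathbb R)$ such that $\frac{\mathrm d}{\mathrm dt}\mathsf v(\mathsf x_t(\cdot))-\mathsf s(z(t),w(t))\le0$ for almost all $t\ge t_0$ along its trajectories, where $\mathsf x_t(\theta)=x(t+\theta)$, $\theta\in\mathcal J$. **Exponential stability** of the trivial solution has its usual meaning for functional differential equations, with initial functions in $C(\mathcal J;\mathbb R^n)$ and the sup norm. *)

theory Defs
  imports
    "HOL-Analysis.Analysis"
    "Jordan_Normal_Form.Gauss_Jordan_Elimination"
    "Jordan_Normal_Form.VS_Connect"
begin

hide_const (open) Finite_Cartesian_Product.vec Finite_Cartesian_Product.row
  Finite_Cartesian_Product.mat Finite_Cartesian_Product.transpose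
unbundle no vec_syntax
unbundle no inner_syntax

section \<open>Block matrices\<close>

text \<open>Matrices and vectors are those of \<^theory>\<open>Jordan_Normal_Form.Matrix\<close>, whose dimensions are
  natural numbers and may be zero.\<close>

definition append_cols :: "real mat \<Rightarrow> real mat \<Rightarrow> real mat" (infixr \<open>@\<^sub>c\<close> 65) where
  "A @\<^sub>c B = four_block_mat A B (0\<^sub>m 0 (dim_col A)) (0\<^sub>m 0 (dim_col B))"

text \<open>The number \<open>k\<close> of rows is only needed when there are no blocks.\<close>

definition row_blocks :: "nat \<Rightarrow> real mat list \<Rightarrow> real mat" where
  "row_blocks k Xs = foldr (@\<^sub>c) Xs (0\<^sub>m k 0)"

definition diag_upto :: "nat \<Rightarrow> (nat \<Rightarrow> real mat) \<Rightarrow> real mat" where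
  "diag_upto \<nu> X = diag_block_mat (map X [1..<Suc \<nu>])"

definition col_mat :: "real vec \<Rightarrow> real mat" where
  "col_mat v = mat_of_cols (dim_vec v) [v]"

definition kron :: "real mat \<Rightarrow> real mat \<Rightarrow> real mat" (infixl \<open>\<otimes>\<^sub>k\<close> 68) where
  "A \<otimes>\<^sub>k B = mat (dim_row A * dim_row B) (dim_col A * dim_col B)
     (\<lambda>(i, j). A $$ (i div dim_row B, j div dim_col B) * B $$ (i mod dim_row B, j mod dim_col B))"

definition Sy :: "real mat \<Rightarrow> real mat" where
  "Sy X = X + transpose_mat X"

definition sym_mats :: "nat \<Rightarrow> real mat set" where
  "sym_mats k = {X \<in> carrier_mat k k. transpose_mat X = X}"

definition pos_def :: "real mat \<Rightarrow> bool" where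
  "pos_def X \<longleftrightarrow> X \<in> sym_mats (dim_row X) \<and>
     (\<forall>v \<in> carrier_vec (dim_row X). v \<noteq> 0\<^sub>v (dim_row X) \<longrightarrow> v \<bullet> (X *\<^sub>v v) > 0)"

definition pos_semidef :: "real mat \<Rightarrow> bool" where
  "pos_semidef X \<longleftrightarrow> X \<in> sym_mats (dim_row X) \<and>
     (\<forall>v \<in> carrier_vec (dim_row X). v \<bullet> (X *\<^sub>v v) \<ge> 0)"

abbreviation neg_def :: "real mat \<Rightarrow> bool" where
  "neg_def X \<equiv> pos_def (- X)"

abbreviation neg_semidef :: "real mat \<Rightarrow> bool" where
  "neg_semidef X \<equiv> pos_semidef (- X)"

text \<open>Unspecified when the argument is singular.\<close>

definition minv :: "real mat \<Rightarrow> real mat" where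
  "minv X = the (mat_inverse X)"

definition cholesky_factor :: "real mat \<Rightarrow> real mat \<Rightarrow> bool" where
  "cholesky_factor L X \<longleftrightarrow> L \<in> carrier_mat (dim_row X) (dim_row X) \<and>
     (\<forall>i < dim_row X. \<forall>j < dim_row X. i < j \<longrightarrow> L $$ (i, j) = 0) \<and>
     (\<forall>i < dim_row X. L $$ (i, i) > 0) \<and> X = L * transpose_mat L"

section \<open>Function spaces\<close>

definition L2_on :: "real set \<Rightarrow> (real \<Rightarrow> real) \<Rightarrow> bool" where
  "L2_on X f \<longleftrightarrow> f \<in> borel_measurable (lebesgue_on X) \<and> integrable (lebesgue_on X) (\<lambda>s. (f s)\<^sup>2)"

definition L2_vec :: "real set \<Rightarrow> nat \<Rightarrow> (real \<Rightarrow> real vec) \<Rightarrow> bool" where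
  "L2_vec X k f \<longleftrightarrow> (\<forall>s \<in> X. f s \<in> carrier_vec k) \<and> (\<forall>j < k. L2_on X (\<lambda>s. f s $ j))"

definition L2_mat :: "real set \<Rightarrow> nat \<Rightarrow> nat \<Rightarrow> (real \<Rightarrow> real mat) \<Rightarrow> bool" where
  "L2_mat X k l f \<longleftrightarrow> (\<forall>s \<in> X. f s \<in> carrier_mat k l) \<and>
     (\<forall>i < k. \<forall>j < l. L2_on X (\<lambda>s. f s $$ (i, j)))"

text \<open>Test functions are the continuously differentiable functions with compact support in the
  interior of the interval.\<close>

definition weak_deriv :: "real set \<Rightarrow> (real \<Rightarrow> real) \<Rightarrow> (real \<Rightarrow> real) \<Rightarrow> bool" where
  "weak_deriv X f g \<longleftrightarrow>
     (\<forall>\<eta> \<eta>'. (\<forall>s. (\<eta> has_real_derivative \<eta>' s) (at s)) \<and> continuous_on UNIV \<eta>' \<and>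
        (\<exists>K. compact K \<and> K \<subseteq> interior X \<and> (\<forall>s. s \<notin> K \<longrightarrow> \<eta> s = 0)) \<longrightarrow>
        (\<integral>s. f s * \<eta>' s \<partial>lebesgue_on X) = - (\<integral>s. g s * \<eta> s \<partial>lebesgue_on X))"

definition weak_deriv_vec :: "real set \<Rightarrow> nat \<Rightarrow> (real \<Rightarrow> real vec) \<Rightarrow> (real \<Rightarrow> real vec) \<Rightarrow> bool" where
  "weak_deriv_vec X k f g \<longleftrightarrow> (\<forall>j < k. weak_deriv X (\<lambda>s. f s $ j) (\<lambda>s. g s $ j))"

text \<open>An element of the Sobolev space is given by its continuous representative, so that it can be
  evaluated at the endpoints of the interval.\<close>

definition W12_vec :: "real set \<Rightarrow> nat \<Rightarrow> (real \<Rightarrow> real vec) \<Rightarrow> bool" where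
  "W12_vec X k f \<longleftrightarrow> L2_vec X k f \<and> (\<exists>g. L2_vec X k g \<and> weak_deriv_vec X k f g) \<and>
     (\<forall>j < k. continuous_on X (\<lambda>s. f s $ j))"

definition gram :: "real set \<Rightarrow> nat \<Rightarrow> nat \<Rightarrow> (real \<Rightarrow> real vec) \<Rightarrow> (real \<Rightarrow> real vec) \<Rightarrow> real mat" where
  "gram X k l a b = mat k l (\<lambda>(i, j). \<integral>s. a s $ i * b s $ j \<partial>lebesgue_on X)"

definition abs_cont_on :: "real \<Rightarrow> real \<Rightarrow> (real \<Rightarrow> real) \<Rightarrow> bool" where
  "abs_cont_on a b f \<longleftrightarrow> (\<forall>e > 0. \<exists>\<delta> > 0. \<forall>D. finite D \<and>
     (\<forall>(u, v) \<in> D. a \<le> u \<and> u \<le> v \<and> v \<le> b) \<and>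
     pairwise (\<lambda>(u, v) (u', v'). v \<le> u' \<or> v' \<le> u) D \<and>
     (\<Sum>(u, v) \<in> D. v - u) < \<delta> \<longrightarrow> (\<Sum>(u, v) \<in> D. \<bar>f v - f u\<bar>) < e)"

definition vnorm :: "real vec \<Rightarrow> real" where
  "vnorm v = sqrt (v \<bullet> v)"

subsection \<open>Continuous functions on an interval and smooth functionals on them\<close>

text \<open>The type of vectors carries no topology, hence the Banach space of continuous functions
  \<open>J \<rightarrow> \<real>\<^sup>k\<close> with the supremum norm is a set of extensional functions, and Frechet
  differentiability is spelled out.\<close>

definition C_space :: "real set \<Rightarrow> nat \<Rightarrow> (real \<Rightarrow> real vec) set" where
  "C_space J k = {\<phi> \<in> J \<rightarrow>\<^sub>E carrier_vec k. \<forall>j < k. continuous_on J (\<lambda>\<theta>. \<phi> \<theta> $ j)}"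

definition sup_norm :: "real set \<Rightarrow> (real \<Rightarrow> real vec) \<Rightarrow> real" where
  "sup_norm J \<phi> = (SUP \<theta> \<in> J. vnorm (\<phi> \<theta>))"

definition C_add :: "real set \<Rightarrow> (real \<Rightarrow> real vec) \<Rightarrow> (real \<Rightarrow> real vec) \<Rightarrow> real \<Rightarrow> real vec" where
  "C_add J \<phi> \<psi> = (\<lambda>\<theta> \<in> J. \<phi> \<theta> + \<psi> \<theta>)"

definition C_smult :: "real set \<Rightarrow> real \<Rightarrow> (real \<Rightarrow> real vec) \<Rightarrow> real \<Rightarrow> real vec" where
  "C_smult J a \<phi> = (\<lambda>\<theta> \<in> J. a \<cdot>\<^sub>v \<phi> \<theta>)"

definition C_bounded_linear :: "real set \<Rightarrow> nat \<Rightarrow> ((real \<Rightarrow> real vec) \<Rightarrow> real) \<Rightarrow> bool" where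
  "C_bounded_linear J k L \<longleftrightarrow>
     (\<forall>\<phi> \<in> C_space J k. \<forall>\<psi> \<in> C_space J k. L (C_add J \<phi> \<psi>) = L \<phi> + L \<psi>) \<and>
     (\<forall>a. \<forall>\<phi> \<in> C_space J k. L (C_smult J a \<phi>) = a * L \<phi>) \<and>
     (\<exists>b. \<forall>\<phi> \<in> C_space J k. \<bar>L \<phi>\<bar> \<le> b * sup_norm J \<phi>)"

definition C1_functional :: "real set \<Rightarrow> nat \<Rightarrow> ((real \<Rightarrow> real vec) \<Rightarrow> real) \<Rightarrow> bool" where
  "C1_functional J k v \<longleftrightarrow> (\<exists>dv. \<forall>\<phi> \<in> C_space J k.
     C_bounded_linear J k (dv \<phi>) \<and>
     (\<forall>e > 0. \<exists>\<delta> > 0. \<forall>\<eta> \<in> C_space J k. sup_norm J \<eta> < \<delta> \<longrightarrow>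
        \<bar>v (C_add J \<phi> \<eta>) - v \<phi> - dv \<phi> \<eta>\<bar> \<le> e * sup_norm J \<eta>) \<and>
     (\<forall>e > 0. \<exists>\<delta> > 0. \<forall>\<eta> \<in> C_space J k. sup_norm J \<eta> < \<delta> \<longrightarrow>
        (\<forall>\<chi> \<in> C_space J k. \<bar>dv (C_add J \<phi> \<eta>) \<chi> - dv \<phi> \<chi>\<bar> \<le> e * sup_norm J \<chi>)))"

definition segment :: "real set \<Rightarrow> (real \<Rightarrow> real vec) \<Rightarrow> real \<Rightarrow> real \<Rightarrow> real vec" where
  "segment J x t = (\<lambda>\<theta> \<in> J. x (t + \<theta>))"

section \<open>System data\<close>

text \<open>Correspondence with the usual symbols: \<open>dim_x\<close>, \<open>dim_z\<close>, \<open>dim_u\<close>, \<open>dim_w\<close>, \<open>num_del\<close> are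
  \<open>n\<close>, \<open>m\<close>, \<open>p\<close>, \<open>q\<close>, \<open>\<nu>\<close>; \<open>mat_B\<close> and \<open>mat_Bz\<close> are the input matrices of the state and of the
  output equation; \<open>ker_A\<close> and \<open>ker_C\<close> are the kernels of the distributed delays, \<open>coef_A\<close> and
  \<open>coef_C\<close> their coefficient matrices with respect to \<open>g\<^sub>i\<close>; \<open>dim_f\<close>, \<open>dim_vphi\<close>, \<open>dim_phi\<close> are
  \<open>d\<^sub>i\<close>, \<open>\<delta>\<^sub>i\<close>, \<open>\<mu>\<^sub>i\<close>, the dimensions of \<open>fun_f\<close>, \<open>fun_vphi\<close>, \<open>fun_phi\<close>, where \<open>h\<^sub>i\<close> stacks \<open>fun_vphi\<close>
  and \<open>fun_f\<close>, and \<open>g\<^sub>i\<close> stacks \<open>fun_phi\<close> and \<open>h\<^sub>i\<close>.  Delays are indexed by \<open>{1..\<nu>}\<close>, and by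
  \<open>{0..\<nu>}\<close> for \<open>del\<close>, \<open>mat_A\<close>, \<open>mat_C\<close>; values at other indices are irrelevant.\<close>

record system =
  dim_x :: nat
  dim_z :: nat
  dim_u :: nat
  dim_w :: nat
  num_del :: nat
  del :: "nat \<Rightarrow> real"
  init_time :: real
  mat_A :: "nat \<Rightarrow> real mat"
  mat_C :: "nat \<Rightarrow> real mat"
  mat_B :: "real mat"
  mat_Bz :: "real mat"
  mat_D1 :: "real mat"
  mat_D2 :: "real mat"
  ker_A :: "nat \<Rightarrow> real \<Rightarrow> real mat"
  ker_C :: "nat \<Rightarrow> real \<Rightarrow> real mat"
  dim_f :: "nat \<Rightarrow> nat"
  dim_vphi :: "nat \<Rightarrow> nat"
  dim_phi :: "nat \<Rightarrow> nat"
  fun_f :: "nat \<Rightarrow> real \<Rightarrow> real vec"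
  fun_vphi :: "nat \<Rightarrow> real \<Rightarrow> real vec"
  fun_phi :: "nat \<Rightarrow> real \<Rightarrow> real vec"
  mat_M :: "nat \<Rightarrow> real mat"
  coef_A :: "nat \<Rightarrow> real mat"
  coef_C :: "nat \<Rightarrow> real mat"
  chol_F :: "nat \<Rightarrow> real mat"
  chol_H :: "nat \<Rightarrow> real mat"
  chol_E :: "nat \<Rightarrow> real mat"
  sup_Jt :: "real mat"
  sup_J1 :: "real mat"
  sup_J2 :: "real mat"
  sup_J3 :: "real mat"

definition full_ivl :: "system \<Rightarrow> real set" where
  "full_ivl S = {- del S (num_del S) .. 0}"

definition del_ivl :: "system \<Rightarrow> nat \<Rightarrow> real set" where
  "del_ivl S i = {- del S i .. - del S (i - 1)}"

definition dim_h :: "system \<Rightarrow> nat \<Rightarrow> nat" where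
  "dim_h S i = dim_f S i + dim_vphi S i"

definition dim_g :: "system \<Rightarrow> nat \<Rightarrow> nat" where
  "dim_g S i = dim_f S i + dim_vphi S i + dim_phi S i"

definition tot_f :: "system \<Rightarrow> nat" where
  "tot_f S = (\<Sum>i = 1..num_del S. dim_f S i)"

definition tot_h :: "system \<Rightarrow> nat" where
  "tot_h S = (\<Sum>i = 1..num_del S. dim_h S i)"

definition tot_phi :: "system \<Rightarrow> nat" where
  "tot_phi S = (\<Sum>i = 1..num_del S. dim_phi S i)"

definition tot_g :: "system \<Rightarrow> nat" where
  "tot_g S = (\<Sum>i = 1..num_del S. dim_g S i)"

definition beta :: "system \<Rightarrow> nat" where
  "beta S = 1 + num_del S + tot_g S"

definition fun_h :: "system \<Rightarrow> nat \<Rightarrow> real \<Rightarrow> real vec" where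
  "fun_h S i \<tau> = fun_vphi S i \<tau> @\<^sub>v fun_f S i \<tau>"

definition fun_g :: "system \<Rightarrow> nat \<Rightarrow> real \<Rightarrow> real vec" where
  "fun_g S i \<tau> = fun_phi S i \<tau> @\<^sub>v fun_h S i \<tau>"

definition gram_F :: "system \<Rightarrow> nat \<Rightarrow> real mat" where
  "gram_F S i = gram (del_ivl S i) (dim_f S i) (dim_f S i) (fun_f S i) (fun_f S i)"

definition gram_H :: "system \<Rightarrow> nat \<Rightarrow> real mat" where
  "gram_H S i = gram (del_ivl S i) (dim_h S i) (dim_h S i) (fun_h S i) (fun_h S i)"

definition cross_gram :: "system \<Rightarrow> nat \<Rightarrow> real mat" where
  "cross_gram S i = gram (del_ivl S i) (dim_phi S i) (dim_h S i) (fun_phi S i) (fun_h S i)"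

definition fun_eps :: "system \<Rightarrow> nat \<Rightarrow> real \<Rightarrow> real vec" where
  "fun_eps S i \<tau> = fun_phi S i \<tau> - (cross_gram S i * minv (gram_H S i)) *\<^sub>v fun_h S i \<tau>"

definition gram_E :: "system \<Rightarrow> nat \<Rightarrow> real mat" where
  "gram_E S i = gram (del_ivl S i) (dim_phi S i) (dim_phi S i) (fun_eps S i) (fun_eps S i)"

definition dist_kernel :: "system \<Rightarrow> (nat \<Rightarrow> real mat) \<Rightarrow> nat \<Rightarrow> real \<Rightarrow> real mat" where
  "dist_kernel S X i \<tau> = X i * (col_mat (fun_g S i \<tau>) \<otimes>\<^sub>k 1\<^sub>m (dim_x S))"

definition plant_data :: "system \<Rightarrow> bool" where
  "plant_data S \<longleftrightarrow>
     dim_x S > 0 \<and> dim_z S > 0 \<and> dim_u S > 0 \<and> dim_w S > 0 \<and> num_del S > 0 \<and>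
     del S 0 = 0 \<and> (\<forall>i \<in> {1..num_del S}. del S (i - 1) < del S i) \<and>
     (\<forall>i \<in> {0..num_del S}. mat_A S i \<in> carrier_mat (dim_x S) (dim_x S)) \<and>
     (\<forall>i \<in> {0..num_del S}. mat_C S i \<in> carrier_mat (dim_z S) (dim_x S)) \<and>
     mat_B S \<in> carrier_mat (dim_x S) (dim_u S) \<and>
     mat_Bz S \<in> carrier_mat (dim_z S) (dim_u S) \<and>
     mat_D1 S \<in> carrier_mat (dim_x S) (dim_w S) \<and>
     mat_D2 S \<in> carrier_mat (dim_z S) (dim_w S) \<and>
     (\<forall>i \<in> {1..num_del S}. L2_mat (del_ivl S i) (dim_x S) (dim_x S) (ker_A S i)) \<and>
     (\<forall>i \<in> {1..num_del S}. L2_mat (del_ivl S i) (dim_z S) (dim_x S) (ker_C S i))"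

text \<open>The kernels are elements of \<open>L\<^sup>2\<close>, so their decomposition is an identity almost
  everywhere.\<close>

definition kernel_data :: "system \<Rightarrow> bool" where
  "kernel_data S \<longleftrightarrow> (\<forall>i \<in> {1..num_del S}.
     dim_f S i > 0 \<and>
     W12_vec (del_ivl S i) (dim_f S i) (fun_f S i) \<and>
     L2_vec (del_ivl S i) (dim_vphi S i) (fun_vphi S i) \<and>
     L2_vec (del_ivl S i) (dim_phi S i) (fun_phi S i) \<and>
     mat_M S i \<in> carrier_mat (dim_f S i) (dim_h S i) \<and>
     weak_deriv_vec (del_ivl S i) (dim_f S i) (fun_f S i) (\<lambda>\<tau>. mat_M S i *\<^sub>v fun_h S i \<tau>) \<and>
     pos_def (gram (del_ivl S i) (dim_g S i) (dim_g S i) (fun_g S i) (fun_g S i)) \<and>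
     coef_A S i \<in> carrier_mat (dim_x S) (dim_g S i * dim_x S) \<and>
     coef_C S i \<in> carrier_mat (dim_z S) (dim_g S i * dim_x S) \<and>
     (AE \<tau> in lebesgue_on (del_ivl S i). ker_A S i \<tau> = dist_kernel S (coef_A S) i \<tau>) \<and>
     (AE \<tau> in lebesgue_on (del_ivl S i). ker_C S i \<tau> = dist_kernel S (coef_C S) i \<tau>) \<and>
     cholesky_factor (chol_F S i) (gram_F S i) \<and>
     cholesky_factor (chol_H S i) (gram_H S i) \<and>
     cholesky_factor (chol_E S i) (gram_E S i))"

definition supply_data :: "system \<Rightarrow> bool" where
  "supply_data S \<longleftrightarrow>
     sup_Jt S \<in> carrier_mat (dim_z S) (dim_z S) \<and>
     sup_J1 S \<in> sym_mats (dim_z S) \<and> invertible_mat (sup_J1 S) \<and>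
     neg_def (minv (sup_J1 S)) \<and>
     neg_semidef (transpose_mat (sup_Jt S) * minv (sup_J1 S) * sup_Jt S) \<and>
     sup_J2 S \<in> carrier_mat (dim_z S) (dim_w S) \<and>
     sup_J3 S \<in> sym_mats (dim_w S)"

definition supply_rate :: "system \<Rightarrow> real vec \<Rightarrow> real vec \<Rightarrow> real" where
  "supply_rate S z w = (z @\<^sub>v w) \<bullet>
     (four_block_mat (transpose_mat (sup_Jt S) * minv (sup_J1 S) * sup_Jt S) (sup_J2 S)
        (transpose_mat (sup_J2 S)) (sup_J3 S) *\<^sub>v (z @\<^sub>v w))"

section \<open>Unknowns\<close>

text \<open>\<open>par_K 0\<close> is \<open>K\<^sub>0\<close>, and \<open>par_Kd i\<close> is the coefficient matrix of the distributed delay of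
  the controller on the \<open>i\<close>-th interval.\<close>

record unknowns =
  par_P1 :: "real mat"
  par_P2 :: "real mat"
  par_P3 :: "real mat"
  par_Q :: "nat \<Rightarrow> real mat"
  par_R :: "nat \<Rightarrow> real mat"
  par_K :: "nat \<Rightarrow> real mat"
  par_Kd :: "nat \<Rightarrow> real mat"

text \<open>The number of scalar unknowns is the dimension of this space.\<close>

definition unknowns_space :: "system \<Rightarrow> (real, unknowns) module" where
  "unknowns_space S = \<lparr>
     carrier = {U. par_P1 U \<in> sym_mats (dim_x S) \<and>
       par_P2 U \<in> carrier_mat (dim_x S) (tot_f S * dim_x S) \<and>
       par_P3 U \<in> sym_mats (tot_f S * dim_x S) \<and>
       par_Q U \<in> {1..num_del S} \<rightarrow>\<^sub>E sym_mats (dim_x S) \<and>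
       par_R U \<in> {1..num_del S} \<rightarrow>\<^sub>E sym_mats (dim_x S) \<and>
       par_K U \<in> {0..num_del S} \<rightarrow>\<^sub>E carrier_mat (dim_u S) (dim_x S) \<and>
       par_Kd U \<in> (\<Pi>\<^sub>E i \<in> {1..num_del S}. carrier_mat (dim_u S) (dim_g S i * dim_x S))},
     mult = undefined,
     one = undefined,
     zero = \<lparr> par_P1 = 0\<^sub>m (dim_x S) (dim_x S),
       par_P2 = 0\<^sub>m (dim_x S) (tot_f S * dim_x S),
       par_P3 = 0\<^sub>m (tot_f S * dim_x S) (tot_f S * dim_x S),
       par_Q = (\<lambda>i \<in> {1..num_del S}. 0\<^sub>m (dim_x S) (dim_x S)),
       par_R = (\<lambda>i \<in> {1..num_del S}. 0\<^sub>m (dim_x S) (dim_x S)),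
       par_K = (\<lambda>i \<in> {0..num_del S}. 0\<^sub>m (dim_u S) (dim_x S)),
       par_Kd = (\<lambda>i \<in> {1..num_del S}. 0\<^sub>m (dim_u S) (dim_g S i * dim_x S)) \<rparr>,
     add = (\<lambda>U V. \<lparr> par_P1 = par_P1 U + par_P1 V,
       par_P2 = par_P2 U + par_P2 V,
       par_P3 = par_P3 U + par_P3 V,
       par_Q = (\<lambda>i \<in> {1..num_del S}. par_Q U i + par_Q V i),
       par_R = (\<lambda>i \<in> {1..num_del S}. par_R U i + par_R V i),
       par_K = (\<lambda>i \<in> {0..num_del S}. par_K U i + par_K V i),
       par_Kd = (\<lambda>i \<in> {1..num_del S}. par_Kd U i + par_Kd V i) \<rparr>),
     smult = (\<lambda>a U. \<lparr> par_P1 = a \<cdot>\<^sub>m par_P1 U,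
       par_P2 = a \<cdot>\<^sub>m par_P2 U,
       par_P3 = a \<cdot>\<^sub>m par_P3 U,
       par_Q = (\<lambda>i \<in> {1..num_del S}. a \<cdot>\<^sub>m par_Q U i),
       par_R = (\<lambda>i \<in> {1..num_del S}. a \<cdot>\<^sub>m par_R U i),
       par_K = (\<lambda>i \<in> {0..num_del S}. a \<cdot>\<^sub>m par_K U i),
       par_Kd = (\<lambda>i \<in> {1..num_del S}. a \<cdot>\<^sub>m par_Kd U i) \<rparr>) \<rparr>"

section \<open>Closed-loop system\<close>

text \<open>\<open>delayed S k X Y x t\<close> is
  \<open>\<Sum>\<^sub>i X\<^sub>i x(t - r\<^sub>i) + \<Sum>\<^sub>i \<integral> Y\<^sub>i(\<tau>) x(t + \<tau>) d\<tau>\<close>, a vector of dimension \<open>k\<close>.\<close>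

definition delayed ::
  "system \<Rightarrow> nat \<Rightarrow> (nat \<Rightarrow> real mat) \<Rightarrow> (nat \<Rightarrow> real \<Rightarrow> real mat) \<Rightarrow> (real \<Rightarrow> real vec) \<Rightarrow> real \<Rightarrow> real vec"
  where
  "delayed S k X Y x t =
     finsum_vec TYPE(real) k (\<lambda>i. X i *\<^sub>v x (t - del S i)) {0..num_del S} +
     finsum_vec TYPE(real) k
       (\<lambda>i. vec k (\<lambda>j. \<integral>\<tau>. (Y i \<tau> *\<^sub>v x (t + \<tau>)) $ j \<partial>lebesgue_on (del_ivl S i))) {1..num_del S}"

definition control :: "system \<Rightarrow> unknowns \<Rightarrow> (real \<Rightarrow> real vec) \<Rightarrow> real \<Rightarrow> real vec" where
  "control S U x t = delayed S (dim_u S) (par_K U) (dist_kernel S (par_Kd U)) x t"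

definition state_rhs ::
  "system \<Rightarrow> unknowns \<Rightarrow> (real \<Rightarrow> real vec) \<Rightarrow> (real \<Rightarrow> real vec) \<Rightarrow> real \<Rightarrow> real vec" where
  "state_rhs S U x w t =
     delayed S (dim_x S) (mat_A S) (ker_A S) x t + mat_B S *\<^sub>v control S U x t + mat_D1 S *\<^sub>v w t"

definition output_rhs ::
  "system \<Rightarrow> unknowns \<Rightarrow> (real \<Rightarrow> real vec) \<Rightarrow> (real \<Rightarrow> real vec) \<Rightarrow> real \<Rightarrow> real vec" where
  "output_rhs S U x w t =
     delayed S (dim_z S) (mat_C S) (ker_C S) x t + mat_Bz S *\<^sub>v control S U x t + mat_D2 S *\<^sub>v w t"

definition is_solution ::
  "system \<Rightarrow> unknowns \<Rightarrow> (real \<Rightarrow> real vec) \<Rightarrow> (real \<Rightarrow> real vec) \<Rightarrow> (real \<Rightarrow> real vec) \<Rightarrow> bool" where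
  "is_solution S U \<psi> w x \<longleftrightarrow>
     \<psi> \<in> C_space (full_ivl S) (dim_x S) \<and>
     L2_vec {init_time S ..} (dim_w S) w \<and>
     (\<forall>t \<ge> init_time S. x t \<in> carrier_vec (dim_x S)) \<and>
     (\<forall>\<theta> \<in> full_ivl S. x (init_time S + \<theta>) = \<psi> \<theta>) \<and>
     (\<forall>j < dim_x S. \<forall>t \<ge> init_time S. abs_cont_on (init_time S) t (\<lambda>s. x s $ j)) \<and>
     (AE t in lebesgue_on {init_time S ..}. \<forall>j < dim_x S.
        ((\<lambda>s. x s $ j) has_real_derivative state_rhs S U x w t $ j) (at t))"

definition is_output ::
  "system \<Rightarrow> unknowns \<Rightarrow> (real \<Rightarrow> real vec) \<Rightarrow> (real \<Rightarrow> real vec) \<Rightarrow> (real \<Rightarrow> real vec) \<Rightarrow> bool" where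
  "is_output S U x w z \<longleftrightarrow> (AE t in lebesgue_on {init_time S ..}. z t = output_rhs S U x w t)"

definition dissipative :: "system \<Rightarrow> unknowns \<Rightarrow> bool" where
  "dissipative S U \<longleftrightarrow> (\<exists>v. C1_functional (full_ivl S) (dim_x S) v \<and>
     (\<forall>\<psi> w x z. is_solution S U \<psi> w x \<and> is_output S U x w z \<longrightarrow>
        (AE t in lebesgue_on {init_time S ..}.
           \<exists>D. ((\<lambda>s. v (segment (full_ivl S) x s)) has_real_derivative D) (at t) \<and>
             D - supply_rate S (z t) (w t) \<le> 0)))"

definition exp_stable :: "system \<Rightarrow> unknowns \<Rightarrow> bool" where
  "exp_stable S U \<longleftrightarrow> (\<exists>c > 0. \<exists>\<alpha> > 0. \<forall>\<psi> x. is_solution S U \<psi> (\<lambda>_. 0\<^sub>v (dim_w S)) x \<longrightarrow>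
     (\<forall>t \<ge> init_time S.
        vnorm (x t) \<le> c * exp (- \<alpha> * (t - init_time S)) * sup_norm (full_ivl S) \<psi>))"

section \<open>Matrices of the synthesis conditions\<close>

definition mat_T :: "system \<Rightarrow> nat \<Rightarrow> real mat" where
  "mat_T S i = ((cross_gram S i * minv (gram_H S i)) @\<^sub>r 1\<^sub>m (dim_h S i)) * chol_H S i"

definition mat_Tt :: "system \<Rightarrow> nat \<Rightarrow> real mat" where
  "mat_Tt S i = (1\<^sub>m (dim_phi S i) @\<^sub>r 0\<^sub>m (dim_h S i) (dim_phi S i)) * chol_E S i"

text \<open>\<open>big_row S k X Y D\<close> is
  \<open>[Row\<^sub>i X\<^sub>i  Row\<^sub>i Y\<^sub>i(T\<^sub>i \<otimes> I)  Row\<^sub>i Y\<^sub>i(T'\<^sub>i \<otimes> I)  D]\<close> with \<open>k\<close> rows.\<close>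

definition big_row ::
  "system \<Rightarrow> nat \<Rightarrow> (nat \<Rightarrow> real mat) \<Rightarrow> (nat \<Rightarrow> real mat) \<Rightarrow> real mat \<Rightarrow> real mat" where
  "big_row S k X Y D = row_blocks k (
     map X [0..<Suc (num_del S)] @
     map (\<lambda>i. Y i * (mat_T S i \<otimes>\<^sub>k 1\<^sub>m (dim_x S))) [1..<Suc (num_del S)] @
     map (\<lambda>i. Y i * (mat_Tt S i \<otimes>\<^sub>k 1\<^sub>m (dim_x S))) [1..<Suc (num_del S)] @ [D])"

definition big_A :: "system \<Rightarrow> real mat" where
  "big_A S = big_row S (dim_x S) (mat_A S) (coef_A S) (mat_D1 S)"

definition big_C :: "system \<Rightarrow> real mat" where
  "big_C S = big_row S (dim_z S) (mat_C S) (coef_C S) (mat_D2 S)"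

definition big_K :: "system \<Rightarrow> unknowns \<Rightarrow> real mat" where
  "big_K S U = big_row S (dim_u S) (par_K U) (par_Kd U) (0\<^sub>m (dim_u S) (dim_w S))"

definition mat_Omega :: "system \<Rightarrow> unknowns \<Rightarrow> real mat" where
  "mat_Omega S U = big_A S + mat_B S * big_K S U"

definition mat_Sigma :: "system \<Rightarrow> unknowns \<Rightarrow> real mat" where
  "mat_Sigma S U = big_C S + mat_Bz S * big_K S U"

definition I_hat :: "system \<Rightarrow> real mat" where
  "I_hat S = diag_upto (num_del S) (\<lambda>i.
     minv (chol_F S i) * (0\<^sub>m (dim_f S i) (dim_vphi S i) @\<^sub>c 1\<^sub>m (dim_f S i)) * chol_H S i)
     \<otimes>\<^sub>k 1\<^sub>m (dim_x S)"

definition mat_Lambda :: "system \<Rightarrow> real mat" where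
  "mat_Lambda S = diag_upto (num_del S) (\<lambda>i. (del S i - del S (i - 1)) \<cdot>\<^sub>m 1\<^sub>m (dim_x S))"

definition big_M :: "system \<Rightarrow> real mat" where
  "big_M S =
     (diag_upto (num_del S) (\<lambda>i. minv (chol_F S i) * col_mat (fun_f S i (- del S (i - 1))))
       @\<^sub>c 0\<^sub>m (tot_f S) 1 @\<^sub>c 0\<^sub>m (tot_f S) (tot_h S)) -
     (0\<^sub>m (tot_f S) 1
       @\<^sub>c diag_upto (num_del S) (\<lambda>i. minv (chol_F S i) * col_mat (fun_f S i (- del S i)))
       @\<^sub>c diag_upto (num_del S) (\<lambda>i. minv (chol_F S i) * mat_M S i * chol_H S i))"

definition mat_Xi :: "system \<Rightarrow> (nat \<Rightarrow> real mat) \<Rightarrow> (nat \<Rightarrow> real mat) \<Rightarrow> real mat" where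
  "mat_Xi S Q R =
     diag_block_mat
       [diag_upto (num_del S) Q + diag_upto (num_del S) R * mat_Lambda S,
        0\<^sub>m (dim_x S) (dim_x S),
        0\<^sub>m (tot_g S * dim_x S) (tot_g S * dim_x S),
        0\<^sub>m (dim_w S) (dim_w S)] -
     diag_block_mat
       [0\<^sub>m (dim_x S) (dim_x S),
        diag_upto (num_del S) Q,
        diag_upto (num_del S) (\<lambda>i. 1\<^sub>m (dim_h S i) \<otimes>\<^sub>k R i),
        diag_upto (num_del S) (\<lambda>i. 1\<^sub>m (dim_phi S i) \<otimes>\<^sub>k R i),
        sup_J3 S]"

definition mat_Phi ::
  "system \<Rightarrow> real mat \<Rightarrow> real mat \<Rightarrow> (nat \<Rightarrow> real mat) \<Rightarrow> (nat \<Rightarrow> real mat) \<Rightarrow> real mat \<Rightarrow> real mat" where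
  "mat_Phi S P2 P3 Q R Sg = (let n = dim_x S; m = dim_z S; q = dim_w S; dn = tot_f S * n;
       l = tot_phi S * n + q + m in
     Sy ((P2 @\<^sub>r 0\<^sub>m (num_del S * n) dn @\<^sub>r (transpose_mat (I_hat S) * P3) @\<^sub>r 0\<^sub>m l dn) *
           ((big_M S \<otimes>\<^sub>k 1\<^sub>m n) @\<^sub>c 0\<^sub>m dn l) +
         (0\<^sub>m (beta S * n) m @\<^sub>r (- transpose_mat (sup_J2 S)) @\<^sub>r sup_Jt S) *
           (Sg @\<^sub>c 0\<^sub>m m m)) +
     diag_block_mat [mat_Xi S Q R, sup_J1 S])"

definition big_P :: "system \<Rightarrow> unknowns \<Rightarrow> real mat" where
  "big_P S U = par_P1 U @\<^sub>c 0\<^sub>m (dim_x S) (num_del S * dim_x S) @\<^sub>c (par_P2 U * I_hat S) @\<^sub>c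
     0\<^sub>m (dim_x S) (tot_phi S * dim_x S + dim_w S + dim_z S)"

definition big_Pi :: "system \<Rightarrow> unknowns \<Rightarrow> real mat" where
  "big_Pi S U = mat_Omega S U @\<^sub>c 0\<^sub>m (dim_x S) (dim_z S)"

end

theory Submission
  imports Defs
begin

text \<open>The Lyapunov--Krasovskii functional is
  \<open>v \<psi> = [\<psi> 0; \<eta>]\<^sup>T P [\<psi> 0; \<eta>] + \<Sum>\<^sub>i \<integral> \<psi>\<^sup>T (Q\<^sub>i + (\<tau> + r\<^sub>i) R\<^sub>i) \<psi>\<close>, where \<open>\<eta>\<close> stacks the integrals of
  the \<open>f\<^sub>i \<otimes> I\<close>, orthonormalised by the Cholesky factor, against \<open>\<psi>\<close>. By Bessel's inequality
  the \<open>R\<^sub>i\<close>-energy of \<open>\<psi>\<close> dominates the \<open>R\<^sub>i\<close>-forms of its coefficients with respect to the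
  orthonormal families of the \<open>h\<^sub>i\<close> and the \<open>\<epsilon>\<^sub>i\<close>, and eliminating the Schur variable
  \<open>- J\<^sub>1\<^sup>-\<^sup>1 J z\<close> from the last matrix inequality bounds the derivative of \<open>v\<close> minus the supply
  rate by \<open>- c |\<theta>|\<^sup>2\<close>, with \<open>\<theta>\<close> the vector of all delayed states and coefficients. For
  exponential stability \<open>R\<^sub>i\<close> is replaced by \<open>R\<^sub>i + e I\<close> with a small \<open>e > 0\<close>: this costs part of
  the term \<open>- c |\<theta>|\<^sup>2\<close>, but makes the derivative control the whole energy of \<open>\<psi>\<close> and hence \<open>v\<close>
  itself. The first matrix inequality, again by Bessel, bounds \<open>v\<close> from below by \<open>|\<psi> 0|\<^sup>2\<close>.\<close>

section \<open>Square-integrable functions on intervals\<close>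

text \<open>The initial function is merely continuous, so during the first delay interval the
  history has no derivative, and the \<open>fun_f\<close> have only a weak one. Hence the integrals
  in \<open>v\<close> cannot be differentiated under the integral sign. The way out is integration
  by parts against an antiderivative \<open>X\<close> of the history: it leaves boundary values of
  \<open>X\<close> and an integral of the weak derivative against \<open>X\<close>, and shifts of
  the C1 function \<open>X\<close> are differentiable in the shift. The quadratic integrals follow
  the same rule, with the weights \<open>1\<close> and \<open>\<tau> + r i\<close> and with products
  of components in place of the history. Along a trajectory everything in \<open>v\<close> is then
  C1 except what involves the current state, which is absolutely continuous and differentiable only
  almost everywhere. To turn a rate valid almost everywhere into decay between two times, an
  absolutely continuous function with nonpositive derivative off a null set is shown not to
  increase, by means of fine tagged divisions. All facts on \<open>v\<close> are stated for
  arbitrary weights, since stability needs them for the shifted ones.\<close>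

lemma L2_on_mult_integrable:
  assumes "L2_on X f" and "L2_on X g"
  shows "integrable (lebesgue_on X) (\<lambda>s. f s * g s)"
proof (rule Bochner_Integration.integrable_bound)
  show "integrable (lebesgue_on X) (\<lambda>s. (f s)\<^sup>2 + (g s)\<^sup>2)"
    using assms by (auto simp: L2_on_def)
  show "(\<lambda>s. f s * g s) \<in> borel_measurable (lebesgue_on X)"
    using assms by (auto simp: L2_on_def)
  have "\<bar>a * b\<bar> \<le> a\<^sup>2 + b\<^sup>2" for a b :: real
  proof -
    have "0 \<le> (\<bar>a\<bar> - \<bar>b\<bar>)\<^sup>2" by simp
    then have "2 * (\<bar>a\<bar> * \<bar>b\<bar>) \<le> a\<^sup>2 + b\<^sup>2"
      by (simp add: power2_diff)
    moreover have "0 \<le> \<bar>a\<bar> * \<bar>b\<bar>" by simp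
    ultimately show ?thesis unfolding abs_mult by linarith
  qed
  then show "AE s in lebesgue_on X. norm (f s * g s) \<le> norm ((f s)\<^sup>2 + (g s)\<^sup>2)"
    by auto
qed

lemma L2_on_add: "L2_on X f \<Longrightarrow> L2_on X g \<Longrightarrow> L2_on X (\<lambda>s. f s + g s)"
  using L2_on_mult_integrable[of X f g]
  by (auto simp: L2_on_def power2_sum mult.assoc)

lemma L2_on_cmult: "L2_on X f \<Longrightarrow> L2_on X (\<lambda>s. c * f s)"
  by (auto simp: L2_on_def power_mult_distrib)

lemma L2_on_zero: "L2_on X (\<lambda>s. 0)"
  by (auto simp: L2_on_def)

lemma L2_on_diff: "L2_on X f \<Longrightarrow> L2_on X g \<Longrightarrow> L2_on X (\<lambda>s. f s - g s)"
  using L2_on_add[of X f "\<lambda>s. (-1) * g s"] L2_on_cmult[of X g "-1"] by simp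

lemma L2_on_sum: "finite I \<Longrightarrow> (\<And>i. i \<in> I \<Longrightarrow> L2_on X (f i)) \<Longrightarrow> L2_on X (\<lambda>s. \<Sum>i\<in>I. f i s)"
  by (induction I rule: finite_induct) (auto intro: L2_on_zero L2_on_add)

lemma continuous_integrable_lebesgue_on:
  fixes f :: "real \<Rightarrow> real"
  assumes "continuous_on {a..b} f"
  shows "integrable (lebesgue_on {a..b}) f"
  using continuous_imp_integrable_real[OF assms] .

lemma L2_on_continuous:
  assumes "continuous_on {a..b} f"
  shows "L2_on {a..b} f"
  unfolding L2_on_def
  using continuous_integrable_lebesgue_on[OF assms]
    continuous_integrable_lebesgue_on[OF continuous_on_power[OF assms, of 2]]
  by (auto)

lemma L2_on_cong:
  assumes "L2_on X f" "\<And>s. s \<in> X \<Longrightarrow> f s = g s"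
  shows "L2_on X g"
proof -
  have *: "g s = f s" if "s \<in> space (lebesgue_on X)" for s using assms that by auto
  have "g \<in> borel_measurable (lebesgue_on X)"
    using assms(1) measurable_cong[of "lebesgue_on X" g f borel, OF *] by (auto simp: L2_on_def)
  moreover have "integrable (lebesgue_on X) (\<lambda>s. (g s)\<^sup>2)"
    using assms(1) Bochner_Integration.integrable_cong[of "lebesgue_on X" "lebesgue_on X" "\<lambda>s. (g s)\<^sup>2" "\<lambda>s. (f s)\<^sup>2", OF refl] *
    by (auto simp: L2_on_def)
  ultimately show ?thesis by (simp add: L2_on_def)
qed

lemma L2_on_integrable:
  assumes "L2_on {a..b} f"
  shows "integrable (lebesgue_on {a..b}) f"
  using L2_on_mult_integrable[OF assms L2_on_continuous[of a b "\<lambda>_. 1"]] by simp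

lemma continuous_Icc_bounded:
  fixes x :: "real \<Rightarrow> real"
  assumes "continuous_on {a..b} x"
  shows "\<exists>B. \<forall>s\<in>{a..b}. \<bar>x s\<bar> \<le> B"
  using compact_imp_bounded[OF compact_continuous_image[OF assms compact_Icc]]
  by (auto simp: bounded_iff)

lemma weighted_integral_bound:
  fixes g y :: "real \<Rightarrow> real"
  assumes "integrable (lebesgue_on X) g" "\<And>s. s \<in> X \<Longrightarrow> \<bar>y s\<bar> \<le> B" 
    and "integrable (lebesgue_on X) (\<lambda>s. g s * y s)"
  shows "\<bar>\<integral>s. g s * y s \<partial>lebesgue_on X\<bar> \<le> B * (\<integral>s. \<bar>g s\<bar> \<partial>lebesgue_on X)"
proof -
  have "\<bar>\<integral>s. g s * y s \<partial>lebesgue_on X\<bar> \<le> (\<integral>s. \<bar>g s * y s\<bar> \<partial>lebesgue_on X)"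
    using integral_norm_bound[of "lebesgue_on X" "\<lambda>s. g s * y s"] by simp
  also have "\<dots> \<le> (\<integral>s. B * \<bar>g s\<bar> \<partial>lebesgue_on X)"
  proof (rule integral_mono)
    show "\<bar>g s * y s\<bar> \<le> B * \<bar>g s\<bar>" if "s \<in> space (lebesgue_on X)" for s
      using assms(2)[of s] that by (auto simp: abs_mult mult.commute[of B] intro!: mult_left_mono)
  qed (use assms in auto)
  finally show ?thesis by simp
qed


section \<open>Antiderivatives and limits of weighted integrals\<close>

lemma integral_FTC_lebesgue_on:
  fixes F f :: "real \<Rightarrow> real"
  assumes "a \<le> b" "\<And>s. (F has_real_derivative f s) (at s)" "continuous_on {a..b} f"
  shows "(\<integral>s. f s \<partial>lebesgue_on {a..b}) = F b - F a"
proof -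
  have "(f has_integral F b - F a) {a..b}"
    by (rule fundamental_theorem_of_calculus[OF assms(1)])
      (use assms(2) has_real_derivative_iff_has_vector_derivative has_vector_derivative_at_within in blast)
  then show ?thesis
    using lebesgue_integral_eq_integral[OF continuous_integrable_lebesgue_on[OF assms(3)]]
    by (simp add: integral_unique)
qed

lemma ex_antiderivative:
  fixes x :: "real \<Rightarrow> real"
  assumes "continuous_on UNIV x"
  shows "\<exists>X. \<forall>s. (X has_real_derivative x s) (at s)"
  using einterval_antiderivative[of "-\<infinity>" "\<infinity>" x] assms
  by (auto simp: continuous_on_eq_continuous_at has_real_derivative_iff_has_vector_derivative)

text \<open>Convergence is asked only in the open interval because the cutoff functions of the
  integration by parts vanish at the end points. The common bound \<open>B\<close> and the
  integrability of \<open>g\<close> supply the dominating function, so \<open>g\<close> itself may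
  be unbounded.\<close>

lemma weighted_dominated_convergence:
  fixes g y :: "real \<Rightarrow> real"
  assumes g: "integrable (lebesgue_on {a..b}) g"
    and yn: "\<And>k. continuous_on {a..b} (Y k)" and bd: "\<And>k s. s \<in> {a..b} \<Longrightarrow> \<bar>Y k s\<bar> \<le> B"
    and lim: "\<And>s. a < s \<Longrightarrow> s < b \<Longrightarrow> (\<lambda>k. Y k s) \<longlonglongrightarrow> y s" and y: "continuous_on {a..b} y"
  shows "(\<lambda>k. \<integral>s. g s * Y k s \<partial>lebesgue_on {a..b}) \<longlonglongrightarrow> (\<integral>s. g s * y s \<partial>lebesgue_on {a..b})"
proof (rule integral_dominated_convergence)
  show "integrable (lebesgue_on {a..b}) (\<lambda>s. \<bar>g s\<bar> * B)" using g by auto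
  have m: "u \<in> borel_measurable (lebesgue_on {a..b})" if "continuous_on {a..b} u" for u :: "real \<Rightarrow> real"
    using continuous_integrable_lebesgue_on[OF that] by auto
  show "(\<lambda>s. g s * y s) \<in> borel_measurable (lebesgue_on {a..b})" using g m[OF y] by auto
  show "(\<lambda>s. g s * Y k s) \<in> borel_measurable (lebesgue_on {a..b})" for k using g m[OF yn] by auto
  show "AE s in lebesgue_on {a..b}. norm (g s * Y k s) \<le> \<bar>g s\<bar> * B" for k
    by (rule AE_I2) (use bd in \<open>auto simp: abs_mult intro!: mult_left_mono\<close>)
  have "{a, b} \<in> null_sets lebesgue" 
    using negligible_iff_null_sets by (metis negligible_finite finite.emptyI finite.insertI)
  then have "AE s in lebesgue. s \<notin> {a, b}" by (rule AE_not_in)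
  then have "AE s in lebesgue_on {a..b}. s \<notin> {a, b}"
    by (subst AE_restrict_space_iff) auto
  then have "AE s in lebesgue_on {a..b}. s \<in> space (lebesgue_on {a..b}) \<and> s \<notin> {a, b}"
    by (auto intro: AE_I2)
  then show "AE s in lebesgue_on {a..b}. (\<lambda>k. g s * Y k s) \<longlonglongrightarrow> g s * y s"
    by eventually_elim (auto intro!: tendsto_mult lim)
qed

text \<open>The \<open>\<rho> k\<close> are an approximate identity at \<open>c\<close>:
  nonnegative, of mass one, supported within \<open>d k\<close> of \<open>c\<close>. The point
  \<open>c\<close> may be an end point of the interval, which is the case needed, since the slopes
  of the cutoffs concentrate at \<open>a\<close> and at \<open>b\<close>.\<close>

lemma tendsto_concentrating_integral:
  fixes F :: "real \<Rightarrow> real"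
  assumes F: "continuous_on {a..b} F" and c: "c \<in> {a..b}"
    and r: "\<And>k. continuous_on {a..b} (\<rho> k)" "\<And>k s. 0 \<le> \<rho> k s"
    and int: "\<And>k. (\<integral>s. \<rho> k s \<partial>lebesgue_on {a..b}) = 1"
    and supp: "\<And>k s. s \<in> {a..b} \<Longrightarrow> \<rho> k s \<noteq> 0 \<Longrightarrow> \<bar>s - c\<bar> \<le> d k" and d: "d \<longlonglongrightarrow> (0::real)"
  shows "(\<lambda>k. \<integral>s. F s * \<rho> k s \<partial>lebesgue_on {a..b}) \<longlonglongrightarrow> F c"
proof (rule LIMSEQ_I)
  fix e :: real assume "0 < e"
  then obtain \<delta> where \<delta>: "\<delta> > 0" "\<And>s. s \<in> {a..b} \<Longrightarrow> \<bar>s - c\<bar> < \<delta> \<Longrightarrow> \<bar>F s - F c\<bar> < e / 2"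
    using F c unfolding continuous_on_iff by (metis dist_real_def half_gt_zero)
  obtain N where N: "\<And>k. k \<ge> N \<Longrightarrow> d k < \<delta>"
    using order_tendstoD(2)[OF d \<delta>(1)] by (auto simp: eventually_sequentially)
  have "\<bar>(\<integral>s. F s * \<rho> k s \<partial>lebesgue_on {a..b}) - F c\<bar> < e" if "k \<ge> N" for k
  proof -
    have i1: "integrable (lebesgue_on {a..b}) (\<lambda>s. F s * \<rho> k s)"
      and i2: "integrable (lebesgue_on {a..b}) (\<rho> k)"
      and i3: "integrable (lebesgue_on {a..b}) (\<lambda>s. \<bar>(F s - F c) * \<rho> k s\<bar>)"
      by (intro continuous_integrable_lebesgue_on continuous_intros F r)+
    have "(\<integral>s. F s * \<rho> k s \<partial>lebesgue_on {a..b}) - F c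
        = (\<integral>s. F s * \<rho> k s \<partial>lebesgue_on {a..b}) - (\<integral>s. F c * \<rho> k s \<partial>lebesgue_on {a..b})"
      using int by simp
    also have "\<dots> = (\<integral>s. (F s - F c) * \<rho> k s \<partial>lebesgue_on {a..b})"
      using i1 i2 by (simp add: algebra_simps Bochner_Integration.integral_diff)
    also have "\<bar>\<dots>\<bar> \<le> (\<integral>s. \<bar>(F s - F c) * \<rho> k s\<bar> \<partial>lebesgue_on {a..b})"
      using integral_norm_bound[of "lebesgue_on {a..b}" "\<lambda>s. (F s - F c) * \<rho> k s"] by simp
    also have "\<dots> \<le> (\<integral>s. e / 2 * \<rho> k s \<partial>lebesgue_on {a..b})"
    proof (rule integral_mono)
      show "\<bar>(F s - F c) * \<rho> k s\<bar> \<le> e / 2 * \<rho> k s" if "s \<in> space (lebesgue_on {a..b})" for s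
      proof (cases "\<rho> k s = 0")
        case False
        then have "\<bar>s - c\<bar> < \<delta>" using supp[of s k] N[OF \<open>k \<ge> N\<close>] that by force
        then have "\<bar>F s - F c\<bar> \<le> e / 2" using \<delta>(2)[of s] that by force
        then show ?thesis unfolding abs_mult using r(2)[of k s] by (metis abs_of_nonneg mult_right_mono)
      qed simp
    qed (use i2 i3 in auto)
    also have "\<dots> = e / 2" using int by simp
    finally show ?thesis using \<open>0 < e\<close> by linarith
  qed
  then show "\<exists>N. \<forall>k\<ge>N. norm ((\<integral>s. F s * \<rho> k s \<partial>lebesgue_on {a..b}) - F c) < e"
    by auto
qed

text \<open>Rises from 0 to 1 on the interval from 0 to 2; its derivative is the hat function
  \<open>tent\<close> of height 1. Test functions of \<open>weak_deriv\<close> have to be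
  continuously differentiable only, so a piecewise quadratic is smooth enough.\<close>

definition smooth_step :: "real \<Rightarrow> real" where
  "smooth_step s = ((max 0 s)\<^sup>2 - 2 * (max 0 (s - 1))\<^sup>2 + (max 0 (s - 2))\<^sup>2) / 2"

definition tent :: "real \<Rightarrow> real" where
  "tent s = max 0 s - 2 * max 0 (s - 1) + max 0 (s - 2)"

lemma has_derivative_square_pos_part: "((\<lambda>s. (max 0 s)\<^sup>2) has_real_derivative 2 * max 0 (s::real)) (at s)"
proof (cases "s = 0")
  case True
  have "((\<lambda>h. ((max 0 h)\<^sup>2 :: real) / h) \<longlongrightarrow> 0) (at 0)"
  proof (rule Lim_null_comparison)
    show "\<forall>\<^sub>F h in at 0. norm ((max 0 h)\<^sup>2 / h) \<le> \<bar>h::real\<bar>"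
      by (rule eventuallyI) (auto simp: max_def power2_eq_square)
    show "((\<lambda>h::real. \<bar>h\<bar>) \<longlongrightarrow> 0) (at 0)" by (rule tendsto_rabs_zero) (rule tendsto_ident_at)
  qed
  then show ?thesis using True by (simp add: has_field_derivative_iff)
next
  case False
  then consider "s > 0" | "s < 0" by linarith
  then show ?thesis
  proof cases
    case 1
    have "((\<lambda>s. s\<^sup>2) has_real_derivative 2 * max 0 s) (at s)"
      using 1 by (auto intro!: derivative_eq_intros)
    then show ?thesis
      by (rule has_field_derivative_transform_within_open[where S="{0<..}"]) (use 1 in auto)
  next
    case 2
    have "((\<lambda>s. 0) has_real_derivative 2 * max 0 s) (at s)"
      using 2 by (auto intro!: derivative_eq_intros)
    then show ?thesis
      by (rule has_field_derivative_transform_within_open[where S="{..<0}"]) (use 2 in auto)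
  qed
qed

lemma smooth_step_derivative: "(smooth_step has_real_derivative tent s) (at s)"
proof -
  have shift: "((\<lambda>s. (max 0 (s - c))\<^sup>2) has_real_derivative 2 * max 0 (s - c)) (at s)" for c
  proof -
    have "((\<lambda>s. s - c) has_real_derivative 1) (at s)" by (auto intro!: derivative_eq_intros)
    from DERIV_chain2[OF has_derivative_square_pos_part this] show ?thesis by simp
  qed
  show ?thesis unfolding smooth_step_def[abs_def] tent_def
    by (rule derivative_eq_intros shift[of 0, simplified] shift[of 1] shift[of 2] refl)+
      (simp_all add: field_simps)
qed

lemma smooth_step_props:
  "s \<le> 0 \<Longrightarrow> smooth_step s = 0" "s \<ge> 2 \<Longrightarrow> smooth_step s = 1"
  "0 \<le> tent s" "s \<le> 0 \<Longrightarrow> tent s = 0" "s \<ge> 2 \<Longrightarrow> tent s = 0"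
  by (auto simp: smooth_step_def tent_def max_def power2_eq_square algebra_simps)

text \<open>The slope \<open>tent\<close> is nonnegative, so the step is monotone and lies between
  its values at \<open>min 0 s\<close> and at \<open>max 2 s\<close>.\<close>

lemma smooth_step_bounds: "0 \<le> smooth_step s" "smooth_step s \<le> 1"
proof -
  have mono: "smooth_step u \<le> smooth_step v" if "u \<le> v" for u v
    using DERIV_nonneg_imp_nondecreasing[OF that, of smooth_step] smooth_step_derivative smooth_step_props(3)
    by blast
  show "0 \<le> smooth_step s" using mono[of "min 0 s" s] smooth_step_props(1)[of "min 0 s"] by auto
  show "smooth_step s \<le> 1" using mono[of s "max 2 s"] smooth_step_props(2)[of "max 2 s"] by auto
qed

lemma continuous_tent: "continuous_on A (\<lambda>s. tent (f s))" if "continuous_on A f"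
  unfolding tent_def using that by (intro continuous_intros)


text \<open>The weak derivative is tested with \<open>\<chi> k s * X s\<close>, where the cutoff
  \<open>\<chi> k\<close> is 1 away from the end points. The derivative of this product is
  \<open>\<chi> k s * x s\<close> plus \<open>X\<close> times a bump near \<open>a\<close> minus
  \<open>X\<close> times a bump near \<open>b\<close>; as the cutoffs fill the interval, the bumps
  produce the two boundary terms.\<close>

lemma weak_deriv_integral_by_parts:
  fixes f g x X :: "real \<Rightarrow> real"
  assumes wd: "weak_deriv {a..b} f g" and ab: "a < b"
    and f: "continuous_on {a..b} f" and g: "integrable (lebesgue_on {a..b}) g"
    and X: "\<And>s. (X has_real_derivative x s) (at s)" and x: "continuous_on UNIV x"
  shows "(\<integral>s. f s * x s \<partial>lebesgue_on {a..b}) = f b * X b - f a * X a - (\<integral>s. g s * X s \<partial>lebesgue_on {a..b})"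
proof -
  \<comment> \<open>The 6 keeps \<open>6 * e k \<le> b - a\<close>, so that the rising part of the
    cutoff ends before its falling part begins.\<close>
  define e where "e k = (b - a) / (6 * real (Suc k))" for k
  have e0: "e k > 0" for k using ab by (simp add: e_def)
  have e6: "6 * e k \<le> b - a" for k
  proof -
    have "6 * e k = (b - a) / real (Suc k)" by (simp add: e_def field_simps)
    also have "\<dots> \<le> (b - a) / 1" by (rule divide_left_mono) (use ab in auto)
    finally show ?thesis by simp
  qed
  have elim: "e \<longlonglongrightarrow> 0"
  proof -
    have "(\<lambda>k. (b - a) / 6 * inverse (real (Suc k))) \<longlonglongrightarrow> (b - a) / 6 * 0"
      by (intro tendsto_mult tendsto_const LIMSEQ_inverse_real_of_nat)
    then show ?thesis unfolding e_def[abs_def] by (simp add: field_simps)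
  qed
  \<comment> \<open>\<open>p k\<close> carries the interval from \<open>a + e k\<close> to
    \<open>a + 3 * e k\<close>, and \<open>q k\<close> the interval from \<open>b - 3 * e k\<close>
    to \<open>b - e k\<close>, onto the transition zone of \<open>smooth_step\<close>. The margins
    of width \<open>e k\<close> put the support of \<open>\<chi> k\<close> in the interior, as a
    test function requires.\<close>
  define p where "p k s = (s - a - e k) / e k" for k s
  define q where "q k s = (s - b + 3 * e k) / e k" for k s
  define \<chi> where "\<chi> k s = smooth_step (p k s) - smooth_step (q k s)" for k s
  define \<rho>p where "\<rho>p k s = tent (p k s) / e k" for k s
  define \<rho>q where "\<rho>q k s = tent (q k s) / e k" for k s
  have dp: "((\<lambda>s. smooth_step (p k s)) has_real_derivative \<rho>p k s) (at s)" for k s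
  proof -
    have "(p k has_real_derivative 1 / e k) (at s)"
      unfolding p_def[abs_def] using e0[of k] by (auto intro!: derivative_eq_intros)
    from DERIV_chain2[OF smooth_step_derivative this] show ?thesis by (simp add: \<rho>p_def)
  qed
  have dq: "((\<lambda>s. smooth_step (q k s)) has_real_derivative \<rho>q k s) (at s)" for k s
  proof -
    have "(q k has_real_derivative 1 / e k) (at s)"
      unfolding q_def[abs_def] using e0[of k] by (auto intro!: derivative_eq_intros)
    from DERIV_chain2[OF smooth_step_derivative this] show ?thesis by (simp add: \<rho>q_def)
  qed
  have cp: "continuous_on A (\<rho>p k)" and cq: "continuous_on A (\<rho>q k)" for A k
    unfolding \<rho>p_def[abs_def] \<rho>q_def[abs_def] p_def[abs_def] q_def[abs_def] using e0[of k]
    by (auto intro!: continuous_intros continuous_tent)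
  have nn: "0 \<le> \<rho>p k s" "0 \<le> \<rho>q k s" for k s
    using e0[of k] by (simp_all add: \<rho>p_def \<rho>q_def smooth_step_props)
  have zero: "p k s \<le> 0 \<longleftrightarrow> s \<le> a + e k" "2 \<le> p k s \<longleftrightarrow> a + 3 * e k \<le> s"
    "q k s \<le> 0 \<longleftrightarrow> s \<le> b - 3 * e k" "2 \<le> q k s \<longleftrightarrow> b - e k \<le> s" for k s
    using e0[of k] by (auto simp: p_def q_def field_simps)
  have Xc: "continuous_on A X" for A
    using X by (meson DERIV_isCont continuous_at_imp_continuous_on)
  have xc: "continuous_on A x" for A using x continuous_on_subset by blast
  have \<chi>c: "continuous_on A (\<chi> k)" for A k
    unfolding \<chi>_def[abs_def] using DERIV_isCont[OF dp] DERIV_isCont[OF dq]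
    by (intro continuous_intros) (auto intro!: continuous_at_imp_continuous_on)
  have \<chi>b: "\<bar>\<chi> k s\<bar> \<le> 1" for k s
    unfolding \<chi>_def using smooth_step_bounds[of "p k s"] smooth_step_bounds[of "q k s"] by linarith
  have \<chi>0: "\<chi> k s = 0" if "s \<notin> {a + e k .. b - e k}" for k s
    using that e0[of k] e6[of k] zero[of k s] unfolding \<chi>_def
    by (cases "s \<le> a + e k") (auto simp: smooth_step_props)
  have \<chi>1: "\<chi> k s = 1" if "a + 3 * e k \<le> s" "s \<le> b - 3 * e k" for k s
    using that zero[of k s] unfolding \<chi>_def by (auto simp: smooth_step_props)
  have \<chi>lim: "(\<lambda>k. \<chi> k s) \<longlonglongrightarrow> 1" if "a < s" "s < b" for s
  proof (rule tendsto_eventually)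
    have "(\<lambda>k. 3 * e k) \<longlonglongrightarrow> 3 * 0" by (intro tendsto_intros elim)
    then have "\<forall>\<^sub>F k in sequentially. 3 * e k < min (s - a) (b - s)"
      by (rule order_tendstoD) (use that in auto)
    then show "\<forall>\<^sub>F k in sequentially. \<chi> k s = 1"
      by eventually_elim (auto intro!: \<chi>1)
  qed
  \<comment> \<open>The defining identity of the weak derivative at this test function, arranged so
    that each of the four integrals has a limit of its own.\<close>
  have eq: "(\<integral>s. f s * (\<chi> k s * x s) \<partial>lebesgue_on {a..b})
      + ((\<integral>s. (f s * X s) * \<rho>p k s \<partial>lebesgue_on {a..b}) - (\<integral>s. (f s * X s) * \<rho>q k s \<partial>lebesgue_on {a..b}))
      = - (\<integral>s. g s * (\<chi> k s * X s) \<partial>lebesgue_on {a..b})" for k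
  proof -
    let ?d = "\<lambda>s. \<chi> k s * x s + (\<rho>p k s - \<rho>q k s) * X s"
    have "\<And>s. ((\<lambda>s. \<chi> k s * X s) has_real_derivative ?d s) (at s)"
      unfolding \<chi>_def by (auto intro!: derivative_eq_intros dp dq X simp: algebra_simps)
    moreover have "continuous_on UNIV ?d"
      by (intro continuous_intros \<chi>c xc cp cq Xc)
    moreover have "\<exists>K. compact K \<and> K \<subseteq> interior {a..b} \<and> (\<forall>s. s \<notin> K \<longrightarrow> \<chi> k s * X s = 0)"
      using \<chi>0[of _ k] e0[of k] by (intro exI[of _ "{a + e k .. b - e k}"]) auto
    ultimately have "(\<integral>s. f s * ?d s \<partial>lebesgue_on {a..b}) = - (\<integral>s. g s * (\<chi> k s * X s) \<partial>lebesgue_on {a..b})"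
      using wd[unfolded weak_deriv_def, rule_format, of "\<lambda>s. \<chi> k s * X s" ?d] by blast
    moreover have "(\<integral>s. f s * ?d s \<partial>lebesgue_on {a..b}) =
      (\<integral>s. f s * (\<chi> k s * x s) + ((f s * X s) * \<rho>p k s - (f s * X s) * \<rho>q k s) \<partial>lebesgue_on {a..b})"
      by (simp add: algebra_simps)
    moreover have "\<dots> = (\<integral>s. f s * (\<chi> k s * x s) \<partial>lebesgue_on {a..b})
      + ((\<integral>s. (f s * X s) * \<rho>p k s \<partial>lebesgue_on {a..b}) - (\<integral>s. (f s * X s) * \<rho>q k s \<partial>lebesgue_on {a..b}))"
    proof -
      have i: "integrable (lebesgue_on {a..b}) (\<lambda>s. f s * (\<chi> k s * x s))"
        "integrable (lebesgue_on {a..b}) (\<lambda>s. (f s * X s) * \<rho>p k s)"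
        "integrable (lebesgue_on {a..b}) (\<lambda>s. (f s * X s) * \<rho>q k s)"
        by (intro continuous_integrable_lebesgue_on continuous_intros f \<chi>c xc cp cq Xc)+
      show ?thesis using i by simp
    qed
    ultimately show ?thesis by simp
  qed
  obtain Bx where Bx: "\<And>s. s \<in> {a..b} \<Longrightarrow> \<bar>x s\<bar> \<le> Bx"
    using continuous_Icc_bounded[OF xc] by blast
  obtain BX where BX: "\<And>s. s \<in> {a..b} \<Longrightarrow> \<bar>X s\<bar> \<le> BX"
    using continuous_Icc_bounded[OF Xc] by blast
  have le: "\<bar>\<chi> k s * y\<bar> \<le> B" if "\<bar>y\<bar> \<le> B" for k s y B
    using mult_mono[OF \<chi>b[of k s] that] by (simp add: abs_mult)
  have l1: "(\<lambda>k. \<integral>s. f s * (\<chi> k s * x s) \<partial>lebesgue_on {a..b}) \<longlonglongrightarrow> (\<integral>s. f s * x s \<partial>lebesgue_on {a..b})"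
    by (rule weighted_dominated_convergence[where B=Bx])
      (use tendsto_mult[OF \<chi>lim tendsto_const] in
        \<open>auto intro!: continuous_integrable_lebesgue_on f continuous_intros \<chi>c xc le Bx\<close>)
  have l2: "(\<lambda>k. \<integral>s. g s * (\<chi> k s * X s) \<partial>lebesgue_on {a..b}) \<longlonglongrightarrow> (\<integral>s. g s * X s \<partial>lebesgue_on {a..b})"
    by (rule weighted_dominated_convergence[where B=BX])
      (use tendsto_mult[OF \<chi>lim tendsto_const] in
        \<open>auto intro!: g continuous_intros \<chi>c Xc le BX\<close>)
  have l3: "(\<lambda>k. \<integral>s. (f s * X s) * \<rho>p k s \<partial>lebesgue_on {a..b}) \<longlonglongrightarrow> f a * X a"
  proof (rule tendsto_concentrating_integral[where d="\<lambda>k. 3 * e k"])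
    show "(\<integral>s. \<rho>p k s \<partial>lebesgue_on {a..b}) = 1" for k
      using integral_FTC_lebesgue_on[OF _ dp cp, of a b k] ab zero[of k a] zero[of k b] e0[of k] e6[of k]
      by (simp add: smooth_step_props)
    show "\<bar>s - a\<bar> \<le> 3 * e k" if "s \<in> {a..b}" "\<rho>p k s \<noteq> 0" for k s
    proof (rule ccontr)
      assume "\<not> ?thesis"
      then have "2 \<le> p k s" using that zero[of k s] by auto
      then show False using that by (simp add: \<rho>p_def smooth_step_props)
    qed
    show "(\<lambda>k. 3 * e k) \<longlonglongrightarrow> 0" using tendsto_mult[OF tendsto_const elim, of 3] by simp
  qed (use ab nn in \<open>auto intro!: continuous_intros f Xc cp\<close>)
  have l4: "(\<lambda>k. \<integral>s. (f s * X s) * \<rho>q k s \<partial>lebesgue_on {a..b}) \<longlonglongrightarrow> f b * X b"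
  proof (rule tendsto_concentrating_integral[where d="\<lambda>k. 3 * e k"])
    show "(\<integral>s. \<rho>q k s \<partial>lebesgue_on {a..b}) = 1" for k
      using integral_FTC_lebesgue_on[OF _ dq cq, of a b k] ab zero[of k a] zero[of k b] e0[of k] e6[of k]
      by (simp add: smooth_step_props)
    show "\<bar>s - b\<bar> \<le> 3 * e k" if "s \<in> {a..b}" "\<rho>q k s \<noteq> 0" for k s
    proof (rule ccontr)
      assume "\<not> ?thesis"
      then have "q k s \<le> 0" using that zero[of k s] by auto
      then show False using that by (simp add: \<rho>q_def smooth_step_props)
    qed
    show "(\<lambda>k. 3 * e k) \<longlonglongrightarrow> 0" using tendsto_mult[OF tendsto_const elim, of 3] by simp
  qed (use ab nn in \<open>auto intro!: continuous_intros f Xc cq\<close>)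
  show ?thesis
    using LIMSEQ_unique[OF tendsto_add[OF l1 tendsto_diff[OF l3 l4], unfolded eq] tendsto_minus[OF l2]]
    by linarith
qed

section \<open>Integrals over a moving window\<close>

lemma bounded_shift:
  fixes x :: "real \<Rightarrow> real"
  assumes "continuous_on UNIV x" 
  shows "\<exists>B. \<forall>u. a - H \<le> u \<and> u \<le> b + H \<longrightarrow> \<bar>x u\<bar> \<le> B"
  using continuous_Icc_bounded[OF continuous_on_subset[OF assms(1) subset_UNIV], of "a - H" "b + H"]
  by (simp add: Ball_def)

text \<open>A convergent sequence of shifts is bounded, so all shifted functions share a bound on
  one compact interval and dominated convergence applies.\<close>

lemma shift_integral_continuous:
  fixes g y :: "real \<Rightarrow> real"
  assumes g: "integrable (lebesgue_on {a..b}) g" and y: "continuous_on UNIV y"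
  shows "continuous_on UNIV (\<lambda>t. \<integral>s. g s * y (t + s) \<partial>lebesgue_on {a..b})"
  unfolding continuous_on_sequentially
proof (intro allI ballI impI, elim conjE)
  fix T t assume T: "T \<longlonglongrightarrow> t" "\<forall>n::nat. T n \<in> (UNIV :: real set)"
  have yc: "isCont y u" for u using y by (simp add: continuous_on_eq_continuous_at)
  have ys: "continuous_on A (\<lambda>s. y (c + s))" for A c
    by (intro continuous_on_compose2[OF y]) (auto intro!: continuous_intros)
  obtain C where C: "\<And>n. \<bar>T n\<bar> \<le> C"
    using convergent_imp_bounded[of T] T(1) by (auto simp: convergent_def bounded_iff)
  obtain B where B: "\<And>u. a - C \<le> u \<Longrightarrow> u \<le> b + C \<Longrightarrow> \<bar>y u\<bar> \<le> B"
    using bounded_shift[OF y, of a C b] by blast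
  show "((\<lambda>t. \<integral>s. g s * y (t + s) \<partial>lebesgue_on {a..b}) \<circ> T) \<longlonglongrightarrow> (\<integral>s. g s * y (t + s) \<partial>lebesgue_on {a..b})"
    unfolding o_def
  proof (rule weighted_dominated_convergence[OF g ys _ _ ys])
    show "\<bar>y (T k + s)\<bar> \<le> B" if "s \<in> {a..b}" for k s
      using that C[of k] by (intro B) auto
    show "(\<lambda>k. y (T k + s)) \<longlonglongrightarrow> y (t + s)" for s
      by (rule isCont_tendsto_compose[OF yc]) (intro tendsto_intros T)
  qed
qed

text \<open>Difference quotients of \<open>X\<close> are values of \<open>x\<close> at intermediate
  points. They are therefore bounded uniformly in the step, and dominated convergence moves the
  limit inside although \<open>g\<close> is only integrable.\<close>

lemma shift_integral_derivative:
  fixes g x X :: "real \<Rightarrow> real"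
  assumes g: "integrable (lebesgue_on {a..b}) g" and x: "continuous_on UNIV x"
    and X: "\<And>s. (X has_real_derivative x s) (at s)"
  shows "((\<lambda>t. \<integral>s. g s * X (t + s) \<partial>lebesgue_on {a..b}) has_real_derivative
    (\<integral>s. g s * x (t + s) \<partial>lebesgue_on {a..b})) (at t)"
  unfolding DERIV_def tendsto_at_iff_sequentially
proof (intro allI impI)
  fix h assume h0: "\<forall>i. h i \<in> UNIV - {0::real}" and h: "h \<longlonglongrightarrow> 0"
  have Xc: "continuous_on UNIV X" using X by (meson DERIV_isCont continuous_at_imp_continuous_on)
  have Xs: "continuous_on A (\<lambda>s. X (c + s))" for A c
    by (intro continuous_on_compose2[OF Xc]) (auto intro!: continuous_intros)
  have xs: "continuous_on A (\<lambda>s. x (c + s))" for A c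
    by (intro continuous_on_compose2[OF x]) (auto intro!: continuous_intros)
  obtain C where C: "\<And>n. \<bar>h n\<bar> \<le> C"
    using convergent_imp_bounded[of h] h by (auto simp: convergent_def bounded_iff)
  obtain B where B: "\<And>u. t + a - C \<le> u \<Longrightarrow> u \<le> t + b + C \<Longrightarrow> \<bar>x u\<bar> \<le> B"
    using bounded_shift[OF x, of "t + a" C "t + b"] by blast
  have Xg: "integrable (lebesgue_on {a..b}) (\<lambda>s. g s * X (c + s))" for c
  proof -
    obtain B' where B': "\<And>s. s \<in> {a..b} \<Longrightarrow> \<bar>X (c + s)\<bar> \<le> B'"
      using continuous_Icc_bounded[OF Xs] by blast
    show ?thesis
    proof (rule Bochner_Integration.integrable_bound)
      show "integrable (lebesgue_on {a..b}) (\<lambda>s. \<bar>g s\<bar> * B')" using g by auto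
      show "(\<lambda>s. g s * X (c + s)) \<in> borel_measurable (lebesgue_on {a..b})"
        using g continuous_integrable_lebesgue_on[OF Xs] by auto
      show "AE s in lebesgue_on {a..b}. norm (g s * X (c + s)) \<le> norm (\<bar>g s\<bar> * B')"
        by (rule AE_I2) (use B' in \<open>force simp: abs_mult intro!: mult_left_mono\<close>)
    qed
  qed
  let ?Y = "\<lambda>k s. (X (t + h k + s) - X (t + s)) / h k"
  have "(\<lambda>k. \<integral>s. g s * ?Y k s \<partial>lebesgue_on {a..b}) \<longlonglongrightarrow> (\<integral>s. g s * x (t + s) \<partial>lebesgue_on {a..b})"
  proof (rule weighted_dominated_convergence[OF g _ _ _ xs])
    show "continuous_on {a..b} (?Y k)" for k
      using h0 by (intro continuous_intros Xs) auto
    show "\<bar>?Y k s\<bar> \<le> B" if s: "s \<in> {a..b}" for k s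
    proof -
      \<comment> \<open>The mean value theorem, applied to the right or to the left of
        \<open>t + s\<close> according to the sign of \<open>h k\<close>.\<close>
      have "\<exists>z. min (t + s) (t + h k + s) \<le> z \<and> z \<le> max (t + s) (t + h k + s) \<and> ?Y k s = x z"
      proof (cases "h k > 0")
        case True
        then obtain z where "z > t + s" "z < t + h k + s" "X (t + h k + s) - X (t + s) = (t + h k + s - (t + s)) * x z"
          using MVT2[of "t + s" "t + h k + s" X x] X by auto
        then show ?thesis using True by (intro exI[of _ z]) auto
      next
        case False
        then have "h k < 0" using h0 by (metis DiffD2 insertCI linorder_less_linear)
        then obtain z where "z > t + h k + s" "z < t + s" "X (t + s) - X (t + h k + s) = (t + s - (t + h k + s)) * x z"
          using MVT2[of "t + h k + s" "t + s" X x] X by auto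
        then show ?thesis using \<open>h k < 0\<close> by (intro exI[of _ z]) (auto simp: field_simps)
      qed
      then obtain z where z: "min (t + s) (t + h k + s) \<le> z" "z \<le> max (t + s) (t + h k + s)" "?Y k s = x z"
        by blast
      have "t + a - C \<le> z" "z \<le> t + b + C" using z s C[of k] by (auto simp: min_def max_def split: if_splits)
      then show ?thesis using B z by simp
    qed
    show "(\<lambda>k. ?Y k s) \<longlonglongrightarrow> x (t + s)" for s
    proof -
      have "(\<lambda>h. (X (t + s + h) - X (t + s)) / h) \<midarrow>0\<rightarrow> x (t + s)"
        using X[of "t + s"] by (simp add: DERIV_def)
      then have "((\<lambda>h. (X (t + s + h) - X (t + s)) / h) \<circ> h) \<longlonglongrightarrow> x (t + s)"
        using h0 h unfolding tendsto_at_iff_sequentially by blast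
      then show ?thesis by (simp add: o_def add_ac)
    qed
  qed
  moreover have "(\<integral>s. g s * ?Y k s \<partial>lebesgue_on {a..b}) = ((\<integral>s. g s * X (t + h k + s) \<partial>lebesgue_on {a..b}) -
       (\<integral>s. g s * X (t + s) \<partial>lebesgue_on {a..b})) / h k" for k
    using Xg[of t] Xg[of "t + h k"] by (simp add: right_diff_distrib diff_divide_distrib)
  ultimately show "((\<lambda>h. ((\<integral>s. g s * X (t + h + s) \<partial>lebesgue_on {a..b}) -
       (\<integral>s. g s * X (t + s) \<partial>lebesgue_on {a..b})) / h) \<circ> h) \<longlonglongrightarrow> (\<integral>s. g s * x (t + s) \<partial>lebesgue_on {a..b})"
    by (simp only: o_def)
qed

text \<open>One antiderivative \<open>X\<close> serves all \<open>t\<close>, because its shift by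
  \<open>t\<close> is an antiderivative of the shifted \<open>x\<close>. After integration by parts
  every term depends on \<open>t\<close> through \<open>X\<close> alone, so neither \<open>x\<close>
  nor \<open>f\<close> has to be differentiable in the classical sense.\<close>

lemma delay_integral_derivative:
  fixes f g x :: "real \<Rightarrow> real"
  assumes wd: "weak_deriv {a..b} f g" and ab: "a < b"
    and f: "continuous_on {a..b} f" and g: "integrable (lebesgue_on {a..b}) g"
    and x: "continuous_on UNIV x"
  shows "((\<lambda>t. \<integral>s. f s * x (t + s) \<partial>lebesgue_on {a..b}) has_real_derivative
    f b * x (t + b) - f a * x (t + a) - (\<integral>s. g s * x (t + s) \<partial>lebesgue_on {a..b})) (at t)"
proof -
  obtain X where X: "\<And>s. (X has_real_derivative x s) (at s)"
    using ex_antiderivative[OF x] by blast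
  have Xt: "((\<lambda>s. X (c + s)) has_real_derivative x (c + s)) (at s)" for c s
  proof -
    have "((\<lambda>s. c + s) has_real_derivative 1) (at s)" by (auto intro!: derivative_eq_intros)
    from DERIV_chain2[OF X this] show ?thesis by simp
  qed
  have xt: "continuous_on UNIV (\<lambda>s. x (c + s))" for c
    by (intro continuous_on_compose2[OF x]) (auto intro!: continuous_intros)
  have "(\<lambda>t. \<integral>s. f s * x (t + s) \<partial>lebesgue_on {a..b}) =
      (\<lambda>t. f b * X (t + b) - f a * X (t + a) - (\<integral>s. g s * X (t + s) \<partial>lebesgue_on {a..b}))"
    by (rule ext, rule weak_deriv_integral_by_parts[OF wd ab f g Xt xt])
  moreover have "((\<lambda>t. X (t + c)) has_real_derivative x (t + c)) (at t)" for c
    using Xt[of c t] by (simp add: add.commute)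
  ultimately show ?thesis
    by (auto intro!: derivative_eq_intros shift_integral_derivative[OF g x X])
qed

text \<open>Brings the weights \<open>1\<close> and \<open>\<tau> + r i\<close> of the quadratic
  integrals under the same differentiation rule as the functions \<open>orth_f\<close>.\<close>

lemma weak_deriv_smooth:
  fixes f f' :: "real \<Rightarrow> real"
  assumes ab: "a < b" and f: "\<And>s. (f has_real_derivative f' s) (at s)" and f': "continuous_on UNIV f'"
  shows "weak_deriv {a..b} f f'"
  unfolding weak_deriv_def
proof (intro allI impI, elim conjE exE)
  fix \<eta> \<eta>' K
  assume \<eta>: "\<forall>s. (\<eta> has_real_derivative \<eta>' s) (at s)" "continuous_on UNIV \<eta>'"
    and K: "compact K" "K \<subseteq> interior {a..b}" "\<forall>s. s \<notin> K \<longrightarrow> \<eta> s = 0"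
  have c: "continuous_on {a..b} f" "continuous_on {a..b} f'" "continuous_on {a..b} \<eta>" "continuous_on {a..b} \<eta>'"
    using f f' \<eta> by (auto intro: continuous_on_subset continuous_at_imp_continuous_on DERIV_isCont)
  have "(\<integral>s. f s * \<eta>' s + f' s * \<eta> s \<partial>lebesgue_on {a..b}) = f b * \<eta> b - f a * \<eta> a"
  proof (rule integral_FTC_lebesgue_on)
    show "((\<lambda>s. f s * \<eta> s) has_real_derivative f s * \<eta>' s + f' s * \<eta> s) (at s)" for s
      using \<eta> f by (auto intro!: derivative_eq_intros simp: mult.commute)
  qed (use ab c in \<open>auto intro!: continuous_intros\<close>)
  moreover have "\<eta> a = 0" "\<eta> b = 0" using K by auto
  moreover have "integrable (lebesgue_on {a..b}) (\<lambda>s. f s * \<eta>' s)" "integrable (lebesgue_on {a..b}) (\<lambda>s. f' s * \<eta> s)"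
    by (intro continuous_integrable_lebesgue_on continuous_intros c)+
  ultimately show "(\<integral>s. f s * \<eta>' s \<partial>lebesgue_on {a..b}) = - (\<integral>s. f' s * \<eta> s \<partial>lebesgue_on {a..b})"
    by simp
qed

section \<open>Absolutely continuous functions\<close>

text \<open>A gauge argument. Around a point off \<open>N\<close> the increments are at most
  \<open>e\<close> times the length; the points of \<open>N\<close> are covered by an open set of
  small measure, on which absolute continuity makes the total increment less than \<open>e\<close>.
  A tagged division fine for this gauge splits \<open>f b - f a\<close> into these two kinds of
  increments.\<close>

lemma abs_cont_on_nonincreasing:
  assumes ac: "abs_cont_on a b f" and ab: "a \<le> b"
    and N: "negligible N"
    and D: "\<And>t. t \<in> {a..b} \<Longrightarrow> t \<notin> N \<Longrightarrow> \<exists>D\<le>0. (f has_real_derivative D) (at t)"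
  shows "f b \<le> f a"
proof (rule field_le_epsilon)
  fix e' :: real assume "0 < e'"
  \<comment> \<open>The total error will be \<open>e\<close> from the tags in \<open>N\<close> plus
    \<open>e * (b - a)\<close> from the others, which is exactly \<open>e'\<close>.\<close>
  define e where "e = e' / (b - a + 1)"
  have e: "e > 0" using \<open>0 < e'\<close> ab by (simp add: e_def)
  obtain \<delta> where \<delta>: "\<delta> > 0" "\<And>D. finite D \<Longrightarrow>
     (\<forall>(u, v) \<in> D. a \<le> u \<and> u \<le> v \<and> v \<le> b) \<Longrightarrow>
     pairwise (\<lambda>(u, v) (u', v'). v \<le> u' \<or> v' \<le> u) D \<Longrightarrow>
     (\<Sum>(u, v) \<in> D. v - u) < \<delta> \<Longrightarrow> (\<Sum>(u, v) \<in> D. \<bar>f v - f u\<bar>) < e"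
    using ac e unfolding abs_cont_on_def by meson
  \<comment> \<open>Outer regularity encloses the null set in an open \<open>U\<close> of measure
    below \<open>\<delta>\<close>, the total length that absolute continuity tolerates.\<close>
  have "N \<in> sets lebesgue" and N0: "emeasure lebesgue N = 0"
    using N by (auto simp: negligible_iff_null_sets)
  then obtain U where U: "open U" "N \<subseteq> U" "(U - N) \<in> lmeasurable" "emeasure lebesgue (U - N) < ennreal \<delta>"
    using sets_lebesgue_outer_open[of N \<delta>] \<delta>(1) by blast
  have Ul: "emeasure lebesgue U < ennreal \<delta>"
  proof -
    have "emeasure lebesgue U \<le> emeasure lebesgue (N \<union> (U - N))"
      using U by (intro emeasure_mono) (auto simp: \<open>N \<in> sets lebesgue\<close> fmeasurableD)
    also have "\<dots> \<le> emeasure lebesgue N + emeasure lebesgue (U - N)"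
      using U \<open>N \<in> sets lebesgue\<close> by (intro emeasure_subadditive) (auto simp: fmeasurableD)
    finally show ?thesis using U N0 by simp
  qed
  have "\<exists>r>0. \<forall>y. \<bar>y - t\<bar> < r \<longrightarrow> (t \<le> y \<longrightarrow> f y - f t \<le> e * (y - t)) \<and> (y \<le> t \<longrightarrow> f t - f y \<le> e * (t - y))"
    if t: "t \<in> {a..b}" "t \<notin> N" for t
  proof -
    obtain D where D: "D \<le> 0" "(f has_real_derivative D) (at t)" using D[OF t] by blast
    have "((\<lambda>y. (f y - f t) / (y - t)) \<longlongrightarrow> D) (at t)"
      using D(2) by (simp add: has_field_derivative_iff)
    moreover have "D < e" using D e by simp
    ultimately have "\<forall>\<^sub>F y in at t. (f y - f t) / (y - t) < e" by (rule order_tendstoD)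
    then obtain r where r: "r > 0" "\<And>y. y \<noteq> t \<Longrightarrow> dist y t < r \<Longrightarrow> (f y - f t) / (y - t) < e"
      by (auto simp: eventually_at)
    show ?thesis
    proof (intro exI[of _ r] conjI allI impI)
      fix y assume y: "\<bar>y - t\<bar> < r"
      { assume "t \<le> y"
        then show "f y - f t \<le> e * (y - t)" using r(2)[of y] y
          by (cases "y = t") (auto simp: dist_real_def pos_divide_less_eq) }
      { assume "y \<le> t"
        then show "f t - f y \<le> e * (t - y)" using r(2)[of y] y
          by (cases "y = t") (auto simp: dist_real_def neg_divide_less_eq algebra_simps) }
    qed (use r in auto)
  qed
  then obtain r where r: "\<And>t. t \<in> {a..b} \<Longrightarrow> t \<notin> N \<Longrightarrow> r t > 0"
    "\<And>t y. t \<in> {a..b} \<Longrightarrow> t \<notin> N \<Longrightarrow> \<bar>y - t\<bar> < r t \<Longrightarrow> t \<le> y \<Longrightarrow> f y - f t \<le> e * (y - t)"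
    "\<And>t y. t \<in> {a..b} \<Longrightarrow> t \<notin> N \<Longrightarrow> \<bar>y - t\<bar> < r t \<Longrightarrow> y \<le> t \<Longrightarrow> f t - f y \<le> e * (t - y)"
    using bchoice[of "{a..b} - N" "\<lambda>t r. r > 0 \<and> (\<forall>y. \<bar>y - t\<bar> < r \<longrightarrow>
      (t \<le> y \<longrightarrow> f y - f t \<le> e * (y - t)) \<and> (y \<le> t \<longrightarrow> f t - f y \<le> e * (t - y)))"]
    by blast
  \<comment> \<open>The value \<open>UNIV\<close> only completes the gauge, as tags lie between
    \<open>a\<close> and \<open>b\<close>.\<close>
  define \<gamma> where "\<gamma> t = (if t \<in> N then U else if t \<in> {a..b} then ball t (r t) else UNIV)" for t
  have "gauge \<gamma>"
    unfolding gauge_def \<gamma>_def using U r(1) by auto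
  then obtain p where p: "p tagged_division_of {a..b}" "\<gamma> fine p"
    by (rule fine_division_exists_real)
  have fin: "finite p" using p by auto
  have K: "\<exists>u v. K = {u..v} \<and> u \<le> t \<and> t \<le> v \<and> a \<le> u \<and> v \<le> b" if tK: "(t, K) \<in> p" for t K
  proof -
    have "t \<in> K" "K \<subseteq> {a..b}" using p(1) tK by auto
    moreover obtain u v where "K = cbox u v" using tagged_division_ofD(4)[OF p(1) tK] by blast
    ultimately show ?thesis by auto
  qed
  let ?d = "\<lambda>(t, K). f (Sup K) - f (Inf K)"
  let ?PN = "{(t, K) \<in> p. t \<in> N}"
  let ?PG = "{(t, K) \<in> p. t \<notin> N}"
  have "f b - f a = sum ?d p"
    using additive_tagged_division_1[OF ab p(1), of f] by simp
  also have "p = ?PN \<union> ?PG" by auto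
  also have "sum ?d (?PN \<union> ?PG) = sum ?d ?PN + sum ?d ?PG"
    using fin by (intro sum.union_disjoint) (auto intro: finite_subset[OF _ fin])
  also have "sum ?d ?PG \<le> (\<Sum>(t, K)\<in>?PG. e * (Sup K - Inf K))"
  proof (rule sum_mono, safe)
    fix t K assume tK: "(t, K) \<in> p" "t \<notin> N"
    then obtain u v where uv: "K = {u..v}" "u \<le> t" "t \<le> v" "a \<le> u" "v \<le> b" using K by blast
    have "K \<subseteq> ball t (r t)" using fineD[OF p(2) tK(1)] tK(2) uv unfolding \<gamma>_def by auto
    moreover have "u \<in> K" "v \<in> K" using uv by auto
    ultimately have "u \<in> ball t (r t)" "v \<in> ball t (r t)" by blast+
    then have "\<bar>u - t\<bar> < r t" "\<bar>v - t\<bar> < r t" by (auto simp: dist_real_def)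
    then have "f v - f t \<le> e * (v - t)" "f t - f u \<le> e * (t - u)"
      using r(2)[of t v] r(3)[of t u] tK uv by auto
    then show "f (Sup K) - f (Inf K) \<le> e * (Sup K - Inf K)"
      using uv by (simp add: algebra_simps)
  qed
  also have "(\<Sum>(t, K)\<in>?PG. e * (Sup K - Inf K)) \<le> (\<Sum>(t, K)\<in>p. e * (Sup K - Inf K))"
    using fin e by (intro sum_mono2) (auto dest!: K)
  also have "\<dots> = e * (b - a)"
    using additive_tagged_division_1[OF ab p(1), of "\<lambda>x. x"]
    by (simp add: sum_distrib_left[symmetric] case_prod_unfold)
  also have "sum ?d ?PN \<le> e"
  proof -
    \<comment> \<open>Degenerate intervals carry no increment. They are dropped because one of them
      may lie inside another interval of the division, which would violate the non-overlap condition
      in \<open>abs_cont_on\<close>.\<close>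
    let ?P = "{(t, K) \<in> p. t \<in> N \<and> Inf K < Sup K}"
    let ?h = "\<lambda>(t :: real, K :: real set). (Inf K, Sup K)"
    have disj: "v \<le> u' \<or> v' \<le> u" if "(t, {u..v}) \<in> p" "(t', {u'..v'}) \<in> p"
      "(t, {u..v}) \<noteq> (t', {u'..v'})" "u < v" "u' < v'" for t t' u v u' v'
    proof (rule ccontr)
      assume *: "\<not> ?thesis"
      have "interior {u..v} \<inter> interior {u'..v'} = {}"
        using tagged_division_ofD(5)[OF p(1) that(1,2,3)] .
      moreover have "(max u u' + min v v') / 2 \<in> {u<..<v} \<inter> {u'<..<v'}"
        using * that(4,5) by (auto simp: max_def min_def field_simps)
      ultimately show False by auto
    qed
    have inj: "inj_on ?h ?P"
    proof (rule inj_onI)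
      fix x y assume x: "x \<in> ?P" and y: "y \<in> ?P" and h: "?h x = ?h y"
      obtain t K t' K' where xy: "x = (t, K)" "y = (t', K')" by (metis prod.exhaust)
      have p: "(t, K) \<in> p" "(t', K') \<in> p" "Inf K < Sup K" "Inf K = Inf K'" "Sup K = Sup K'"
        using x y h by (auto simp: xy)
      obtain u v where uv: "K = {u..v}" "u \<le> t" "t \<le> v" using K[OF p(1)] by blast
      obtain u' v' where uv': "K' = {u'..v'}" "u' \<le> t'" "t' \<le> v'" using K[OF p(2)] by blast
      have eq: "u = u'" "v = v'" "u < v" using p(3-5) uv uv' by simp_all
      show "x = y"
      proof (rule ccontr)
        assume "x \<noteq> y"
        then have "v \<le> u' \<or> v' \<le> u"
          using p(1,2) eq by (intro disj[of t u v t' u' v']) (simp_all add: xy uv uv')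
        then show False using eq by simp
      qed
    qed
    have "sum ?d ?PN = sum ?d ?P"
    proof (rule sum.mono_neutral_right)
      show "finite ?PN" by (rule finite_subset[OF _ fin]) auto
      show "\<forall>y\<in>?PN - ?P. ?d y = 0"
      proof (rule ballI)
        fix y assume y: "y \<in> ?PN - ?P"
        obtain t K where tK: "y = (t, K)" by fastforce
        have *: "(t, K) \<in> p" "\<not> Inf K < Sup K" using y by (auto simp: tK)
        obtain u v where uv: "K = {u..v}" "u \<le> t" "t \<le> v" using K[OF *(1)] by blast
        then have "u = v" using * by auto
        then show "?d y = 0" using uv by (simp add: tK)
      qed
    qed auto
    also have "\<dots> = (\<Sum>(u, v)\<in>?h ` ?P. f v - f u)"
      using inj by (subst sum.reindex) (auto intro!: sum.cong)
    also have "\<dots> \<le> (\<Sum>(u, v)\<in>?h ` ?P. \<bar>f v - f u\<bar>)"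
      by (rule sum_mono) auto
    also have "\<dots> < e"
    proof (rule \<delta>(2))
      show finh: "finite (?h ` ?P)" using fin by (auto intro: finite_subset[OF _ fin])
      show "\<forall>(u, v) \<in> ?h ` ?P. a \<le> u \<and> u \<le> v \<and> v \<le> b"
        by (auto dest!: K)
      show pw: "pairwise (\<lambda>(u, v) (u', v'). v \<le> u' \<or> v' \<le> u) (?h ` ?P)"
      proof (rule pairwiseI)
        fix x y assume xy: "x \<in> ?h ` ?P" "y \<in> ?h ` ?P" "x \<noteq> y"
        obtain t K where tK: "(t, K) \<in> p" "Inf K < Sup K" "x = (Inf K, Sup K)" using xy(1) by auto
        obtain t' K' where tK': "(t', K') \<in> p" "Inf K' < Sup K'" "y = (Inf K', Sup K')" using xy(2) by auto
        obtain u v where uv: "K = {u..v}" "u \<le> t" "t \<le> v" using K[OF tK(1)] by blast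
        obtain u' v' where uv': "K' = {u'..v'}" "u' \<le> t'" "t' \<le> v'" using K[OF tK'(1)] by blast
        have lt: "u < v" "u' < v'" "{u..v} \<noteq> {u'..v'}" using tK tK' xy(3) uv uv' by auto
        then have "v \<le> u' \<or> v' \<le> u"
          using tK(1) tK'(1) by (intro disj[of t u v t' u' v']) (simp_all add: uv uv')
        then show "(case x of (u, v) \<Rightarrow> \<lambda>(u', v'). v \<le> u' \<or> v' \<le> u) y"
          using tK(3) tK'(3) lt uv uv' by simp
      qed
      have sub: "(\<Union>i\<in>?h ` ?P. {fst i<..<snd i}) \<subseteq> U"
      proof safe
        fix t K y assume *: "(t, K) \<in> p" "t \<in> N" and y: "y \<in> {fst (Inf K, Sup K)<..<snd (Inf K, Sup K)}"
        have "K \<subseteq> U" using fineD[OF p(2) *(1)] *(2) unfolding \<gamma>_def by auto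
        then show "y \<in> U" using K[OF *(1)] y by force
      qed
      have disj_ivl: "disjoint_family_on (\<lambda>i. {fst i<..<snd i}) (?h ` ?P)"
        unfolding disjoint_family_on_def
      proof (intro ballI impI)
        fix i j assume ij: "i \<in> ?h ` ?P" "j \<in> ?h ` ?P" "i \<noteq> j"
        have "(case i of (u, v) \<Rightarrow> \<lambda>(u', v'). v \<le> u' \<or> v' \<le> u) j"
          by (rule pairwiseD[OF pw ij])
        then show "{fst i<..<snd i} \<inter> {fst j<..<snd j} = {}"
          by (cases i; cases j) auto
      qed
      \<comment> \<open>The total length is the measure of a disjoint union of open intervals, and
        this union is contained in \<open>U\<close>.\<close>
      have "ennreal (\<Sum>(u, v)\<in>?h ` ?P. v - u) = (\<Sum>(u, v)\<in>?h ` ?P. ennreal (v - u))"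
        by (subst sum_ennreal[symmetric]) (auto simp: case_prod_unfold)
      also have "\<dots> = (\<Sum>i\<in>?h ` ?P. emeasure lebesgue {fst i<..<snd i})"
        by (rule sum.cong) auto
      also have "\<dots> = emeasure lebesgue (\<Union>i\<in>?h ` ?P. {fst i<..<snd i})"
        by (rule sum_emeasure)
          (use finh disj_ivl in auto)
      also have "\<dots> \<le> emeasure lebesgue U"
        using U(1) sub by (intro emeasure_mono) auto
      also have "\<dots> < ennreal \<delta>" by (rule Ul)
      finally have "ennreal (\<Sum>(u, v)\<in>?h ` ?P. v - u) < ennreal \<delta>" .
      moreover have "0 \<le> (\<Sum>(u, v)\<in>?h ` ?P. v - u)" by (rule sum_nonneg) auto
      ultimately show "(\<Sum>(u, v)\<in>?h ` ?P. v - u) < \<delta>" by (simp only: ennreal_less_iff)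
    qed
    finally show ?thesis by simp
  qed
  finally have "f b - f a \<le> e + e * (b - a)" by simp
  also have "\<dots> = e * (b - a + 1)" by (simp add: algebra_simps)
  also have "\<dots> = e'" using ab by (simp add: e_def)
  finally show "f b \<le> f a + e'" by simp
qed


text \<open>A single criterion behind sums, products, constants and C1 functions: increments
  dominated by those of absolutely continuous functions. Two comparison functions are allowed for
  the sake of products.\<close>

lemma abs_cont_on_lipschitz_comb:
  assumes f: "abs_cont_on a b f" and g: "abs_cont_on a b g"
    and C: "\<And>u v. a \<le> u \<Longrightarrow> u \<le> v \<Longrightarrow> v \<le> b \<Longrightarrow> \<bar>h v - h u\<bar> \<le> C * (\<bar>f v - f u\<bar> + \<bar>g v - g u\<bar>)"
  shows "abs_cont_on a b h"
  unfolding abs_cont_on_def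
proof (intro allI impI)
  fix e :: real assume "e > 0"
  \<comment> \<open>\<open>C\<close> may be 0, as it is for constants, but the tolerance has to be
    divided by a positive number.\<close>
  define c where "c = \<bar>C\<bar> + 1"
  have c: "c > 0" by (simp add: c_def)
  have e: "e / (2 * c) > 0" using c \<open>e > 0\<close> by simp
  obtain \<delta>1 where \<delta>1: "\<delta>1 > 0" "\<And>D. finite D \<and> (\<forall>(u, v) \<in> D. a \<le> u \<and> u \<le> v \<and> v \<le> b) \<and>
     pairwise (\<lambda>(u, v) (u', v'). v \<le> u' \<or> v' \<le> u) D \<and> (\<Sum>(u, v) \<in> D. v - u) < \<delta>1 \<Longrightarrow>
     (\<Sum>(u, v) \<in> D. \<bar>f v - f u\<bar>) < e / (2 * c)"
    using f e unfolding abs_cont_on_def by meson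
  obtain \<delta>2 where \<delta>2: "\<delta>2 > 0" "\<And>D. finite D \<and> (\<forall>(u, v) \<in> D. a \<le> u \<and> u \<le> v \<and> v \<le> b) \<and>
     pairwise (\<lambda>(u, v) (u', v'). v \<le> u' \<or> v' \<le> u) D \<and> (\<Sum>(u, v) \<in> D. v - u) < \<delta>2 \<Longrightarrow>
     (\<Sum>(u, v) \<in> D. \<bar>g v - g u\<bar>) < e / (2 * c)"
    using g e unfolding abs_cont_on_def by meson
  show "\<exists>\<delta>>0. \<forall>D. finite D \<and> (\<forall>(u, v) \<in> D. a \<le> u \<and> u \<le> v \<and> v \<le> b) \<and>
     pairwise (\<lambda>(u, v) (u', v'). v \<le> u' \<or> v' \<le> u) D \<and> (\<Sum>(u, v) \<in> D. v - u) < \<delta> \<longrightarrow>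
     (\<Sum>(u, v) \<in> D. \<bar>h v - h u\<bar>) < e"
  proof (intro exI[of _ "min \<delta>1 \<delta>2"] conjI allI impI, goal_cases)
    case (2 D)
    have "(\<Sum>(u, v) \<in> D. \<bar>h v - h u\<bar>) \<le> (\<Sum>(u, v) \<in> D. c * (\<bar>f v - f u\<bar> + \<bar>g v - g u\<bar>))"
    proof (rule sum_mono, clarify)
      fix u v assume "(u, v) \<in> D"
      then have "\<bar>h v - h u\<bar> \<le> C * (\<bar>f v - f u\<bar> + \<bar>g v - g u\<bar>)" using C 2 by auto
      also have "\<dots> \<le> c * (\<bar>f v - f u\<bar> + \<bar>g v - g u\<bar>)"
        by (rule mult_right_mono) (auto simp: c_def)
      finally show "\<bar>h v - h u\<bar> \<le> c * (\<bar>f v - f u\<bar> + \<bar>g v - g u\<bar>)" .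
    qed
    also have "\<dots> = c * ((\<Sum>(u, v) \<in> D. \<bar>f v - f u\<bar>) + (\<Sum>(u, v) \<in> D. \<bar>g v - g u\<bar>))"
      by (simp add: case_prod_unfold sum.distrib sum_distrib_left[symmetric])
    also have "\<dots> < c * (e / (2 * c) + e / (2 * c))"
      using 2 c by (intro mult_strict_left_mono add_strict_mono \<delta>1(2) \<delta>2(2)) auto
    also have "\<dots> = e" using c by (simp add: field_simps)
    finally show ?case .
  qed (use \<delta>1 \<delta>2 in auto)
qed

lemma abs_cont_on_add:
  assumes "abs_cont_on a b f" "abs_cont_on a b g"
  shows "abs_cont_on a b (\<lambda>s. f s + g s)"
  by (rule abs_cont_on_lipschitz_comb[OF assms, of _ 1]) auto

lemma abs_cont_on_ident: "abs_cont_on a b (\<lambda>s. s)"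
  unfolding abs_cont_on_def
proof (intro allI impI)
  fix e :: real assume "e > 0"
  have "(\<Sum>(u, v) \<in> D. \<bar>v - u\<bar>) = (\<Sum>(u, v) \<in> D. v - u)"
    if "\<forall>(u, v) \<in> D. a \<le> u \<and> u \<le> v \<and> v \<le> b" for D
    using that by (intro sum.cong) auto
  then show "\<exists>\<delta>>0. \<forall>D. finite D \<and> (\<forall>(u, v) \<in> D. a \<le> u \<and> u \<le> v \<and> v \<le> b) \<and>
     pairwise (\<lambda>(u, v) (u', v'). v \<le> u' \<or> v' \<le> u) D \<and> (\<Sum>(u, v) \<in> D. v - u) < \<delta> \<longrightarrow>
     (\<Sum>(u, v) \<in> D. \<bar>v - u\<bar>) < e"
    using \<open>e > 0\<close> by (intro exI[of _ e]) auto
qed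

text \<open>By the mean value theorem the function is Lipschitz on the compact interval; both
  comparison functions are the identity.\<close>

lemma abs_cont_on_C1:
  fixes f f' :: "real \<Rightarrow> real"
  assumes f: "\<And>s. (f has_real_derivative f' s) (at s)" and f': "continuous_on UNIV f'"
  shows "abs_cont_on a b f"
proof -
  obtain B where B: "\<And>s. s \<in> {a..b} \<Longrightarrow> \<bar>f' s\<bar> \<le> B"
    using compact_imp_bounded[OF compact_continuous_image[OF continuous_on_subset[OF f' subset_UNIV] compact_Icc]]
    by (auto simp: bounded_iff) (metis atLeastAtMost_iff)
  show ?thesis
  proof (rule abs_cont_on_lipschitz_comb[OF abs_cont_on_ident abs_cont_on_ident])
    fix u v assume uv: "a \<le> u" "u \<le> v" "v \<le> b"
    show "\<bar>f v - f u\<bar> \<le> B * (\<bar>v - u\<bar> + \<bar>v - u\<bar>)"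
    proof (cases "u = v")
      case False
      then obtain z where z: "u < z" "z < v" "f v - f u = (v - u) * f' z"
        using MVT2[of u v f f'] f uv by auto
      have "\<bar>f v - f u\<bar> = (v - u) * \<bar>f' z\<bar>" using z by (simp add: abs_mult)
      also have "\<dots> \<le> (v - u) * B" using B[of z] z uv by (intro mult_left_mono) auto
      also have "\<dots> \<le> B * (\<bar>v - u\<bar> + \<bar>v - u\<bar>)"
        using z uv B[of z] mult_nonneg_nonneg[of B "v - u"] by (simp add: algebra_simps)
      finally show ?thesis .
    qed simp
  qed
qed

lemma abs_cont_on_const: "abs_cont_on a b (\<lambda>_. c)"
  by (rule abs_cont_on_lipschitz_comb[OF abs_cont_on_ident abs_cont_on_ident, of _ _ _ 0]) auto

lemma abs_cont_on_mult:
  fixes f g :: "real \<Rightarrow> real"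
  assumes f: "abs_cont_on a b f" "continuous_on {a..b} f"
    and g: "abs_cont_on a b g" "continuous_on {a..b} g"
  shows "abs_cont_on a b (\<lambda>s. f s * g s)"
proof -
  obtain Bf where Bf: "\<And>s. s \<in> {a..b} \<Longrightarrow> \<bar>f s\<bar> \<le> Bf"
    using compact_imp_bounded[OF compact_continuous_image[OF f(2) compact_Icc]]
    by (auto simp: bounded_iff) (metis atLeastAtMost_iff)
  obtain Bg where Bg: "\<And>s. s \<in> {a..b} \<Longrightarrow> \<bar>g s\<bar> \<le> Bg"
    using compact_imp_bounded[OF compact_continuous_image[OF g(2) compact_Icc]]
    by (auto simp: bounded_iff) (metis atLeastAtMost_iff)
  show ?thesis
  proof (rule abs_cont_on_lipschitz_comb[OF f(1) g(1)])
    fix u v assume uv: "a \<le> u" "u \<le> v" "v \<le> b"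
    have "f v * g v - f u * g u = (f v - f u) * g v + f u * (g v - g u)" by (simp add: algebra_simps)
    then have "\<bar>f v * g v - f u * g u\<bar> \<le> \<bar>f v - f u\<bar> * \<bar>g v\<bar> + \<bar>f u\<bar> * \<bar>g v - g u\<bar>"
      by (metis abs_mult abs_triangle_ineq)
    also have "\<dots> \<le> \<bar>f v - f u\<bar> * max Bf Bg + max Bf Bg * \<bar>g v - g u\<bar>"
      using Bf[of u] Bg[of v] uv by (intro add_mono mult_left_mono mult_right_mono) auto
    finally show "\<bar>f v * g v - f u * g u\<bar> \<le> max Bf Bg * (\<bar>f v - f u\<bar> + \<bar>g v - g u\<bar>)"
      by (simp add: algebra_simps)
  qed
qed

lemma abs_cont_on_sum:
  "finite I \<Longrightarrow> (\<And>i. i \<in> I \<Longrightarrow> abs_cont_on a b (f i)) \<Longrightarrow> abs_cont_on a b (\<lambda>s. \<Sum>i\<in>I. f i s)"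
  by (induction I rule: finite_induct) (auto intro: abs_cont_on_const abs_cont_on_add)

text \<open>The family consisting of a single interval already gives the continuity
  estimate.\<close>

lemma abs_cont_on_imp_continuous_on:
  assumes "abs_cont_on a b f"
  shows "continuous_on {a..b} f"
  unfolding continuous_on_iff
proof (intro ballI allI impI)
  fix x e :: real assume x: "x \<in> {a..b}" and "e > 0"
  then obtain \<delta> where \<delta>: "\<delta> > 0" "\<And>D. finite D \<and> (\<forall>(u, v) \<in> D. a \<le> u \<and> u \<le> v \<and> v \<le> b) \<and>
     pairwise (\<lambda>(u, v) (u', v'). v \<le> u' \<or> v' \<le> u) D \<and> (\<Sum>(u, v) \<in> D. v - u) < \<delta> \<Longrightarrow>
     (\<Sum>(u, v) \<in> D. \<bar>f v - f u\<bar>) < e"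
    using assms unfolding abs_cont_on_def by meson
  have "\<bar>f y - f x\<bar> < e" if "y \<in> {a..b}" "\<bar>y - x\<bar> < \<delta>" for y
    using \<delta>(2)[of "{(min x y, max x y)}"] that x by (cases "x \<le> y") (auto simp: min_def max_def abs_minus_commute)
  then show "\<exists>d>0. \<forall>x'\<in>{a..b}. dist x' x < d \<longrightarrow> dist (f x') (f x) < e"
    using \<delta>(1) by (auto simp: dist_real_def)
qed

section \<open>Stacked vectors and Kronecker products\<close>

text \<open>Vectors are stacked from lists, as block matrices are built from lists, so that a block
  matrix acts on the list of blocks term by term.\<close>

definition vstack :: "real vec list \<Rightarrow> real vec" where
  "vstack us = foldr (@\<^sub>v) us vNil"

lemma append_vNil [simp]: "v @\<^sub>v vNil = v"
  by (rule eq_vecI) auto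

lemma append_vec_assoc: "(u @\<^sub>v v) @\<^sub>v w = u @\<^sub>v (v @\<^sub>v w)"
  by (rule eq_vecI) auto

lemma vstack_simps [simp]: "vstack [] = vNil" "vstack (u # us) = u @\<^sub>v vstack us"
  by (simp_all add: vstack_def)

lemma vstack_append: "vstack (us @ vs) = vstack us @\<^sub>v vstack vs"
  by (induction us) (simp_all add: append_vec_assoc)

lemma dim_vstack [simp]: "dim_vec (vstack us) = sum_list (map dim_vec us)"
  by (induction us) simp_all

lemma scalar_prod_append':
  assumes "dim_vec u = dim_vec v" "dim_vec u' = dim_vec v'"
  shows "(u @\<^sub>v u') \<bullet> (v @\<^sub>v v') = u \<bullet> v + u' \<bullet> (v' :: real vec)"
  using scalar_prod_append[of u "dim_vec u" u' "dim_vec u'" v v'] assms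
  by (metis carrier_vec_dim_vec)

lemma vstack_scalar_prod:
  "(\<And>i. i \<in> set is \<Longrightarrow> dim_vec (u i) = dim_vec (v i)) \<Longrightarrow>
   vstack (map u is) \<bullet> vstack (map v is) = (\<Sum>i\<leftarrow>is. u i \<bullet> v i)"
proof (induction "is")
  case (Cons i js)
  have "sum_list (map (\<lambda>x. dim_vec (u x)) js) = sum_list (map (\<lambda>x. dim_vec (v x)) js)"
    by (rule arg_cong[where f=sum_list], rule map_cong) (use Cons in auto)
  then have "dim_vec (vstack (map u js)) = dim_vec (vstack (map v js))" by (simp add: o_def)
  then show ?case using Cons by (simp add: scalar_prod_append' del: dim_vstack)
qed (simp add: scalar_prod_def)

lemma diag_block_mat_mult_vstack:
  "list_all2 (\<lambda>X u. dim_col X = dim_vec u) Xs us \<Longrightarrow>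
   diag_block_mat Xs *\<^sub>v vstack us = vstack (map2 (*\<^sub>v) Xs us)"
proof (induction Xs us rule: list_all2_induct)
  case Nil
  show ?case by (rule eq_vecI) auto
next
  case (Cons X Xs u us)
  let ?D = "diag_block_mat Xs"
  have "sum_list (map dim_col Xs) = sum_list (map dim_vec us)"
    using Cons(2) by (induction rule: list_all2_induct) auto
  then have D: "dim_col ?D = dim_vec (vstack us)" by (simp add: dim_diag_block_mat)
  define U where "U = vstack us"
  have "four_block_mat X (0\<^sub>m (dim_row X) (dim_col ?D)) (0\<^sub>m (dim_row ?D) (dim_col X)) ?D *\<^sub>v (u @\<^sub>v U)
      = (X *\<^sub>v u + 0\<^sub>m (dim_row X) (dim_col ?D) *\<^sub>v U) @\<^sub>v (0\<^sub>m (dim_row ?D) (dim_col X) *\<^sub>v u + ?D *\<^sub>v U)"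
    apply (rule four_block_mat_mult_vec[of _ "dim_row X" "dim_col X" _ "dim_col ?D" _ "dim_row ?D"])
    subgoal by (rule carrier_matI) (rule refl)+
    subgoal by (rule zero_carrier_mat)
    subgoal by (rule zero_carrier_mat)
    subgoal by (rule carrier_matI) (rule refl)+
    subgoal using Cons(1) by (intro carrier_vecI) (rule sym)
    subgoal unfolding U_def by (rule carrier_vecI) (rule D[symmetric])
    done
  moreover have "X *\<^sub>v u + 0\<^sub>m (dim_row X) (dim_col ?D) *\<^sub>v U = X *\<^sub>v u"
    using D by (intro eq_vecI) (simp_all add: scalar_prod_def U_def[symmetric])
  moreover have "0\<^sub>m (dim_row ?D) (dim_col X) *\<^sub>v u + ?D *\<^sub>v U = ?D *\<^sub>v U"
    using Cons(1) by (intro eq_vecI) (simp_all add: scalar_prod_def)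
  ultimately show ?case using Cons(3) by (simp add: Let_def U_def)
qed

lemma diag_block_mat_mult_map:
  assumes "\<And>i. i \<in> set is \<Longrightarrow> dim_col (X i) = dim_vec (u i)"
  shows "diag_block_mat (map X is) *\<^sub>v vstack (map u is) = vstack (map (\<lambda>i. X i *\<^sub>v u i) is)"
proof -
  have "list_all2 (\<lambda>X u. dim_col X = dim_vec u) (map X is) (map u is)"
    using assms by (auto simp: list_all2_conv_all_nth)
  from diag_block_mat_mult_vstack[OF this] show ?thesis
    by (simp add: zip_map_map zip_same_conv_map o_def)
qed

lemma append_cols_dims [simp]: "dim_row (A @\<^sub>c B) = dim_row A" "dim_col (A @\<^sub>c B) = dim_col A + dim_col B"
  by (auto simp: append_cols_def)

lemma append_cols_carrier: "A \<in> carrier_mat r c1 \<Longrightarrow> B \<in> carrier_mat r c2 \<Longrightarrow> A @\<^sub>c B \<in> carrier_mat r (c1 + c2)"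
  by (auto simp: append_cols_def)

lemma append_cols_mult_vec:
  assumes "A \<in> carrier_mat r c1" "B \<in> carrier_mat r c2" "u \<in> carrier_vec c1" "v \<in> carrier_vec c2"
  shows "(A @\<^sub>c B) *\<^sub>v (u @\<^sub>v v) = A *\<^sub>v u + B *\<^sub>v v"
proof -
  have "(A @\<^sub>c B) *\<^sub>v (u @\<^sub>v v) = (A *\<^sub>v u + B *\<^sub>v v) @\<^sub>v (0\<^sub>m 0 c1 *\<^sub>v u + 0\<^sub>m 0 c2 *\<^sub>v v)"
    unfolding append_cols_def using assms
    by (subst four_block_mat_mult_vec[where ?nr1.0=r and ?nc1.0=c1 and ?nc2.0=c2 and ?nr2.0=0]) auto
  also have "\<dots> = A *\<^sub>v u + B *\<^sub>v v"
    by (rule eq_vecI) auto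
  finally show ?thesis .
qed

lemma row_blocks_carrier:
  "(\<And>X. X \<in> set Xs \<Longrightarrow> dim_row X = k) \<Longrightarrow> row_blocks k Xs \<in> carrier_mat k (sum_list (map dim_col Xs))"
  unfolding row_blocks_def by (induction Xs) (auto intro!: append_cols_carrier)

text \<open>Stated for one entry, since entries can be summed over a list, while vectors of
  arbitrary dimension share no zero vector from which a list sum could start.\<close>

lemma row_blocks_mult_index:
  assumes "list_all2 (\<lambda>X u. dim_row X = k \<and> dim_col X = dim_vec u) Xs us" "j < k"
  shows "(row_blocks k Xs *\<^sub>v vstack us) $ j = (\<Sum>(X, u)\<leftarrow>zip Xs us. (X *\<^sub>v u) $ j)"
  using assms(1)
proof (induction Xs us rule: list_all2_induct)
  case Nil
  show ?case using assms(2) by (simp add: row_blocks_def scalar_prod_def)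
next
  case (Cons X Xs u us)
  have "sum_list (map dim_col Xs) = sum_list (map dim_vec us)" "\<forall>Y\<in>set Xs. dim_row Y = k"
    using Cons(2) by (induction rule: list_all2_induct) auto
  then have R: "row_blocks k Xs \<in> carrier_mat k (dim_vec (vstack us))"
    using row_blocks_carrier[of Xs k] by auto
  have "row_blocks k (X # Xs) = X @\<^sub>c row_blocks k Xs" by (simp add: row_blocks_def)
  then have "row_blocks k (X # Xs) *\<^sub>v vstack (u # us) = X *\<^sub>v u + row_blocks k Xs *\<^sub>v vstack us"
    using append_cols_mult_vec[OF _ R _ carrier_vec_dim_vec, of X "dim_col X" u] Cons(1)
    by (metis carrier_matI carrier_vec_dim_vec vstack_simps(2))
  then show ?case using Cons(1,3) R assms(2) by simp
qed

lemma sum_mult_nat: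
  fixes g :: "nat \<Rightarrow> real"
  shows "(\<Sum>j<k * n. g j) = (\<Sum>a<k. \<Sum>c<n. g (a * n + c))"
proof -
  have "(\<Sum>c<n. g (a * n + c)) = sum g {a * n..<a * n + n}" for a
    using sum.shift_bounds_nat_ivl[of g 0 "a * n" n]
    by (simp add: lessThan_atLeast0 add.commute)
  then show ?thesis using sum.nat_group[of g n k] by (simp add: mult.commute)
qed

text \<open>Position \<open>a * n + c\<close> holds \<open>G a c\<close>, the index convention of
  \<open>kron\<close>. Kronecker products map vectors of this form to vectors of this form, so all
  computations can be done with double indices.\<close>

definition kvec :: "nat \<Rightarrow> nat \<Rightarrow> (nat \<Rightarrow> nat \<Rightarrow> real) \<Rightarrow> real vec" where
  "kvec k n G = vec (k * n) (\<lambda>j. G (j div n) (j mod n))"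

lemma dim_kvec [simp]: "dim_vec (kvec k n G) = k * n"
  by (simp add: kvec_def)

lemma kvec_carrier [simp]: "kvec k n G \<in> carrier_vec (k * n)"
  by (simp add: kvec_def)

lemma kvec_index: "a < k \<Longrightarrow> c < n \<Longrightarrow> kvec k n G $ (a * n + c) = G a c"
proof -
  assume "a < k" "c < n"
  then have "a * n + c < Suc a * n" by simp
  also have "\<dots> \<le> k * n" using \<open>a < k\<close> by (intro mult_right_mono) auto
  finally show ?thesis using \<open>c < n\<close> by (simp add: kvec_def)
qed

lemma div_less_mult: "j < k * n \<Longrightarrow> j div n < k" for j k n :: nat
  by (metis mult.commute less_mult_imp_div_less)

lemma mod_less_mult: "j < k * n \<Longrightarrow> j mod n < n" for j k n :: nat
  by (metis mod_less_divisor mult_0_right neq0_conv not_less0)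

lemma kvec_cong:
  "(\<And>a c. a < k \<Longrightarrow> c < n \<Longrightarrow> G a c = G' a c) \<Longrightarrow> kvec k n G = kvec k n G'"
  by (rule eq_vecI) (auto simp: kvec_def div_less_mult mod_less_mult)

lemma scalar_prod_kvec: "kvec k n F \<bullet> kvec k n G = (\<Sum>a<k. \<Sum>c<n. F a c * G a c)"
  by (simp add: scalar_prod_def atLeast0LessThan sum_mult_nat kvec_index)

lemma kron_carrier: "A \<in> carrier_mat r c \<Longrightarrow> B \<in> carrier_mat r' c' \<Longrightarrow> A \<otimes>\<^sub>k B \<in> carrier_mat (r * r') (c * c')"
  by (simp add: kron_def)

lemma kron_dims [simp]: "dim_row (A \<otimes>\<^sub>k B) = dim_row A * dim_row B" "dim_col (A \<otimes>\<^sub>k B) = dim_col A * dim_col B"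
  by (simp_all add: kron_def)

lemma mult_add_less: "a < k \<Longrightarrow> c < n \<Longrightarrow> a * n + c < k * n" for a c k n :: nat
proof -
  assume "a < k" "c < n"
  then have "a * n + c < Suc a * n" by simp
  also have "\<dots> \<le> k * n" using \<open>a < k\<close> by (intro mult_right_mono) auto
  finally show ?thesis .
qed

lemma kron_index:
  "a < dim_row A \<Longrightarrow> c < dim_row B \<Longrightarrow> b < dim_col A \<Longrightarrow> d < dim_col B \<Longrightarrow>
   (A \<otimes>\<^sub>k B) $$ (a * dim_row B + c, b * dim_col B + d) = A $$ (a, b) * B $$ (c, d)"
  by (simp add: kron_def mult_add_less)

lemma kron_mult_kvec:
  assumes "A \<in> carrier_mat k l" "B \<in> carrier_mat n n'"
  shows "(A \<otimes>\<^sub>k B) *\<^sub>v kvec l n' G = kvec k n (\<lambda>a c. \<Sum>b<l. \<Sum>d<n'. A $$ (a, b) * B $$ (c, d) * G b d)"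
proof (rule eq_vecI)
  fix i assume "i < dim_vec (kvec k n (\<lambda>a c. \<Sum>b<l. \<Sum>d<n'. A $$ (a, b) * B $$ (c, d) * G b d))"
  then have i: "i < k * n" by simp
  define a c where "a = i div n" and "c = i mod n"
  have ac: "a < k" "c < n" "i = a * n + c"
    using i by (auto simp: a_def c_def div_less_mult mod_less_mult)
  have "((A \<otimes>\<^sub>k B) *\<^sub>v kvec l n' G) $ i = (\<Sum>j<l * n'. (A \<otimes>\<^sub>k B) $$ (i, j) * kvec l n' G $ j)"
    using assms i by (simp add: scalar_prod_def atLeast0LessThan)
  also have "\<dots> = (\<Sum>b<l. \<Sum>d<n'. A $$ (a, b) * B $$ (c, d) * G b d)"
    unfolding sum_mult_nat ac(3)
    using assms ac kron_index[of a A c B] by (intro sum.cong refl) (auto simp: kvec_index)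
  finally show "((A \<otimes>\<^sub>k B) *\<^sub>v kvec l n' G) $ i = kvec k n (\<lambda>a c. \<Sum>b<l. \<Sum>d<n'. A $$ (a, b) * B $$ (c, d) * G b d) $ i"
    using ac by (simp add: kvec_index)
qed (use assms in auto)

lemma kron_one_mult_kvec:
  assumes "A \<in> carrier_mat k l"
  shows "(A \<otimes>\<^sub>k 1\<^sub>m n) *\<^sub>v kvec l n G = kvec k n (\<lambda>a c. \<Sum>b<l. A $$ (a, b) * G b c)"
  unfolding kron_mult_kvec[OF assms one_carrier_mat]
proof (rule kvec_cong)
  fix a c assume ac: "a < k" "c < n"
  have "(\<Sum>d<n. A $$ (a, b) * 1\<^sub>m n $$ (c, d) * G b d) = (\<Sum>d<n. if d = c then A $$ (a, b) * G b d else 0)" for b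
    using ac by (intro sum.cong) auto
  then show "(\<Sum>b<l. \<Sum>d<n. A $$ (a, b) * 1\<^sub>m n $$ (c, d) * G b d) = (\<Sum>b<l. A $$ (a, b) * G b c)"
    using ac by simp
qed

lemma one_kron_mult_kvec:
  assumes "R \<in> carrier_mat n n"
  shows "(1\<^sub>m k \<otimes>\<^sub>k R) *\<^sub>v kvec k n G = kvec k n (\<lambda>a c. \<Sum>d<n. R $$ (c, d) * G a d)"
  unfolding kron_mult_kvec[OF one_carrier_mat assms]
proof (rule kvec_cong)
  fix a c assume ac: "a < k" "c < n"
  have "(\<Sum>d<n. 1\<^sub>m k $$ (a, b) * R $$ (c, d) * G b d) = (if b = a then (\<Sum>d<n. R $$ (c, d) * G b d) else 0)" if "b < k" for b
    using ac that by (auto intro: sum.cong)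
  then have "(\<Sum>b<k. \<Sum>d<n. 1\<^sub>m k $$ (a, b) * R $$ (c, d) * G b d) = (\<Sum>b<k. if b = a then (\<Sum>d<n. R $$ (c, d) * G b d) else 0)"
    by (intro sum.cong) auto
  then show "(\<Sum>b<k. \<Sum>d<n. 1\<^sub>m k $$ (a, b) * R $$ (c, d) * G b d) = (\<Sum>d<n. R $$ (c, d) * G a d)"
    using ac by simp
qed

lemma vec_eq_kvec: "x \<in> carrier_vec n \<Longrightarrow> x = kvec 1 n (\<lambda>_ c. x $ c)"
  by (rule eq_vecI) (auto simp: kvec_def)

lemma kron_one_column_mult_vec:
  assumes "A \<in> carrier_mat k 1" "x \<in> carrier_vec n"
  shows "(A \<otimes>\<^sub>k 1\<^sub>m n) *\<^sub>v x = kvec k n (\<lambda>a c. A $$ (a, 0) * x $ c)"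
  by (subst vec_eq_kvec[OF assms(2)], subst kron_one_mult_kvec[OF assms(1)]) simp

text \<open>In \<open>kron\<close> the left factor owns the coarse index, so block boundaries are
  merely scaled by \<open>n\<close>. This splits \<open>I_hat\<close> and \<open>big_M\<close>,
  which are tensored with the identity as whole block matrices, into their blocks.\<close>

lemma kron_one_four_block_mat:
  assumes "A \<in> carrier_mat r1 c1" "B \<in> carrier_mat r1 c2" "C \<in> carrier_mat r2 c1" "D \<in> carrier_mat r2 c2"
  shows "four_block_mat A B C D \<otimes>\<^sub>k 1\<^sub>m n =
    four_block_mat (A \<otimes>\<^sub>k 1\<^sub>m n) (B \<otimes>\<^sub>k 1\<^sub>m n) (C \<otimes>\<^sub>k 1\<^sub>m n) (D \<otimes>\<^sub>k 1\<^sub>m n)" (is "?L = ?R")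
proof (rule eq_matI)
  fix i j assume "i < dim_row ?R" "j < dim_col ?R"
  then have ij: "i < (r1 + r2) * n" "j < (c1 + c2) * n" using assms by (auto simp: algebra_simps)
  have n: "n > 0" using ij by (cases n) auto
  have lt: "i div n < r1 + r2" "j div n < c1 + c2" "i mod n < n" "j mod n < n"
    using div_less_mult[OF ij(1)] div_less_mult[OF ij(2)] n by simp_all
  \<comment> \<open>Removing \<open>r\<close> full blocks of size \<open>n\<close> lowers the coarse
    index by \<open>r\<close> and keeps the fine one.\<close>
  have shift: "(k - r * n) div n = k div n - r \<and> (k - r * n) mod n = k mod n" if kr: "r * n \<le> k" for k r
  proof -
    obtain l where "k = r * n + l" using le_Suc_ex[OF kr] by blast
    then show ?thesis using n by simp
  qed
  have "r1 * n \<le> i \<Longrightarrow> i - r1 * n < r2 * n" "c1 * n \<le> j \<Longrightarrow> j - c1 * n < c2 * n"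
    using ij by (auto simp: algebra_simps)
  moreover have "i < r1 * n \<longleftrightarrow> i div n < r1" "j < c1 * n \<longleftrightarrow> j div n < c1"
    using n by (simp_all add: div_less_iff_less_mult)
  ultimately show "?L $$ (i, j) = ?R $$ (i, j)"
    using assms ij lt shift[of r1 i] shift[of c1 j]
    by (cases "i < r1 * n"; cases "j < c1 * n") (simp_all add: kron_def)
qed (use assms in \<open>simp_all add: algebra_simps\<close>)

lemma kron_zero [simp]: "0\<^sub>m r c \<otimes>\<^sub>k B = 0\<^sub>m (r * dim_row B) (c * dim_col B)"
  by (rule eq_matI) (auto simp: kron_def div_less_mult)

lemma kron_one_append_cols:
  assumes "A \<in> carrier_mat r c1" "B \<in> carrier_mat r c2"
  shows "(A @\<^sub>c B) \<otimes>\<^sub>k 1\<^sub>m n = (A \<otimes>\<^sub>k 1\<^sub>m n) @\<^sub>c (B \<otimes>\<^sub>k 1\<^sub>m n)"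
  unfolding append_cols_def using assms
  by (subst kron_one_four_block_mat[where ?r1.0=r and ?c1.0=c1 and ?c2.0=c2 and ?r2.0=0]) auto

lemma kron_one_diag_block_mat:
  "diag_block_mat Xs \<otimes>\<^sub>k 1\<^sub>m n = diag_block_mat (map (\<lambda>X. X \<otimes>\<^sub>k 1\<^sub>m n) Xs)"
proof (induction Xs)
  case (Cons X Xs)
  let ?D = "diag_block_mat Xs"
  have "diag_block_mat (X # Xs) \<otimes>\<^sub>k 1\<^sub>m n =
    four_block_mat (X \<otimes>\<^sub>k 1\<^sub>m n) (0\<^sub>m (dim_row X) (dim_col ?D) \<otimes>\<^sub>k 1\<^sub>m n) (0\<^sub>m (dim_row ?D) (dim_col X) \<otimes>\<^sub>k 1\<^sub>m n) (?D \<otimes>\<^sub>k 1\<^sub>m n)"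
    unfolding diag_block_mat.simps Let_def
    by (rule kron_one_four_block_mat) auto
  then show ?case using Cons by (simp add: Let_def dim_diag_block_mat o_def sum_list_mult_const)
qed simp

lemma kron_diff: "A \<in> carrier_mat r c \<Longrightarrow> B \<in> carrier_mat r c \<Longrightarrow> (A - B) \<otimes>\<^sub>k E = (A \<otimes>\<^sub>k E) - (B \<otimes>\<^sub>k E)"
  by (rule eq_matI) (auto simp: kron_def div_less_mult mod_less_mult algebra_simps)

section \<open>Quadratic forms\<close>

lemma scalar_prod_transpose_mult:
  fixes A B :: "real mat"
  assumes "A \<in> carrier_mat k n" "B \<in> carrier_mat k n'" "u \<in> carrier_vec n" "v \<in> carrier_vec n'"
  shows "u \<bullet> ((transpose_mat A * B) *\<^sub>v v) = (A *\<^sub>v u) \<bullet> (B *\<^sub>v v)"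
proof -
  have "u \<bullet> ((transpose_mat A * B) *\<^sub>v v) = u \<bullet> (transpose_mat A *\<^sub>v (B *\<^sub>v v))"
    using assms by (simp add: assoc_mult_mat_vec[of _ n k])
  also have "\<dots> = (transpose_mat A *\<^sub>v (B *\<^sub>v v)) \<bullet> u"
    using assms by (intro comm_scalar_prod[of _ n]) (auto intro!: mult_mat_vec_carrier)
  also have "\<dots> = (B *\<^sub>v v) \<bullet> (A *\<^sub>v u)"
    using assms by (intro transpose_vec_mult_scalar) (auto intro!: mult_mat_vec_carrier)
  also have "\<dots> = (A *\<^sub>v u) \<bullet> (B *\<^sub>v v)"
    using assms by (intro comm_scalar_prod[of _ k]) (auto intro!: mult_mat_vec_carrier)
  finally show ?thesis .
qed

lemma scalar_prod_transpose_vec: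
  fixes A :: "real mat"
  assumes "A \<in> carrier_mat k n" "u \<in> carrier_vec n" "v \<in> carrier_vec k"
  shows "u \<bullet> (transpose_mat A *\<^sub>v v) = (A *\<^sub>v u) \<bullet> v"
  using transpose_vec_mult_scalar[OF assms] assms
  by (metis comm_scalar_prod mult_mat_vec_carrier transpose_carrier_mat)

lemma Sy_carrier: "X \<in> carrier_mat n n \<Longrightarrow> Sy X \<in> carrier_mat n n"
  by (simp add: Sy_def)

lemma scalar_prod_Sy:
  assumes X: "X \<in> carrier_mat n n" and u: "u \<in> carrier_vec n"
  shows "u \<bullet> (Sy X *\<^sub>v u) = 2 * (u \<bullet> (X *\<^sub>v u))"
proof -
  have "u \<bullet> (Sy X *\<^sub>v u) = u \<bullet> (X *\<^sub>v u + transpose_mat X *\<^sub>v u)"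
    unfolding Sy_def using assms by (subst add_mult_distrib_mat_vec[of _ n n]) auto
  also have "\<dots> = u \<bullet> (X *\<^sub>v u) + u \<bullet> (transpose_mat X *\<^sub>v u)"
    using assms by (intro scalar_prod_add_distrib[of _ n]) auto
  also have "u \<bullet> (transpose_mat X *\<^sub>v u) = u \<bullet> (X *\<^sub>v u)"
    using scalar_prod_transpose_vec[OF X u u] comm_scalar_prod[of u n "X *\<^sub>v u"] assms by auto
  finally show ?thesis by simp
qed

lemma scalar_prod_add_mat:
  fixes A B :: "real mat"
  assumes "A \<in> carrier_mat k n" "B \<in> carrier_mat k n" "u \<in> carrier_vec k" "v \<in> carrier_vec n"
  shows "u \<bullet> ((A + B) *\<^sub>v v) = u \<bullet> (A *\<^sub>v v) + u \<bullet> (B *\<^sub>v v)"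
  using assms by (subst add_mult_distrib_mat_vec[of _ k n])
    (auto intro!: scalar_prod_add_distrib[of _ k] mult_mat_vec_carrier)

lemma scalar_prod_sum: "u \<bullet> v = (\<Sum>i<dim_vec v. u $ i * v $ i)"
  by (simp add: scalar_prod_def atLeast0LessThan)

lemma quadratic_form_sum:
  fixes A :: "real mat"
  assumes "A \<in> carrier_mat k n" "u \<in> carrier_vec k" "v \<in> carrier_vec n"
  shows "u \<bullet> (A *\<^sub>v v) = (\<Sum>i<k. \<Sum>j<n. A $$ (i, j) * (u $ i * v $ j))"
  using assms by (simp add: scalar_prod_sum sum_distrib_left mult_ac)

lemma scalar_prod_self_nonneg: "0 \<le> v \<bullet> (v :: real vec)"
  by (simp add: scalar_prod_sum sum_nonneg)

lemma sq_index_le_scalar_prod: "i < dim_vec v \<Longrightarrow> (v $ i)\<^sup>2 \<le> v \<bullet> (v :: real vec)"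
  unfolding scalar_prod_sum power2_eq_square
  by (rule member_le_sum) auto

lemma quadratic_form_bound:
  fixes A :: "real mat"
  assumes A: "A \<in> carrier_mat n n"
  shows "\<exists>C\<ge>0. \<forall>v \<in> carrier_vec n. \<bar>v \<bullet> (A *\<^sub>v v)\<bar> \<le> C * (v \<bullet> v)"
proof (intro exI[of _ "\<Sum>i<n. \<Sum>j<n. \<bar>A $$ (i, j)\<bar>"] conjI ballI)
  fix v :: "real vec" assume v: "v \<in> carrier_vec n"
  have "\<bar>v \<bullet> (A *\<^sub>v v)\<bar> \<le> (\<Sum>i<n. \<Sum>j<n. \<bar>A $$ (i, j) * (v $ i * v $ j)\<bar>)"
    unfolding quadratic_form_sum[OF A v v] by (rule order_trans[OF sum_abs], rule sum_mono, rule sum_abs)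
  also have "\<dots> \<le> (\<Sum>i<n. \<Sum>j<n. \<bar>A $$ (i, j)\<bar> * (v \<bullet> v))"
  proof (intro sum_mono)
    fix i j assume "i \<in> {..<n}" "j \<in> {..<n}"
    then have "(v $ i)\<^sup>2 \<le> v \<bullet> v" "(v $ j)\<^sup>2 \<le> v \<bullet> v" using v by (auto intro!: sq_index_le_scalar_prod)
    moreover have "0 \<le> (\<bar>v $ i\<bar> - \<bar>v $ j\<bar>)\<^sup>2" by simp
    then have "2 * (\<bar>v $ i\<bar> * \<bar>v $ j\<bar>) \<le> (v $ i)\<^sup>2 + (v $ j)\<^sup>2" by (simp add: power2_diff)
    ultimately have "\<bar>v $ i * v $ j\<bar> \<le> v \<bullet> v" unfolding abs_mult by linarith
    then show "\<bar>A $$ (i, j) * (v $ i * v $ j)\<bar> \<le> \<bar>A $$ (i, j)\<bar> * (v \<bullet> v)"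
      unfolding abs_mult[of "A $$ (i, j)"] by (intro mult_left_mono) auto
  qed
  finally show "\<bar>v \<bullet> (A *\<^sub>v v)\<bar> \<le> (\<Sum>i<n. \<Sum>j<n. \<bar>A $$ (i, j)\<bar>) * (v \<bullet> v)"
    by (simp add: sum_distrib_right)
qed (auto intro!: sum_nonneg)

section \<open>Inverses, coercivity and Cholesky factors\<close>

lemma minv_props:
  assumes A: "A \<in> carrier_mat n n" and det: "det A \<noteq> 0"
  shows "minv A \<in> carrier_mat n n" "A * minv A = 1\<^sub>m n" "minv A * A = 1\<^sub>m n"
proof -
  obtain B where "mat_inverse A = Some B"
    using mat_inverse(1)[OF A, where b="()"] det_non_zero_imp_unit[OF A det, where b="()"] by (cases "mat_inverse A") auto
  then show "minv A \<in> carrier_mat n n" "A * minv A = 1\<^sub>m n" "minv A * A = 1\<^sub>m n"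
    using mat_inverse(2)[OF A] by (auto simp: minv_def)
qed

lemma pos_def_det_nonzero:
  assumes "pos_def X"
  shows "det X \<noteq> 0"
proof
  assume "det X = 0"
  have X: "X \<in> carrier_mat (dim_row X) (dim_row X)" using assms by (simp add: pos_def_def sym_mats_def)
  obtain v where v: "v \<in> carrier_vec (dim_row X)" "v \<noteq> 0\<^sub>v (dim_row X)" "X *\<^sub>v v = 0\<^sub>v (dim_row X)"
    using det_0_iff_vec_prod_zero_field[OF X] \<open>det X = 0\<close> by auto
  then have "v \<bullet> (X *\<^sub>v v) > 0" using assms unfolding pos_def_def by blast
  then show False unfolding v(3) using v(1) by simp
qed

lemma pos_def_nonneg:
  assumes "pos_def X" "v \<in> carrier_vec (dim_row X)"
  shows "0 \<le> v \<bullet> (X *\<^sub>v v)"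
proof (cases "v = 0\<^sub>v (dim_row X)")
  case True
  have "X *\<^sub>v v \<in> carrier_vec (dim_row X)" by (rule carrier_vecI) simp
  then show ?thesis unfolding True by simp
next
  case False
  then show ?thesis using assms unfolding pos_def_def by (meson less_imp_le)
qed

text \<open>The vector \<open>v - s X\<^sup>-\<^sup>1 v\<close> has a nonnegative \<open>X\<close>-square, which for small \<open>s > 0\<close> bounds the
  form of \<open>X\<close> at \<open>v\<close> from below; no compactness of the sphere is needed.\<close>

lemma pos_def_coercive:
  assumes X: "pos_def X"
  shows "\<exists>c>0. \<forall>v \<in> carrier_vec (dim_row X). c * (v \<bullet> v) \<le> v \<bullet> (X *\<^sub>v v)"
proof -
  define n where "n = dim_row X"
  have Xc: "X \<in> carrier_mat n n" and Xs: "transpose_mat X = X"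
    using X by (simp_all add: pos_def_def sym_mats_def n_def)
  note inv = minv_props[OF Xc pos_def_det_nonzero[OF X]]
  obtain C where C: "C \<ge> 0" "\<And>v. v \<in> carrier_vec n \<Longrightarrow> \<bar>v \<bullet> (minv X *\<^sub>v v)\<bar> \<le> C * (v \<bullet> v)"
    using quadratic_form_bound[OF inv(1)] by blast
  \<comment> \<open>With \<open>s * (C + 1) = 1\<close> the term quadratic in \<open>s\<close> costs
    at most half of the gain \<open>2 * s * (v \<bullet> v)\<close>.\<close>
  define s where "s = 1 / (C + 1)"
  have s: "s > 0" "s * (C + 1) = 1" using C(1) by (simp_all add: s_def)
  have "s * (v \<bullet> v) \<le> v \<bullet> (X *\<^sub>v v)" if v: "v \<in> carrier_vec n" for v
  proof -
    define w where "w = minv X *\<^sub>v v"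
    have w: "w \<in> carrier_vec n" using inv(1) v by (simp add: w_def)
    have Xw: "X *\<^sub>v w = v"
      unfolding w_def using inv v Xc by (simp add: assoc_mult_mat_vec[of X n n "minv X" n, symmetric])
    have wXv: "w \<bullet> (X *\<^sub>v v) = v \<bullet> v"
      using scalar_prod_transpose_vec[OF Xc w v] Xs Xw by simp
    have "0 \<le> (v + (-s) \<cdot>\<^sub>v w) \<bullet> (X *\<^sub>v (v + (-s) \<cdot>\<^sub>v w))"
      using pos_def_nonneg[OF X] v w by (simp add: n_def)
    also have "X *\<^sub>v (v + (-s) \<cdot>\<^sub>v w) = X *\<^sub>v v + (-s) \<cdot>\<^sub>v v"
      using v w Xc Xw by (simp add: mult_add_distrib_mat_vec[of _ n n] mult_mat_vec[of X n n])
    also have "(v + (-s) \<cdot>\<^sub>v w) \<bullet> (X *\<^sub>v v + (-s) \<cdot>\<^sub>v v) =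
        v \<bullet> (X *\<^sub>v v) - 2 * s * (v \<bullet> v) + s * s * (w \<bullet> v)"
      using v w Xc wXv
      by (simp add: scalar_prod_add_distrib[of _ n] add_scalar_prod_distrib[of _ n] mult_mat_vec_carrier[OF Xc v] algebra_simps)
    finally have "2 * s * (v \<bullet> v) - s * s * (w \<bullet> v) \<le> v \<bullet> (X *\<^sub>v v)" by simp
    moreover have "w \<bullet> v = v \<bullet> w" using comm_scalar_prod[OF w v] .
    moreover have "s * s * (v \<bullet> w) \<le> s * (v \<bullet> v)"
    proof -
      have "v \<bullet> w \<le> C * (v \<bullet> v)" using C(2)[OF v] by (simp add: w_def)
      also have "\<dots> \<le> (C + 1) * (v \<bullet> v)" using scalar_prod_self_nonneg[of v] by (intro mult_right_mono) auto
      finally have "s * (s * (v \<bullet> w)) \<le> s * (s * ((C + 1) * (v \<bullet> v)))"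
        using s(1) by (intro mult_left_mono) auto
      also have "s * ((C + 1) * (v \<bullet> v)) = v \<bullet> v" using s(2) by (simp add: mult.assoc[symmetric])
      finally show ?thesis by (simp add: mult.assoc)
    qed
    ultimately show ?thesis by (simp add: algebra_simps)
  qed
  then show ?thesis using s(1) by (auto simp: n_def)
qed

text \<open>The form is tested at a vector that is \<open>v\<close> in block \<open>i\<close> and
  zero elsewhere. Semidefiniteness of each \<open>Q i\<close> and \<open>R i\<close> is all that
  Bessel's inequality asks for.\<close>

lemma pos_def_block_nonneg:
  assumes pd: "pos_def (diag_block_mat (map X is))" and d: "distinct is" "i \<in> set is"
    and X: "\<And>j. j \<in> set is \<Longrightarrow> X j \<in> carrier_mat n n" and v: "v \<in> carrier_vec n"
  shows "0 \<le> v \<bullet> (X i *\<^sub>v v)"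
proof -
  define u where "u j = (if j = i then v else 0\<^sub>v n)" for j
  have du: "dim_vec (u j) = n" for j using v by (simp add: u_def)
  have eqr: "sum_list (map (\<lambda>j. dim_row (X j)) is) = sum_list (map (\<lambda>j. dim_vec (u j)) is)"
    by (rule arg_cong[where f=sum_list], rule map_cong) (use X du in auto)
  have "0 \<le> vstack (map u is) \<bullet> (diag_block_mat (map X is) *\<^sub>v vstack (map u is))"
    using eqr by (intro pos_def_nonneg[OF pd] carrier_vecI) (simp add: dim_diag_block_mat o_def)
  also have "diag_block_mat (map X is) *\<^sub>v vstack (map u is) = vstack (map (\<lambda>j. X j *\<^sub>v u j) is)"
    using X du by (intro diag_block_mat_mult_map) auto
  also have "vstack (map u is) \<bullet> \<dots> = (\<Sum>j\<leftarrow>is. u j \<bullet> (X j *\<^sub>v u j))"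
    using X du by (intro vstack_scalar_prod) (metis carrier_matD(1) dim_mult_mat_vec)
  also have "\<dots> = (\<Sum>j\<in>set is. u j \<bullet> (X j *\<^sub>v u j))"
    using d(1) by (simp add: sum_list_distinct_conv_sum_set)
  also have "\<dots> = (\<Sum>j\<in>set is. if j = i then v \<bullet> (X i *\<^sub>v v) else 0)"
    using X by (intro sum.cong refl) (auto simp: u_def scalar_prod_sum)
  also have "\<dots> = v \<bullet> (X i *\<^sub>v v)" using d(2) by simp
  finally show ?thesis .
qed

text \<open>The determinant of the triangular \<open>L\<close> is the product of its positive
  diagonal entries, so \<open>L\<close> is invertible. The last identity is what makes
  \<open>minv L\<close> turn a family with Gram matrix \<open>X\<close> into an orthonormal
  one.\<close>

lemma cholesky_factor_props:
  assumes ch: "cholesky_factor L X" and X: "X \<in> carrier_mat n n"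
  shows "L \<in> carrier_mat n n" "det L \<noteq> 0" "det X \<noteq> 0" "minv L * X * transpose_mat (minv L) = 1\<^sub>m n"
proof -
  show L: "L \<in> carrier_mat n n" using ch X by (auto simp: cholesky_factor_def)
  have "det L = prod_list (diag_mat L)"
    using ch X by (intro det_lower_triangular[OF _ L]) (auto simp: cholesky_factor_def)
  moreover have "\<forall>y \<in> set (diag_mat L). y > 0"
    using ch X L by (auto simp: diag_mat_def cholesky_factor_def)
  ultimately show dL: "det L \<noteq> 0" by (simp add: prod_list_zero_iff) auto
  have XL: "X = L * transpose_mat L" using ch by (simp add: cholesky_factor_def)
  then show "det X \<noteq> 0" using det_mult[OF L, of "transpose_mat L"] det_transpose[OF L] L dL by simp
  note inv = minv_props[OF L dL]
  have "minv L * X = transpose_mat L"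
    unfolding XL using inv L by (simp add: assoc_mult_mat[of _ n n _ n _ n, symmetric])
  moreover have "transpose_mat L * transpose_mat (minv L) = 1\<^sub>m n"
    using transpose_mult[OF inv(1) L] inv(3) by simp
  ultimately show "minv L * X * transpose_mat (minv L) = 1\<^sub>m n" by simp
qed

text \<open>Separates the matrix algebra from the analysis: the blocks are arbitrary and their sizes
  are variables. Once the history is inserted for \<open>th\<close>, the first two terms of the
  result are the derivative of the quadratic part of \<open>v\<close>, and the Schur variable
  inserted for \<open>y\<close> produces the supply rate from the others.\<close>

lemma block_form:
  fixes P1 P2 P3 Ih MM Om Sg Xi J1 J2 Jt :: "real mat"
  assumes P1: "P1 \<in> carrier_mat n n" and P2: "P2 \<in> carrier_mat n dn" and P3: "P3 \<in> carrier_mat dn dn"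
    and Ih: "Ih \<in> carrier_mat dn kh" and MM: "MM \<in> carrier_mat dn (n + (nx + kh))"
    and Om: "Om \<in> carrier_mat n (n + (nx + (kh + (ke + q))))"
    and Sg: "Sg \<in> carrier_mat m (n + (nx + (kh + (ke + q))))"
    and Xi: "Xi \<in> carrier_mat (n + (nx + (kh + (ke + q)))) (n + (nx + (kh + (ke + q))))"
    and J1: "J1 \<in> carrier_mat m m" and J2: "J2 \<in> carrier_mat m q" and Jt: "Jt \<in> carrier_mat m m"
    and x0: "x0 \<in> carrier_vec n" and xs: "xs \<in> carrier_vec nx" and hs: "hs \<in> carrier_vec kh"
    and es: "es \<in> carrier_vec ke" and w: "w \<in> carrier_vec q" and y: "y \<in> carrier_vec m"
    and l: "l = ke + q + m" and b: "b = n + nx + kh + ke"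
  defines "th \<equiv> x0 @\<^sub>v (xs @\<^sub>v (hs @\<^sub>v (es @\<^sub>v w)))"
  defines "\<zeta> \<equiv> th @\<^sub>v y"
  defines "e \<equiv> MM *\<^sub>v (x0 @\<^sub>v (xs @\<^sub>v hs))"
  defines "X \<equiv> Sy (transpose_mat (P1 @\<^sub>c 0\<^sub>m n nx @\<^sub>c (P2 * Ih) @\<^sub>c 0\<^sub>m n l) * (Om @\<^sub>c 0\<^sub>m n m)) +
     (Sy ((P2 @\<^sub>r 0\<^sub>m nx dn @\<^sub>r (transpose_mat Ih * P3) @\<^sub>r 0\<^sub>m l dn) * (MM @\<^sub>c 0\<^sub>m dn l) +
         (0\<^sub>m b m @\<^sub>r (- transpose_mat J2) @\<^sub>r Jt) * (Sg @\<^sub>c 0\<^sub>m m m)) + diag_block_mat [Xi, J1])"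
  shows "X \<in> carrier_mat (b + q + m) (b + q + m)" (is ?g1)
    and "\<zeta> \<in> carrier_vec (b + q + m)" (is ?g2)
    and "\<zeta> \<bullet> (X *\<^sub>v \<zeta>) = 2 * ((P1 *\<^sub>v x0 + P2 *\<^sub>v (Ih *\<^sub>v hs)) \<bullet> (Om *\<^sub>v th))
      + 2 * (x0 \<bullet> (P2 *\<^sub>v e) + (Ih *\<^sub>v hs) \<bullet> (P3 *\<^sub>v e))
      + 2 * (y \<bullet> (Jt *\<^sub>v (Sg *\<^sub>v th)) - w \<bullet> (transpose_mat J2 *\<^sub>v (Sg *\<^sub>v th)))
      + th \<bullet> (Xi *\<^sub>v th) + y \<bullet> (J1 *\<^sub>v y)" (is ?g3)
proof -
  let ?N = "n + (nx + (kh + (ke + q)))"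
  \<comment> \<open>The factors group the same coordinates differently: \<open>l\<close> lumps the
    last three blocks together, \<open>b\<close> the first four.\<close>
  have NN: "n + (nx + (kh + l)) = ?N + m" "n + (nx + (kh + (ke + (q + m)))) = ?N + m" 
     "b + q + m = ?N + m" "b + (q + m) = ?N + m" "n + (nx + kh) + l = ?N + m" using l b by simp_all
  define P where "P = P1 @\<^sub>c 0\<^sub>m n nx @\<^sub>c (P2 * Ih) @\<^sub>c 0\<^sub>m n l"
  define Pi where "Pi = Om @\<^sub>c 0\<^sub>m n m"
  define C1 where "C1 = P2 @\<^sub>r 0\<^sub>m nx dn @\<^sub>r (transpose_mat Ih * P3) @\<^sub>r 0\<^sub>m l dn"
  define R1 where "R1 = MM @\<^sub>c 0\<^sub>m dn l"
  define C2 where "C2 = 0\<^sub>m b m @\<^sub>r (- transpose_mat J2) @\<^sub>r Jt"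
  define R2 where "R2 = Sg @\<^sub>c 0\<^sub>m m m"
  have th: "th \<in> carrier_vec ?N" unfolding th_def using x0 xs hs es w by auto
  have z: "\<zeta> \<in> carrier_vec (?N + m)" unfolding \<zeta>_def using th y by auto
  have P: "P \<in> carrier_mat n (?N + m)" unfolding P_def NN(1)[symmetric]
    using P1 P2 Ih by (intro append_cols_carrier) auto
  have Pi: "Pi \<in> carrier_mat n (?N + m)" unfolding Pi_def using Om by (intro append_cols_carrier) auto
  have C1: "C1 \<in> carrier_mat (?N + m) dn" unfolding C1_def NN(1)[symmetric]
    using P2 P3 Ih by (intro carrier_append_rows) auto
  have R1: "R1 \<in> carrier_mat dn (?N + m)" unfolding R1_def NN(5)[symmetric] using MM by (intro append_cols_carrier) auto
  have C2: "C2 \<in> carrier_mat (?N + m) m" unfolding C2_def NN(4)[symmetric]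
    using J2 Jt by (intro carrier_append_rows) auto
  have R2: "R2 \<in> carrier_mat m (?N + m)" unfolding R2_def using Sg by (intro append_cols_carrier) auto
  have D: "diag_block_mat [Xi, J1] \<in> carrier_mat (?N + m) (?N + m)"
    using Xi J1 by (intro carrier_matI) (simp_all add: dim_diag_block_mat)
  have CR: "C1 * R1 + C2 * R2 \<in> carrier_mat (?N + m) (?N + m)" using C1 R1 C2 R2 by auto
  have PP: "transpose_mat P * Pi \<in> carrier_mat (?N + m) (?N + m)" using P Pi by auto
  have Xeq: "X = Sy (transpose_mat P * Pi) + (Sy (C1 * R1 + C2 * R2) + diag_block_mat [Xi, J1])"
    unfolding X_def P_def Pi_def C1_def R1_def C2_def R2_def ..
  show ?g1 unfolding NN(3) Xeq using Sy_carrier[OF PP] Sy_carrier[OF CR] D by auto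
  show ?g2 unfolding NN(3) by (rule z)
  \<comment> \<open>Three bracketings of the same vector: \<open>z1\<close> matches \<open>P\<close>
    and \<open>C1\<close>, \<open>z2\<close> matches \<open>R1\<close>, and \<open>z3\<close>
    matches \<open>C2\<close>.\<close>
  have z1: "\<zeta> = x0 @\<^sub>v (xs @\<^sub>v (hs @\<^sub>v (es @\<^sub>v (w @\<^sub>v y))))"
    by (simp add: \<zeta>_def th_def append_vec_assoc)
  have z2: "\<zeta> = (x0 @\<^sub>v (xs @\<^sub>v hs)) @\<^sub>v (es @\<^sub>v (w @\<^sub>v y))"
    by (simp add: \<zeta>_def th_def append_vec_assoc)
  have z3: "\<zeta> = (x0 @\<^sub>v (xs @\<^sub>v (hs @\<^sub>v es))) @\<^sub>v (w @\<^sub>v y)"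
    by (simp add: \<zeta>_def th_def append_vec_assoc)
  have ewy: "es @\<^sub>v (w @\<^sub>v y) \<in> carrier_vec l" using es w y l by (auto simp: add.assoc)
  have eC: "e \<in> carrier_vec dn" unfolding e_def using MM x0 xs hs by (auto intro!: mult_mat_vec_carrier)
  have zero: "0\<^sub>m r c *\<^sub>v v = 0\<^sub>v r" if "v \<in> carrier_vec c" for r c and v :: "real vec"
    using that by (intro eq_vecI) (auto simp: scalar_prod_def)
  have Pz: "P *\<^sub>v \<zeta> = P1 *\<^sub>v x0 + P2 *\<^sub>v (Ih *\<^sub>v hs)"
  proof -
    have c1: "(P2 * Ih) @\<^sub>c 0\<^sub>m n l \<in> carrier_mat n (kh + l)"
      using P2 Ih by (intro append_cols_carrier) auto
    have c2: "0\<^sub>m n nx @\<^sub>c (P2 * Ih) @\<^sub>c 0\<^sub>m n l \<in> carrier_mat n (nx + (kh + l))"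
      by (intro append_cols_carrier c1) auto
    have "P *\<^sub>v \<zeta> = P1 *\<^sub>v x0 + (0\<^sub>m n nx *\<^sub>v xs + ((P2 * Ih) *\<^sub>v hs + 0\<^sub>m n l *\<^sub>v (es @\<^sub>v (w @\<^sub>v y))))"
      unfolding P_def z1 using P1 P2 Ih x0 xs hs ewy c1 c2
      by (subst append_cols_mult_vec[OF P1 c2 x0], simp, subst append_cols_mult_vec[OF _ c1 xs], simp, simp,
          subst append_cols_mult_vec[OF _ _ hs ewy]) auto
    also have "\<dots> = P1 *\<^sub>v x0 + P2 *\<^sub>v (Ih *\<^sub>v hs)"
      using P1 P2 Ih x0 xs hs ewy by (simp add: zero assoc_mult_mat_vec[OF P2 Ih hs])
    finally show ?thesis .
  qed
  have Piz: "Pi *\<^sub>v \<zeta> = Om *\<^sub>v th"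
    unfolding Pi_def \<zeta>_def using Om th y by (subst append_cols_mult_vec[OF Om _ th y]) (auto simp: zero)
  have R1z: "R1 *\<^sub>v \<zeta> = e"
    unfolding R1_def z2 using MM x0 xs hs ewy eC
    by (subst append_cols_mult_vec[OF MM _ _ ewy]) (auto simp: zero e_def)
  have R2z: "R2 *\<^sub>v \<zeta> = Sg *\<^sub>v th"
    unfolding R2_def \<zeta>_def using Sg th y by (subst append_cols_mult_vec[OF Sg _ th y]) (auto simp: zero)
  have t1: "\<zeta> \<bullet> (Sy (transpose_mat P * Pi) *\<^sub>v \<zeta>) = 2 * ((P1 *\<^sub>v x0 + P2 *\<^sub>v (Ih *\<^sub>v hs)) \<bullet> (Om *\<^sub>v th))"
    unfolding scalar_prod_Sy[OF PP z] scalar_prod_transpose_mult[OF P Pi z z] Pz Piz ..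
  have t2: "\<zeta> \<bullet> ((C1 * R1) *\<^sub>v \<zeta>) = x0 \<bullet> (P2 *\<^sub>v e) + (Ih *\<^sub>v hs) \<bullet> (P3 *\<^sub>v e)"
  proof -
    have c1: "(transpose_mat Ih * P3) @\<^sub>r 0\<^sub>m l dn \<in> carrier_mat (kh + l) dn"
      using P3 Ih by (intro carrier_append_rows) auto
    have c2: "0\<^sub>m nx dn @\<^sub>r (transpose_mat Ih * P3) @\<^sub>r 0\<^sub>m l dn \<in> carrier_mat (nx + (kh + l)) dn"
      by (intro carrier_append_rows c1) auto
    have ewy0: "(es @\<^sub>v (w @\<^sub>v y)) \<bullet> 0\<^sub>v l = 0" using ewy by simp
    have c3: "transpose_mat Ih * P3 \<in> carrier_mat kh dn" using Ih P3 by auto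
    have "(C1 * R1) *\<^sub>v \<zeta> = C1 *\<^sub>v e" using assoc_mult_mat_vec[OF C1 R1 z] R1z by simp
    also have "\<dots> = (P2 *\<^sub>v e) @\<^sub>v ((0\<^sub>m nx dn *\<^sub>v e) @\<^sub>v (((transpose_mat Ih * P3) *\<^sub>v e) @\<^sub>v (0\<^sub>m l dn *\<^sub>v e)))"
      unfolding C1_def mat_mult_append[OF P2 c2 eC] mat_mult_append[OF zero_carrier_mat c1 eC]
        mat_mult_append[OF c3 zero_carrier_mat eC] ..
    also have "\<dots> = (P2 *\<^sub>v e) @\<^sub>v (0\<^sub>v nx @\<^sub>v ((transpose_mat Ih *\<^sub>v (P3 *\<^sub>v e)) @\<^sub>v 0\<^sub>v l))"
      using eC assoc_mult_mat_vec[OF _ P3 eC, of "transpose_mat Ih" kh] Ih by (simp add: zero)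
    finally have "\<zeta> \<bullet> ((C1 * R1) *\<^sub>v \<zeta>) = x0 \<bullet> (P2 *\<^sub>v e) + hs \<bullet> (transpose_mat Ih *\<^sub>v (P3 *\<^sub>v e))"
      unfolding z1 using x0 xs hs P2 P3 Ih eC carrier_vecD[OF ewy] ewy0
      by (simp add: scalar_prod_append')
    also have "hs \<bullet> (transpose_mat Ih *\<^sub>v (P3 *\<^sub>v e)) = (Ih *\<^sub>v hs) \<bullet> (P3 *\<^sub>v e)"
      by (rule scalar_prod_transpose_vec[OF Ih hs]) (use P3 eC in auto)
    finally show ?thesis .
  qed
  have t3: "\<zeta> \<bullet> ((C2 * R2) *\<^sub>v \<zeta>) = y \<bullet> (Jt *\<^sub>v (Sg *\<^sub>v th)) - w \<bullet> (transpose_mat J2 *\<^sub>v (Sg *\<^sub>v th))"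
  proof -
    define s where "s = Sg *\<^sub>v th"
    have s: "s \<in> carrier_vec m" unfolding s_def using Sg th by auto
    have xh: "x0 @\<^sub>v (xs @\<^sub>v (hs @\<^sub>v es)) \<in> carrier_vec b"
      using x0 xs hs es b by (auto simp: add.assoc)
    then have xh0: "(x0 @\<^sub>v (xs @\<^sub>v (hs @\<^sub>v es))) \<bullet> 0\<^sub>v b = 0" by simp
    have c0: "- transpose_mat J2 \<in> carrier_mat q m" using J2 by auto
    have c1: "(- transpose_mat J2) @\<^sub>r Jt \<in> carrier_mat (q + m) m"
      using J2 Jt by (intro carrier_append_rows) auto
    have "(C2 * R2) *\<^sub>v \<zeta> = C2 *\<^sub>v s" using assoc_mult_mat_vec[OF C2 R2 z] R2z by (simp add: s_def)
    also have "\<dots> = 0\<^sub>v b @\<^sub>v ((- (transpose_mat J2 *\<^sub>v s)) @\<^sub>v (Jt *\<^sub>v s))"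
      unfolding C2_def mat_mult_append[OF zero_carrier_mat c1 s] mat_mult_append[OF c0 Jt s]
      using s J2 uminus_mult_mat_vec[of s "transpose_mat J2"] by (simp add: zero)
    finally have "\<zeta> \<bullet> ((C2 * R2) *\<^sub>v \<zeta>) = w \<bullet> (- (transpose_mat J2 *\<^sub>v s)) + y \<bullet> (Jt *\<^sub>v s)"
      unfolding z3 using w y J2 Jt s carrier_vecD[OF xh] xh0
      by (simp add: scalar_prod_append')
    also have "w \<bullet> (- (transpose_mat J2 *\<^sub>v s)) = - (w \<bullet> (transpose_mat J2 *\<^sub>v s))"
      using w J2 s by (intro scalar_prod_uminus_right) auto
    finally show ?thesis by (simp add: s_def)
  qed
  have t4: "\<zeta> \<bullet> (diag_block_mat [Xi, J1] *\<^sub>v \<zeta>) = th \<bullet> (Xi *\<^sub>v th) + y \<bullet> (J1 *\<^sub>v y)"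
  proof -
    have "diag_block_mat [Xi, J1] *\<^sub>v vstack [th, y] = vstack (map2 (*\<^sub>v) [Xi, J1] [th, y])"
      by (rule diag_block_mat_mult_vstack) (use Xi J1 th y in auto)
    then have "diag_block_mat [Xi, J1] *\<^sub>v \<zeta> = (Xi *\<^sub>v th) @\<^sub>v (J1 *\<^sub>v y)"
      by (simp add: \<zeta>_def)
    then show ?thesis unfolding \<zeta>_def using Xi J1 th y by (simp add: scalar_prod_append')
  qed
  have "\<zeta> \<bullet> (X *\<^sub>v \<zeta>) = \<zeta> \<bullet> (Sy (transpose_mat P * Pi) *\<^sub>v \<zeta>) +
      (2 * (\<zeta> \<bullet> ((C1 * R1) *\<^sub>v \<zeta>) + \<zeta> \<bullet> ((C2 * R2) *\<^sub>v \<zeta>)) + \<zeta> \<bullet> (diag_block_mat [Xi, J1] *\<^sub>v \<zeta>))"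
  proof -
    have "C1 * R1 \<in> carrier_mat (?N + m) (?N + m)" "C2 * R2 \<in> carrier_mat (?N + m) (?N + m)"
      using C1 R1 C2 R2 by auto
    note a = scalar_prod_add_mat[OF this z z]
    have sd: "Sy (C1 * R1 + C2 * R2) + diag_block_mat [Xi, J1] \<in> carrier_mat (?N + m) (?N + m)"
      using Sy_carrier[OF CR] D by auto
    show ?thesis unfolding Xeq scalar_prod_add_mat[OF Sy_carrier[OF PP] sd z z]
        scalar_prod_add_mat[OF Sy_carrier[OF CR] D z z] scalar_prod_Sy[OF CR z] a ..
  qed
  then show ?g3 unfolding t1 t2 t3 t4 by simp
qed

section \<open>Gram matrices and Bessel's inequality\<close>

text \<open>Bessel's identity for two functions, because a matrix \<open>R\<close> also couples
  different components of the history; the scalar version would settle diagonal matrices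
  only.\<close>

lemma bessel_bilinear:
  fixes e :: "'i \<Rightarrow> real \<Rightarrow> real" and x y :: "real \<Rightarrow> real"
  assumes I: "finite I" and e: "\<And>a. a \<in> I \<Longrightarrow> L2_on X (e a)" and x: "L2_on X x" and y: "L2_on X y"
    and on: "\<And>a b. a \<in> I \<Longrightarrow> b \<in> I \<Longrightarrow> (\<integral>s. e a s * e b s \<partial>lebesgue_on X) = (if a = b then 1 else 0)"
  defines "c \<equiv> \<lambda>x a. \<integral>s. e a s * x s \<partial>lebesgue_on X"
  shows "(\<integral>s. (x s - (\<Sum>a\<in>I. c x a * e a s)) * (y s - (\<Sum>a\<in>I. c y a * e a s)) \<partial>lebesgue_on X)
      = (\<integral>s. x s * y s \<partial>lebesgue_on X) - (\<Sum>a\<in>I. c x a * c y a)"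
proof -
  let ?p = "\<lambda>s. \<Sum>a\<in>I. c x a * e a s" and ?q = "\<lambda>s. \<Sum>a\<in>I. c y a * e a s"
  have p: "L2_on X ?p" and q: "L2_on X ?q" using I e by (auto intro!: L2_on_sum L2_on_cmult)
  note i = L2_on_mult_integrable
  have xq: "(\<integral>s. u s * (\<Sum>a\<in>I. d a * e a s) \<partial>lebesgue_on X) = (\<Sum>a\<in>I. d a * c u a)" if u: "L2_on X u" for u d
  proof -
    have "(\<integral>s. u s * (\<Sum>a\<in>I. d a * e a s) \<partial>lebesgue_on X) = (\<integral>s. (\<Sum>a\<in>I. d a * (e a s * u s)) \<partial>lebesgue_on X)"
      by (simp add: sum_distrib_left mult_ac)
    also have "\<dots> = (\<Sum>a\<in>I. \<integral>s. d a * (e a s * u s) \<partial>lebesgue_on X)"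
      using e u by (intro Bochner_Integration.integral_sum integrable_mult_right i) auto
    finally show ?thesis by (simp add: c_def)
  qed
  have cp: "c (\<lambda>s. \<Sum>b\<in>I. d b * e b s) a = d a" if "a \<in> I" for a d
  proof -
    have "c (\<lambda>s. \<Sum>b\<in>I. d b * e b s) a = (\<integral>s. e a s * (\<Sum>b\<in>I. d b * e b s) \<partial>lebesgue_on X)"
      by (simp only: c_def)
    also have "\<dots> = (\<Sum>b\<in>I. d b * c (e a) b)" using xq[OF e[OF that]] .
    also have "\<dots> = (\<Sum>b\<in>I. if b = a then d a else 0)"
      using on that by (intro sum.cong) (auto simp: c_def)
    finally show ?thesis using I that by simp
  qed
  have "(\<integral>s. (x s - ?p s) * (y s - ?q s) \<partial>lebesgue_on X)
      = (\<integral>s. (x s * y s - x s * ?q s) - (y s * ?p s - ?p s * ?q s) \<partial>lebesgue_on X)"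
    by (rule Bochner_Integration.integral_cong) (auto simp: algebra_simps)
  also have "\<dots> = ((\<integral>s. x s * y s \<partial>lebesgue_on X) - (\<integral>s. x s * ?q s \<partial>lebesgue_on X))
      - ((\<integral>s. y s * ?p s \<partial>lebesgue_on X) - (\<integral>s. ?p s * ?q s \<partial>lebesgue_on X))"
    using i[OF x y] i[OF x q] i[OF y p] i[OF p q]
    by (simp only: Bochner_Integration.integral_diff Bochner_Integration.integrable_diff)
  also have "\<dots> = (\<integral>s. x s * y s \<partial>lebesgue_on X) - (\<Sum>a\<in>I. c y a * c x a)"
    using xq[OF x, of "c y"] xq[OF y, of "c x"] xq[OF p, of "c y"] cp[of _ "c x"]
    by (simp add: mult.commute)
  finally show ?thesis by (simp add: mult.commute)
qed

text \<open>The residuals left after subtracting the projections have a pointwise nonnegative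
  \<open>R\<close>-form. Its integral, expanded by the bilinear identity, is the energy minus the
  form of the coefficients.\<close>

lemma bessel_quadratic:
  fixes e :: "'i \<Rightarrow> real \<Rightarrow> real" and x :: "nat \<Rightarrow> real \<Rightarrow> real" and R :: "nat \<Rightarrow> nat \<Rightarrow> real"
  assumes I: "finite I" and e: "\<And>a. a \<in> I \<Longrightarrow> L2_on X (e a)" and x: "\<And>c. c < n \<Longrightarrow> L2_on X (x c)"
    and on: "\<And>a b. a \<in> I \<Longrightarrow> b \<in> I \<Longrightarrow> (\<integral>s. e a s * e b s \<partial>lebesgue_on X) = (if a = b then 1 else 0)"
    and R: "\<And>y. 0 \<le> (\<Sum>c<n. \<Sum>d<n. R c d * (y c * y d))"
  shows "(\<Sum>a\<in>I. \<Sum>c<n. \<Sum>d<n. R c d * ((\<integral>s. e a s * x c s \<partial>lebesgue_on X) * (\<integral>s. e a s * x d s \<partial>lebesgue_on X)))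
      \<le> (\<Sum>c<n. \<Sum>d<n. R c d * (\<integral>s. x c s * x d s \<partial>lebesgue_on X))"
proof -
  define C where "C c a = (\<integral>s. e a s * x c s \<partial>lebesgue_on X)" for c a
  define y where "y c s = x c s - (\<Sum>a\<in>I. C c a * e a s)" for c s
  have y: "L2_on X (y c)" if "c < n" for c
    unfolding y_def using x[OF that] e I by (auto intro!: L2_on_diff L2_on_sum L2_on_cmult)
  have "0 \<le> (\<integral>s. (\<Sum>c<n. \<Sum>d<n. R c d * (y c s * y d s)) \<partial>lebesgue_on X)"
    by (rule Bochner_Integration.integral_nonneg) (rule R)
  also have "\<dots> = (\<Sum>c<n. \<Sum>d<n. R c d * (\<integral>s. y c s * y d s \<partial>lebesgue_on X))"
  proof -
    have i: "integrable (lebesgue_on X) (\<lambda>s. R c d * (y c s * y d s))" if "c < n" "d < n" for c d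
      using y that by (intro integrable_mult_right L2_on_mult_integrable) auto
    have "(\<integral>s. (\<Sum>c<n. \<Sum>d<n. R c d * (y c s * y d s)) \<partial>lebesgue_on X)
      = (\<Sum>c<n. \<integral>s. (\<Sum>d<n. R c d * (y c s * y d s)) \<partial>lebesgue_on X)"
      using i by (intro Bochner_Integration.integral_sum Bochner_Integration.integrable_sum) auto
    also have "\<dots> = (\<Sum>c<n. \<Sum>d<n. \<integral>s. R c d * (y c s * y d s) \<partial>lebesgue_on X)"
      using i by (intro sum.cong refl Bochner_Integration.integral_sum) auto
    finally show ?thesis by simp
  qed
  also have "\<dots> = (\<Sum>c<n. \<Sum>d<n. R c d * ((\<integral>s. x c s * x d s \<partial>lebesgue_on X) - (\<Sum>a\<in>I. C c a * C d a)))"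
    unfolding y_def C_def using bessel_bilinear[OF I e x x on] by (intro sum.cong refl) auto
  also have "\<dots> = (\<Sum>c<n. \<Sum>d<n. R c d * (\<integral>s. x c s * x d s \<partial>lebesgue_on X))
      - (\<Sum>c<n. \<Sum>d<n. \<Sum>a\<in>I. R c d * (C c a * C d a))"
    by (simp add: right_diff_distrib sum_subtractf sum_distrib_left)
  also have "(\<Sum>c<n. \<Sum>d<n. \<Sum>a\<in>I. R c d * (C c a * C d a)) = (\<Sum>a\<in>I. \<Sum>c<n. \<Sum>d<n. R c d * (C c a * C d a))"
  proof -
    have "(\<Sum>c<n. \<Sum>d<n. \<Sum>a\<in>I. R c d * (C c a * C d a)) = (\<Sum>c<n. \<Sum>a\<in>I. \<Sum>d<n. R c d * (C c a * C d a))"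
      by (intro sum.cong refl sum.swap)
    then show ?thesis by (simp only: sum.swap[of _ I])
  qed
  finally show ?thesis by (simp add: C_def)
qed

section \<open>Square-integrable vector functions and their Gram matrices\<close>

lemma L2_vec_dim: "L2_vec X k a \<Longrightarrow> s \<in> X \<Longrightarrow> dim_vec (a s) = k"
  by (auto simp: L2_vec_def)

lemma L2_vec_mult_mat:
  assumes "A \<in> carrier_mat k' k" "L2_vec X k a"
  shows "L2_vec X k' (\<lambda>s. A *\<^sub>v a s)"
  unfolding L2_vec_def
proof (intro conjI ballI allI impI)
  fix j assume j: "j < k'"
  have "L2_on X (\<lambda>s. \<Sum>b<k. A $$ (j, b) * a s $ b)"
    using assms by (intro L2_on_sum L2_on_cmult) (auto simp: L2_vec_def)
  then show "L2_on X (\<lambda>s. (A *\<^sub>v a s) $ j)"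
    by (rule L2_on_cong) (use assms j in \<open>auto simp: scalar_prod_def atLeast0LessThan L2_vec_dim\<close>)
qed (use assms in \<open>auto simp: L2_vec_def\<close>)

lemma L2_vec_append:
  assumes "L2_vec X k a" "L2_vec X l b"
  shows "L2_vec X (k + l) (\<lambda>s. a s @\<^sub>v b s)"
  unfolding L2_vec_def
proof (intro conjI ballI allI impI)
  fix j assume j: "j < k + l"
  have "L2_on X (\<lambda>s. if j < k then a s $ j else b s $ (j - k))"
    using assms j by (cases "j < k") (auto simp: L2_vec_def)
  then show "L2_on X (\<lambda>s. (a s @\<^sub>v b s) $ j)"
    by (rule L2_on_cong) (use assms j in \<open>auto simp: L2_vec_dim\<close>)
qed (use assms in \<open>auto simp: L2_vec_def\<close>)

lemma L2_vec_diff: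
  assumes "L2_vec X k a" "L2_vec X k b"
  shows "L2_vec X k (\<lambda>s. a s - b s)"
  unfolding L2_vec_def
proof (intro conjI ballI allI impI)
  fix j assume j: "j < k"
  have "L2_on X (\<lambda>s. a s $ j - b s $ j)"
    using assms j by (intro L2_on_diff) (auto simp: L2_vec_def)
  then show "L2_on X (\<lambda>s. (a s - b s) $ j)"
    by (rule L2_on_cong) (use assms j in \<open>auto simp: L2_vec_dim\<close>)
qed (use assms in \<open>auto simp: L2_vec_def\<close>)

lemma gram_carrier [simp]: "gram X k l a b \<in> carrier_mat k l"
  by (simp add: gram_def)

lemma integral_mult_mat_vec:
  assumes A: "A \<in> carrier_mat k' k" and a: "L2_vec X k a" and y: "L2_on X y" and j: "j < k'"
  shows "(\<integral>s. (A *\<^sub>v a s) $ j * y s \<partial>lebesgue_on X) = (\<Sum>b<k. A $$ (j, b) * (\<integral>s. a s $ b * y s \<partial>lebesgue_on X))"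
proof -
  have "(\<integral>s. (A *\<^sub>v a s) $ j * y s \<partial>lebesgue_on X) = (\<integral>s. (\<Sum>b<k. A $$ (j, b) * (a s $ b * y s)) \<partial>lebesgue_on X)"
    using A j by (intro Bochner_Integration.integral_cong refl)
      (auto simp: scalar_prod_def atLeast0LessThan L2_vec_dim[OF a] sum_distrib_right mult.assoc)
  also have "\<dots> = (\<Sum>b<k. \<integral>s. A $$ (j, b) * (a s $ b * y s) \<partial>lebesgue_on X)"
    using a y by (intro Bochner_Integration.integral_sum integrable_mult_right L2_on_mult_integrable)
      (auto simp: L2_vec_def)
  finally show ?thesis by simp
qed

text \<open>Serves both to normalise a family by an inverse Cholesky factor and to verify that a
  projection residual is orthogonal to the family projected on.\<close>

lemma gram_mult_mat:
  assumes A: "A \<in> carrier_mat k' k" and B: "B \<in> carrier_mat l' l" and a: "L2_vec X k a" and b: "L2_vec X l b"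
  shows "gram X k' l' (\<lambda>s. A *\<^sub>v a s) (\<lambda>s. B *\<^sub>v b s) = A * gram X k l a b * transpose_mat B"
proof (rule eq_matI)
  fix i j assume "i < dim_row (A * gram X k l a b * transpose_mat B)" "j < dim_col (A * gram X k l a b * transpose_mat B)"
  then have ij: "i < k'" "j < l'" using A B by auto
  have Bb: "L2_vec X l' (\<lambda>s. B *\<^sub>v b s)" using B b by (rule L2_vec_mult_mat)
  have "gram X k' l' (\<lambda>s. A *\<^sub>v a s) (\<lambda>s. B *\<^sub>v b s) $$ (i, j) = (\<integral>s. (A *\<^sub>v a s) $ i * (B *\<^sub>v b s) $ j \<partial>lebesgue_on X)"
    using ij by (simp add: gram_def)
  also have "\<dots> = (\<Sum>c<k. A $$ (i, c) * (\<integral>s. a s $ c * (B *\<^sub>v b s) $ j \<partial>lebesgue_on X))"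
    using Bb ij by (intro integral_mult_mat_vec[OF A a]) (auto simp: L2_vec_def)
  also have "\<dots> = (\<Sum>c<k. A $$ (i, c) * (\<Sum>d<l. B $$ (j, d) * gram X k l a b $$ (c, d)))"
  proof (intro sum.cong refl arg_cong2[where f="(*)"])
    fix c assume "c \<in> {..<k}"
    then have "(\<integral>s. (B *\<^sub>v b s) $ j * a s $ c \<partial>lebesgue_on X) = (\<Sum>d<l. B $$ (j, d) * (\<integral>s. b s $ d * a s $ c \<partial>lebesgue_on X))"
      using a ij by (intro integral_mult_mat_vec[OF B b]) (auto simp: L2_vec_def)
    then show "(\<integral>s. a s $ c * (B *\<^sub>v b s) $ j \<partial>lebesgue_on X) = (\<Sum>d<l. B $$ (j, d) * gram X k l a b $$ (c, d))"
      using \<open>c \<in> {..<k}\<close> by (simp add: gram_def mult.commute)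
  qed
  also have "\<dots> = (A * gram X k l a b * transpose_mat B) $$ (i, j)"
  proof -
    have "(A * gram X k l a b * transpose_mat B) $$ (i, j) = (\<Sum>d<l. (\<Sum>c<k. A $$ (i, c) * gram X k l a b $$ (c, d)) * B $$ (j, d))"
      using A B ij by (simp add: scalar_prod_def atLeast0LessThan gram_def)
    also have "\<dots> = (\<Sum>d<l. \<Sum>c<k. A $$ (i, c) * (B $$ (j, d) * gram X k l a b $$ (c, d)))"
      by (simp add: sum_distrib_right sum_distrib_left mult_ac)
    also have "\<dots> = (\<Sum>c<k. \<Sum>d<l. A $$ (i, c) * (B $$ (j, d) * gram X k l a b $$ (c, d)))"
      by (rule sum.swap)
    finally show ?thesis by (simp add: sum_distrib_left)
  qed
  finally show "gram X k' l' (\<lambda>s. A *\<^sub>v a s) (\<lambda>s. B *\<^sub>v b s) $$ (i, j) = (A * gram X k l a b * transpose_mat B) $$ (i, j)" .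
qed (use A B in \<open>auto simp: gram_def\<close>)

lemma gram_cong:
  assumes "\<And>s. s \<in> X \<Longrightarrow> a s = a' s" "\<And>s. s \<in> X \<Longrightarrow> b s = b' s"
  shows "gram X k l a b = gram X k l a' b'"
  using assms unfolding gram_def
  by (intro cong_mat refl) (auto intro!: Bochner_Integration.integral_cong)

lemma gram_diff_left:
  assumes a: "L2_vec X k a" and a': "L2_vec X k a'" and b: "L2_vec X l b"
  shows "gram X k l (\<lambda>s. a s - a' s) b = gram X k l a b - gram X k l a' b"
proof (rule eq_matI)
  fix i j assume "i < dim_row (gram X k l a b - gram X k l a' b)" "j < dim_col (gram X k l a b - gram X k l a' b)"
  then have ij: "i < k" "j < l" by (auto simp: gram_def)
  have "(\<integral>s. (a s - a' s) $ i * b s $ j \<partial>lebesgue_on X) = (\<integral>s. a s $ i * b s $ j - a' s $ i * b s $ j \<partial>lebesgue_on X)"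
    using ij by (intro Bochner_Integration.integral_cong refl)
      (auto simp: L2_vec_dim[OF a] L2_vec_dim[OF a'] left_diff_distrib)
  also have "\<dots> = (\<integral>s. a s $ i * b s $ j \<partial>lebesgue_on X) - (\<integral>s. a' s $ i * b s $ j \<partial>lebesgue_on X)"
    using a a' b ij by (intro Bochner_Integration.integral_diff L2_on_mult_integrable) (auto simp: L2_vec_def)
  finally show "gram X k l (\<lambda>s. a s - a' s) b $$ (i, j) = (gram X k l a b - gram X k l a' b) $$ (i, j)"
    using ij by (simp add: gram_def)
qed (auto simp: gram_def)

section \<open>Coordinates on the space of unknowns\<close>

text \<open>Finitely many linear functionals that separate points and attain all prescribed values
  are the dual of a basis, so their number is the dimension. Thus the scalar unknowns can be counted
  by listing matrix entries, without writing down basis elements in a space of records.\<close>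

lemma fin_dim_dim_by_coordinates:
  fixes V :: "(real, 'v) module" and c :: "'b \<Rightarrow> 'v \<Rightarrow> real"
  assumes V: "vectorspace class_ring V" and B: "finite B"
    and add: "\<And>b u v. b \<in> B \<Longrightarrow> u \<in> carrier V \<Longrightarrow> v \<in> carrier V \<Longrightarrow> c b (u \<oplus>\<^bsub>V\<^esub> v) = c b u + c b v"
    and smult: "\<And>b a u. b \<in> B \<Longrightarrow> u \<in> carrier V \<Longrightarrow> c b (a \<odot>\<^bsub>V\<^esub> u) = a * c b u"
    and inj: "\<And>u v. u \<in> carrier V \<Longrightarrow> v \<in> carrier V \<Longrightarrow> (\<And>b. b \<in> B \<Longrightarrow> c b u = c b v) \<Longrightarrow> u = v"
    and surj: "\<And>g. \<exists>u \<in> carrier V. \<forall>b \<in> B. c b u = g b"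
  shows "vectorspace.fin_dim class_ring V" "vectorspace.dim class_ring V = card B"
proof -
  interpret V: vectorspace class_ring V by (rule V)
  \<comment> \<open>The dual basis; such a vector exists by \<open>surj\<close>, applied to the
    indicator of \<open>b\<close>.\<close>
  define e where "e b = (SOME u. u \<in> carrier V \<and> (\<forall>b' \<in> B. c b' u = (if b' = b then 1 else 0)))" for b
  have "e b \<in> carrier V \<and> (\<forall>b' \<in> B. c b' (e b) = (if b' = b then 1 else 0))" for b
    unfolding e_def by (rule someI_ex) (use surj[of "\<lambda>b'. if b' = b then 1 else 0"] in \<open>simp add: Bex_def\<close>)
  then have e: "\<And>b. e b \<in> carrier V" "\<And>b b'. b' \<in> B \<Longrightarrow> c b' (e b) = (if b' = b then 1 else 0)"
    by simp_all
  have inj_e: "inj_on e B"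
  proof (rule inj_onI)
    fix b b' assume "b \<in> B" "b' \<in> B" "e b = e b'"
    then have "c b (e b) = c b (e b')" by simp
    then show "b = b'" using e(2)[OF \<open>b \<in> B\<close>, of b] e(2)[OF \<open>b \<in> B\<close>, of b'] by (auto split: if_splits)
  qed
  have zero: "c b \<zero>\<^bsub>V\<^esub> = 0" if "b \<in> B" for b
    using smult[OF that V.M.zero_closed, of 0] V.M.zero_closed by simp
  have c_sum: "c b (\<Oplus>\<^bsub>V\<^esub>x\<in>A. a x \<odot>\<^bsub>V\<^esub> f x) = (\<Sum>x\<in>A. a x * c b (f x))"
    if "finite A" "\<And>x. x \<in> A \<Longrightarrow> f x \<in> carrier V" "b \<in> B" for A and f :: "'c \<Rightarrow> 'v" and a b
    using that(1,2)
  proof (induction A rule: finite_induct)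
    case empty
    then show ?case using zero[OF that(3)] by simp
  next
    case (insert x A)
    have cl: "a y \<odot>\<^bsub>V\<^esub> f y \<in> carrier V" if "y \<in> insert x A" for y
      using insert.prems[OF that] by (intro V.smult_closed) auto
    have "(\<Oplus>\<^bsub>V\<^esub>x\<in>insert x A. a x \<odot>\<^bsub>V\<^esub> f x) = a x \<odot>\<^bsub>V\<^esub> f x \<oplus>\<^bsub>V\<^esub> (\<Oplus>\<^bsub>V\<^esub>x\<in>A. a x \<odot>\<^bsub>V\<^esub> f x)"
      using insert.hyps cl by (intro V.M.finsum_insert) auto
    moreover have "(\<Oplus>\<^bsub>V\<^esub>x\<in>A. a x \<odot>\<^bsub>V\<^esub> f x) \<in> carrier V"
      using cl by (intro V.M.finsum_closed) auto
    ultimately show ?case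
      using insert add[OF that(3) cl, of x] smult[OF that(3)] by simp
  qed
  have gen: "V.gen_set (e ` B)"
  proof
    show "V.span (e ` B) \<subseteq> carrier V" using e(1) by (intro V.span_is_subset2) auto
    show "carrier V \<subseteq> V.span (e ` B)"
    proof
      fix u assume u: "u \<in> carrier V"
      \<comment> \<open>The coefficient at the basis vector \<open>e b\<close> is the coordinate of
        \<open>u\<close> at \<open>b\<close>; linear combinations are indexed by vectors, hence the
        inverse of \<open>e\<close>.\<close>
      define a where "a v = c (the_inv_into B e v) u" for v
      have cb: "c b (V.lincomb a (e ` B)) = c b u" if "b \<in> B" for b
      proof -
        have "c b (V.lincomb a (e ` B)) = (\<Sum>v\<in>e ` B. a v * c b v)"
          unfolding V.lincomb_def using c_sum[of "e ` B" "\<lambda>v. v" b a] B e(1) that by auto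
        also have "\<dots> = (\<Sum>b'\<in>B. c b' u * c b (e b'))"
          using inj_e by (subst sum.reindex) (auto simp: a_def the_inv_into_f_f)
        also have "\<dots> = (\<Sum>b'\<in>B. if b' = b then c b u else 0)"
          using e(2)[OF that] by (intro sum.cong) auto
        finally show ?thesis using B that by simp
      qed
      have "V.lincomb a (e ` B) \<in> carrier V"
        using e(1) by (intro V.lincomb_closed) auto
      then have "V.lincomb a (e ` B) = u" using u cb by (intro inj) auto
      then show "u \<in> V.span (e ` B)"
        unfolding V.span_def using B by (auto intro!: exI[of _ a] exI[of _ "e ` B"])
    qed
  qed
  have li: "\<not> V.lin_dep (e ` B)"
  proof (rule V.finite_lin_indpt2)
    fix a assume "V.lincomb a (e ` B) = \<zero>\<^bsub>V\<^esub>"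
    show "\<forall>v\<in>e ` B. a v = \<zero>\<^bsub>class_ring\<^esub>"
    proof clarify
      fix b assume b: "b \<in> B"
      have "0 = c b (V.lincomb a (e ` B))" using zero[OF b] \<open>V.lincomb a (e ` B) = _\<close> by simp
      also have "\<dots> = (\<Sum>v\<in>e ` B. a v * c b v)"
        unfolding V.lincomb_def using c_sum[of "e ` B" "\<lambda>v. v" b a] B e(1) b by auto
      also have "\<dots> = (\<Sum>b'\<in>B. a (e b') * c b (e b'))"
        using inj_e by (subst sum.reindex) auto
      also have "\<dots> = (\<Sum>b'\<in>B. if b' = b then a (e b) else 0)"
        using e(2)[OF b] by (intro sum.cong) auto
      also have "\<dots> = a (e b)" using B b by simp
      finally show "a (e b) = \<zero>\<^bsub>class_ring\<^esub>" by simp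
    qed
  qed (use B e(1) in auto)
  show "vectorspace.fin_dim class_ring V"
    unfolding V.fin_dim_def using gen B e(1) by (intro exI[of _ "e ` B"]) auto
  have "V.basis (e ` B)" unfolding V.basis_def using gen li e(1) by auto
  then have "V.dim = card (e ` B)" using B by (intro V.dim_basis) auto
  then show "vectorspace.dim class_ring V = card B" using inj_e by (simp add: card_image)
qed


text \<open>Every axiom is an equation between vectors, and equations may be tested on separating
  coordinates, where they are identities of real numbers. Additive inverses are the multiples by
  -1.\<close>

lemma vectorspace_by_coordinates:
  fixes V :: "(real, 'v) module" and c :: "'b \<Rightarrow> 'v \<Rightarrow> real"
  assumes cl: "\<And>u v. u \<in> carrier V \<Longrightarrow> v \<in> carrier V \<Longrightarrow> u \<oplus>\<^bsub>V\<^esub> v \<in> carrier V"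
      "\<And>a u. u \<in> carrier V \<Longrightarrow> a \<odot>\<^bsub>V\<^esub> u \<in> carrier V" "\<zero>\<^bsub>V\<^esub> \<in> carrier V"
    and add: "\<And>b u v. b \<in> B \<Longrightarrow> u \<in> carrier V \<Longrightarrow> v \<in> carrier V \<Longrightarrow> c b (u \<oplus>\<^bsub>V\<^esub> v) = c b u + c b v"
    and smult: "\<And>b a u. b \<in> B \<Longrightarrow> u \<in> carrier V \<Longrightarrow> c b (a \<odot>\<^bsub>V\<^esub> u) = a * c b u"
    and zero: "\<And>b. b \<in> B \<Longrightarrow> c b \<zero>\<^bsub>V\<^esub> = 0"
    and inj: "\<And>u v. u \<in> carrier V \<Longrightarrow> v \<in> carrier V \<Longrightarrow> (\<And>b. b \<in> B \<Longrightarrow> c b u = c b v) \<Longrightarrow> u = v"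
  shows "vectorspace class_ring V"
proof -
  have "abelian_group V"
  proof (rule abelian_groupI)
    fix x assume x: "x \<in> carrier V"
    then have "(-1) \<odot>\<^bsub>V\<^esub> x \<oplus>\<^bsub>V\<^esub> x = \<zero>\<^bsub>V\<^esub>"
      by (intro inj) (auto simp: cl add smult zero)
    then show "\<exists>y\<in>carrier V. y \<oplus>\<^bsub>V\<^esub> x = \<zero>\<^bsub>V\<^esub>" using cl(2)[OF x] by blast
  qed (auto intro!: inj simp: cl add zero)
  moreover have "Module.module class_ring V"
    by (rule Module.moduleI)
      (use calculation in \<open>auto intro!: inj class_cring.is_cring simp: cl add smult algebra_simps\<close>)
  ultimately show ?thesis
    unfolding vectorspace_def using class_field by auto
qed

section \<open>Counting the independent matrix entries\<close>

definition sym_idx :: "nat \<Rightarrow> (nat \<times> nat) set" where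
  "sym_idx m = {(a, b). a \<le> b \<and> b < m}"

lemma sym_idx_finite: "finite (sym_idx m)"
  by (rule finite_subset[of _ "{..<m} \<times> {..<m}"]) (auto simp: sym_idx_def)

lemma card_sym_idx: "real (card (sym_idx m)) = real m * (real m + 1) / 2"
proof -
  have "sym_idx m = (\<lambda>(b, a). (a, b)) ` (SIGMA b:{..<m}. {..b})"
    by (auto simp: sym_idx_def image_iff)
  moreover have "inj_on (\<lambda>(b, a). (a, b)) (SIGMA b:{..<m}. {..b})" by (auto simp: inj_on_def)
  ultimately have "card (sym_idx m) = (\<Sum>b<m. Suc b)"
    by (simp add: card_image)
  moreover have "real (\<Sum>b<k. Suc b) = real k * (real k + 1) / 2" for k
    by (induction k) (auto simp: field_simps)
  ultimately show ?thesis by simp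
qed

lemma sym_mats_eqI:
  assumes "X \<in> sym_mats m" "Y \<in> sym_mats m" "\<And>a b. (a, b) \<in> sym_idx m \<Longrightarrow> X $$ (a, b) = Y $$ (a, b)"
  shows "X = Y"
proof (rule eq_matI)
  have X: "X \<in> carrier_mat m m" "transpose_mat X = X" and Y: "Y \<in> carrier_mat m m" "transpose_mat Y = Y"
    using assms by (auto simp: sym_mats_def)
  fix a b assume "a < dim_row Y" "b < dim_col Y"
  then have ab: "a < m" "b < m" using Y by auto
  show "X $$ (a, b) = Y $$ (a, b)"
  proof (cases "a \<le> b")
    case False
    have "X $$ (a, b) = X $$ (b, a)" "Y $$ (a, b) = Y $$ (b, a)"
      using X Y ab by (metis carrier_matD index_transpose_mat(1))+
    then show ?thesis using assms(3)[of b a] False ab by (auto simp: sym_idx_def)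
  qed (use assms(3)[of a b] ab in \<open>auto simp: sym_idx_def\<close>)
qed (use assms in \<open>auto simp: sym_mats_def\<close>)

lemma sym_mats_closed:
  "X \<in> sym_mats m \<Longrightarrow> Y \<in> sym_mats m \<Longrightarrow> X + Y \<in> sym_mats m"
  "X \<in> sym_mats m \<Longrightarrow> a \<cdot>\<^sub>m X \<in> sym_mats m"
  "0\<^sub>m m m \<in> sym_mats m"
  by (auto simp: sym_mats_def transpose_add intro: eq_matI) (rule eq_matI; metis carrier_matD index_smult_mat index_transpose_mat)

text \<open>Arbitrary values on and above the diagonal extend to a symmetric matrix; this makes the
  coordinates surjective.\<close>

lemma sym_mats_mat: "mat m m (\<lambda>(a, b). g (min a b) (max a b)) \<in> sym_mats m"
  by (auto simp: sym_mats_def min.commute max.commute intro!: eq_matI)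

text \<open>Coordinates are indexed by \<open>(k, i, a, b)\<close>, where \<open>k\<close> numbers the seven families of unknowns,
  \<open>i\<close> the member of the family, and \<open>(a, b)\<close> the entry.\<close>

definition unknown_coord :: "nat \<times> nat \<times> nat \<times> nat \<Rightarrow> unknowns \<Rightarrow> real" where
  "unknown_coord = (\<lambda>(k, i, ab) U.
     (if k = 0 then par_P1 U else if k = 1 then par_P2 U else if k = 2 then par_P3 U
      else if k = 3 then par_Q U i else if k = 4 then par_R U i
      else if k = 5 then par_K U i else par_Kd U i) $$ ab)"

text \<open>A symmetric unknown contributes only its entries on and above the diagonal. The three
  unknowns that are single matrices carry the dummy member index \<open>0\<close>.\<close>

definition unknown_family :: "system \<Rightarrow> nat \<Rightarrow> (nat \<times> nat \<times> nat) set" where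
  "unknown_family S k =
     (if k = 0 then {0} \<times> sym_idx (dim_x S)
      else if k = 1 then {0} \<times> ({..<dim_x S} \<times> {..<tot_f S * dim_x S})
      else if k = 2 then {0} \<times> sym_idx (tot_f S * dim_x S)
      else if k = 3 \<or> k = 4 then {1..num_del S} \<times> sym_idx (dim_x S)
      else if k = 5 then {0..num_del S} \<times> ({..<dim_u S} \<times> {..<dim_x S})
      else (SIGMA i:{1..num_del S}. {..<dim_u S} \<times> {..<dim_g S i * dim_x S}))"

definition unknown_idx :: "system \<Rightarrow> (nat \<times> nat \<times> nat \<times> nat) set" where
  "unknown_idx S = (SIGMA k:{..<7}. unknown_family S k)"

lemma finite_unknown_family: "finite (unknown_family S k)"
  by (auto simp: unknown_family_def sym_idx_finite)

lemma finite_unknown_idx: "finite (unknown_idx S)"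
  by (auto simp: unknown_idx_def finite_unknown_family)

text \<open>The two controller families contribute \<open>1 + num_del S\<close> and
  \<open>tot_g S\<close> blocks of \<open>dim_u S * dim_x S\<close> entries, which add up to the
  term with \<open>beta S\<close>. The families \<open>Q\<close> and \<open>R\<close> have equal
  size and together cancel the factor one half.\<close>

lemma card_unknown_idx:
  "real (card (unknown_idx S)) =
     (0.5 * real (tot_f S) ^ 2 + real (tot_f S) + real (num_del S) + 0.5) * real (dim_x S) ^ 2 +
     (0.5 * real (tot_f S) + 0.5 + real (num_del S) + real (beta S) * real (dim_u S)) * real (dim_x S)"
proof -
  let ?n = "real (dim_x S)" and ?d = "real (tot_f S)" and ?v = "real (num_del S)" and ?p = "real (dim_u S)"
  have "card (unknown_idx S) = (\<Sum>k<7. card (unknown_family S k))"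
    unfolding unknown_idx_def by (rule card_SigmaI) (auto simp: finite_unknown_family)
  then have "real (card (unknown_idx S)) = (\<Sum>k<7. real (card (unknown_family S k)))" by simp
  also have "{..<7} = {0, 1, 2, 3, 4, 5, 6 :: nat}" by auto
  also have "(\<Sum>k\<in>{0, 1, 2, 3, 4, 5, 6 :: nat}. real (card (unknown_family S k))) =
      real (card (unknown_family S 0)) + (real (card (unknown_family S 1)) + (real (card (unknown_family S 2))
      + (real (card (unknown_family S 3)) + (real (card (unknown_family S 4)) + (real (card (unknown_family S 5))
      + real (card (unknown_family S 6)))))))"
    by simp
  also have "real (card (unknown_family S 0)) = ?n * (?n + 1) / 2"
    by (simp add: unknown_family_def card_cartesian_product card_sym_idx)
  also have "real (card (unknown_family S 1)) = ?n * (?d * ?n)"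
    by (simp add: unknown_family_def card_cartesian_product)
  also have "real (card (unknown_family S 2)) = (?d * ?n) * (?d * ?n + 1) / 2"
    by (simp add: unknown_family_def card_cartesian_product card_sym_idx)
  also have "real (card (unknown_family S 3)) = ?v * (?n * (?n + 1) / 2)"
    by (simp add: unknown_family_def card_cartesian_product card_sym_idx)
  also have "real (card (unknown_family S 4)) = ?v * (?n * (?n + 1) / 2)"
    by (simp add: unknown_family_def card_cartesian_product card_sym_idx)
  also have "real (card (unknown_family S 5)) = (1 + ?v) * (?p * ?n)"
    by (simp add: unknown_family_def card_cartesian_product distrib_right)
  also have "real (card (unknown_family S 6)) = ?p * real (tot_g S) * ?n"
  proof -
    have "card (unknown_family S 6) = (\<Sum>i = 1..num_del S. dim_u S * (dim_g S i * dim_x S))"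
      unfolding unknown_family_def by (simp add: card_SigmaI card_cartesian_product)
    also have "\<dots> = dim_u S * tot_g S * dim_x S"
      by (simp add: tot_g_def sum_distrib_left sum_distrib_right mult.assoc)
    finally show ?thesis by simp
  qed
  finally show ?thesis
    by (simp add: beta_def power2_eq_square field_simps)
qed

lemma unknown_idxD:
  assumes "(k, i, a, b) \<in> unknown_idx S"
  shows "k < 7" "k = 0 \<Longrightarrow> (a, b) \<in> sym_idx (dim_x S)"
    "k = 1 \<Longrightarrow> a < dim_x S \<and> b < tot_f S * dim_x S"
    "k = 2 \<Longrightarrow> (a, b) \<in> sym_idx (tot_f S * dim_x S)"
    "k = 3 \<Longrightarrow> i \<in> {1..num_del S} \<and> (a, b) \<in> sym_idx (dim_x S)"
    "k = 4 \<Longrightarrow> i \<in> {1..num_del S} \<and> (a, b) \<in> sym_idx (dim_x S)"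
    "k = 5 \<Longrightarrow> i \<in> {0..num_del S} \<and> a < dim_u S \<and> b < dim_x S"
    "k = 6 \<Longrightarrow> i \<in> {1..num_del S} \<and> a < dim_u S \<and> b < dim_g S i * dim_x S"
  using assms by (auto simp: unknown_idx_def unknown_family_def split: if_splits)

lemma unknowns_carrierD:
  assumes "U \<in> carrier (unknowns_space S)"
  shows "par_P1 U \<in> sym_mats (dim_x S)" "par_P2 U \<in> carrier_mat (dim_x S) (tot_f S * dim_x S)"
    "par_P3 U \<in> sym_mats (tot_f S * dim_x S)"
    "par_Q U \<in> {1..num_del S} \<rightarrow>\<^sub>E sym_mats (dim_x S)" "par_R U \<in> {1..num_del S} \<rightarrow>\<^sub>E sym_mats (dim_x S)"
    "par_K U \<in> {0..num_del S} \<rightarrow>\<^sub>E carrier_mat (dim_u S) (dim_x S)"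
    "par_Kd U \<in> (\<Pi>\<^sub>E i \<in> {1..num_del S}. carrier_mat (dim_u S) (dim_g S i * dim_x S))"
  using assms by (auto simp: unknowns_space_def)

lemma unknowns_space_simps:
  "U \<oplus>\<^bsub>unknowns_space S\<^esub> V = \<lparr> par_P1 = par_P1 U + par_P1 V, par_P2 = par_P2 U + par_P2 V, par_P3 = par_P3 U + par_P3 V,
     par_Q = (\<lambda>i \<in> {1..num_del S}. par_Q U i + par_Q V i), par_R = (\<lambda>i \<in> {1..num_del S}. par_R U i + par_R V i),
     par_K = (\<lambda>i \<in> {0..num_del S}. par_K U i + par_K V i), par_Kd = (\<lambda>i \<in> {1..num_del S}. par_Kd U i + par_Kd V i) \<rparr>"
  "x \<odot>\<^bsub>unknowns_space S\<^esub> U = \<lparr> par_P1 = x \<cdot>\<^sub>m par_P1 U, par_P2 = x \<cdot>\<^sub>m par_P2 U, par_P3 = x \<cdot>\<^sub>m par_P3 U,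
     par_Q = (\<lambda>i \<in> {1..num_del S}. x \<cdot>\<^sub>m par_Q U i), par_R = (\<lambda>i \<in> {1..num_del S}. x \<cdot>\<^sub>m par_R U i),
     par_K = (\<lambda>i \<in> {0..num_del S}. x \<cdot>\<^sub>m par_K U i), par_Kd = (\<lambda>i \<in> {1..num_del S}. x \<cdot>\<^sub>m par_Kd U i) \<rparr>"
  "\<zero>\<^bsub>unknowns_space S\<^esub> = \<lparr> par_P1 = 0\<^sub>m (dim_x S) (dim_x S),
       par_P2 = 0\<^sub>m (dim_x S) (tot_f S * dim_x S),
       par_P3 = 0\<^sub>m (tot_f S * dim_x S) (tot_f S * dim_x S),
       par_Q = (\<lambda>i \<in> {1..num_del S}. 0\<^sub>m (dim_x S) (dim_x S)),
       par_R = (\<lambda>i \<in> {1..num_del S}. 0\<^sub>m (dim_x S) (dim_x S)),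
       par_K = (\<lambda>i \<in> {0..num_del S}. 0\<^sub>m (dim_u S) (dim_x S)),
       par_Kd = (\<lambda>i \<in> {1..num_del S}. 0\<^sub>m (dim_u S) (dim_g S i * dim_x S)) \<rparr>"
  by (simp_all add: unknowns_space_def)

text \<open>Entries of sums and multiples can be evaluated only at positions inside the matrix; the
  range facts are collected here for all seven families.\<close>

lemma unknowns_dims:
  assumes "U \<in> carrier (unknowns_space S)" "(k, i, a, c) \<in> unknown_idx S"
  shows "k = 0 \<Longrightarrow> a < dim_row (par_P1 U) \<and> c < dim_col (par_P1 U)"
    "k = 1 \<Longrightarrow> a < dim_row (par_P2 U) \<and> c < dim_col (par_P2 U)"
    "k = 2 \<Longrightarrow> a < dim_row (par_P3 U) \<and> c < dim_col (par_P3 U)"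
    "k = 3 \<Longrightarrow> i \<in> {1..num_del S} \<and> a < dim_row (par_Q U i) \<and> c < dim_col (par_Q U i)"
    "k = 4 \<Longrightarrow> i \<in> {1..num_del S} \<and> a < dim_row (par_R U i) \<and> c < dim_col (par_R U i)"
    "k = 5 \<Longrightarrow> i \<in> {0..num_del S} \<and> a < dim_row (par_K U i) \<and> c < dim_col (par_K U i)"
    "k = 6 \<Longrightarrow> i \<in> {1..num_del S} \<and> a < dim_row (par_Kd U i) \<and> c < dim_col (par_Kd U i)"
proof -
  note V = unknowns_carrierD[OF assms(1)] and D = unknown_idxD[OF assms(2)]
  have sym: "X \<in> sym_mats m \<Longrightarrow> (a, c) \<in> sym_idx m \<Longrightarrow> a < dim_row X \<and> c < dim_col X" for X m
    by (auto simp: sym_mats_def sym_idx_def)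
  have full: "X \<in> carrier_mat m l \<Longrightarrow> a < m \<and> c < l \<Longrightarrow> a < dim_row X \<and> c < dim_col X" for X :: "real mat" and m l
    by auto
  show "k = 0 \<Longrightarrow> a < dim_row (par_P1 U) \<and> c < dim_col (par_P1 U)" by (rule sym[OF V(1) D(2)])
  show "k = 1 \<Longrightarrow> a < dim_row (par_P2 U) \<and> c < dim_col (par_P2 U)" by (rule full[OF V(2) D(3)])
  show "k = 2 \<Longrightarrow> a < dim_row (par_P3 U) \<and> c < dim_col (par_P3 U)" by (rule sym[OF V(3) D(4)])
  show "i \<in> {1..num_del S} \<and> a < dim_row (par_Q U i) \<and> c < dim_col (par_Q U i)" if "k = 3"
    using D(5)[OF that] sym[OF PiE_mem[OF V(4)]] by blast
  show "i \<in> {1..num_del S} \<and> a < dim_row (par_R U i) \<and> c < dim_col (par_R U i)" if "k = 4"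
    using D(6)[OF that] sym[OF PiE_mem[OF V(5)]] by blast
  show "i \<in> {0..num_del S} \<and> a < dim_row (par_K U i) \<and> c < dim_col (par_K U i)" if "k = 5"
    using D(7)[OF that] full[OF PiE_mem[OF V(6)]] by blast
  show "i \<in> {1..num_del S} \<and> a < dim_row (par_Kd U i) \<and> c < dim_col (par_Kd U i)" if "k = 6"
    using D(8)[OF that] full[OF PiE_mem[OF V(7)]] by blast
qed

lemma unknown_idx_cases:
  assumes "b \<in> unknown_idx S"
  obtains k i a c where "b = (k, i, a, c)" "k \<in> {0, 1, 2, 3, 4, 5, 6}" "(k, i, a, c) \<in> unknown_idx S"
proof -
  obtain k i a c where kiac: "b = (k, i, a, c)" by (cases b) auto
  moreover have "k < 7" using unknown_idxD(1)[OF assms[unfolded kiac]] .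
  then have "k \<in> {0, 1, 2, 3, 4, 5, 6}" by auto
  ultimately show ?thesis using that assms by blast
qed

lemma unknown_coord_add:
  assumes b: "b \<in> unknown_idx S" and U: "U \<in> carrier (unknowns_space S)" and V: "V \<in> carrier (unknowns_space S)"
  shows "unknown_coord b (U \<oplus>\<^bsub>unknowns_space S\<^esub> V) = unknown_coord b U + unknown_coord b V"
proof (rule unknown_idx_cases[OF b])
  fix k i a c assume kiac: "b = (k, i, a, c)" "k \<in> {0, 1, 2, 3, 4, 5, 6}" "(k, i, a, c) \<in> unknown_idx S"
  note D = unknowns_dims[OF V kiac(3)]
  show ?thesis
    using kiac(2) D unfolding kiac(1) unknowns_space_simps unknown_coord_def
    by (elim insertE) simp_all
qed

lemma unknown_coord_smult:
  assumes b: "b \<in> unknown_idx S" and U: "U \<in> carrier (unknowns_space S)"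
  shows "unknown_coord b (x \<odot>\<^bsub>unknowns_space S\<^esub> U) = x * unknown_coord b U"
proof (rule unknown_idx_cases[OF b])
  fix k i a c assume kiac: "b = (k, i, a, c)" "k \<in> {0, 1, 2, 3, 4, 5, 6}" "(k, i, a, c) \<in> unknown_idx S"
  note D = unknowns_dims[OF U kiac(3)]
  show ?thesis
    using kiac(2) D unfolding kiac(1) unknowns_space_simps unknown_coord_def
    by (elim insertE) simp_all
qed

lemma unknowns_space_closed:
  "U \<in> carrier (unknowns_space S) \<Longrightarrow> V \<in> carrier (unknowns_space S) \<Longrightarrow> U \<oplus>\<^bsub>unknowns_space S\<^esub> V \<in> carrier (unknowns_space S)"
  "U \<in> carrier (unknowns_space S) \<Longrightarrow> a \<odot>\<^bsub>unknowns_space S\<^esub> U \<in> carrier (unknowns_space S)"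
  "\<zero>\<^bsub>unknowns_space S\<^esub> \<in> carrier (unknowns_space S)"
  by (auto simp: unknowns_space_def sym_mats_closed PiE_def Pi_def)

lemma unknown_coord_zero:
  assumes b: "b \<in> unknown_idx S"
  shows "unknown_coord b \<zero>\<^bsub>unknowns_space S\<^esub> = 0"
proof (rule unknown_idx_cases[OF b])
  fix k i a c assume kiac: "b = (k, i, a, c)" "k \<in> {0, 1, 2, 3, 4, 5, 6}" "(k, i, a, c) \<in> unknown_idx S"
  note D = unknowns_dims[OF unknowns_space_closed(3) kiac(3)]
  show ?thesis
    using kiac(2) D unfolding kiac(1) unknowns_space_simps unknown_coord_def
    by (elim insertE) (simp_all split: if_splits)
qed

text \<open>The families are extensional functions, so outside the index range they agree by
  convention, and the listed entries determine the whole record.\<close>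

lemma unknown_coord_inj:
  assumes U: "U \<in> carrier (unknowns_space S)" and V: "V \<in> carrier (unknowns_space S)"
    and eq: "\<And>b. b \<in> unknown_idx S \<Longrightarrow> unknown_coord b U = unknown_coord b V"
  shows "U = V"
proof (rule unknowns.equality)
  note U' = unknowns_carrierD[OF U] and V' = unknowns_carrierD[OF V]
  have eq': "unknown_coord (k, i, a, b) U = unknown_coord (k, i, a, b) V"
    if "k < 7" "(i, a, b) \<in> unknown_family S k" for k i a b
    using that by (intro eq) (auto simp: unknown_idx_def)
  show "par_P1 U = par_P1 V"
    using eq'[of 0 0] by (intro sym_mats_eqI[OF U'(1) V'(1)]) (auto simp: unknown_family_def unknown_coord_def)
  show "par_P2 U = par_P2 V"
    using eq'[of 1 0] U'(2) V'(2) by (intro eq_matI) (auto simp: unknown_family_def unknown_coord_def)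
  show "par_P3 U = par_P3 V"
    using eq'[of 2 0] by (intro sym_mats_eqI[OF U'(3) V'(3)]) (auto simp: unknown_family_def unknown_coord_def)
  show "par_Q U = par_Q V"
  proof (rule PiE_ext[OF U'(4) V'(4)])
    fix i assume i: "i \<in> {1..num_del S}"
    show "par_Q U i = par_Q V i"
      using eq'[of 3 i] i by (intro sym_mats_eqI[OF PiE_mem[OF U'(4) i] PiE_mem[OF V'(4) i]])
        (auto simp: unknown_family_def unknown_coord_def)
  qed
  show "par_R U = par_R V"
  proof (rule PiE_ext[OF U'(5) V'(5)])
    fix i assume i: "i \<in> {1..num_del S}"
    show "par_R U i = par_R V i"
      using eq'[of 4 i] i by (intro sym_mats_eqI[OF PiE_mem[OF U'(5) i] PiE_mem[OF V'(5) i]])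
        (auto simp: unknown_family_def unknown_coord_def)
  qed
  show "par_K U = par_K V"
  proof (rule PiE_ext[OF U'(6) V'(6)])
    fix i assume i: "i \<in> {0..num_del S}"
    show "par_K U i = par_K V i"
      using eq'[of 5 i] i PiE_mem[OF U'(6) i] PiE_mem[OF V'(6) i]
      by (intro eq_matI) (auto simp: unknown_family_def unknown_coord_def)
  qed
  show "par_Kd U = par_Kd V"
  proof (rule PiE_ext[OF U'(7) V'(7)])
    fix i assume i: "i \<in> {1..num_del S}"
    show "par_Kd U i = par_Kd V i"
      using eq'[of 6 i] i PiE_mem[OF U'(7) i] PiE_mem[OF V'(7) i]
      by (intro eq_matI) (auto simp: unknown_family_def unknown_coord_def)
  qed
qed simp

lemma unknown_coord_surj: "\<exists>U \<in> carrier (unknowns_space S). \<forall>b \<in> unknown_idx S. unknown_coord b U = g b"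
proof
  define sm where "sm k i m = mat m m (\<lambda>(a, b). g (k, i, min a b, max a b))" for k i m :: nat
  define fm where "fm k i m l = mat m l (\<lambda>(a, b). g (k, i, a, b))" for k i m l :: nat
  define U where "U = \<lparr> par_P1 = sm 0 0 (dim_x S),
       par_P2 = fm 1 0 (dim_x S) (tot_f S * dim_x S),
       par_P3 = sm 2 0 (tot_f S * dim_x S),
       par_Q = (\<lambda>i \<in> {1..num_del S}. sm 3 i (dim_x S)),
       par_R = (\<lambda>i \<in> {1..num_del S}. sm 4 i (dim_x S)),
       par_K = (\<lambda>i \<in> {0..num_del S}. fm 5 i (dim_u S) (dim_x S)),
       par_Kd = (\<lambda>i \<in> {1..num_del S}. fm 6 i (dim_u S) (dim_g S i * dim_x S)) \<rparr>"
  have sm: "sm k i m \<in> sym_mats m" for k i m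
    unfolding sm_def using sym_mats_mat[of m "\<lambda>a b. g (k, i, a, b)"] by simp
  have fm: "fm k i m l \<in> carrier_mat m l" for k i m l by (simp add: fm_def)
  show "U \<in> carrier (unknowns_space S)"
    by (auto simp: U_def unknowns_space_def sm fm)
  show "\<forall>b \<in> unknown_idx S. unknown_coord b U = g b"
  proof
    fix b assume b: "b \<in> unknown_idx S"
    obtain k i a c where kiac: "b = (k, i, a, c)" by (cases b) auto
    note D = unknown_idxD[OF b[unfolded kiac]]
    have smi: "sm k i m $$ (a, c) = g (k, i, a, c)" if "(a, c) \<in> sym_idx m" for k i m
      using that by (auto simp: sm_def sym_idx_def min_def max_def)
    have fmi: "fm k i m l $$ (a, c) = g (k, i, a, c)" if "a < m" "c < l" for k i m l
      using that by (auto simp: fm_def)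
    have fam: "(i, a, c) \<in> unknown_family S k" using b by (auto simp: kiac unknown_idx_def)
    consider "k = 0" | "k = 1" | "k = 2" | "k = 3" | "k = 4" | "k = 5" | "k = 6" using D(1) by linarith
    then show "unknown_coord b U = g b"
      by cases (use D fam in \<open>auto simp: kiac unknown_coord_def unknown_family_def U_def smi fmi\<close>)
  qed
qed

lemma unknowns_space_dim:
  shows "vectorspace class_ring (unknowns_space S)"
    and "vectorspace.fin_dim class_ring (unknowns_space S)"
    and "real (vectorspace.dim class_ring (unknowns_space S)) =
        (0.5 * real (tot_f S) ^ 2 + real (tot_f S) + real (num_del S) + 0.5) * real (dim_x S) ^ 2 +
        (0.5 * real (tot_f S) + 0.5 + real (num_del S) + real (beta S) * real (dim_u S)) * real (dim_x S)"
proof -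
  show V: "vectorspace class_ring (unknowns_space S)"
    by (rule vectorspace_by_coordinates[where c=unknown_coord and B="unknown_idx S"])
      (blast intro: unknowns_space_closed unknown_coord_add unknown_coord_smult unknown_coord_zero unknown_coord_inj)+
  have dim: "vectorspace.fin_dim class_ring (unknowns_space S)"
      "vectorspace.dim class_ring (unknowns_space S) = card (unknown_idx S)"
    by (rule fin_dim_dim_by_coordinates[where c=unknown_coord, OF V finite_unknown_idx unknown_coord_add
      unknown_coord_smult unknown_coord_inj unknown_coord_surj]; assumption)+
  show "vectorspace.fin_dim class_ring (unknowns_space S)" by (rule dim(1))
  show "real (vectorspace.dim class_ring (unknowns_space S)) =
        (0.5 * real (tot_f S) ^ 2 + real (tot_f S) + real (num_del S) + 0.5) * real (dim_x S) ^ 2 +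
        (0.5 * real (tot_f S) + 0.5 + real (num_del S) + real (beta S) * real (dim_u S)) * real (dim_x S)"
    using card_unknown_idx[of S] unfolding dim(2) .
qed

section \<open>Orthonormal coefficients of the history\<close>

text \<open>The integral of \<open>(E \<otimes> I) y\<close>: the tensor product with the identity
  pairs every component of \<open>E\<close> with every component of \<open>y\<close>.\<close>

definition intvec :: "real set \<Rightarrow> nat \<Rightarrow> nat \<Rightarrow> (real \<Rightarrow> real vec) \<Rightarrow> (real \<Rightarrow> real vec) \<Rightarrow> real vec" where
  "intvec X k n E y = kvec k n (\<lambda>a c. \<integral>s. E s $ a * y s $ c \<partial>lebesgue_on X)"

lemma dim_intvec [simp]: "dim_vec (intvec X k n E y) = k * n"
  by (simp add: intvec_def)

lemma intvec_carrier [simp]: "intvec X k n E y \<in> carrier_vec (k * n)"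
  by (simp add: intvec_def)

lemma intvec_cong:
  assumes "\<And>s. s \<in> X \<Longrightarrow> E s = E' s" "\<And>s. s \<in> X \<Longrightarrow> y s = y' s"
  shows "intvec X k n E y = intvec X k n E' y'"
  unfolding intvec_def using assms
  by (intro kvec_cong Bochner_Integration.integral_cong refl) simp

lemma intvec_mult_mat:
  assumes A: "A \<in> carrier_mat k' k" and E: "L2_vec X k E" and y: "\<And>c. c < n \<Longrightarrow> L2_on X (\<lambda>s. y s $ c)"
  shows "intvec X k' n (\<lambda>s. A *\<^sub>v E s) y = (A \<otimes>\<^sub>k 1\<^sub>m n) *\<^sub>v intvec X k n E y"
  unfolding intvec_def kron_one_mult_kvec[OF A]
  by (rule kvec_cong) (rule integral_mult_mat_vec[OF A E y])

lemma intvec_add: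
  assumes E: "L2_vec X k E" and E': "L2_vec X k E'" and y: "\<And>c. c < n \<Longrightarrow> L2_on X (\<lambda>s. y s $ c)"
  shows "intvec X k n (\<lambda>s. E s + E' s) y = intvec X k n E y + intvec X k n E' y"
proof (rule eq_vecI)
  fix j assume "j < dim_vec (intvec X k n E y + intvec X k n E' y)"
  then have j: "j < k * n" by simp
  let ?a = "j div n" and ?c = "j mod n"
  have ac: "?a < k" "?c < n" using div_less_mult[OF j] mod_less_mult[OF j] by auto
  have "(\<integral>s. (E s + E' s) $ ?a * y s $ ?c \<partial>lebesgue_on X) = (\<integral>s. E s $ ?a * y s $ ?c + E' s $ ?a * y s $ ?c \<partial>lebesgue_on X)"
    using ac by (intro Bochner_Integration.integral_cong refl) (auto simp: L2_vec_dim[OF E'] distrib_right)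
  also have "\<dots> = (\<integral>s. E s $ ?a * y s $ ?c \<partial>lebesgue_on X) + (\<integral>s. E' s $ ?a * y s $ ?c \<partial>lebesgue_on X)"
    using E E' y ac by (intro Bochner_Integration.integral_add L2_on_mult_integrable) (auto simp: L2_vec_def)
  finally show "intvec X k n (\<lambda>s. E s + E' s) y $ j = (intvec X k n E y + intvec X k n E' y) $ j"
    using j by (simp add: intvec_def kvec_def)
qed simp

text \<open>A test function and its derivative are continuous, hence square-integrable on the
  interval, which makes every product integrable. Used for the rows of the inverse Cholesky factor
  of \<open>gram_F\<close>.\<close>

lemma weak_deriv_sum:
  assumes I: "finite I" and f: "\<And>i. i \<in> I \<Longrightarrow> L2_on {a..b} (f i)" and g: "\<And>i. i \<in> I \<Longrightarrow> L2_on {a..b} (g i)"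
    and wd: "\<And>i. i \<in> I \<Longrightarrow> weak_deriv {a..b} (f i) (g i)"
  shows "weak_deriv {a..b} (\<lambda>s. \<Sum>i\<in>I. c i * f i s) (\<lambda>s. \<Sum>i\<in>I. c i * g i s)"
  unfolding weak_deriv_def
proof (intro allI impI, elim conjE)
  fix \<eta> \<eta>' assume \<eta>: "\<forall>s. (\<eta> has_real_derivative \<eta>' s) (at s)" "continuous_on UNIV \<eta>'"
    "\<exists>K. compact K \<and> K \<subseteq> interior {a..b} \<and> (\<forall>s. s \<notin> K \<longrightarrow> \<eta> s = 0)"
  have L: "L2_on {a..b} \<eta>'" "L2_on {a..b} \<eta>"
    using \<eta>(1) by (auto intro!: L2_on_continuous continuous_on_subset[OF \<eta>(2)])
      (meson DERIV_isCont continuous_at_imp_continuous_on)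
  have lin: "(\<integral>s. (\<Sum>i\<in>I. c i * h i s) * \<zeta> s \<partial>lebesgue_on {a..b}) = (\<Sum>i\<in>I. c i * (\<integral>s. h i s * \<zeta> s \<partial>lebesgue_on {a..b}))"
    if h: "\<And>i. i \<in> I \<Longrightarrow> L2_on {a..b} (h i)" and z: "L2_on {a..b} \<zeta>" for h \<zeta>
  proof -
    have "(\<integral>s. (\<Sum>i\<in>I. c i * h i s) * \<zeta> s \<partial>lebesgue_on {a..b}) = (\<integral>s. (\<Sum>i\<in>I. c i * (h i s * \<zeta> s)) \<partial>lebesgue_on {a..b})"
      by (simp add: sum_distrib_right mult.assoc)
    also have "\<dots> = (\<Sum>i\<in>I. \<integral>s. c i * (h i s * \<zeta> s) \<partial>lebesgue_on {a..b})"
      using h z by (intro Bochner_Integration.integral_sum integrable_mult_right L2_on_mult_integrable) auto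
    finally show ?thesis by simp
  qed
  have "(\<integral>s. f i s * \<eta>' s \<partial>lebesgue_on {a..b}) = - (\<integral>s. g i s * \<eta> s \<partial>lebesgue_on {a..b})" if "i \<in> I" for i
    using wd[OF that] \<eta> unfolding weak_deriv_def by blast
  then show "(\<integral>s. (\<Sum>i\<in>I. c i * f i s) * \<eta>' s \<partial>lebesgue_on {a..b}) = - (\<integral>s. (\<Sum>i\<in>I. c i * g i s) * \<eta> s \<partial>lebesgue_on {a..b})"
    by (simp add: lin f g L sum_negf)
qed

text \<open>Holds what does not depend on the unknowns, so that the functional and its derivative
  are available for all weights.\<close>

locale delay_system =
  fixes S :: system
  assumes plant: "plant_data S" and kernel: "kernel_data S"
begin

abbreviation "n \<equiv> dim_x S"
abbreviation "nu \<equiv> num_del S"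
abbreviation "r \<equiv> del S"
abbreviation "J \<equiv> full_ivl S"
abbreviation "ivl \<equiv> del_ivl S"
abbreviation "idx \<equiv> [1..<Suc nu]"

lemma nu_pos: "nu > 0" and r0: "r 0 = 0"
  using plant by (simp_all add: plant_data_def)

lemma r_less: "i \<in> {1..nu} \<Longrightarrow> r (i - 1) < r i"
  using plant by (simp add: plant_data_def)

lemma r_mono: "i \<le> j \<Longrightarrow> j \<le> nu \<Longrightarrow> r i \<le> r j"
proof (induction j rule: dec_induct)
  case (step k)
  then show ?case using r_less[of "Suc k"] by simp
qed simp

lemma r_nonneg: "i \<le> nu \<Longrightarrow> 0 \<le> r i"
  using r_mono[of 0 i] r0 by simp

lemma r_nu_pos: "0 < r nu"
  using r_less[of 1] r_mono[of 1 nu] nu_pos r0 by simp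

lemma ivl_eq: "ivl i = {- r i .. - r (i - 1)}"
  by (simp add: del_ivl_def)

lemma ivl_subset: "i \<in> {1..nu} \<Longrightarrow> ivl i \<subseteq> J"
  using r_mono[of i nu] r_nonneg[of "i - 1"] by (auto simp: del_ivl_def full_ivl_def)

lemma minus_r_in_J: "i \<le> nu \<Longrightarrow> - r i \<in> J"
  using r_mono[of i nu] r_nonneg[of i] by (auto simp: full_ivl_def)

lemma zero_in_J: "0 \<in> J"
  using minus_r_in_J[of 0] r0 by simp

lemma kernelD:
  assumes "i \<in> {1..nu}"
  shows "dim_f S i > 0" "W12_vec (ivl i) (dim_f S i) (fun_f S i)"
    "L2_vec (ivl i) (dim_vphi S i) (fun_vphi S i)" "L2_vec (ivl i) (dim_phi S i) (fun_phi S i)"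
    "mat_M S i \<in> carrier_mat (dim_f S i) (dim_h S i)"
    "weak_deriv_vec (ivl i) (dim_f S i) (fun_f S i) (\<lambda>\<tau>. mat_M S i *\<^sub>v fun_h S i \<tau>)"
    "coef_A S i \<in> carrier_mat n (dim_g S i * n)" "coef_C S i \<in> carrier_mat (dim_z S) (dim_g S i * n)"
    "AE \<tau> in lebesgue_on (ivl i). ker_A S i \<tau> = dist_kernel S (coef_A S) i \<tau>"
    "AE \<tau> in lebesgue_on (ivl i). ker_C S i \<tau> = dist_kernel S (coef_C S) i \<tau>"
    "cholesky_factor (chol_F S i) (gram_F S i)" "cholesky_factor (chol_H S i) (gram_H S i)"
    "cholesky_factor (chol_E S i) (gram_E S i)"
  using kernel[unfolded kernel_data_def, rule_format, OF assms] by blast+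

lemma L2_f: "i \<in> {1..nu} \<Longrightarrow> L2_vec (ivl i) (dim_f S i) (fun_f S i)"
  using kernelD(2) by (simp add: W12_vec_def)

lemma L2_h: "i \<in> {1..nu} \<Longrightarrow> L2_vec (ivl i) (dim_h S i) (fun_h S i)"
  using L2_vec_append[OF kernelD(3) L2_f] unfolding fun_h_def dim_h_def by (simp add: add.commute)

lemma chol_F:
  assumes "i \<in> {1..nu}"
  shows "chol_F S i \<in> carrier_mat (dim_f S i) (dim_f S i)" "det (chol_F S i) \<noteq> 0"
    "minv (chol_F S i) \<in> carrier_mat (dim_f S i) (dim_f S i)"
    "minv (chol_F S i) * gram_F S i * transpose_mat (minv (chol_F S i)) = 1\<^sub>m (dim_f S i)"
  using cholesky_factor_props[OF kernelD(11)[OF assms], of "dim_f S i"] minv_props[of "chol_F S i" "dim_f S i"]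
  by (simp_all add: gram_F_def)

lemma chol_H:
  assumes "i \<in> {1..nu}"
  shows "chol_H S i \<in> carrier_mat (dim_h S i) (dim_h S i)" "det (chol_H S i) \<noteq> 0"
    "minv (chol_H S i) \<in> carrier_mat (dim_h S i) (dim_h S i)"
    "minv (chol_H S i) * gram_H S i * transpose_mat (minv (chol_H S i)) = 1\<^sub>m (dim_h S i)"
    "chol_H S i * minv (chol_H S i) = 1\<^sub>m (dim_h S i)"
    "minv (gram_H S i) \<in> carrier_mat (dim_h S i) (dim_h S i)"
    "minv (gram_H S i) * gram_H S i = 1\<^sub>m (dim_h S i)"
  using cholesky_factor_props[OF kernelD(12)[OF assms], of "dim_h S i"] minv_props[of "chol_H S i" "dim_h S i"]
    minv_props[of "gram_H S i" "dim_h S i"]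
  by (simp_all add: gram_H_def)

lemma chol_E:
  assumes "i \<in> {1..nu}"
  shows "chol_E S i \<in> carrier_mat (dim_phi S i) (dim_phi S i)" "det (chol_E S i) \<noteq> 0"
    "minv (chol_E S i) \<in> carrier_mat (dim_phi S i) (dim_phi S i)"
    "minv (chol_E S i) * gram_E S i * transpose_mat (minv (chol_E S i)) = 1\<^sub>m (dim_phi S i)"
    "chol_E S i * minv (chol_E S i) = 1\<^sub>m (dim_phi S i)"
  using cholesky_factor_props[OF kernelD(13)[OF assms], of "dim_phi S i"] minv_props[of "chol_E S i" "dim_phi S i"]
  by (simp_all add: gram_E_def)

text \<open>Like \<open>orth_h\<close> and \<open>orth_e\<close> below, an orthonormal family in the
  square-integrable functions on \<open>ivl i\<close>. The families \<open>orth_h\<close> and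
  \<open>orth_e\<close> are moreover orthogonal to each other, whereas \<open>orth_f\<close> lies in
  the span of \<open>orth_h\<close>.\<close>

definition orth_f :: "nat \<Rightarrow> real \<Rightarrow> real vec" where
  "orth_f i \<tau> = minv (chol_F S i) *\<^sub>v fun_f S i \<tau>"

definition orth_h :: "nat \<Rightarrow> real \<Rightarrow> real vec" where
  "orth_h i \<tau> = minv (chol_H S i) *\<^sub>v fun_h S i \<tau>"

definition orth_e :: "nat \<Rightarrow> real \<Rightarrow> real vec" where
  "orth_e i \<tau> = minv (chol_E S i) *\<^sub>v fun_eps S i \<tau>"

text \<open>Coefficients of the orthogonal projection of \<open>fun_phi\<close> onto the span of
  \<open>fun_h\<close>; the residual is \<open>fun_eps\<close>.\<close>

abbreviation "proj i \<equiv> cross_gram S i * minv (gram_H S i)"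

lemma proj_carrier: "i \<in> {1..nu} \<Longrightarrow> proj i \<in> carrier_mat (dim_phi S i) (dim_h S i)"
  unfolding cross_gram_def by (rule mult_carrier_mat[OF gram_carrier chol_H(6)])

lemma L2_eps: "i \<in> {1..nu} \<Longrightarrow> L2_vec (ivl i) (dim_phi S i) (fun_eps S i)"
  unfolding fun_eps_def by (intro L2_vec_diff L2_vec_mult_mat[OF proj_carrier] L2_h kernelD)

lemma L2_orth_f: "i \<in> {1..nu} \<Longrightarrow> L2_vec (ivl i) (dim_f S i) (orth_f i)"
  unfolding orth_f_def by (intro L2_vec_mult_mat[OF chol_F(3)] L2_f)

lemma L2_orth_h: "i \<in> {1..nu} \<Longrightarrow> L2_vec (ivl i) (dim_h S i) (orth_h i)"
  unfolding orth_h_def by (intro L2_vec_mult_mat[OF chol_H(3)] L2_h)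

lemma L2_orth_e: "i \<in> {1..nu} \<Longrightarrow> L2_vec (ivl i) (dim_phi S i) (orth_e i)"
  unfolding orth_e_def by (intro L2_vec_mult_mat[OF chol_E(3)] L2_eps)

lemma gram_orth_f: "i \<in> {1..nu} \<Longrightarrow> gram (ivl i) (dim_f S i) (dim_f S i) (orth_f i) (orth_f i) = 1\<^sub>m (dim_f S i)"
  unfolding orth_f_def using gram_mult_mat[OF chol_F(3) chol_F(3) L2_f L2_f, of i] chol_F(4)
  by (simp add: gram_F_def)

lemma gram_orth_h: "i \<in> {1..nu} \<Longrightarrow> gram (ivl i) (dim_h S i) (dim_h S i) (orth_h i) (orth_h i) = 1\<^sub>m (dim_h S i)"
  unfolding orth_h_def using gram_mult_mat[OF chol_H(3) chol_H(3) L2_h L2_h, of i] chol_H(4)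
  by (simp add: gram_H_def)

lemma gram_orth_e: "i \<in> {1..nu} \<Longrightarrow> gram (ivl i) (dim_phi S i) (dim_phi S i) (orth_e i) (orth_e i) = 1\<^sub>m (dim_phi S i)"
  unfolding orth_e_def using gram_mult_mat[OF chol_E(3) chol_E(3) L2_eps L2_eps, of i] chol_E(4)
  by (simp add: gram_E_def)

text \<open>These are the normal equations of the least squares projection: multiplying
  \<open>proj i\<close> by the Gram matrix of \<open>fun_h\<close> gives back the cross Gram
  matrix.\<close>

lemma gram_eps_h:
  assumes i: "i \<in> {1..nu}"
  shows "gram (ivl i) (dim_phi S i) (dim_h S i) (fun_eps S i) (fun_h S i) = 0\<^sub>m (dim_phi S i) (dim_h S i)"
proof -
  let ?G = "gram_H S i"
  have Gc: "?G \<in> carrier_mat (dim_h S i) (dim_h S i)" by (simp add: gram_H_def)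
  have cg: "cross_gram S i \<in> carrier_mat (dim_phi S i) (dim_h S i)" by (simp add: cross_gram_def)
  \<comment> \<open>The identity matrix is inserted so that the product rule for Gram matrices
    applies to both arguments.\<close>
  have one: "fun_h S i \<tau> = 1\<^sub>m (dim_h S i) *\<^sub>v fun_h S i \<tau>" if "\<tau> \<in> ivl i" for \<tau>
    using L2_h[OF i] that by (simp add: L2_vec_def)
  have "gram (ivl i) (dim_phi S i) (dim_h S i) (\<lambda>\<tau>. proj i *\<^sub>v fun_h S i \<tau>) (fun_h S i)
     = gram (ivl i) (dim_phi S i) (dim_h S i) (\<lambda>\<tau>. proj i *\<^sub>v fun_h S i \<tau>) (\<lambda>\<tau>. 1\<^sub>m (dim_h S i) *\<^sub>v fun_h S i \<tau>)"
    using one by (intro gram_cong) auto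
  also have "\<dots> = proj i * ?G * transpose_mat (1\<^sub>m (dim_h S i))"
    by (rule gram_mult_mat[OF proj_carrier[OF i] one_carrier_mat L2_h[OF i] L2_h[OF i], folded gram_H_def])
  also have "\<dots> = cross_gram S i * (minv ?G * ?G)"
    using proj_carrier[OF i] Gc chol_H(6)[OF i] cg by (simp add: assoc_mult_mat[of _ "dim_phi S i" "dim_h S i" _ "dim_h S i" _ "dim_h S i"])
  also have "\<dots> = cross_gram S i" using chol_H(7)[OF i] cg by simp
  finally have "gram (ivl i) (dim_phi S i) (dim_h S i) (\<lambda>\<tau>. proj i *\<^sub>v fun_h S i \<tau>) (fun_h S i) = cross_gram S i" .
  then show ?thesis
    unfolding fun_eps_def gram_diff_left[OF kernelD(4)[OF i] L2_vec_mult_mat[OF proj_carrier[OF i] L2_h[OF i]] L2_h[OF i]]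
    by (simp add: cross_gram_def)
qed

lemma gram_orth_e_h:
  assumes i: "i \<in> {1..nu}"
  shows "gram (ivl i) (dim_phi S i) (dim_h S i) (orth_e i) (orth_h i) = 0\<^sub>m (dim_phi S i) (dim_h S i)"
  unfolding orth_e_def orth_h_def gram_mult_mat[OF chol_E(3)[OF i] chol_H(3)[OF i] L2_eps[OF i] L2_h[OF i]] gram_eps_h[OF i]
  using chol_E(3)[OF i] chol_H(3)[OF i] by simp

lemma zero_mult_vec: "v \<in> carrier_vec c \<Longrightarrow> 0\<^sub>m k c *\<^sub>v v = (0\<^sub>v k :: real vec)"
  by (intro eq_vecI) (auto simp: scalar_prod_def)

text \<open>The Cholesky factors recover \<open>fun_h\<close> and \<open>fun_eps\<close> from their
  normalised versions, and \<open>fun_phi\<close> is its projection plus \<open>fun_eps\<close>. So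
  the two matrices turn coefficients with respect to \<open>fun_g\<close> into coefficients with
  respect to the two orthonormal families.\<close>

lemma fun_g_decomposition:
  assumes i: "i \<in> {1..nu}" and t: "\<tau> \<in> ivl i"
  shows "fun_g S i \<tau> = mat_T S i *\<^sub>v orth_h i \<tau> + mat_Tt S i *\<^sub>v orth_e i \<tau>"
proof -
  let ?h = "fun_h S i \<tau>" and ?e = "fun_eps S i \<tau>" and ?dh = "dim_h S i" and ?dp = "dim_phi S i"
  have h: "?h \<in> carrier_vec ?dh" using L2_h[OF i] t by (simp add: L2_vec_def)
  have p: "fun_phi S i \<tau> \<in> carrier_vec ?dp" using kernelD(4)[OF i] t by (simp add: L2_vec_def)
  have e: "?e \<in> carrier_vec ?dp" using L2_eps[OF i] t by (simp add: L2_vec_def)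
  have Lh: "chol_H S i *\<^sub>v orth_h i \<tau> = ?h"
    unfolding orth_h_def using chol_H[OF i] h
    by (simp add: assoc_mult_mat_vec[of _ ?dh ?dh _ ?dh, symmetric])
  have Le: "chol_E S i *\<^sub>v orth_e i \<tau> = ?e"
    unfolding orth_e_def using chol_E[OF i] e
    by (simp add: assoc_mult_mat_vec[of _ ?dp ?dp _ ?dp, symmetric])
  have oh: "orth_h i \<tau> \<in> carrier_vec ?dh" using L2_orth_h[OF i] t by (simp add: L2_vec_def)
  have oe: "orth_e i \<tau> \<in> carrier_vec ?dp" using L2_orth_e[OF i] t by (simp add: L2_vec_def)
  have "mat_T S i *\<^sub>v orth_h i \<tau> = (proj i @\<^sub>r 1\<^sub>m ?dh) *\<^sub>v ?h"
    unfolding mat_T_def Lh[symmetric]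
    by (rule assoc_mult_mat_vec[OF carrier_append_rows[OF proj_carrier[OF i] one_carrier_mat] chol_H(1)[OF i] oh])
  also have "\<dots> = (proj i *\<^sub>v ?h) @\<^sub>v ?h"
    using mat_mult_append[OF proj_carrier[OF i] one_carrier_mat h] h by simp
  finally have T: "mat_T S i *\<^sub>v orth_h i \<tau> = (proj i *\<^sub>v ?h) @\<^sub>v ?h" .
  have "mat_Tt S i *\<^sub>v orth_e i \<tau> = (1\<^sub>m ?dp @\<^sub>r 0\<^sub>m ?dh ?dp) *\<^sub>v ?e"
    unfolding mat_Tt_def Le[symmetric]
    by (rule assoc_mult_mat_vec[OF carrier_append_rows[OF one_carrier_mat zero_carrier_mat] chol_E(1)[OF i] oe])
  also have "\<dots> = ?e @\<^sub>v 0\<^sub>v ?dh"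
    using mat_mult_append[OF one_carrier_mat zero_carrier_mat e, of ?dh] e by (simp add: zero_mult_vec)
  finally have "mat_Tt S i *\<^sub>v orth_e i \<tau> = ?e @\<^sub>v 0\<^sub>v ?dh" .
  then show ?thesis unfolding T fun_g_def fun_eps_def
    using h p proj_carrier[OF i] by (intro eq_vecI) auto
qed

lemma mat_T_carrier: "i \<in> {1..nu} \<Longrightarrow> mat_T S i \<in> carrier_mat (dim_g S i) (dim_h S i)"
  using mult_carrier_mat[OF carrier_append_rows[OF proj_carrier one_carrier_mat] chol_H(1)]
  unfolding mat_T_def dim_g_def dim_h_def by (simp add: add.commute)

lemma mat_Tt_carrier: "i \<in> {1..nu} \<Longrightarrow> mat_Tt S i \<in> carrier_mat (dim_g S i) (dim_phi S i)"
  using mult_carrier_mat[OF carrier_append_rows[OF one_carrier_mat zero_carrier_mat[of "dim_h S i"]] chol_E(1)]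
  unfolding mat_Tt_def dim_g_def dim_h_def by (simp add: add.commute)

lemma L2_g: "i \<in> {1..nu} \<Longrightarrow> L2_vec (ivl i) (dim_g S i) (fun_g S i)"
  using L2_vec_append[OF kernelD(4) L2_h] unfolding fun_g_def dim_g_def dim_h_def by (simp add: add.commute)

lemma intvec_g:
  assumes i: "i \<in> {1..nu}" and y: "\<And>c. c < n \<Longrightarrow> L2_on (ivl i) (\<lambda>s. y s $ c)"
  shows "intvec (ivl i) (dim_g S i) n (fun_g S i) y =
    (mat_T S i \<otimes>\<^sub>k 1\<^sub>m n) *\<^sub>v intvec (ivl i) (dim_h S i) n (orth_h i) y +
    (mat_Tt S i \<otimes>\<^sub>k 1\<^sub>m n) *\<^sub>v intvec (ivl i) (dim_phi S i) n (orth_e i) y"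
proof -
  note T = mat_T_carrier[OF i] mat_Tt_carrier[OF i]
  have "intvec (ivl i) (dim_g S i) n (fun_g S i) y =
    intvec (ivl i) (dim_g S i) n (\<lambda>\<tau>. mat_T S i *\<^sub>v orth_h i \<tau> + mat_Tt S i *\<^sub>v orth_e i \<tau>) y"
    by (rule intvec_cong) (use fun_g_decomposition[OF i] in auto)
  also have "\<dots> = intvec (ivl i) (dim_g S i) n (\<lambda>\<tau>. mat_T S i *\<^sub>v orth_h i \<tau>) y +
      intvec (ivl i) (dim_g S i) n (\<lambda>\<tau>. mat_Tt S i *\<^sub>v orth_e i \<tau>) y"
    by (intro intvec_add L2_vec_mult_mat[OF T(1)] L2_vec_mult_mat[OF T(2)] L2_orth_h[OF i] L2_orth_e[OF i] y)
  finally show ?thesis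
    by (simp add: intvec_mult_mat[OF T(1) L2_orth_h[OF i] y] intvec_mult_mat[OF T(2) L2_orth_e[OF i] y])
qed

end

section \<open>The closed loop as block rows applied to the history\<close>

lemma sum_list_map_upt: "(\<Sum>i\<leftarrow>[a..<Suc b]. f i) = (\<Sum>i = a..b. f i)" for f :: "nat \<Rightarrow> 'a :: comm_monoid_add"
  by (simp add: interv_sum_list_conv_sum_set_nat atLeastLessThanSuc_atLeastAtMost del: upt_Suc)

lemma list_all2_mapI: "(\<And>i. i \<in> set is \<Longrightarrow> P (f i) (g i)) \<Longrightarrow> list_all2 P (map f is) (map g is)"
  by (induction "is") auto

lemma list_all2_dims:
  "list_all2 (\<lambda>X u. dim_row X = k \<and> dim_col X = dim_vec u) Xs us \<Longrightarrow>
   sum_list (map dim_col Xs) = sum_list (map dim_vec us) \<and> (\<forall>Z\<in>set Xs. dim_row Z = k)"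
  by (induction rule: list_all2_induct) auto

lemma integral_double_sum:
  fixes C :: "nat \<Rightarrow> nat \<Rightarrow> real"
  assumes h: "\<And>a c. a < k \<Longrightarrow> c < n \<Longrightarrow> integrable M (h a c)"
  shows "(\<integral>s. (\<Sum>a<k. \<Sum>c<n. C a c * h a c s) \<partial>M) = (\<Sum>a<k. \<Sum>c<n. C a c * (\<integral>s. h a c s \<partial>M))"
proof -
  have "(\<integral>s. (\<Sum>a<k. \<Sum>c<n. C a c * h a c s) \<partial>M) = (\<Sum>a<k. \<integral>s. (\<Sum>c<n. C a c * h a c s) \<partial>M)"
    using h by (intro Bochner_Integration.integral_sum Bochner_Integration.integrable_sum integrable_mult_right) auto
  also have "\<dots> = (\<Sum>a<k. \<Sum>c<n. \<integral>s. C a c * h a c s \<partial>M)"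
    using h by (intro sum.cong refl Bochner_Integration.integral_sum integrable_mult_right) auto
  finally show ?thesis by simp
qed

lemma dist_kernel_mult_index:
  assumes X: "X i \<in> carrier_mat k (dim_g S i * dim_x S)" and g: "fun_g S i \<tau> \<in> carrier_vec (dim_g S i)"
    and y: "y \<in> carrier_vec (dim_x S)" and j: "j < k"
  shows "(dist_kernel S X i \<tau> *\<^sub>v y) $ j =
    (\<Sum>a<dim_g S i. \<Sum>c<dim_x S. X i $$ (j, a * dim_x S + c) * (fun_g S i \<tau> $ a * y $ c))"
proof -
  let ?n = "dim_x S" and ?k = "dim_g S i"
  have cm: "col_mat (fun_g S i \<tau>) \<in> carrier_mat ?k 1" using g mat_of_cols_carrier(1)[of "dim_g S i" "[fun_g S i \<tau>]"] by (simp add: col_mat_def)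
  have K: "col_mat (fun_g S i \<tau>) \<otimes>\<^sub>k 1\<^sub>m ?n \<in> carrier_mat (?k * ?n) ?n"
    using kron_carrier[OF cm one_carrier_mat[of ?n]] by simp
  have "dist_kernel S X i \<tau> *\<^sub>v y = X i *\<^sub>v ((col_mat (fun_g S i \<tau>) \<otimes>\<^sub>k 1\<^sub>m ?n) *\<^sub>v y)"
    unfolding dist_kernel_def by (rule assoc_mult_mat_vec[OF X K y])
  also have "(col_mat (fun_g S i \<tau>) \<otimes>\<^sub>k 1\<^sub>m ?n) *\<^sub>v y = kvec ?k ?n (\<lambda>a c. fun_g S i \<tau> $ a * y $ c)"
    unfolding kron_one_column_mult_vec[OF cm y]
    by (rule kvec_cong) (use g in \<open>auto simp: col_mat_def mat_of_cols_def\<close>)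
  also have "(X i *\<^sub>v \<dots>) $ j = (\<Sum>l<?k * ?n. X i $$ (j, l) * kvec ?k ?n (\<lambda>a c. fun_g S i \<tau> $ a * y $ c) $ l)"
    using X j by (simp add: scalar_prod_def atLeast0LessThan)
  finally show ?thesis by (simp add: sum_mult_nat kvec_index)
qed

context delay_system
begin

text \<open>Membership in \<open>C_space\<close> without extensionality, so that the window of a
  trajectory at time \<open>t\<close> qualifies without being restricted to
  \<open>J\<close>.\<close>

definition cont_seg :: "(real \<Rightarrow> real vec) \<Rightarrow> bool" where
  "cont_seg y \<longleftrightarrow> (\<forall>\<theta>\<in>J. y \<theta> \<in> carrier_vec n) \<and> (\<forall>c<n. continuous_on J (\<lambda>\<theta>. y \<theta> $ c))"

lemma cont_seg_L2: "cont_seg y \<Longrightarrow> i \<in> {1..nu} \<Longrightarrow> c < n \<Longrightarrow> L2_on (ivl i) (\<lambda>s. y s $ c)"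
  using ivl_subset[of i] unfolding cont_seg_def ivl_eq by (auto intro!: L2_on_continuous intro: continuous_on_subset)

text \<open>Measurability is recorded as well: the kernels of the plant agree with these only almost
  everywhere, and the comparison of the integrals asks for it.\<close>

lemma dist_kernel_integral:
  assumes i: "i \<in> {1..nu}" and X: "X i \<in> carrier_mat k (dim_g S i * n)" and y: "cont_seg y" and j: "j < k"
  shows "(\<integral>\<tau>. (dist_kernel S X i \<tau> *\<^sub>v y \<tau>) $ j \<partial>lebesgue_on (ivl i)) = (X i *\<^sub>v intvec (ivl i) (dim_g S i) n (fun_g S i) y) $ j" (is ?int)
    and "(\<lambda>\<tau>. (dist_kernel S X i \<tau> *\<^sub>v y \<tau>) $ j) \<in> borel_measurable (lebesgue_on (ivl i))" (is ?meas)
proof -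
  let ?f = "\<lambda>\<tau>. \<Sum>a<dim_g S i. \<Sum>c<n. X i $$ (j, a * n + c) * (fun_g S i \<tau> $ a * y \<tau> $ c)"
  have eq: "(dist_kernel S X i \<tau> *\<^sub>v y \<tau>) $ j = ?f \<tau>" if "\<tau> \<in> ivl i" for \<tau>
    using L2_g[OF i] that ivl_subset[OF i] y j X
    by (intro dist_kernel_mult_index) (auto simp: L2_vec_def cont_seg_def)
  have int: "integrable (lebesgue_on (ivl i)) (\<lambda>\<tau>. fun_g S i \<tau> $ a * y \<tau> $ c)" if "a < dim_g S i" "c < n" for a c
    using L2_g[OF i] cont_seg_L2[OF y i] that by (intro L2_on_mult_integrable) (auto simp: L2_vec_def)
  have "(\<integral>\<tau>. (dist_kernel S X i \<tau> *\<^sub>v y \<tau>) $ j \<partial>lebesgue_on (ivl i)) = (\<integral>\<tau>. ?f \<tau> \<partial>lebesgue_on (ivl i))"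
    by (rule Bochner_Integration.integral_cong) (use eq in auto)
  also have "\<dots> = (\<Sum>a<dim_g S i. \<Sum>c<n. X i $$ (j, a * n + c) * (\<integral>\<tau>. fun_g S i \<tau> $ a * y \<tau> $ c \<partial>lebesgue_on (ivl i)))"
    by (rule integral_double_sum[OF int])
  also have "\<dots> = (X i *\<^sub>v intvec (ivl i) (dim_g S i) n (fun_g S i) y) $ j"
    using X j by (simp add: scalar_prod_def atLeast0LessThan intvec_def sum_mult_nat kvec_index)
  finally show ?int .
  have "?f \<in> borel_measurable (lebesgue_on (ivl i))"
    by (intro borel_measurable_sum borel_measurable_times[OF borel_measurable_const] borel_measurable_integrable int) auto
  then show ?meas using eq by (subst measurable_cong[of _ _ ?f]) auto
qed

text \<open>The blocks of the vector of delayed states, coefficients and disturbance, in the order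
  of the columns of \<open>big_row\<close>.\<close>

definition hist :: "(real \<Rightarrow> real vec) \<Rightarrow> real vec \<Rightarrow> real vec list" where
  "hist y w = map (\<lambda>i. y (- r i)) [0..<Suc nu] @
     map (\<lambda>i. intvec (ivl i) (dim_h S i) n (orth_h i) y) idx @
     map (\<lambda>i. intvec (ivl i) (dim_phi S i) n (orth_e i) y) idx @ [w]"

lemma cont_segD: "cont_seg y \<Longrightarrow> \<theta> \<in> J \<Longrightarrow> y \<theta> \<in> carrier_vec n"
  by (simp add: cont_seg_def)

text \<open>The two groups of coefficient columns recombine: by \<open>intvec_g\<close> they amount
  to \<open>Y i\<close> applied to the integral of the history against \<open>fun_g\<close>.\<close>

lemma big_row_carrier:
  assumes X: "\<And>i. i \<le> nu \<Longrightarrow> X i \<in> carrier_mat k n"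
    and Y: "\<And>i. i \<in> {1..nu} \<Longrightarrow> Y i \<in> carrier_mat k (dim_g S i * n)" and D: "D \<in> carrier_mat k q"
    and y: "cont_seg y" and w: "w \<in> carrier_vec q"
  shows "big_row S k X Y D \<in> carrier_mat k (dim_vec (vstack (hist y w)))"
    and "j < k \<Longrightarrow> (big_row S k X Y D *\<^sub>v vstack (hist y w)) $ j =
      (\<Sum>i = 0..nu. (X i *\<^sub>v y (- r i)) $ j) +
      (\<Sum>i = 1..nu. (Y i *\<^sub>v intvec (ivl i) (dim_g S i) n (fun_g S i) y) $ j) + (D *\<^sub>v w) $ j"
proof -
  let ?Xs = "map X [0..<Suc nu] @ map (\<lambda>i. Y i * (mat_T S i \<otimes>\<^sub>k 1\<^sub>m n)) idx @
    map (\<lambda>i. Y i * (mat_Tt S i \<otimes>\<^sub>k 1\<^sub>m n)) idx @ [D]"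
  let ?h = "\<lambda>i. intvec (ivl i) (dim_h S i) n (orth_h i) y"
  let ?e = "\<lambda>i. intvec (ivl i) (dim_phi S i) n (orth_e i) y"
  have T: "mat_T S i \<otimes>\<^sub>k 1\<^sub>m n \<in> carrier_mat (dim_g S i * n) (dim_h S i * n)"
    "mat_Tt S i \<otimes>\<^sub>k 1\<^sub>m n \<in> carrier_mat (dim_g S i * n) (dim_phi S i * n)" if "i \<in> {1..nu}" for i
    using kron_carrier[OF mat_T_carrier one_carrier_mat] kron_carrier[OF mat_Tt_carrier one_carrier_mat] that by auto
  have dimy: "dim_vec (y (- r i)) = n" if "i \<le> nu" for i
    using cont_segD[OF y minus_r_in_J[OF that]] by simp
  have dX: "dim_row (X i) = k \<and> dim_col (X i) = n" if "i \<le> nu" for i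
    using X[OF that] by auto
  have all: "list_all2 (\<lambda>X u. dim_row X = k \<and> dim_col X = dim_vec u) ?Xs (hist y w)"
    unfolding hist_def
  proof (intro list_all2_appendI)
    show "list_all2 (\<lambda>X u. dim_row X = k \<and> dim_col X = dim_vec u) (map X [0..<Suc nu]) (map (\<lambda>i. y (- r i)) [0..<Suc nu])"
      using dX dimy by (intro list_all2_mapI) auto
    show "list_all2 (\<lambda>X u. dim_row X = k \<and> dim_col X = dim_vec u) (map (\<lambda>i. Y i * (mat_T S i \<otimes>\<^sub>k 1\<^sub>m n)) idx) (map ?h idx)"
      using Y T by (intro list_all2_mapI) force
    show "list_all2 (\<lambda>X u. dim_row X = k \<and> dim_col X = dim_vec u) (map (\<lambda>i. Y i * (mat_Tt S i \<otimes>\<^sub>k 1\<^sub>m n)) idx) (map ?e idx)"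
      using Y T by (intro list_all2_mapI) force
    show "list_all2 (\<lambda>X u. dim_row X = k \<and> dim_col X = dim_vec u) [D] [w]" using D w by auto
  qed
  have "sum_list (map dim_col ?Xs) = sum_list (map dim_vec (hist y w))" "\<forall>Z\<in>set ?Xs. dim_row Z = k"
    using list_all2_dims[OF all] by blast+
  then show "big_row S k X Y D \<in> carrier_mat k (dim_vec (vstack (hist y w)))"
    unfolding big_row_def dim_vstack using row_blocks_carrier[of ?Xs k] by (simp only: Ball_def)
  assume j: "j < k"
  have z: "zip (map f is) (map g is) = map (\<lambda>i. (f i, g i)) is" for f :: "nat \<Rightarrow> real mat" and g :: "nat \<Rightarrow> real vec" and "is"
    by (induction "is") auto
  have "(big_row S k X Y D *\<^sub>v vstack (hist y w)) $ j = (\<Sum>(Z, u)\<leftarrow>zip ?Xs (hist y w). (Z *\<^sub>v u) $ j)"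
    unfolding big_row_def by (rule row_blocks_mult_index[OF all j])
  also have "\<dots> = (\<Sum>i\<leftarrow>[0..<Suc nu]. (X i *\<^sub>v y (- r i)) $ j) + ((\<Sum>i\<leftarrow>idx. (Y i * (mat_T S i \<otimes>\<^sub>k 1\<^sub>m n) *\<^sub>v ?h i) $ j) +
      ((\<Sum>i\<leftarrow>idx. (Y i * (mat_Tt S i \<otimes>\<^sub>k 1\<^sub>m n) *\<^sub>v ?e i) $ j) + (D *\<^sub>v w) $ j))"
    unfolding hist_def by (simp add: z o_def del: upt_Suc)
  also have "(\<Sum>i\<leftarrow>idx. (Y i * (mat_T S i \<otimes>\<^sub>k 1\<^sub>m n) *\<^sub>v ?h i) $ j) + ((\<Sum>i\<leftarrow>idx. (Y i * (mat_Tt S i \<otimes>\<^sub>k 1\<^sub>m n) *\<^sub>v ?e i) $ j) + (D *\<^sub>v w) $ j)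
     = (\<Sum>i = 1..nu. (Y i *\<^sub>v intvec (ivl i) (dim_g S i) n (fun_g S i) y) $ j) + (D *\<^sub>v w) $ j"
    unfolding sum_list_map_upt add.assoc[symmetric] sum.distrib[symmetric]
  proof (intro arg_cong2[where f="(+)"] sum.cong refl)
    fix i assume i: "i \<in> {1..nu}"
    have "Y i *\<^sub>v intvec (ivl i) (dim_g S i) n (fun_g S i) y =
        Y i *\<^sub>v ((mat_T S i \<otimes>\<^sub>k 1\<^sub>m n) *\<^sub>v ?h i) + Y i *\<^sub>v ((mat_Tt S i \<otimes>\<^sub>k 1\<^sub>m n) *\<^sub>v ?e i)"
    proof -
      have g: "intvec (ivl i) (dim_g S i) n (fun_g S i) y = (mat_T S i \<otimes>\<^sub>k 1\<^sub>m n) *\<^sub>v ?h i + (mat_Tt S i \<otimes>\<^sub>k 1\<^sub>m n) *\<^sub>v ?e i"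
        by (rule intvec_g[OF i]) (rule cont_seg_L2[OF y i])
      show ?thesis unfolding g
        by (rule mult_add_distrib_mat_vec[OF Y[OF i] mult_mat_vec_carrier[OF T(1)[OF i] intvec_carrier]
              mult_mat_vec_carrier[OF T(2)[OF i] intvec_carrier]])
    qed
    also have "Y i *\<^sub>v ((mat_T S i \<otimes>\<^sub>k 1\<^sub>m n) *\<^sub>v ?h i) = Y i * (mat_T S i \<otimes>\<^sub>k 1\<^sub>m n) *\<^sub>v ?h i"
      by (rule assoc_mult_mat_vec[OF Y[OF i] T(1)[OF i] intvec_carrier, symmetric])
    also have "Y i *\<^sub>v ((mat_Tt S i \<otimes>\<^sub>k 1\<^sub>m n) *\<^sub>v ?e i) = Y i * (mat_Tt S i \<otimes>\<^sub>k 1\<^sub>m n) *\<^sub>v ?e i"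
      by (rule assoc_mult_mat_vec[OF Y[OF i] T(2)[OF i] intvec_carrier, symmetric])
    finally show "(Y i * (mat_T S i \<otimes>\<^sub>k 1\<^sub>m n) *\<^sub>v ?h i) $ j + (Y i * (mat_Tt S i \<otimes>\<^sub>k 1\<^sub>m n) *\<^sub>v ?e i) $ j
        = (Y i *\<^sub>v intvec (ivl i) (dim_g S i) n (fun_g S i) y) $ j"
      using Y[OF i] j by simp
  qed
  finally show "(big_row S k X Y D *\<^sub>v vstack (hist y w)) $ j =
      (\<Sum>i = 0..nu. (X i *\<^sub>v y (- r i)) $ j) +
      (\<Sum>i = 1..nu. (Y i *\<^sub>v intvec (ivl i) (dim_g S i) n (fun_g S i) y) $ j) + (D *\<^sub>v w) $ j"
    unfolding sum_list_map_upt by (simp only: add.assoc)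
qed

text \<open>Covers the rows of state, output and controller at once. Hence the alternative in the
  hypothesis on \<open>Z\<close>: a plant kernel is square-integrable and equals
  \<open>dist_kernel\<close> almost everywhere, while the kernel of the controller is
  \<open>dist_kernel\<close> by definition.\<close>

lemma delayed_eq_big_row:
  assumes X: "\<And>i. i \<le> nu \<Longrightarrow> X i \<in> carrier_mat k n"
    and Y: "\<And>i. i \<in> {1..nu} \<Longrightarrow> Y i \<in> carrier_mat k (dim_g S i * n)" and D: "D \<in> carrier_mat k q"
    and Z: "\<And>i. i \<in> {1..nu} \<Longrightarrow> AE \<tau> in lebesgue_on (ivl i). Z i \<tau> = dist_kernel S Y i \<tau>"
    and Zm: "\<And>i. i \<in> {1..nu} \<Longrightarrow> L2_mat (ivl i) k n (Z i) \<or> Z i = dist_kernel S Y i"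
    and y: "cont_seg (\<lambda>\<tau>. x (t + \<tau>))" and w: "w \<in> carrier_vec q"
  shows "delayed S k X Z x t + D *\<^sub>v w = big_row S k X Y D *\<^sub>v vstack (hist (\<lambda>\<tau>. x (t + \<tau>)) w)"
proof (rule eq_vecI)
  let ?y = "\<lambda>\<tau>. x (t + \<tau>)"
  have R1: "big_row S k X Y D \<in> carrier_mat k (dim_vec (vstack (hist ?y w)))"
    using big_row_carrier(1)[of X k Y D q ?y w] X Y D y w by blast
  fix j assume "j < dim_vec (big_row S k X Y D *\<^sub>v vstack (hist ?y w))"
  then have j: "j < k" using R1 by simp
  have xr: "x (t - r i) \<in> carrier_vec n" if "i \<le> nu" for i
    using cont_segD[OF y minus_r_in_J[OF that]] by simp
  have int: "(\<integral>\<tau>. (Z i \<tau> *\<^sub>v x (t + \<tau>)) $ j \<partial>lebesgue_on (ivl i)) = (Y i *\<^sub>v intvec (ivl i) (dim_g S i) n (fun_g S i) ?y) $ j"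
    if i: "i \<in> {1..nu}" for i
  proof -
    have m1: "(\<lambda>\<tau>. (dist_kernel S Y i \<tau> *\<^sub>v ?y \<tau>) $ j) \<in> borel_measurable (lebesgue_on (ivl i))"
      by (rule dist_kernel_integral(2)[where X=Y, OF i Y[OF i] y j])
    have m2: "(\<lambda>\<tau>. (Z i \<tau> *\<^sub>v ?y \<tau>) $ j) \<in> borel_measurable (lebesgue_on (ivl i))"
      using Zm[OF i]
    proof
      assume L: "L2_mat (ivl i) k n (Z i)"
      have eq: "(Z i \<tau> *\<^sub>v ?y \<tau>) $ j = (\<Sum>c<n. Z i \<tau> $$ (j, c) * ?y \<tau> $ c)" if "\<tau> \<in> ivl i" for \<tau>
      proof -
        have "x (t + \<tau>) \<in> carrier_vec n" "Z i \<tau> \<in> carrier_mat k n"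
          using cont_segD[OF y, of \<tau>] ivl_subset[OF i] L that by (auto simp: L2_mat_def)
        then show ?thesis using j by (simp add: scalar_prod_def atLeast0LessThan)
      qed
      have "(\<lambda>\<tau>. \<Sum>c<n. Z i \<tau> $$ (j, c) * ?y \<tau> $ c) \<in> borel_measurable (lebesgue_on (ivl i))"
        using L j cont_seg_L2[OF y i] by (intro borel_measurable_sum borel_measurable_times) (auto simp: L2_mat_def L2_on_def)
      then show ?thesis using eq by (subst measurable_cong[of _ _ "\<lambda>\<tau>. \<Sum>c<n. Z i \<tau> $$ (j, c) * ?y \<tau> $ c"]) auto
    qed (use m1 in simp)
    have "(\<integral>\<tau>. (Z i \<tau> *\<^sub>v ?y \<tau>) $ j \<partial>lebesgue_on (ivl i)) = (\<integral>\<tau>. (dist_kernel S Y i \<tau> *\<^sub>v ?y \<tau>) $ j \<partial>lebesgue_on (ivl i))"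
      by (rule integral_cong_AE[OF m2 m1]) (use Z[OF i] in eventually_elim, simp)
    then show ?thesis using dist_kernel_integral(1)[where X=Y, OF i Y[OF i] y j] by simp
  qed
  have d: "delayed S k X Z x t $ j = (\<Sum>i = 0..nu. (X i *\<^sub>v x (t - r i)) $ j) +
      (\<Sum>i = 1..nu. (Y i *\<^sub>v intvec (ivl i) (dim_g S i) n (fun_g S i) ?y) $ j)"
  proof -
    let ?F = "\<lambda>i. X i *\<^sub>v x (t - r i)"
    let ?G = "\<lambda>i. vec k (\<lambda>j. \<integral>\<tau>. (Z i \<tau> *\<^sub>v x (t + \<tau>)) $ j \<partial>lebesgue_on (ivl i))"
    have F: "?F \<in> {0..nu} \<rightarrow> carrier_vec k" using X xr by (auto intro!: mult_mat_vec_carrier)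
    have G: "?G \<in> {1..nu} \<rightarrow> carrier_vec k" by simp
    have "finsum_vec TYPE(real) k ?F {0..nu} $ j = (\<Sum>i = 0..nu. ?F i $ j)"
      by (rule index_finsum_vec[OF _ j F]) simp
    moreover have "finsum_vec TYPE(real) k ?G {1..nu} $ j = (\<Sum>i = 1..nu. ?G i $ j)"
      by (rule index_finsum_vec[OF _ j G]) simp
    moreover have "dim_vec (finsum_vec TYPE(real) k ?G {1..nu}) = k"
      using finsum_vec_closed[OF G] by simp
    ultimately show ?thesis
      unfolding delayed_def using j int by (simp add: index_add_vec(1))
  qed
  show "(delayed S k X Z x t + D *\<^sub>v w) $ j = (big_row S k X Y D *\<^sub>v vstack (hist ?y w)) $ j"
    using big_row_carrier(2)[of X k Y D q ?y w j] X Y D y w d j by simp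
next
  have "big_row S k X Y D \<in> carrier_mat k (dim_vec (vstack (hist (\<lambda>\<tau>. x (t + \<tau>)) w)))"
    using big_row_carrier(1)[of X k Y D q "\<lambda>\<tau>. x (t + \<tau>)" w] X Y D y w by blast
  then show "dim_vec (delayed S k X Z x t + D *\<^sub>v w) = dim_vec (big_row S k X Y D *\<^sub>v vstack (hist (\<lambda>\<tau>. x (t + \<tau>)) w))"
    using D by simp
qed

end

section \<open>The Lyapunov functional and its derivative\<close>

text \<open>Lifts a property of scalar functions to stacked vectors, whose type carries no topology.
  For derivatives the second argument of \<open>P\<close> is the derivative; for absolute continuity
  and bounded linearity it is ignored, and \<open>v\<close> only fixes the dimension.\<close>

definition comps :: "(('s \<Rightarrow> real) \<Rightarrow> real \<Rightarrow> bool) \<Rightarrow> ('s \<Rightarrow> real vec) \<Rightarrow> real vec \<Rightarrow> bool" where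
  "comps P u v \<longleftrightarrow> (\<forall>s. dim_vec (u s) = dim_vec v) \<and> (\<forall>j<dim_vec v. P (\<lambda>s. u s $ j) (v $ j))"

lemma comps_append:
  assumes "comps P u v" "comps P u' v'"
  shows "comps P (\<lambda>s. u s @\<^sub>v u' s) (v @\<^sub>v v')"
  unfolding comps_def
proof (intro conjI allI impI)
  fix j assume "j < dim_vec (v @\<^sub>v v')"
  then show "P (\<lambda>s. (u s @\<^sub>v u' s) $ j) ((v @\<^sub>v v') $ j)"
    using assms by (cases "j < dim_vec v") (auto simp: comps_def)
qed (use assms in \<open>auto simp: comps_def\<close>)

lemma comps_vstack:
  "(\<And>i. i \<in> set is \<Longrightarrow> comps P (u i) (v i)) \<Longrightarrow>
   comps P (\<lambda>s. vstack (map (\<lambda>i. u i s) is)) (vstack (map v is))"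
proof (induction "is")
  case (Cons i js)
  have "comps P (\<lambda>s. u i s @\<^sub>v vstack (map (\<lambda>i. u i s) js)) (v i @\<^sub>v vstack (map v js))"
    by (rule comps_append) (use Cons in auto)
  then show ?case by simp
qed (simp add: comps_def)

lemma comps_kvec:
  assumes "\<And>a c. a < k \<Longrightarrow> c < n \<Longrightarrow> P (\<lambda>s. G s a c) (G' a c)"
  shows "comps P (\<lambda>s. kvec k n (G s)) (kvec k n G')"
  using assms by (auto simp: comps_def kvec_def div_less_mult mod_less_mult)

text \<open>The form is expanded into its entries, where the scalar product rule applies; the
  symmetry of \<open>P\<close> merges the two resulting sums into the factor 2.\<close>

lemma quadratic_form_derivative:
  assumes P: "P \<in> sym_mats N" and u: "comps (\<lambda>f d. (f has_real_derivative d) (at t)) u u'" and N: "dim_vec u' = N"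
  shows "((\<lambda>s. u s \<bullet> (P *\<^sub>v u s)) has_real_derivative 2 * ((P *\<^sub>v u t) \<bullet> u')) (at t)"
proof -
  have Pc: "P \<in> carrier_mat N N" and Pt: "transpose_mat P = P" using P by (auto simp: sym_mats_def)
  have uc: "u s \<in> carrier_vec N" for s using u N by (auto simp: comps_def intro: carrier_vecI)
  have u'c: "u' \<in> carrier_vec N" using N by (rule carrier_vecI)
  have eq: "(\<lambda>s. u s \<bullet> (P *\<^sub>v u s)) = (\<lambda>s. \<Sum>i<N. \<Sum>j<N. P $$ (i, j) * (u s $ i * u s $ j))"
    using quadratic_form_sum[OF Pc uc uc] by auto
  have d: "((\<lambda>s. u s $ j) has_real_derivative u' $ j) (at t)" if "j < N" for j
    using u that N by (auto simp: comps_def)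
  have "((\<lambda>s. \<Sum>i<N. \<Sum>j<N. P $$ (i, j) * (u s $ i * u s $ j)) has_real_derivative
     (\<Sum>i<N. \<Sum>j<N. P $$ (i, j) * (u' $ i * u t $ j + u t $ i * u' $ j))) (at t)"
    using d by (intro DERIV_sum DERIV_cmult) (auto intro!: derivative_eq_intros)
  moreover have "(\<Sum>i<N. \<Sum>j<N. P $$ (i, j) * (u' $ i * u t $ j + u t $ i * u' $ j)) = u' \<bullet> (P *\<^sub>v u t) + u t \<bullet> (P *\<^sub>v u')"
    unfolding quadratic_form_sum[OF Pc u'c uc] quadratic_form_sum[OF Pc uc u'c]
    by (simp add: distrib_left sum.distrib)
  moreover have "u t \<bullet> (P *\<^sub>v u') = (P *\<^sub>v u t) \<bullet> u'"
    using scalar_prod_transpose_vec[OF Pc uc u'c] Pt by simp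
  moreover have "u' \<bullet> (P *\<^sub>v u t) = (P *\<^sub>v u t) \<bullet> u'"
    by (rule comm_scalar_prod[OF u'c]) (use Pc uc in auto)
  ultimately show ?thesis unfolding eq by simp
qed

lemma quadratic_form_abs_cont:
  assumes P: "P \<in> carrier_mat N N" and u: "comps (\<lambda>f _. abs_cont_on a b f) u v" and N: "dim_vec v = N"
  shows "abs_cont_on a b (\<lambda>s. u s \<bullet> (P *\<^sub>v u s))"
proof -
  have uc: "u s \<in> carrier_vec N" for s using u N by (auto simp: comps_def intro: carrier_vecI)
  have eq: "(\<lambda>s. u s \<bullet> (P *\<^sub>v u s)) = (\<lambda>s. \<Sum>i<N. \<Sum>j<N. P $$ (i, j) * (u s $ i * u s $ j))"
    using quadratic_form_sum[OF P uc uc] by auto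
  have d: "abs_cont_on a b (\<lambda>s. u s $ j)" if "j < N" for j
    using u that N by (auto simp: comps_def)
  note c = abs_cont_on_imp_continuous_on[OF d]
  show ?thesis unfolding eq
    by (intro abs_cont_on_sum abs_cont_on_mult abs_cont_on_const continuous_intros d c) auto
qed

lemma weak_deriv_cong:
  assumes "weak_deriv X f g" "\<And>s. s \<in> X \<Longrightarrow> f s = f' s" "\<And>s. s \<in> X \<Longrightarrow> g s = g' s"
  shows "weak_deriv X f' g'"
proof -
  have "(\<integral>s. f s * h s \<partial>lebesgue_on X) = (\<integral>s. f' s * h s \<partial>lebesgue_on X)"
    "(\<integral>s. g s * h s \<partial>lebesgue_on X) = (\<integral>s. g' s * h s \<partial>lebesgue_on X)" for h
    using assms(2,3) by (auto intro!: Bochner_Integration.integral_cong)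
  then show ?thesis using assms(1) unfolding weak_deriv_def by simp
qed

context delay_system
begin

text \<open>The matrix \<open>mat_M S i\<close> in the normalised bases: it expresses the weak
  derivative of \<open>orth_f\<close> through \<open>orth_h\<close>, and is the last diagonal block
  in \<open>big_M\<close>.\<close>

abbreviation "mat_N i \<equiv> minv (chol_F S i) * mat_M S i * chol_H S i"

lemma mat_N_carrier: "i \<in> {1..nu} \<Longrightarrow> mat_N i \<in> carrier_mat (dim_f S i) (dim_h S i)"
  using chol_F(3) kernelD(5) chol_H(1) by (intro mult_carrier_mat) auto

lemma weak_deriv_orth_f:
  assumes i: "i \<in> {1..nu}" and a: "a < dim_f S i"
  shows "weak_deriv (ivl i) (\<lambda>\<tau>. orth_f i \<tau> $ a) (\<lambda>\<tau>. (mat_N i *\<^sub>v orth_h i \<tau>) $ a)"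
proof -
  let ?d = "dim_f S i" and ?L = "minv (chol_F S i)" and ?M = "mat_M S i"
  note L = chol_F(3)[OF i] and M = kernelD(5)[OF i] and f = L2_f[OF i] and h = L2_h[OF i]
  have Mh: "L2_vec (ivl i) ?d (\<lambda>\<tau>. ?M *\<^sub>v fun_h S i \<tau>)" by (rule L2_vec_mult_mat[OF M h])
  have "weak_deriv (ivl i) (\<lambda>\<tau>. \<Sum>b<?d. ?L $$ (a, b) * fun_f S i \<tau> $ b) (\<lambda>\<tau>. \<Sum>b<?d. ?L $$ (a, b) * (?M *\<^sub>v fun_h S i \<tau>) $ b)"
    unfolding ivl_eq
    by (rule weak_deriv_sum) (use f Mh kernelD(6)[OF i] in \<open>auto simp: L2_vec_def weak_deriv_vec_def ivl_eq\<close>)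
  then show ?thesis
  proof (rule weak_deriv_cong)
    fix \<tau> assume t: "\<tau> \<in> ivl i"
    have fc: "fun_f S i \<tau> \<in> carrier_vec ?d" using f t by (simp add: L2_vec_def)
    have hc: "fun_h S i \<tau> \<in> carrier_vec (dim_h S i)" using h t by (simp add: L2_vec_def)
    have oc: "orth_h i \<tau> \<in> carrier_vec (dim_h S i)" using L2_orth_h[OF i] t by (simp add: L2_vec_def)
    show "(\<Sum>b<?d. ?L $$ (a, b) * fun_f S i \<tau> $ b) = orth_f i \<tau> $ a"
      unfolding orth_f_def using L fc a by (simp add: scalar_prod_def atLeast0LessThan)
    have Lh: "chol_H S i *\<^sub>v orth_h i \<tau> = fun_h S i \<tau>"
      unfolding orth_h_def using chol_H[OF i] hc
      by (simp add: assoc_mult_mat_vec[of _ "dim_h S i" "dim_h S i" _ "dim_h S i", symmetric])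
    have "mat_N i *\<^sub>v orth_h i \<tau> = (?L * ?M) *\<^sub>v fun_h S i \<tau>"
      unfolding Lh[symmetric] by (rule assoc_mult_mat_vec[OF mult_carrier_mat[OF L M] chol_H(1)[OF i] oc])
    also have "\<dots> = ?L *\<^sub>v (?M *\<^sub>v fun_h S i \<tau>)" by (rule assoc_mult_mat_vec[OF L M hc])
    finally show "(\<Sum>b<?d. ?L $$ (a, b) * (?M *\<^sub>v fun_h S i \<tau>) $ b) = (mat_N i *\<^sub>v orth_h i \<tau>) $ a"
      using L M hc a by (simp add: scalar_prod_def atLeast0LessThan)
  qed
qed

lemma orth_f_continuous:
  assumes i: "i \<in> {1..nu}" and a: "a < dim_f S i"
  shows "continuous_on (ivl i) (\<lambda>\<tau>. orth_f i \<tau> $ a)"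
proof -
  have "continuous_on (ivl i) (\<lambda>\<tau>. \<Sum>b<dim_f S i. minv (chol_F S i) $$ (a, b) * fun_f S i \<tau> $ b)"
    using kernelD(2)[OF i] by (intro continuous_intros) (auto simp: W12_vec_def)
  then show ?thesis
    by (rule continuous_on_eq)
      (use chol_F(3)[OF i] L2_f[OF i] a in \<open>auto simp: orth_f_def scalar_prod_def atLeast0LessThan L2_vec_def\<close>)
qed

definition eta :: "(real \<Rightarrow> real vec) \<Rightarrow> real vec" where
  "eta y = vstack (map (\<lambda>i. intvec (ivl i) (dim_f S i) n (orth_f i) y) idx)"

text \<open>What \<open>delay_integral_derivative\<close> gives for each entry of \<open>eta\<close>
  along a moving window: the values at the right and at the left end, and the integral against the
  weak derivative. It involves no derivative of \<open>y\<close>.\<close>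

definition eta_deriv :: "(real \<Rightarrow> real vec) \<Rightarrow> real vec" where
  "eta_deriv y = vstack (map (\<lambda>i. kvec (dim_f S i) n (\<lambda>a c. orth_f i (- r (i - 1)) $ a * y (- r (i - 1)) $ c
     - orth_f i (- r i) $ a * y (- r i) $ c
     - (\<integral>\<tau>. (mat_N i *\<^sub>v orth_h i \<tau>) $ a * y \<tau> $ c \<partial>lebesgue_on (ivl i)))) idx)"

lemma dim_eta [simp]: "dim_vec (eta y) = tot_f S * n" "dim_vec (eta_deriv y) = tot_f S * n"
proof -
  have "(\<Sum>i\<leftarrow>idx. dim_f S i * n) = tot_f S * n"
    unfolding tot_f_def sum_list_map_upt by (simp add: sum_distrib_right)
  then show "dim_vec (eta y) = tot_f S * n" "dim_vec (eta_deriv y) = tot_f S * n"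
    by (simp_all add: eta_def eta_deriv_def o_def del: upt_Suc)
qed

text \<open>The first block is rebuilt with \<open>vec n\<close> so that the dimension is right for
  every function \<open>y\<close> whatsoever, as \<open>comps\<close> demands.\<close>

definition ext :: "(real \<Rightarrow> real vec) \<Rightarrow> real vec" where
  "ext y = vec n (\<lambda>c. y 0 $ c) @\<^sub>v eta y"

lemma dim_ext [simp]: "dim_vec (ext y) = n + tot_f S * n"
  by (simp add: ext_def)

text \<open>The factor \<open>1\<close> makes both integrals weighted integrals of \<open>y \<tau> $ c * y \<tau> $ d\<close>.\<close>

definition quad_int :: "nat \<Rightarrow> real mat \<Rightarrow> real mat \<Rightarrow> (real \<Rightarrow> real vec) \<Rightarrow> real" where
  "quad_int i Q R y = (\<Sum>c<n. \<Sum>d<n. Q $$ (c, d) * (\<integral>\<tau>. 1 * (y \<tau> $ c * y \<tau> $ d) \<partial>lebesgue_on (ivl i))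
     + R $$ (c, d) * (\<integral>\<tau>. (\<tau> + r i) * (y \<tau> $ c * y \<tau> $ d) \<partial>lebesgue_on (ivl i)))"

definition lyap :: "real mat \<Rightarrow> (nat \<Rightarrow> real mat) \<Rightarrow> (nat \<Rightarrow> real mat) \<Rightarrow> (real \<Rightarrow> real vec) \<Rightarrow> real" where
  "lyap P Q R y = ext y \<bullet> (P *\<^sub>v ext y) + (\<Sum>i = 1..nu. quad_int i (Q i) (R i) y)"

definition int_form :: "nat \<Rightarrow> real mat \<Rightarrow> (real \<Rightarrow> real vec) \<Rightarrow> real" where
  "int_form i R y = (\<Sum>c<n. \<Sum>d<n. R $$ (c, d) * (\<integral>\<tau>. y \<tau> $ c * y \<tau> $ d \<partial>lebesgue_on (ivl i)))"

text \<open>The weight \<open>1\<close> has zero derivative and leaves boundary values only. The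
  weight \<open>\<tau> + r i\<close> vanishes at the left end, equals \<open>r i - r (i - 1)\<close>
  at the right end and has derivative 1, which gives the negative integral.\<close>

definition quad_int_deriv :: "nat \<Rightarrow> real mat \<Rightarrow> real mat \<Rightarrow> (real \<Rightarrow> real vec) \<Rightarrow> real" where
  "quad_int_deriv i Q R y = (\<Sum>c<n. \<Sum>d<n. Q $$ (c, d) * (y (- r (i - 1)) $ c * y (- r (i - 1)) $ d - y (- r i) $ c * y (- r i) $ d)
     + R $$ (c, d) * ((r i - r (i - 1)) * (y (- r (i - 1)) $ c * y (- r (i - 1)) $ d)
       - (\<integral>\<tau>. y \<tau> $ c * y \<tau> $ d \<partial>lebesgue_on (ivl i))))"

text \<open>The derivative from \<open>delay_integral_derivative\<close> is continuous in
  \<open>t\<close>, which also yields absolute continuity.\<close>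

lemma delay_integral_C1:
  assumes wd: "weak_deriv (ivl i) f g" and i: "i \<in> {1..nu}"
    and f: "continuous_on (ivl i) f" and g: "integrable (lebesgue_on (ivl i)) g" and z: "continuous_on UNIV z"
  shows "((\<lambda>t. \<integral>s. f s * z (t + s) \<partial>lebesgue_on (ivl i)) has_real_derivative
      f (- r (i - 1)) * z (t + - r (i - 1)) - f (- r i) * z (t + - r i) - (\<integral>s. g s * z (t + s) \<partial>lebesgue_on (ivl i))) (at t)" (is ?D)
    and "abs_cont_on a b (\<lambda>t. \<integral>s. f s * z (t + s) \<partial>lebesgue_on (ivl i))" (is ?AC)
proof -
  have lt: "- r i < - r (i - 1)" using r_less[OF i] by simp
  note D = delay_integral_derivative[OF wd[unfolded ivl_eq] lt f[unfolded ivl_eq] g[unfolded ivl_eq] z, folded ivl_eq]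
  show ?D by (rule D)
  have zt: "continuous_on UNIV (\<lambda>t. z (t + c))" for c
    by (intro continuous_on_compose2[OF z]) (auto intro!: continuous_intros)
  have "continuous_on UNIV (\<lambda>t. \<integral>s. g s * z (t + s) \<partial>lebesgue_on (ivl i))"
    unfolding ivl_eq by (rule shift_integral_continuous[OF g[unfolded ivl_eq] z])
  then have "continuous_on UNIV (\<lambda>t. f (- r (i - 1)) * z (t + - r (i - 1)) - f (- r i) * z (t + - r i) - (\<integral>s. g s * z (t + s) \<partial>lebesgue_on (ivl i)))"
    by (intro continuous_intros zt)
  then show ?AC by (rule abs_cont_on_C1[OF D])
qed

lemma eta_C1:
  assumes x: "\<And>c. c < n \<Longrightarrow> continuous_on UNIV (\<lambda>s. x s $ c)"
  shows "comps (\<lambda>f d. (f has_real_derivative d) (at t)) (\<lambda>t. eta (\<lambda>\<tau>. x (t + \<tau>))) (eta_deriv (\<lambda>\<tau>. x (t + \<tau>)))"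
    and "comps (\<lambda>f d. abs_cont_on a b f) (\<lambda>t. eta (\<lambda>\<tau>. x (t + \<tau>))) (eta_deriv (\<lambda>\<tau>. x (t + \<tau>)))"
proof -
  have L: "integrable (lebesgue_on (ivl i)) (\<lambda>\<tau>. (mat_N i *\<^sub>v orth_h i \<tau>) $ a)" if "i \<in> {1..nu}" "a < dim_f S i" for i a
    using L2_vec_mult_mat[OF mat_N_carrier L2_orth_h, OF that(1) that(1)] that(2)
    unfolding ivl_eq by (intro L2_on_integrable) (auto simp: L2_vec_def)
  show "comps (\<lambda>f d. (f has_real_derivative d) (at t)) (\<lambda>t. eta (\<lambda>\<tau>. x (t + \<tau>))) (eta_deriv (\<lambda>\<tau>. x (t + \<tau>)))"
    unfolding eta_def eta_deriv_def intvec_def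
    by (intro comps_vstack comps_kvec delay_integral_C1(1) weak_deriv_orth_f orth_f_continuous L x) auto
  show "comps (\<lambda>f d. abs_cont_on a b f) (\<lambda>t. eta (\<lambda>\<tau>. x (t + \<tau>))) (eta_deriv (\<lambda>\<tau>. x (t + \<tau>)))"
    unfolding eta_def eta_deriv_def intvec_def
  proof (intro comps_vstack comps_kvec)
    fix i aa c assume "i \<in> set idx" "aa < dim_f S i" "c < n"
    then show "abs_cont_on a b (\<lambda>s. \<integral>\<tau>. orth_f i \<tau> $ aa * x (s + \<tau>) $ c \<partial>lebesgue_on (ivl i))"
      by (intro delay_integral_C1(2)[OF weak_deriv_orth_f _ orth_f_continuous L x]) auto
  qed
qed

lemma quad_int_C1:
  assumes x: "\<And>c. c < n \<Longrightarrow> continuous_on UNIV (\<lambda>s. x s $ c)" and i: "i \<in> {1..nu}"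
  shows "((\<lambda>t. quad_int i Q R (\<lambda>\<tau>. x (t + \<tau>))) has_real_derivative quad_int_deriv i Q R (\<lambda>\<tau>. x (t + \<tau>))) (at t)"
    and "abs_cont_on a b (\<lambda>t. quad_int i Q R (\<lambda>\<tau>. x (t + \<tau>)))"
proof -
  have lt: "- r i < - r (i - 1)" using r_less[OF i] by simp
  have wd1: "weak_deriv (ivl i) (\<lambda>_. 1) (\<lambda>_. 0)" unfolding ivl_eq
    by (rule weak_deriv_smooth[OF lt]) (auto intro!: derivative_eq_intros)
  have wd2: "weak_deriv (ivl i) (\<lambda>\<tau>. \<tau> + r i) (\<lambda>_. 1)" unfolding ivl_eq
    by (rule weak_deriv_smooth[OF lt]) (auto intro!: derivative_eq_intros)
  have i1: "integrable (lebesgue_on (ivl i)) (\<lambda>_. 0 :: real)" "integrable (lebesgue_on (ivl i)) (\<lambda>_. 1 :: real)"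
    unfolding ivl_eq by (intro continuous_integrable_lebesgue_on continuous_intros)+
  have xx: "continuous_on UNIV (\<lambda>t. x t $ c * x t $ d)" if "c < n" "d < n" for c d
    using x that by (intro continuous_intros) auto
  have c1: "continuous_on (ivl i) (\<lambda>_. 1 :: real)" "continuous_on (ivl i) (\<lambda>\<tau>. \<tau> + r i)" by (intro continuous_intros)+
  note D1 = delay_integral_C1[OF wd1 i c1(1) i1(1) xx] and D2 = delay_integral_C1[OF wd2 i c1(2) i1(2) xx]
  show "((\<lambda>t. quad_int i Q R (\<lambda>\<tau>. x (t + \<tau>))) has_real_derivative quad_int_deriv i Q R (\<lambda>\<tau>. x (t + \<tau>))) (at t)"
    unfolding quad_int_def quad_int_deriv_def
  proof (intro DERIV_sum DERIV_add DERIV_cmult)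
    fix c d assume "c \<in> {..<n}" "d \<in> {..<n}"
    then have cd: "c < n" "d < n" by auto
    show "((\<lambda>t. \<integral>\<tau>. 1 * (x (t + \<tau>) $ c * x (t + \<tau>) $ d) \<partial>lebesgue_on (ivl i)) has_real_derivative
        x (t + - r (i - 1)) $ c * x (t + - r (i - 1)) $ d - x (t + - r i) $ c * x (t + - r i) $ d) (at t)"
      using D1(1)[OF cd, of t] by simp
    show "((\<lambda>t. \<integral>\<tau>. (\<tau> + r i) * (x (t + \<tau>) $ c * x (t + \<tau>) $ d) \<partial>lebesgue_on (ivl i)) has_real_derivative
        (r i - r (i - 1)) * (x (t + - r (i - 1)) $ c * x (t + - r (i - 1)) $ d)
        - (\<integral>\<tau>. x (t + \<tau>) $ c * x (t + \<tau>) $ d \<partial>lebesgue_on (ivl i))) (at t)"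
      using D2(1)[OF cd, of t] by (simp add: algebra_simps)
  qed
  show "abs_cont_on a b (\<lambda>t. quad_int i Q R (\<lambda>\<tau>. x (t + \<tau>)))"
    unfolding quad_int_def
    by (intro abs_cont_on_sum abs_cont_on_add abs_cont_on_mult abs_cont_on_const D1(2) D2(2)
        abs_cont_on_imp_continuous_on) auto
qed

lemma lyap_derivative:
  assumes x: "\<And>c. c < n \<Longrightarrow> continuous_on UNIV (\<lambda>s. x s $ c)" and P: "P \<in> sym_mats (n + tot_f S * n)"
    and x': "dim_vec x' = n" "\<And>c. c < n \<Longrightarrow> ((\<lambda>s. x s $ c) has_real_derivative x' $ c) (at t)"
  shows "((\<lambda>s. lyap P Q R (\<lambda>\<tau>. x (s + \<tau>))) has_real_derivative
     2 * ((P *\<^sub>v ext (\<lambda>\<tau>. x (t + \<tau>))) \<bullet> (x' @\<^sub>v eta_deriv (\<lambda>\<tau>. x (t + \<tau>)))) +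
     (\<Sum>i = 1..nu. quad_int_deriv i (Q i) (R i) (\<lambda>\<tau>. x (t + \<tau>)))) (at t)"
  unfolding lyap_def
proof (intro DERIV_add DERIV_sum quad_int_C1(1) x)
  have "comps (\<lambda>f d. (f has_real_derivative d) (at t)) (\<lambda>s. vec n (\<lambda>c. x (s + 0) $ c)) x'"
    using x' by (auto simp: comps_def)
  from comps_append[OF this eta_C1(1)[OF x]]
  show "((\<lambda>s. ext (\<lambda>\<tau>. x (s + \<tau>)) \<bullet> (P *\<^sub>v ext (\<lambda>\<tau>. x (s + \<tau>)))) has_real_derivative
     2 * ((P *\<^sub>v ext (\<lambda>\<tau>. x (t + \<tau>))) \<bullet> (x' @\<^sub>v eta_deriv (\<lambda>\<tau>. x (t + \<tau>))))) (at t)"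
    unfolding ext_def by (rule quadratic_form_derivative[OF P]) (use x' in auto)
qed auto

text \<open>Absolute continuity of \<open>x\<close> enters through the current state in
  \<open>ext\<close> alone; \<open>eta\<close> and the quadratic integrals are C1 for every
  continuous \<open>x\<close>.\<close>

lemma lyap_abs_cont:
  assumes x: "\<And>c. c < n \<Longrightarrow> continuous_on UNIV (\<lambda>s. x s $ c)" and P: "P \<in> sym_mats (n + tot_f S * n)"
    and x': "\<And>c. c < n \<Longrightarrow> abs_cont_on a b (\<lambda>s. x s $ c)"
  shows "abs_cont_on a b (\<lambda>s. lyap P Q R (\<lambda>\<tau>. x (s + \<tau>)))"
  unfolding lyap_def
proof (intro abs_cont_on_add abs_cont_on_sum quad_int_C1(2) x)
  have "comps (\<lambda>f d. abs_cont_on a b f) (\<lambda>s. vec n (\<lambda>c. x (s + 0) $ c)) (0\<^sub>v n)"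
    using x' by (auto simp: comps_def)
  from comps_append[OF this eta_C1(2)[OF x]]
  show "abs_cont_on a b (\<lambda>s. ext (\<lambda>\<tau>. x (s + \<tau>)) \<bullet> (P *\<^sub>v ext (\<lambda>\<tau>. x (s + \<tau>))))"
    unfolding ext_def by (rule quadratic_form_abs_cont[rotated]) (use P in \<open>auto simp: sym_mats_def\<close>)
qed auto

end

section \<open>The quadratic form of the matrix inequality\<close>

lemma diag_upto_mult_vec:
  assumes "\<And>i. i \<in> {1..k} \<Longrightarrow> dim_col (X i) = dim_vec (u i)"
  shows "diag_upto k X *\<^sub>v vstack (map u [1..<Suc k]) = vstack (map (\<lambda>i. X i *\<^sub>v u i) [1..<Suc k])"
  unfolding diag_upto_def by (rule diag_block_mat_mult_map) (use assms in auto)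

lemma diag_upto_carrier:
  assumes "\<And>i. i \<in> {1..k} \<Longrightarrow> X i \<in> carrier_mat (f i) (g i)"
  shows "diag_upto k X \<in> carrier_mat (\<Sum>i = 1..k. f i) (\<Sum>i = 1..k. g i)"
proof -
  have "sum_list (map (\<lambda>i. dim_row (X i)) [1..<Suc k]) = (\<Sum>i = 1..k. f i)"
    "sum_list (map (\<lambda>i. dim_col (X i)) [1..<Suc k]) = (\<Sum>i = 1..k. g i)"
    unfolding sum_list_map_upt by (intro sum.cong refl carrier_matD[OF assms]; assumption)+
  then show ?thesis by (intro carrier_matI) (simp_all add: diag_upto_def dim_diag_block_mat o_def del: upt_Suc)
qed

lemma diag_upto_form:
  assumes "\<And>i. i \<in> {1..k} \<Longrightarrow> X i \<in> carrier_mat (f i) (f i)" "\<And>i. i \<in> {1..k} \<Longrightarrow> u i \<in> carrier_vec (f i)"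
  shows "vstack (map u [1..<Suc k]) \<bullet> (diag_upto k X *\<^sub>v vstack (map u [1..<Suc k])) = (\<Sum>i = 1..k. u i \<bullet> (X i *\<^sub>v u i))"
proof -
  have d: "dim_col (X i) = dim_vec (u i)" "dim_row (X i) = dim_vec (u i)" if "i \<in> {1..k}" for i
    using assms[OF that] by auto
  have "vstack (map u [1..<Suc k]) \<bullet> (diag_upto k X *\<^sub>v vstack (map u [1..<Suc k])) = (\<Sum>i\<leftarrow>[1..<Suc k]. u i \<bullet> (X i *\<^sub>v u i))"
    by (subst diag_upto_mult_vec) (use d in \<open>auto intro!: vstack_scalar_prod simp del: upt_Suc\<close>)
  then show ?thesis unfolding sum_list_map_upt .
qed

lemma vstack_upt_carrier:
  assumes "\<And>i. i \<in> {1..k} \<Longrightarrow> dim_vec (u i) = f i"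
  shows "vstack (map u [1..<Suc k]) \<in> carrier_vec (\<Sum>i = 1..k. f i)"
proof -
  have "sum_list (map (\<lambda>i. dim_vec (u i)) [1..<Suc k]) = (\<Sum>i = 1..k. f i)"
    unfolding sum_list_map_upt using assms by (auto intro!: sum.cong)
  then show ?thesis by (intro carrier_vecI) (simp add: o_def del: upt_Suc)
qed

lemma scalar_prod_zero_block [simp]: "dim_vec v = k \<Longrightarrow> v \<bullet> (0\<^sub>m k k *\<^sub>v v) = (0::real)"
  by (simp add: scalar_prod_def)

lemma diag_block_form:
  assumes "list_all2 (\<lambda>X u. dim_col X = dim_vec u \<and> dim_row X = dim_vec u) Xs us"
  shows "vstack us \<bullet> (diag_block_mat Xs *\<^sub>v vstack us) = (\<Sum>(X, u)\<leftarrow>zip Xs us. u \<bullet> (X *\<^sub>v (u :: real vec)))"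
proof -
  have "list_all2 (\<lambda>X u. dim_col X = dim_vec u) Xs us" using assms by (auto elim: list_all2_mono)
  then have "vstack us \<bullet> (diag_block_mat Xs *\<^sub>v vstack us) = vstack us \<bullet> vstack (map2 (*\<^sub>v) Xs us)"
    by (simp add: diag_block_mat_mult_vstack)
  also have "\<dots> = (\<Sum>(X, u)\<leftarrow>zip Xs us. u \<bullet> (X *\<^sub>v u))"
    using assms
  proof (induction Xs us rule: list_all2_induct)
    case (Cons X Xs u us)
    have "sum_list (map dim_vec us) = sum_list (map dim_vec (map2 (*\<^sub>v) Xs us))"
      using Cons(2) by (induction rule: list_all2_induct) auto
    then have "dim_vec (vstack us) = dim_vec (vstack (map2 (*\<^sub>v) Xs us))" by simp
    then show ?case using Cons by (simp add: scalar_prod_append' del: dim_vstack)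
  qed (simp add: scalar_prod_def)
  finally show ?thesis .
qed

context delay_system
begin

abbreviation "h_part y \<equiv> vstack (map (\<lambda>i. intvec (ivl i) (dim_h S i) n (orth_h i) y) idx)"
abbreviation "e_part y \<equiv> vstack (map (\<lambda>i. intvec (ivl i) (dim_phi S i) n (orth_e i) y) idx)"
abbreviation "x_part y \<equiv> vstack (map (\<lambda>i. y (- r i)) idx)"

lemma hist_eq: "vstack (hist y w) = y 0 @\<^sub>v (x_part y @\<^sub>v (h_part y @\<^sub>v (e_part y @\<^sub>v w)))"
proof -
  have "[0..<Suc nu] = 0 # idx" by (simp add: upt_conv_Cons)
  then show ?thesis unfolding hist_def by (simp add: vstack_append append_vec_assoc r0 del: upt_Suc)
qed

lemma x_part_carrier: "cont_seg y \<Longrightarrow> x_part y \<in> carrier_vec (nu * n)"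
  using vstack_upt_carrier[of nu "\<lambda>i. y (- r i)" "\<lambda>_. n"] cont_segD[OF _ minus_r_in_J] by (simp del: upt_Suc)

lemma h_part_carrier: "h_part y \<in> carrier_vec (tot_h S * n)"
  using vstack_upt_carrier[of nu "\<lambda>i. intvec (ivl i) (dim_h S i) n (orth_h i) y" "\<lambda>i. dim_h S i * n"]
  by (simp add: tot_h_def sum_distrib_right del: upt_Suc)

lemma e_part_carrier: "e_part y \<in> carrier_vec (tot_phi S * n)"
  using vstack_upt_carrier[of nu "\<lambda>i. intvec (ivl i) (dim_phi S i) n (orth_e i) y" "\<lambda>i. dim_phi S i * n"]
  by (simp add: tot_phi_def sum_distrib_right del: upt_Suc)

lemma eta_carrier: "eta y \<in> carrier_vec (tot_f S * n)" "eta_deriv y \<in> carrier_vec (tot_f S * n)"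
  by (simp_all add: carrier_vecI)

lemma y0_carrier: "cont_seg y \<Longrightarrow> y 0 \<in> carrier_vec n"
  using cont_segD[OF _ zero_in_J] .

lemma ext_append: "cont_seg y \<Longrightarrow> ext y = y 0 @\<^sub>v eta y"
proof -
  assume "cont_seg y"
  then have "dim_vec (y 0) = n" by (rule carrier_vecD[OF y0_carrier])
  then have "vec n (\<lambda>c. y 0 $ c) = y 0" by (intro eq_vecI) simp_all
  then show ?thesis by (simp only: ext_def)
qed

abbreviation "mat_If i \<equiv> minv (chol_F S i) * (0\<^sub>m (dim_f S i) (dim_vphi S i) @\<^sub>c 1\<^sub>m (dim_f S i)) * chol_H S i"

lemma mat_If_carrier: "i \<in> {1..nu} \<Longrightarrow> mat_If i \<in> carrier_mat (dim_f S i) (dim_h S i)"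
  using chol_F(3) chol_H(1) unfolding dim_h_def
  by (intro mult_carrier_mat[of _ _ "dim_f S i + dim_vphi S i"] mult_carrier_mat[of _ _ "dim_f S i"])
    (auto simp: append_cols_def add.commute)

text \<open>The Cholesky factor recovers \<open>fun_h\<close>, the block row of zero and identity
  selects its lower part \<open>fun_f\<close>, and the inverse factor normalises it. Hence
  \<open>I_hat\<close> computes \<open>eta\<close> from the coefficients that occur in the
  history.\<close>

lemma mat_If_mult:
  assumes i: "i \<in> {1..nu}" and t: "\<tau> \<in> ivl i"
  shows "mat_If i *\<^sub>v orth_h i \<tau> = orth_f i \<tau>"
proof -
  let ?d = "dim_f S i" and ?L = "minv (chol_F S i)" and ?E = "0\<^sub>m (dim_f S i) (dim_vphi S i) @\<^sub>c 1\<^sub>m (dim_f S i)"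
  have h: "fun_h S i \<tau> \<in> carrier_vec (dim_h S i)" using L2_h[OF i] t by (simp add: L2_vec_def)
  have v: "fun_vphi S i \<tau> \<in> carrier_vec (dim_vphi S i)" using kernelD(3)[OF i] t by (simp add: L2_vec_def)
  have f: "fun_f S i \<tau> \<in> carrier_vec ?d" using L2_f[OF i] t by (simp add: L2_vec_def)
  have oc: "orth_h i \<tau> \<in> carrier_vec (dim_h S i)" using L2_orth_h[OF i] t by (simp add: L2_vec_def)
  have E: "?E \<in> carrier_mat ?d (dim_h S i)"
    unfolding dim_h_def add.commute[of "dim_f S i"] by (rule append_cols_carrier) auto
  have Lh: "chol_H S i *\<^sub>v orth_h i \<tau> = fun_h S i \<tau>"
    unfolding orth_h_def using chol_H[OF i] h
    by (simp add: assoc_mult_mat_vec[of _ "dim_h S i" "dim_h S i" _ "dim_h S i", symmetric])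
  have "mat_If i *\<^sub>v orth_h i \<tau> = (?L * ?E) *\<^sub>v fun_h S i \<tau>"
    unfolding Lh[symmetric] by (rule assoc_mult_mat_vec[OF mult_carrier_mat[OF chol_F(3)[OF i] E] chol_H(1)[OF i] oc])
  also have "\<dots> = ?L *\<^sub>v (?E *\<^sub>v fun_h S i \<tau>)" by (rule assoc_mult_mat_vec[OF chol_F(3)[OF i] E h])
  also have "?E *\<^sub>v fun_h S i \<tau> = fun_f S i \<tau>"
    unfolding fun_h_def append_cols_mult_vec[OF zero_carrier_mat one_carrier_mat v f]
    using v f by (simp add: zero_mult_vec)
  finally show ?thesis by (simp add: orth_f_def)
qed

lemma I_hat_eq: "I_hat S = diag_upto nu (\<lambda>i. mat_If i \<otimes>\<^sub>k 1\<^sub>m n)"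
  unfolding I_hat_def diag_upto_def kron_one_diag_block_mat by (simp add: o_def del: upt_Suc)

lemma I_hat_carrier: "I_hat S \<in> carrier_mat (tot_f S * n) (tot_h S * n)"
  unfolding I_hat_eq tot_f_def tot_h_def sum_distrib_right
  by (rule diag_upto_carrier) (use kron_carrier[OF mat_If_carrier one_carrier_mat] in auto)

lemma I_hat_mult: "cont_seg y \<Longrightarrow> I_hat S *\<^sub>v h_part y = eta y"
proof -
  assume y: "cont_seg y"
  have "I_hat S *\<^sub>v h_part y = vstack (map (\<lambda>i. (mat_If i \<otimes>\<^sub>k 1\<^sub>m n) *\<^sub>v intvec (ivl i) (dim_h S i) n (orth_h i) y) idx)"
    unfolding I_hat_eq
    by (rule diag_upto_mult_vec) (simp only: carrier_matD(2)[OF kron_carrier[OF mat_If_carrier one_carrier_mat]] dim_intvec)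
  also have "\<dots> = eta y"
    unfolding eta_def
  proof (intro arg_cong[where f=vstack] map_cong refl)
    fix i assume "i \<in> set idx"
    then have i: "i \<in> {1..nu}" by auto
    have "(mat_If i \<otimes>\<^sub>k 1\<^sub>m n) *\<^sub>v intvec (ivl i) (dim_h S i) n (orth_h i) y = intvec (ivl i) (dim_f S i) n (\<lambda>\<tau>. mat_If i *\<^sub>v orth_h i \<tau>) y"
      by (rule intvec_mult_mat[symmetric, OF mat_If_carrier[OF i] L2_orth_h[OF i]]) (rule cont_seg_L2[OF y i])
    also have "\<dots> = intvec (ivl i) (dim_f S i) n (orth_f i) y"
      by (rule intvec_cong) (use mat_If_mult[OF i] in auto)
    finally show "(mat_If i \<otimes>\<^sub>k 1\<^sub>m n) *\<^sub>v intvec (ivl i) (dim_h S i) n (orth_h i) y = intvec (ivl i) (dim_f S i) n (orth_f i) y" .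
  qed
  finally show ?thesis .
qed

text \<open>The states at the right ends of the intervals, whereas \<open>x_part\<close> collects
  those at the left ends. The two overlap, and the list of all delayed states can be cut after its
  first or before its last block.\<close>

abbreviation "x_prev y \<equiv> vstack (map (\<lambda>i. y (- r (i - 1))) idx)"

lemma x_prev_append: "y 0 @\<^sub>v x_part y = x_prev y @\<^sub>v y (- r nu)"
proof -
  have "map (\<lambda>i. y (- r (i - 1))) idx = map (\<lambda>i. y (- r i)) [0..<nu]"
    by (rule nth_equalityI) (auto simp del: upt_Suc)
  then have "x_prev y @\<^sub>v y (- r nu) = vstack (map (\<lambda>i. y (- r i)) ([0..<nu] @ [nu]))"
    by (simp add: vstack_append)
  also have "[0..<nu] @ [nu] = 0 # idx" using nu_pos by (simp add: upt_conv_Cons)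
  finally show ?thesis by (simp add: r0 del: upt_Suc)
qed

lemma x_prev_carrier:
  assumes y: "cont_seg y"
  shows "x_prev y \<in> carrier_vec (nu * n)"
proof -
  have "dim_vec (y (- r (i - 1))) = n" if "i \<in> {1..nu}" for i
    using that by (intro carrier_vecD[OF cont_segD[OF y minus_r_in_J]]) auto
  from vstack_upt_carrier[of nu "\<lambda>i. y (- r (i - 1))" "\<lambda>_. n", OF this] show ?thesis by simp
qed

text \<open>The first bracket of \<open>big_M\<close> acts on \<open>x_prev\<close> and yields the
  boundary values at the right ends; the second acts on \<open>x_part\<close> and
  \<open>h_part\<close> and yields those at the left ends and the integrals against the weak
  derivatives.\<close>

lemma big_M_mult:
  assumes y: "cont_seg y"
  shows "big_M S \<otimes>\<^sub>k 1\<^sub>m n \<in> carrier_mat (tot_f S * n) (n + (nu * n + tot_h S * n))"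
    and "(big_M S \<otimes>\<^sub>k 1\<^sub>m n) *\<^sub>v (y 0 @\<^sub>v (x_part y @\<^sub>v h_part y)) = eta_deriv y"
proof -
  let ?d = "tot_f S" and ?k = "tot_h S"
  let ?A = "\<lambda>i. minv (chol_F S i) * col_mat (fun_f S i (- r (i - 1)))"
  let ?B = "\<lambda>i. minv (chol_F S i) * col_mat (fun_f S i (- r i))"
  have inI: "- r (i - 1) \<in> ivl i" "- r i \<in> ivl i" if "i \<in> {1..nu}" for i
    using r_less[OF that] by (auto simp: ivl_eq)
  have cm: "col_mat (fun_f S i \<tau>) \<in> carrier_mat (dim_f S i) 1" if "i \<in> {1..nu}" "\<tau> \<in> ivl i" for i \<tau>
    using L2_vec_dim[OF L2_f[OF that(1)] that(2)] mat_of_cols_carrier(1)[of "dim_f S i" "[fun_f S i \<tau>]"]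
    by (simp add: col_mat_def)
  have Lc: "minv (chol_F S i) * col_mat (fun_f S i \<tau>) \<in> carrier_mat (dim_f S i) 1" if "i \<in> {1..nu}" "\<tau> \<in> ivl i" for i \<tau>
    using mult_carrier_mat[OF chol_F(3)[OF that(1)] cm[OF that]] .
  have A: "diag_upto nu ?A \<in> carrier_mat ?d nu" and B: "diag_upto nu ?B \<in> carrier_mat ?d nu"
    using diag_upto_carrier[of nu ?A "dim_f S" "\<lambda>_. 1"] diag_upto_carrier[of nu ?B "dim_f S" "\<lambda>_. 1"] Lc inI
    by (auto simp: tot_f_def)
  have N: "diag_upto nu mat_N \<in> carrier_mat ?d ?k"
    unfolding tot_f_def tot_h_def by (rule diag_upto_carrier) (rule mat_N_carrier)
  have c1: "0\<^sub>m ?d 1 @\<^sub>c 0\<^sub>m ?d ?k \<in> carrier_mat ?d (1 + ?k)" by (rule append_cols_carrier) auto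
  have M1: "diag_upto nu ?A @\<^sub>c 0\<^sub>m ?d 1 @\<^sub>c 0\<^sub>m ?d ?k \<in> carrier_mat ?d (nu + (1 + ?k))"
    by (rule append_cols_carrier[OF A c1])
  have c2: "diag_upto nu ?B @\<^sub>c diag_upto nu mat_N \<in> carrier_mat ?d (nu + ?k)" by (rule append_cols_carrier[OF B N])
  have M2: "0\<^sub>m ?d 1 @\<^sub>c diag_upto nu ?B @\<^sub>c diag_upto nu mat_N \<in> carrier_mat ?d (nu + (1 + ?k))"
    using append_cols_carrier[OF zero_carrier_mat[of ?d 1] c2] by (simp add: add.left_commute)
  have K1: "(diag_upto nu ?A @\<^sub>c 0\<^sub>m ?d 1 @\<^sub>c 0\<^sub>m ?d ?k) \<otimes>\<^sub>k 1\<^sub>m n =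
      (diag_upto nu ?A \<otimes>\<^sub>k 1\<^sub>m n) @\<^sub>c (0\<^sub>m (?d * n) n @\<^sub>c 0\<^sub>m (?d * n) (?k * n))"
    unfolding kron_one_append_cols[OF A c1] kron_one_append_cols[OF zero_carrier_mat zero_carrier_mat] by simp
  have K2: "(0\<^sub>m ?d 1 @\<^sub>c diag_upto nu ?B @\<^sub>c diag_upto nu mat_N) \<otimes>\<^sub>k 1\<^sub>m n =
      0\<^sub>m (?d * n) n @\<^sub>c ((diag_upto nu ?B \<otimes>\<^sub>k 1\<^sub>m n) @\<^sub>c (diag_upto nu mat_N \<otimes>\<^sub>k 1\<^sub>m n))"
    unfolding kron_one_append_cols[OF zero_carrier_mat c2] kron_one_append_cols[OF B N] by simp
  have M: "big_M S \<otimes>\<^sub>k 1\<^sub>m n = (diag_upto nu ?A @\<^sub>c 0\<^sub>m ?d 1 @\<^sub>c 0\<^sub>m ?d ?k) \<otimes>\<^sub>k 1\<^sub>m n -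
      (0\<^sub>m ?d 1 @\<^sub>c diag_upto nu ?B @\<^sub>c diag_upto nu mat_N) \<otimes>\<^sub>k 1\<^sub>m n"
    unfolding big_M_def by (rule kron_diff[OF M1 M2])
  have dims: "(nu + (1 + ?k)) * n = n + (nu * n + ?k * n)" by (simp add: algebra_simps)
  note KM1 = kron_carrier[OF M1 one_carrier_mat[of n], unfolded dims]
    and KM2 = kron_carrier[OF M2 one_carrier_mat[of n], unfolded dims]
  show "big_M S \<otimes>\<^sub>k 1\<^sub>m n \<in> carrier_mat (?d * n) (n + (nu * n + ?k * n))"
    unfolding M by (rule minus_carrier_mat[OF KM2])
  let ?v = "y 0 @\<^sub>v (x_part y @\<^sub>v h_part y)"
  have v: "?v \<in> carrier_vec (n + (nu * n + ?k * n))"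
    using y0_carrier[OF y] x_part_carrier[OF y] h_part_carrier by auto
  \<comment> \<open>Regrouped so that the block diagonal matrix of the first bracket meets exactly
    the states at the right ends.\<close>
  have v2: "?v = x_prev y @\<^sub>v (y (- r nu) @\<^sub>v h_part y)"
    by (simp only: append_vec_assoc[symmetric] x_prev_append)
  have ynu: "y (- r nu) \<in> carrier_vec n" using cont_segD[OF y minus_r_in_J] by simp
  have KA: "diag_upto nu ?A \<otimes>\<^sub>k 1\<^sub>m n \<in> carrier_mat (?d * n) (nu * n)" by (rule kron_carrier[OF A one_carrier_mat])
  have KB: "diag_upto nu ?B \<otimes>\<^sub>k 1\<^sub>m n \<in> carrier_mat (?d * n) (nu * n)" by (rule kron_carrier[OF B one_carrier_mat])
  have KN: "diag_upto nu mat_N \<otimes>\<^sub>k 1\<^sub>m n \<in> carrier_mat (?d * n) (?k * n)" by (rule kron_carrier[OF N one_carrier_mat])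
  have e1: "((diag_upto nu ?A @\<^sub>c 0\<^sub>m ?d 1 @\<^sub>c 0\<^sub>m ?d ?k) \<otimes>\<^sub>k 1\<^sub>m n) *\<^sub>v ?v = (diag_upto nu ?A \<otimes>\<^sub>k 1\<^sub>m n) *\<^sub>v x_prev y"
  proof -
    have z: "0\<^sub>m (?d * n) n @\<^sub>c 0\<^sub>m (?d * n) (?k * n) \<in> carrier_mat (?d * n) (n + ?k * n)"
      by (rule append_cols_carrier) auto
    have yh: "y (- r nu) @\<^sub>v h_part y \<in> carrier_vec (n + ?k * n)" using ynu h_part_carrier by auto
    have "(0\<^sub>m (?d * n) n @\<^sub>c 0\<^sub>m (?d * n) (?k * n)) *\<^sub>v (y (- r nu) @\<^sub>v h_part y) = 0\<^sub>v (?d * n)"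
      unfolding append_cols_mult_vec[OF zero_carrier_mat zero_carrier_mat ynu h_part_carrier]
      using ynu h_part_carrier by (simp add: zero_mult_vec)
    then show ?thesis unfolding K1 v2 append_cols_mult_vec[OF KA z x_prev_carrier[OF y] yh]
      using KA x_prev_carrier[OF y] by simp
  qed
  have e2: "((0\<^sub>m ?d 1 @\<^sub>c diag_upto nu ?B @\<^sub>c diag_upto nu mat_N) \<otimes>\<^sub>k 1\<^sub>m n) *\<^sub>v ?v =
      (diag_upto nu ?B \<otimes>\<^sub>k 1\<^sub>m n) *\<^sub>v x_part y + (diag_upto nu mat_N \<otimes>\<^sub>k 1\<^sub>m n) *\<^sub>v h_part y"
  proof -
    have z: "(diag_upto nu ?B \<otimes>\<^sub>k 1\<^sub>m n) @\<^sub>c (diag_upto nu mat_N \<otimes>\<^sub>k 1\<^sub>m n) \<in> carrier_mat (?d * n) (nu * n + ?k * n)"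
      by (rule append_cols_carrier[OF KB KN])
    have xh: "x_part y @\<^sub>v h_part y \<in> carrier_vec (nu * n + ?k * n)" using x_part_carrier[OF y] h_part_carrier by auto
    show ?thesis unfolding K2 append_cols_mult_vec[OF zero_carrier_mat z y0_carrier[OF y] xh]
        append_cols_mult_vec[OF KB KN x_part_carrier[OF y] h_part_carrier]
      using KB KN y0_carrier[OF y] x_part_carrier[OF y] h_part_carrier by (simp add: zero_mult_vec)
  qed
  have kd: "diag_upto nu X \<otimes>\<^sub>k 1\<^sub>m n = diag_upto nu (\<lambda>i. X i \<otimes>\<^sub>k 1\<^sub>m n)" for X
    unfolding diag_upto_def kron_one_diag_block_mat by (simp add: o_def del: upt_Suc)
  let ?u = "\<lambda>i. (?A i \<otimes>\<^sub>k 1\<^sub>m n) *\<^sub>v y (- r (i - 1))"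
  let ?w = "\<lambda>i. (?B i \<otimes>\<^sub>k 1\<^sub>m n) *\<^sub>v y (- r i)"
  let ?z = "\<lambda>i. (mat_N i \<otimes>\<^sub>k 1\<^sub>m n) *\<^sub>v intvec (ivl i) (dim_h S i) n (orth_h i) y"
  have dimA: "dim_col (?A i) = 1" "dim_row (?A i) = dim_f S i" "dim_col (?B i) = 1" "dim_row (?B i) = dim_f S i"
     "dim_col (mat_N i) = dim_h S i" "dim_row (mat_N i) = dim_f S i" if "i \<in> {1..nu}" for i
    using carrier_matD[OF Lc[OF that inI(1)[OF that]]] carrier_matD[OF Lc[OF that inI(2)[OF that]]]
      carrier_matD[OF mat_N_carrier[OF that]] by blast+
  have ydim: "dim_vec (y (- r i)) = n" if "i \<le> nu" for i using cont_segD[OF y minus_r_in_J[OF that]] by simp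
  have ydim': "dim_vec (y (- r (i - 1))) = n" if "i \<in> {1..nu}" for i
    using that by (intro ydim) auto
  have f1: "(diag_upto nu ?A \<otimes>\<^sub>k 1\<^sub>m n) *\<^sub>v x_prev y = vstack (map ?u idx)"
    unfolding kd by (rule diag_upto_mult_vec) (use dimA ydim' in \<open>simp del: index_mult_mat\<close>)
  have f2: "(diag_upto nu ?B \<otimes>\<^sub>k 1\<^sub>m n) *\<^sub>v x_part y = vstack (map ?w idx)"
    unfolding kd by (rule diag_upto_mult_vec) (use dimA ydim in \<open>simp del: index_mult_mat\<close>)
  have f3: "(diag_upto nu mat_N \<otimes>\<^sub>k 1\<^sub>m n) *\<^sub>v h_part y = vstack (map ?z idx)"
    unfolding kd by (rule diag_upto_mult_vec) (use dimA in \<open>simp del: index_mult_mat\<close>)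
  have lin: "vstack (map u js) - (vstack (map w js) + vstack (map z js)) = vstack (map (\<lambda>i. u i - (w i + z i)) js)"
    if "\<And>i. i \<in> set js \<Longrightarrow> dim_vec (u i) = dim_vec (z i) \<and> dim_vec (w i) = dim_vec (z i)"
    for u w z :: "nat \<Rightarrow> real vec" and js
    using that
  proof (induction js)
    case (Cons j js)
    have "sum_list (map (\<lambda>i. dim_vec (u i)) js) = sum_list (map (\<lambda>i. dim_vec (z i)) js)"
      "sum_list (map (\<lambda>i. dim_vec (w i)) js) = sum_list (map (\<lambda>i. dim_vec (z i)) js)"
      using Cons(2) by (auto intro!: arg_cong[where f=sum_list])
    then have d: "dim_vec (vstack (map u js)) = dim_vec (vstack (map z js))"
      "dim_vec (vstack (map w js)) = dim_vec (vstack (map z js))" by (simp_all add: o_def)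
    have dj: "dim_vec (u j) = dim_vec (z j)" "dim_vec (w j) = dim_vec (z j)" using Cons(2) by auto
    have "vstack (map (\<lambda>i. u i - (w i + z i)) (j # js)) = (u j - (w j + z j)) @\<^sub>v (vstack (map u js) - (vstack (map w js) + vstack (map z js)))"
      using Cons by simp
    also have "\<dots> = vstack (map u (j # js)) - (vstack (map w (j # js)) + vstack (map z (j # js)))"
      using d dj by (intro eq_vecI) (auto simp del: dim_vstack)
    finally show ?case ..
  next
    case Nil
    show ?case by (rule eq_vecI) auto
  qed
  have "(big_M S \<otimes>\<^sub>k 1\<^sub>m n) *\<^sub>v ?v = vstack (map ?u idx) - (vstack (map ?w idx) + vstack (map ?z idx))"
    unfolding M minus_mult_distrib_mat_vec[OF KM1 KM2 v] e1 e2 f1 f2 f3 ..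
  also have "\<dots> = vstack (map (\<lambda>i. ?u i - (?w i + ?z i)) idx)"
  proof (rule lin)
    fix i assume "i \<in> set idx"
    then have "i \<in> {1..nu}" by auto
    from dimA[OF this] show "dim_vec (?u i) = dim_vec (?z i) \<and> dim_vec (?w i) = dim_vec (?z i)"
      by (simp del: index_mult_mat)
  qed
  also have "\<dots> = eta_deriv y"
    unfolding eta_deriv_def
  proof (intro arg_cong[where f=vstack] map_cong refl)
    fix i assume "i \<in> set idx"
    then have i: "i \<in> {1..nu}" by auto
    have entry: "(minv (chol_F S i) * col_mat (fun_f S i \<tau>)) $$ (a, 0) = orth_f i \<tau> $ a" if "a < dim_f S i" "\<tau> \<in> ivl i" for a \<tau>
    proof -
      have fc: "fun_f S i \<tau> \<in> carrier_vec (dim_f S i)" using L2_f[OF i] that by (simp add: L2_vec_def)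
      then have "col (col_mat (fun_f S i \<tau>)) 0 = fun_f S i \<tau>" by (simp add: col_mat_def)
      then show ?thesis using that(1) chol_F(3)[OF i] cm[OF i that(2)] by (simp add: orth_f_def)
    qed
    have yc: "y (- r (i - 1)) \<in> carrier_vec n" "y (- r i) \<in> carrier_vec n"
      using i by (auto intro!: cont_segD[OF y] minus_r_in_J)
    have u: "?u i = kvec (dim_f S i) n (\<lambda>a c. orth_f i (- r (i - 1)) $ a * y (- r (i - 1)) $ c)"
      unfolding kron_one_column_mult_vec[OF Lc[OF i inI(1)[OF i]] yc(1)]
      by (rule kvec_cong) (simp only: entry[OF _ inI(1)[OF i]])
    have w: "?w i = kvec (dim_f S i) n (\<lambda>a c. orth_f i (- r i) $ a * y (- r i) $ c)"
      unfolding kron_one_column_mult_vec[OF Lc[OF i inI(2)[OF i]] yc(2)]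
      by (rule kvec_cong) (simp only: entry[OF _ inI(2)[OF i]])
    have "?z i = intvec (ivl i) (dim_f S i) n (\<lambda>\<tau>. mat_N i *\<^sub>v orth_h i \<tau>) y"
      by (rule intvec_mult_mat[symmetric, OF mat_N_carrier[OF i] L2_orth_h[OF i]]) (rule cont_seg_L2[OF y i])
    then show "?u i - (?w i + ?z i) = kvec (dim_f S i) n (\<lambda>a c. orth_f i (- r (i - 1)) $ a * y (- r (i - 1)) $ c
     - orth_f i (- r i) $ a * y (- r i) $ c - (\<integral>\<tau>. (mat_N i *\<^sub>v orth_h i \<tau>) $ a * y \<tau> $ c \<partial>lebesgue_on (ivl i)))"
      unfolding u w intvec_def by (intro eq_vecI) (auto simp: kvec_def)
  qed
  finally show "(big_M S \<otimes>\<^sub>k 1\<^sub>m n) *\<^sub>v ?v = eta_deriv y" .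
qed

end

text \<open>The form \<open>2 * (y \<bullet> u) + y \<bullet> (J1 *\<^sub>v y)\<close> with
  \<open>u = Jt *\<^sub>v z\<close> is critical at this \<open>y\<close>, where its value is
  \<open>- (u \<bullet> (J1i *\<^sub>v u))\<close>: the negative of the first block of the supply
  rate. The remaining blocks agree term by term.\<close>

lemma supply_schur:
  fixes Jt J1 J2 J3 :: "real mat"
  assumes Jt: "Jt \<in> carrier_mat m m" and J1: "J1 \<in> carrier_mat m m" and J1i: "J1i \<in> carrier_mat m m"
    and inv: "J1 * J1i = 1\<^sub>m m"
    and J2: "J2 \<in> carrier_mat m q" and J3: "J3 \<in> carrier_mat q q"
    and z: "z \<in> carrier_vec m" and w: "w \<in> carrier_vec q"
  defines "y \<equiv> - (J1i *\<^sub>v (Jt *\<^sub>v z))"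
  shows "y \<in> carrier_vec m"
    and "2 * (y \<bullet> (Jt *\<^sub>v z) - w \<bullet> (transpose_mat J2 *\<^sub>v z)) + y \<bullet> (J1 *\<^sub>v y) - w \<bullet> (J3 *\<^sub>v w) =
     - ((z @\<^sub>v w) \<bullet> (four_block_mat (transpose_mat Jt * J1i * Jt) J2 (transpose_mat J2) J3 *\<^sub>v (z @\<^sub>v w)))"
proof -
  define u where "u = Jt *\<^sub>v z"
  define a where "a = J1i *\<^sub>v u"
  have u: "u \<in> carrier_vec m" unfolding u_def using Jt z by auto
  have a: "a \<in> carrier_vec m" unfolding a_def using J1i u by auto
  have ya: "y = - a" by (simp add: y_def a_def u_def)
  show y: "y \<in> carrier_vec m" unfolding ya using a by simp
  have J1a: "J1 *\<^sub>v a = u" unfolding a_def using assoc_mult_mat_vec[OF J1 J1i u] inv u by simp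
  have "J1 *\<^sub>v (- a) = - (J1 *\<^sub>v a)"
    by (rule eq_vecI) (use J1 a in \<open>simp_all add: scalar_prod_uminus_right\<close>)
  then have "J1 *\<^sub>v y = - u" unfolding ya J1a .
  then have yJ1y: "y \<bullet> (J1 *\<^sub>v y) = a \<bullet> u"
    unfolding ya using a u by simp
  have yu: "y \<bullet> u = - (a \<bullet> u)" unfolding ya using a u by simp
  have J2w: "J2 *\<^sub>v w \<in> carrier_vec m" using J2 w by auto
  have J2z: "transpose_mat J2 *\<^sub>v z \<in> carrier_vec q" using J2 z by auto
  have J3w: "J3 *\<^sub>v w \<in> carrier_vec q" using J3 w by auto
  have T: "transpose_mat Jt * J1i * Jt \<in> carrier_mat m m" using Jt J1i by auto
  have Tz: "(transpose_mat Jt * J1i * Jt) *\<^sub>v z = transpose_mat Jt *\<^sub>v a"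
    unfolding a_def u_def using Jt J1i z
    by (simp add: assoc_mult_mat_vec[of _ m m _ m])
  have "(z @\<^sub>v w) \<bullet> (four_block_mat (transpose_mat Jt * J1i * Jt) J2 (transpose_mat J2) J3 *\<^sub>v (z @\<^sub>v w))
     = (z @\<^sub>v w) \<bullet> ((transpose_mat Jt *\<^sub>v a + J2 *\<^sub>v w) @\<^sub>v (transpose_mat J2 *\<^sub>v z + J3 *\<^sub>v w))"
    using four_block_mat_mult_vec[OF T J2 transpose_carrier_mat[THEN iffD2, OF J2] J3 z w] Tz by simp
  also have "\<dots> = z \<bullet> (transpose_mat Jt *\<^sub>v a + J2 *\<^sub>v w) + w \<bullet> (transpose_mat J2 *\<^sub>v z + J3 *\<^sub>v w)"
    using z w J2 J3 J2w J2z J3w by (intro scalar_prod_append') auto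
  also have "z \<bullet> (transpose_mat Jt *\<^sub>v a + J2 *\<^sub>v w) = z \<bullet> (transpose_mat Jt *\<^sub>v a) + z \<bullet> (J2 *\<^sub>v w)"
    using z a Jt J2w by (intro scalar_prod_add_distrib[of _ m]) auto
  also have "w \<bullet> (transpose_mat J2 *\<^sub>v z + J3 *\<^sub>v w) = w \<bullet> (transpose_mat J2 *\<^sub>v z) + w \<bullet> (J3 *\<^sub>v w)"
    by (rule scalar_prod_add_distrib[OF w J2z J3w])
  also have "z \<bullet> (transpose_mat Jt *\<^sub>v a) = u \<bullet> a"
    unfolding u_def by (rule scalar_prod_transpose_vec[OF Jt z a])
  also have "u \<bullet> a = a \<bullet> u" by (rule comm_scalar_prod[OF u a])
  also have "z \<bullet> (J2 *\<^sub>v w) = w \<bullet> (transpose_mat J2 *\<^sub>v z)"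
    using scalar_prod_transpose_vec[OF J2 w z] comm_scalar_prod[OF z J2w] by simp
  finally show "2 * (y \<bullet> (Jt *\<^sub>v z) - w \<bullet> (transpose_mat J2 *\<^sub>v z)) + y \<bullet> (J1 *\<^sub>v y) - w \<bullet> (J3 *\<^sub>v w) =
     - ((z @\<^sub>v w) \<bullet> (four_block_mat (transpose_mat Jt * J1i * Jt) J2 (transpose_mat J2) J3 *\<^sub>v (z @\<^sub>v w)))"
    unfolding yJ1y using yu by (simp add: u_def)
qed

context delay_system
begin

section \<open>Bessel's inequality for the history, and the form of \<open>mat_Xi\<close>\<close>

lemma form_intvec:
  assumes R: "R \<in> carrier_mat n n"
  shows "intvec X k n E y \<bullet> ((1\<^sub>m k \<otimes>\<^sub>k R) *\<^sub>v intvec X k n E y) =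
    (\<Sum>a<k. \<Sum>c<n. \<Sum>d<n. R $$ (c, d) * ((\<integral>s. E s $ a * y s $ c \<partial>lebesgue_on X) * (\<integral>s. E s $ a * y s $ d \<partial>lebesgue_on X)))"
  unfolding intvec_def one_kron_mult_kvec[OF R] scalar_prod_kvec
  by (simp add: sum_distrib_left mult_ac)

lemma orthonormal_entries:
  assumes "gram X k l a b = M" "i < k" "j < l"
  shows "(\<integral>s. a s $ i * b s $ j \<partial>lebesgue_on X) = M $$ (i, j)"
  using assms(2,3) unfolding assms(1)[symmetric] by (simp add: gram_def)

lemma psd_sum:
  fixes R :: "real mat"
  assumes R: "R \<in> carrier_mat n n" and psd: "\<And>v. v \<in> carrier_vec n \<Longrightarrow> 0 \<le> v \<bullet> (R *\<^sub>v v)"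
  shows "0 \<le> (\<Sum>c<n. \<Sum>d<n. R $$ (c, d) * (z c * z d))"
  using psd[of "vec n z"] quadratic_form_sum[OF R, of "vec n z" "vec n z"] by simp

text \<open>Being orthogonal to each other, the two families form one orthonormal system, indexed by
  a disjoint sum. So a single energy dominates both forms together, not merely each of them.\<close>

lemma bessel_h_e:
  assumes i: "i \<in> {1..nu}" and y: "cont_seg y" and R: "R \<in> carrier_mat n n"
    and psd: "\<And>v. v \<in> carrier_vec n \<Longrightarrow> 0 \<le> v \<bullet> (R *\<^sub>v v)"
  shows "intvec (ivl i) (dim_h S i) n (orth_h i) y \<bullet> ((1\<^sub>m (dim_h S i) \<otimes>\<^sub>k R) *\<^sub>v intvec (ivl i) (dim_h S i) n (orth_h i) y)
    + intvec (ivl i) (dim_phi S i) n (orth_e i) y \<bullet> ((1\<^sub>m (dim_phi S i) \<otimes>\<^sub>k R) *\<^sub>v intvec (ivl i) (dim_phi S i) n (orth_e i) y)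
    \<le> int_form i R y"
proof -
  let ?I = "{..<dim_h S i} <+> {..<dim_phi S i}"
  define e where "e k \<tau> = (case k of Inl a \<Rightarrow> orth_h i \<tau> $ a | Inr a \<Rightarrow> orth_e i \<tau> $ a)" for k :: "nat + nat" and \<tau>
  have eh: "(\<integral>s. orth_h i s $ a * orth_e i s $ b \<partial>lebesgue_on (ivl i)) = 0" if "a < dim_h S i" "b < dim_phi S i" for a b
    using orthonormal_entries[OF gram_orth_e_h[OF i] that(2,1)] that by (simp add: mult.commute)
  have on: "(\<integral>s. e a s * e b s \<partial>lebesgue_on (ivl i)) = (if a = b then 1 else 0)" if "a \<in> ?I" "b \<in> ?I" for a b
    using that orthonormal_entries[OF gram_orth_h[OF i]] orthonormal_entries[OF gram_orth_e[OF i]]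
      orthonormal_entries[OF gram_orth_e_h[OF i]] eh
    by (auto simp: e_def split: if_splits)
  have L: "L2_on (ivl i) (e a)" if "a \<in> ?I" for a
    using that L2_orth_h[OF i] L2_orth_e[OF i] by (auto simp: e_def[abs_def] L2_vec_def)
  have "(\<Sum>a\<in>?I. \<Sum>c<n. \<Sum>d<n. R $$ (c, d) * ((\<integral>s. e a s * y s $ c \<partial>lebesgue_on (ivl i)) * (\<integral>s. e a s * y s $ d \<partial>lebesgue_on (ivl i))))
     \<le> (\<Sum>c<n. \<Sum>d<n. R $$ (c, d) * (\<integral>s. y s $ c * y s $ d \<partial>lebesgue_on (ivl i)))"
    by (rule bessel_quadratic[where x="\<lambda>c s. y s $ c"])
      (use L on cont_seg_L2[OF y i] psd_sum[OF R psd] in auto)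
  then show ?thesis
    unfolding form_intvec[OF R] int_form_def by (simp add: sum.Plus e_def)
qed

text \<open>Used with \<open>Q i\<close> in the lower bound of the functional and with the identity
  matrix in the upper one.\<close>

lemma bessel_f:
  assumes i: "i \<in> {1..nu}" and y: "cont_seg y" and R: "R \<in> carrier_mat n n"
    and psd: "\<And>v. v \<in> carrier_vec n \<Longrightarrow> 0 \<le> v \<bullet> (R *\<^sub>v v)"
  shows "intvec (ivl i) (dim_f S i) n (orth_f i) y \<bullet> ((1\<^sub>m (dim_f S i) \<otimes>\<^sub>k R) *\<^sub>v intvec (ivl i) (dim_f S i) n (orth_f i) y)
    \<le> int_form i R y"
  unfolding form_intvec[OF R] int_form_def
  by (rule bessel_quadratic[where x="\<lambda>c s. y s $ c" and e="\<lambda>a s. orth_f i s $ a"])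
    (use L2_orth_f[OF i] orthonormal_entries[OF gram_orth_f[OF i]] cont_seg_L2[OF y i] psd_sum[OF R psd] in
      \<open>auto simp: L2_vec_def\<close>)

lemma quad_int_deriv_eq:
  assumes i: "i \<in> {1..nu}" and y: "cont_seg y" and Q: "Q \<in> carrier_mat n n" and R: "R \<in> carrier_mat n n"
  shows "quad_int_deriv i Q R y = y (- r (i - 1)) \<bullet> (Q *\<^sub>v y (- r (i - 1))) + (r i - r (i - 1)) * (y (- r (i - 1)) \<bullet> (R *\<^sub>v y (- r (i - 1))))
     - y (- r i) \<bullet> (Q *\<^sub>v y (- r i)) - int_form i R y"
proof -
  have yc: "y (- r (i - 1)) \<in> carrier_vec n" "y (- r i) \<in> carrier_vec n"
    using i by (auto intro!: cont_segD[OF y] minus_r_in_J)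
  show ?thesis
    unfolding quad_int_deriv_def int_form_def quadratic_form_sum[OF Q yc(1) yc(1)] quadratic_form_sum[OF R yc(1) yc(1)]
      quadratic_form_sum[OF Q yc(2) yc(2)]
    by (simp add: sum_distrib_left sum.distrib sum_subtractf algebra_simps)
qed

text \<open>The two block diagonal matrices in \<open>mat_Xi\<close> cut the history at different
  places, so the form of each is evaluated in its own grouping of the blocks before
  subtracting.\<close>

lemma mat_Xi_form:
  assumes y: "cont_seg y" and w: "w \<in> carrier_vec (dim_w S)" and J3: "sup_J3 S \<in> carrier_mat (dim_w S) (dim_w S)"
    and Q: "\<And>i. i \<in> {1..nu} \<Longrightarrow> Q i \<in> carrier_mat n n" and R: "\<And>i. i \<in> {1..nu} \<Longrightarrow> R i \<in> carrier_mat n n"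
  defines "N \<equiv> n + (nu * n + (tot_h S * n + (tot_phi S * n + dim_w S)))"
  shows "mat_Xi S Q R \<in> carrier_mat N N"
    and "vstack (hist y w) \<bullet> (mat_Xi S Q R *\<^sub>v vstack (hist y w)) =
      (\<Sum>i = 1..nu. y (- r (i - 1)) \<bullet> (Q i *\<^sub>v y (- r (i - 1))) + (r i - r (i - 1)) * (y (- r (i - 1)) \<bullet> (R i *\<^sub>v y (- r (i - 1))))
        - y (- r i) \<bullet> (Q i *\<^sub>v y (- r i))
        - intvec (ivl i) (dim_h S i) n (orth_h i) y \<bullet> ((1\<^sub>m (dim_h S i) \<otimes>\<^sub>k R i) *\<^sub>v intvec (ivl i) (dim_h S i) n (orth_h i) y)
        - intvec (ivl i) (dim_phi S i) n (orth_e i) y \<bullet> ((1\<^sub>m (dim_phi S i) \<otimes>\<^sub>k R i) *\<^sub>v intvec (ivl i) (dim_phi S i) n (orth_e i) y))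
      - w \<bullet> (sup_J3 S *\<^sub>v w)"
proof -
  let ?q = "dim_w S"
  let ?DQ = "diag_upto nu Q" and ?DR = "diag_upto nu R" and ?L = "mat_Lambda S"
  let ?Dh = "diag_upto nu (\<lambda>i. 1\<^sub>m (dim_h S i) \<otimes>\<^sub>k R i)" and ?De = "diag_upto nu (\<lambda>i. 1\<^sub>m (dim_phi S i) \<otimes>\<^sub>k R i)"
  let ?h = "\<lambda>i. intvec (ivl i) (dim_h S i) n (orth_h i) y" and ?e = "\<lambda>i. intvec (ivl i) (dim_phi S i) n (orth_e i) y"
  let ?D1 = "diag_block_mat [?DQ + ?DR * ?L, 0\<^sub>m n n, 0\<^sub>m (tot_g S * n) (tot_g S * n), 0\<^sub>m ?q ?q]"
  let ?D2 = "diag_block_mat [0\<^sub>m n n, ?DQ, ?Dh, ?De, sup_J3 S]"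
  have DQ: "?DQ \<in> carrier_mat (nu * n) (nu * n)" using diag_upto_carrier[of nu Q "\<lambda>_. n" "\<lambda>_. n", OF Q] by simp
  have DR: "?DR \<in> carrier_mat (nu * n) (nu * n)" using diag_upto_carrier[of nu R "\<lambda>_. n" "\<lambda>_. n", OF R] by simp
  have L: "?L \<in> carrier_mat (nu * n) (nu * n)"
    unfolding mat_Lambda_def using diag_upto_carrier[of nu "\<lambda>i. (r i - r (i - 1)) \<cdot>\<^sub>m 1\<^sub>m n" "\<lambda>_. n" "\<lambda>_. n"] by simp
  have Rh: "1\<^sub>m (dim_h S i) \<otimes>\<^sub>k R i \<in> carrier_mat (dim_h S i * n) (dim_h S i * n)" if "i \<in> {1..nu}" for i
    by (rule kron_carrier[OF one_carrier_mat R[OF that]])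
  have Re: "1\<^sub>m (dim_phi S i) \<otimes>\<^sub>k R i \<in> carrier_mat (dim_phi S i * n) (dim_phi S i * n)" if "i \<in> {1..nu}" for i
    by (rule kron_carrier[OF one_carrier_mat R[OF that]])
  have Dh: "?Dh \<in> carrier_mat (tot_h S * n) (tot_h S * n)"
    unfolding tot_h_def sum_distrib_right by (rule diag_upto_carrier[OF Rh])
  have De: "?De \<in> carrier_mat (tot_phi S * n) (tot_phi S * n)"
    unfolding tot_phi_def sum_distrib_right by (rule diag_upto_carrier[OF Re])
  \<comment> \<open>The positive part has one zero block where the negative part has two
    blocks.\<close>
  have tg: "tot_g S * n = tot_h S * n + tot_phi S * n"
    unfolding tot_g_def tot_h_def tot_phi_def dim_g_def dim_h_def by (simp add: sum.distrib algebra_simps)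
  have D1: "?D1 \<in> carrier_mat N N"
    using DQ DR L tg by (intro carrier_matI) (simp_all add: dim_diag_block_mat N_def)
  have D2: "?D2 \<in> carrier_mat N N"
    using DQ Dh De J3 by (intro carrier_matI) (simp_all add: dim_diag_block_mat N_def)
  have Xi: "mat_Xi S Q R = ?D1 - ?D2" by (simp add: mat_Xi_def)
  show "mat_Xi S Q R \<in> carrier_mat N N" unfolding Xi by (rule minus_carrier_mat[OF D2])
  let ?th = "vstack (hist y w)"
  have th: "?th \<in> carrier_vec N"
    unfolding hist_eq N_def using y0_carrier[OF y] x_part_carrier[OF y] h_part_carrier e_part_carrier w by auto
  have ynu: "y (- r nu) \<in> carrier_vec n" using cont_segD[OF y minus_r_in_J] by simp
  \<comment> \<open>The grouping of the positive part: its weights belong to the states at the right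
    ends of the intervals, and the last delayed state is met by a zero block.\<close>
  have th1: "?th = vstack [x_prev y, y (- r nu), h_part y @\<^sub>v e_part y, w]"
  proof -
    have "?th = (y 0 @\<^sub>v x_part y) @\<^sub>v ((h_part y @\<^sub>v e_part y) @\<^sub>v w)"
      by (simp only: hist_eq append_vec_assoc)
    then show ?thesis unfolding x_prev_append by (simp only: vstack_simps append_vNil append_vec_assoc)
  qed
  have th2: "?th = vstack [y 0, x_part y, h_part y, e_part y, w]"
    unfolding hist_eq by simp
  note pc = x_prev_carrier[OF y]
  have yc: "y (- r (i - 1)) \<in> carrier_vec n" "y (- r i) \<in> carrier_vec n" if "i \<in> {1..nu}" for i
    using that by (auto intro!: cont_segD[OF y] minus_r_in_J)
  have QRL: "?DQ + ?DR * ?L \<in> carrier_mat (nu * n) (nu * n)" using DQ DR L by auto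
  have "?th \<bullet> (?D1 *\<^sub>v ?th) = x_prev y \<bullet> ((?DQ + ?DR * ?L) *\<^sub>v x_prev y)"
  proof -
    have he: "dim_vec (h_part y @\<^sub>v e_part y) = tot_g S * n"
      using carrier_vecD[OF h_part_carrier[of y]] carrier_vecD[OF e_part_carrier[of y]] tg by simp
    have "list_all2 (\<lambda>X u. dim_col X = dim_vec u \<and> dim_row X = dim_vec u)
      [?DQ + ?DR * ?L, 0\<^sub>m n n, 0\<^sub>m (tot_g S * n) (tot_g S * n), 0\<^sub>m ?q ?q]
      [x_prev y, y (- r nu), h_part y @\<^sub>v e_part y, w]"
      unfolding list_all2_Cons list_all2_Nil
      using carrier_matD[OF QRL] carrier_vecD[OF pc] carrier_vecD[OF ynu] he carrier_vecD[OF w]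
      by (simp del: index_add_mat index_mult_mat dim_vstack)
    from diag_block_form[OF this] show ?thesis unfolding th1
      using he carrier_vecD[OF ynu] carrier_vecD[OF w] by (simp del: dim_vstack vstack_simps)
  qed
  also have "\<dots> = x_prev y \<bullet> (?DQ *\<^sub>v x_prev y) + x_prev y \<bullet> ((?DR * ?L) *\<^sub>v x_prev y)"
    by (rule scalar_prod_add_mat[OF DQ mult_carrier_mat[OF DR L] pc pc])
  also have "x_prev y \<bullet> (?DQ *\<^sub>v x_prev y) = (\<Sum>i = 1..nu. y (- r (i - 1)) \<bullet> (Q i *\<^sub>v y (- r (i - 1))))"
    by (rule diag_upto_form[OF Q yc(1)])
  also have "x_prev y \<bullet> ((?DR * ?L) *\<^sub>v x_prev y) = (\<Sum>i = 1..nu. (r i - r (i - 1)) * (y (- r (i - 1)) \<bullet> (R i *\<^sub>v y (- r (i - 1)))))"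
  proof -
    have ydim: "dim_vec (y (- r (i - 1))) = n" if "i \<in> {1..nu}" for i using yc(1)[OF that] by simp
    have Rdim: "dim_col (R i) = n" "dim_row (R i) = n" if "i \<in> {1..nu}" for i using R[OF that] by auto
    have one: "((r i - r (i - 1)) \<cdot>\<^sub>m 1\<^sub>m n) *\<^sub>v y (- r (i - 1)) = (r i - r (i - 1)) \<cdot>\<^sub>v y (- r (i - 1))" if "i \<in> {1..nu}" for i
      by (rule eq_vecI) (use yc(1)[OF that] in \<open>simp_all add: scalar_prod_def if_distrib[of "\<lambda>z. _ * z * _"] cong: if_cong\<close>)
    have "(?DR * ?L) *\<^sub>v x_prev y = ?DR *\<^sub>v (?L *\<^sub>v x_prev y)" by (rule assoc_mult_mat_vec[OF DR L pc])
    also have "?L *\<^sub>v x_prev y = vstack (map (\<lambda>i. ((r i - r (i - 1)) \<cdot>\<^sub>m 1\<^sub>m n) *\<^sub>v y (- r (i - 1))) idx)"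
      unfolding mat_Lambda_def by (rule diag_upto_mult_vec) (use ydim in simp)
    also have "?DR *\<^sub>v \<dots> = vstack (map (\<lambda>i. R i *\<^sub>v (((r i - r (i - 1)) \<cdot>\<^sub>m 1\<^sub>m n) *\<^sub>v y (- r (i - 1)))) idx)"
      by (rule diag_upto_mult_vec) (simp add: Rdim)
    finally have "x_prev y \<bullet> ((?DR * ?L) *\<^sub>v x_prev y) =
        (\<Sum>i\<leftarrow>idx. y (- r (i - 1)) \<bullet> (R i *\<^sub>v (((r i - r (i - 1)) \<cdot>\<^sub>m 1\<^sub>m n) *\<^sub>v y (- r (i - 1)))))"
      by (simp only:) (rule vstack_scalar_prod, use ydim Rdim in \<open>simp del: upt_Suc\<close>)
    also have "\<dots> = (\<Sum>i = 1..nu. y (- r (i - 1)) \<bullet> (R i *\<^sub>v (((r i - r (i - 1)) \<cdot>\<^sub>m 1\<^sub>m n) *\<^sub>v y (- r (i - 1)))))"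
      by (rule sum_list_map_upt)
    also have "\<dots> = (\<Sum>i = 1..nu. (r i - r (i - 1)) * (y (- r (i - 1)) \<bullet> (R i *\<^sub>v y (- r (i - 1)))))"
    proof (rule sum.cong[OF refl])
      fix i assume i: "i \<in> {1..nu}"
      show "y (- r (i - 1)) \<bullet> (R i *\<^sub>v (((r i - r (i - 1)) \<cdot>\<^sub>m 1\<^sub>m n) *\<^sub>v y (- r (i - 1)))) = (r i - r (i - 1)) * (y (- r (i - 1)) \<bullet> (R i *\<^sub>v y (- r (i - 1))))"
        unfolding one[OF i] mult_mat_vec[OF R[OF i] yc(1)[OF i]]
        by (rule scalar_prod_smult_distrib[OF yc(1)[OF i]]) (use R[OF i] yc(1)[OF i] in auto)
    qed
    finally show ?thesis .
  qed
  finally have f1: "?th \<bullet> (?D1 *\<^sub>v ?th) = (\<Sum>i = 1..nu. y (- r (i - 1)) \<bullet> (Q i *\<^sub>v y (- r (i - 1)))) +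
    (\<Sum>i = 1..nu. (r i - r (i - 1)) * (y (- r (i - 1)) \<bullet> (R i *\<^sub>v y (- r (i - 1)))))" .
  have "list_all2 (\<lambda>X u. dim_col X = dim_vec u \<and> dim_row X = dim_vec u)
      [0\<^sub>m n n, ?DQ, ?Dh, ?De, sup_J3 S] [y 0, x_part y, h_part y, e_part y, w]"
    unfolding list_all2_Cons list_all2_Nil
    using carrier_matD[OF DQ] carrier_matD[OF Dh] carrier_matD[OF De] carrier_matD[OF J3] carrier_vecD[OF y0_carrier[OF y]]
      carrier_vecD[OF x_part_carrier[OF y]] carrier_vecD[OF h_part_carrier[of y]] carrier_vecD[OF e_part_carrier[of y]] carrier_vecD[OF w]
    by (simp del: dim_vstack)
  from diag_block_form[OF this]
  have "?th \<bullet> (?D2 *\<^sub>v ?th) = x_part y \<bullet> (?DQ *\<^sub>v x_part y) + (h_part y \<bullet> (?Dh *\<^sub>v h_part y) + (e_part y \<bullet> (?De *\<^sub>v e_part y) + w \<bullet> (sup_J3 S *\<^sub>v w)))"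
    unfolding th2 using carrier_vecD[OF y0_carrier[OF y]] by (simp del: vstack_simps)
  moreover have "x_part y \<bullet> (?DQ *\<^sub>v x_part y) = (\<Sum>i = 1..nu. y (- r i) \<bullet> (Q i *\<^sub>v y (- r i)))"
    by (rule diag_upto_form[OF Q yc(2)])
  moreover have "h_part y \<bullet> (?Dh *\<^sub>v h_part y) = (\<Sum>i = 1..nu. ?h i \<bullet> ((1\<^sub>m (dim_h S i) \<otimes>\<^sub>k R i) *\<^sub>v ?h i))"
    by (rule diag_upto_form[OF Rh intvec_carrier])
  moreover have "e_part y \<bullet> (?De *\<^sub>v e_part y) = (\<Sum>i = 1..nu. ?e i \<bullet> ((1\<^sub>m (dim_phi S i) \<otimes>\<^sub>k R i) *\<^sub>v ?e i))"
    by (rule diag_upto_form[OF Re intvec_carrier])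
  moreover have "?th \<bullet> (mat_Xi S Q R *\<^sub>v ?th) = ?th \<bullet> (?D1 *\<^sub>v ?th) - ?th \<bullet> (?D2 *\<^sub>v ?th)"
    unfolding Xi minus_mult_distrib_mat_vec[OF D1 D2 th]
    by (rule scalar_prod_minus_distrib[OF th]) (use D1 D2 th in auto)
  ultimately show "?th \<bullet> (mat_Xi S Q R *\<^sub>v ?th) =
      (\<Sum>i = 1..nu. y (- r (i - 1)) \<bullet> (Q i *\<^sub>v y (- r (i - 1))) + (r i - r (i - 1)) * (y (- r (i - 1)) \<bullet> (R i *\<^sub>v y (- r (i - 1))))
        - y (- r i) \<bullet> (Q i *\<^sub>v y (- r i)) - ?h i \<bullet> ((1\<^sub>m (dim_h S i) \<otimes>\<^sub>k R i) *\<^sub>v ?h i)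
        - ?e i \<bullet> ((1\<^sub>m (dim_phi S i) \<otimes>\<^sub>k R i) *\<^sub>v ?e i)) - w \<bullet> (sup_J3 S *\<^sub>v w)"
    unfolding f1 by (simp add: sum_subtractf sum.distrib)
qed

end

lemma dim_delayed: "dim_vec (delayed S k X Y x t) = k"
proof -
  let ?G = "\<lambda>i. vec k (\<lambda>j. \<integral>\<tau>. (Y i \<tau> *\<^sub>v x (t + \<tau>)) $ j \<partial>lebesgue_on (del_ivl S i))"
  have "finsum_vec TYPE(real) k ?G {1..num_del S} \<in> carrier_vec k"
    by (rule finsum_vec_closed) simp
  then show ?thesis by (simp add: delayed_def)
qed

lemma scalar_prod_uminus_mat:
  fixes A :: "real mat"
  assumes A: "A \<in> carrier_mat k k" and v: "v \<in> carrier_vec k"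
  shows "v \<bullet> (- A *\<^sub>v v) = - (v \<bullet> (A *\<^sub>v v))"
proof -
  have "- A *\<^sub>v v = - (A *\<^sub>v v)" using A v by (intro uminus_mult_mat_vec) auto
  then show ?thesis using A v by (simp add: scalar_prod_uminus_right)
qed

lemma invertible_mat_det_nonzero:
  fixes A :: "real mat"
  assumes A: "A \<in> carrier_mat k k" and inv: "invertible_mat A"
  shows "det A \<noteq> 0"
proof -
  obtain B where B: "A * B = 1\<^sub>m k" "B * A = 1\<^sub>m (dim_row B)"
    using A inv by (auto simp: invertible_mat_def inverts_mat_def)
  have "B \<in> carrier_mat k k"
    using arg_cong[OF B(1), of dim_col] arg_cong[OF B(2), of dim_col] A by (intro carrier_matI) auto
  then show ?thesis using det_mult[OF A, of B] B(1) by auto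
qed

locale dissipative_lmi = delay_system +
  fixes U :: unknowns
  assumes sup: "supply_data S"
    and U: "U \<in> carrier (unknowns_space S)"
    and lmi_P: "pos_def (four_block_mat (par_P1 U) (par_P2 U) (transpose_mat (par_P2 U)) (par_P3 U) +
        diag_block_mat [0\<^sub>m (dim_x S) (dim_x S),
          diag_upto (num_del S) (\<lambda>i. 1\<^sub>m (dim_f S i) \<otimes>\<^sub>k par_Q U i)])"
    and lmi_Q: "pos_def (diag_upto (num_del S) (par_Q U))"
    and lmi_R: "pos_def (diag_upto (num_del S) (par_R U))"
    and lmi: "neg_def (Sy (transpose_mat (big_P S U) * big_Pi S U) +
        mat_Phi S (par_P2 U) (par_P3 U) (par_Q U) (par_R U) (mat_Sigma S U))"
begin

abbreviation "q \<equiv> dim_w S"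
abbreviation "m \<equiv> dim_z S"
abbreviation "dn \<equiv> tot_f S * n"
abbreviation "P1 \<equiv> par_P1 U"
abbreviation "P2 \<equiv> par_P2 U"
abbreviation "P3 \<equiv> par_P3 U"
abbreviation "Q \<equiv> par_Q U"
abbreviation "R \<equiv> par_R U"
abbreviation "PP \<equiv> four_block_mat P1 P2 (transpose_mat P2) P3"
abbreviation "hdim \<equiv> n + (nu * n + (tot_h S * n + (tot_phi S * n + q)))"
abbreviation "hv y w \<equiv> vstack (hist y w)"

lemma PQR:
  "P1 \<in> carrier_mat n n" "transpose_mat P1 = P1" "P2 \<in> carrier_mat n dn" "P3 \<in> carrier_mat dn dn" "transpose_mat P3 = P3"
  using unknowns_carrierD[OF U] by (auto simp: sym_mats_def)

lemma QR:
  assumes "i \<in> {1..nu}"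
  shows "Q i \<in> carrier_mat n n" "R i \<in> carrier_mat n n"
  using PiE_mem[OF unknowns_carrierD(4)[OF U] assms] PiE_mem[OF unknowns_carrierD(5)[OF U] assms]
  by (auto simp: sym_mats_def)

lemma K_carrier: "i \<le> nu \<Longrightarrow> par_K U i \<in> carrier_mat (dim_u S) n"
  "i \<in> {1..nu} \<Longrightarrow> par_Kd U i \<in> carrier_mat (dim_u S) (dim_g S i * n)"
  using PiE_mem[OF unknowns_carrierD(6)[OF U], of i] PiE_mem[OF unknowns_carrierD(7)[OF U], of i] by auto

lemma Q_nonneg: "i \<in> {1..nu} \<Longrightarrow> v \<in> carrier_vec n \<Longrightarrow> 0 \<le> v \<bullet> (Q i *\<^sub>v v)"
  by (rule pos_def_block_nonneg[OF lmi_Q[unfolded diag_upto_def], of i n v]) (use QR(1) in auto)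

lemma R_nonneg: "i \<in> {1..nu} \<Longrightarrow> v \<in> carrier_vec n \<Longrightarrow> 0 \<le> v \<bullet> (R i *\<^sub>v v)"
  by (rule pos_def_block_nonneg[OF lmi_R[unfolded diag_upto_def], of i n v]) (use QR(2) in auto)

lemma PP_sym: "PP \<in> sym_mats (n + dn)"
proof -
  have "PP \<in> carrier_mat (n + dn) (n + dn)" using PQR by auto
  moreover have "transpose_mat PP = PP"
    using PQR by (subst transpose_four_block_mat[of _ n n _ dn _ dn]) auto
  ultimately show ?thesis by (simp add: sym_mats_def)
qed

lemma hv_carrier: "cont_seg y \<Longrightarrow> w \<in> carrier_vec q \<Longrightarrow> hv y w \<in> carrier_vec hdim"
  unfolding hist_eq using y0_carrier x_part_carrier h_part_carrier e_part_carrier by auto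

text \<open>The number of columns does not depend on the history, so it is read off at the zero
  history.\<close>

lemma row_carrier:
  assumes X: "\<And>i. i \<le> nu \<Longrightarrow> X i \<in> carrier_mat k n"
    and Y: "\<And>i. i \<in> {1..nu} \<Longrightarrow> Y i \<in> carrier_mat k (dim_g S i * n)" and D: "D \<in> carrier_mat k q"
  shows "big_row S k X Y D \<in> carrier_mat k hdim"
proof -
  have y: "cont_seg (\<lambda>_. 0\<^sub>v n)" by (simp add: cont_seg_def)
  have w: "0\<^sub>v q \<in> carrier_vec q" by simp
  have "big_row S k X Y D \<in> carrier_mat k (dim_vec (hv (\<lambda>_. 0\<^sub>v n) (0\<^sub>v q)))"
    using big_row_carrier(1)[of X k Y D q] X Y D y w by blast
  then show ?thesis using carrier_vecD[OF hv_carrier[OF y w]] by metis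
qed

lemma plantD:
  "i \<le> nu \<Longrightarrow> mat_A S i \<in> carrier_mat n n" "i \<le> nu \<Longrightarrow> mat_C S i \<in> carrier_mat m n"
  "mat_B S \<in> carrier_mat n (dim_u S)" "mat_Bz S \<in> carrier_mat m (dim_u S)"
  "mat_D1 S \<in> carrier_mat n q" "mat_D2 S \<in> carrier_mat m q"
  "i \<in> {1..nu} \<Longrightarrow> L2_mat (ivl i) n n (ker_A S i)" "i \<in> {1..nu} \<Longrightarrow> L2_mat (ivl i) m n (ker_C S i)"
  using plant by (auto simp: plant_data_def)

lemma big_carriers:
  "big_A S \<in> carrier_mat n hdim" "big_C S \<in> carrier_mat m hdim" "big_K S U \<in> carrier_mat (dim_u S) hdim"
  unfolding big_A_def big_C_def big_K_def by (intro row_carrier plantD kernelD K_carrier zero_carrier_mat; assumption)+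

lemma Omega_carrier: "mat_Omega S U \<in> carrier_mat n hdim"
  unfolding mat_Omega_def using big_carriers plantD(3) by auto

lemma Sigma_carrier: "mat_Sigma S U \<in> carrier_mat m hdim"
  unfolding mat_Sigma_def using big_carriers plantD(4) by auto

lemma supplyD:
  "sup_Jt S \<in> carrier_mat m m" "sup_J1 S \<in> carrier_mat m m" "minv (sup_J1 S) \<in> carrier_mat m m"
  "sup_J1 S * minv (sup_J1 S) = 1\<^sub>m m" "sup_J2 S \<in> carrier_mat m q" "sup_J3 S \<in> carrier_mat q q"
  "neg_semidef (transpose_mat (sup_Jt S) * minv (sup_J1 S) * sup_Jt S)"
proof -
  show J1: "sup_J1 S \<in> carrier_mat m m" using sup by (simp add: supply_data_def sym_mats_def)
  have "det (sup_J1 S) \<noteq> 0"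
    using sup invertible_mat_det_nonzero[OF J1] by (simp add: supply_data_def)
  from minv_props[OF J1 this] show "minv (sup_J1 S) \<in> carrier_mat m m" "sup_J1 S * minv (sup_J1 S) = 1\<^sub>m m" by auto
qed (use sup in \<open>auto simp: supply_data_def sym_mats_def\<close>)

text \<open>The last block of \<open>big_K\<close> is zero, so any \<open>w\<close> may be stacked
  below the history; this lets the controller share the vector of the plant.\<close>

lemma control_eq:
  assumes y: "cont_seg (\<lambda>\<tau>. x (t + \<tau>))" and w: "w \<in> carrier_vec q"
  shows "control S U x t = big_K S U *\<^sub>v hv (\<lambda>\<tau>. x (t + \<tau>)) w"
proof -
  have "delayed S (dim_u S) (par_K U) (dist_kernel S (par_Kd U)) x t + 0\<^sub>m (dim_u S) q *\<^sub>v w = big_K S U *\<^sub>v hv (\<lambda>\<tau>. x (t + \<tau>)) w"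
    unfolding big_K_def by (rule delayed_eq_big_row[OF K_carrier zero_carrier_mat _ _ y w]) auto
  moreover have "delayed S (dim_u S) (par_K U) (dist_kernel S (par_Kd U)) x t \<in> carrier_vec (dim_u S)"
    by (rule carrier_vecI) (rule dim_delayed)
  ultimately show ?thesis unfolding control_def using w by (simp add: zero_mult_vec)
qed

lemma rhs_eq:
  assumes y: "cont_seg (\<lambda>\<tau>. x (t + \<tau>))" and w: "w t \<in> carrier_vec q"
  shows "state_rhs S U x w t = mat_Omega S U *\<^sub>v hv (\<lambda>\<tau>. x (t + \<tau>)) (w t)"
    and "output_rhs S U x w t = mat_Sigma S U *\<^sub>v hv (\<lambda>\<tau>. x (t + \<tau>)) (w t)"
proof -
  let ?h = "hv (\<lambda>\<tau>. x (t + \<tau>)) (w t)"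
  have h: "?h \<in> carrier_vec hdim" by (rule hv_carrier[OF y w])
  have dA: "delayed S n (mat_A S) (ker_A S) x t + mat_D1 S *\<^sub>v w t = big_A S *\<^sub>v ?h"
    unfolding big_A_def
    by (rule delayed_eq_big_row[OF plantD(1) kernelD(7) plantD(5) kernelD(9) _ y w]) (auto intro: plantD(7))
  have dC: "delayed S m (mat_C S) (ker_C S) x t + mat_D2 S *\<^sub>v w t = big_C S *\<^sub>v ?h"
    unfolding big_C_def
    by (rule delayed_eq_big_row[OF plantD(2) kernelD(8) plantD(6) kernelD(10) _ y w]) (auto intro: plantD(8))
  have comm: "a + b + c = a + c + b" if "dim_vec b = dim_vec c" "dim_vec (a + c) = dim_vec c" for a b c :: "real vec"
    using that by (intro eq_vecI) auto
  note cu = control_eq[OF y w]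
  have "state_rhs S U x w t = (delayed S n (mat_A S) (ker_A S) x t + mat_D1 S *\<^sub>v w t) + mat_B S *\<^sub>v (big_K S U *\<^sub>v ?h)"
    unfolding state_rhs_def cu by (rule comm) (use plantD(3,5) in auto)
  also have "\<dots> = mat_Omega S U *\<^sub>v ?h"
    unfolding dA mat_Omega_def using big_carriers plantD(3) h
    by (simp add: add_mult_distrib_mat_vec[of _ n hdim] assoc_mult_mat_vec[of _ n "dim_u S" _ hdim])
  finally show "state_rhs S U x w t = mat_Omega S U *\<^sub>v ?h" .
  have "output_rhs S U x w t = (delayed S m (mat_C S) (ker_C S) x t + mat_D2 S *\<^sub>v w t) + mat_Bz S *\<^sub>v (big_K S U *\<^sub>v ?h)"
    unfolding output_rhs_def cu by (rule comm) (use plantD(4,6) in auto)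
  also have "\<dots> = mat_Sigma S U *\<^sub>v ?h"
    unfolding dC mat_Sigma_def using big_carriers plantD(4) h
    by (simp add: add_mult_distrib_mat_vec[of _ m hdim] assoc_mult_mat_vec[of _ m "dim_u S" _ hdim])
  finally show "output_rhs S U x w t = mat_Sigma S U *\<^sub>v ?h" .
qed

text \<open>The matrix inequality is tested at the history extended by the Schur variable, and
  \<open>c\<close> is its coercivity constant. The statement is about arbitrary windows
  \<open>y\<close>, not about trajectories, so it holds at every instant without reference to
  time.\<close>

lemma main_inequality:
  "\<exists>c>0. \<forall>y (w :: real vec). cont_seg y \<longrightarrow> w \<in> carrier_vec q \<longrightarrow>
     2 * ((PP *\<^sub>v ext y) \<bullet> ((mat_Omega S U *\<^sub>v hv y w) @\<^sub>v eta_deriv y)) + (\<Sum>i = 1..nu. quad_int_deriv i (Q i) (R i) y)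
       - supply_rate S (mat_Sigma S U *\<^sub>v hv y w) w \<le> - c * (hv y w \<bullet> hv y w)"
proof -
  let ?X = "Sy (transpose_mat (big_P S U) * big_Pi S U) + mat_Phi S P2 P3 Q R (mat_Sigma S U)"
  let ?Om = "mat_Omega S U" and ?Sg = "mat_Sigma S U"
  let ?b = "beta S * n"
  have b: "?b = n + nu * n + tot_h S * n + tot_phi S * n"
    unfolding beta_def tot_g_def tot_h_def tot_phi_def dim_g_def dim_h_def by (simp add: sum.distrib algebra_simps)
  obtain c where c: "c > 0" "\<And>v. v \<in> carrier_vec (dim_row (- ?X)) \<Longrightarrow> c * (v \<bullet> v) \<le> v \<bullet> (- ?X *\<^sub>v v)"
    using pos_def_coercive[OF lmi] by blast
  show ?thesis
  proof (intro exI[of _ c] conjI allI impI)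
    fix y and w :: "real vec" assume y: "cont_seg y" and w: "w \<in> carrier_vec q"
    let ?th = "hv y w" and ?e = "eta_deriv y" and ?eta = "eta y"
    define z where "z = ?Sg *\<^sub>v ?th"
    \<comment> \<open>The choice for which \<open>supply_schur\<close> returns the supply rate
      exactly, with equality instead of an estimate.\<close>
    define v where "v = - (minv (sup_J1 S) *\<^sub>v (sup_Jt S *\<^sub>v z))"
    have th: "?th \<in> carrier_vec hdim" by (rule hv_carrier[OF y w])
    have z: "z \<in> carrier_vec m" unfolding z_def using Sigma_carrier th by auto
    note schur = supply_schur[OF supplyD(1-6) z w, folded v_def]
    have Xi: "mat_Xi S Q R \<in> carrier_mat hdim hdim"
      using mat_Xi_form(1)[of y w Q R] y w supplyD(6) QR by blast
    note BF = block_form[OF PQR(1) PQR(3) PQR(4) I_hat_carrier big_M_mult(1)[OF y] Omega_carrier Sigma_carrier Xi supplyD(2)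
        supplyD(5) supplyD(1) y0_carrier[OF y] x_part_carrier[OF y] h_part_carrier[of y] e_part_carrier[of y] w schur(1) refl b,
        folded hist_eq[of y w] big_P_def[of S U] big_Pi_def[of S U], unfolded big_M_mult(2)[OF y] I_hat_mult[OF y]]
    have X: "?X \<in> carrier_mat (?b + q + m) (?b + q + m)"
      using BF(1) unfolding mat_Phi_def Let_def .
    let ?z = "?th @\<^sub>v v"
    have zc: "?z \<in> carrier_vec (?b + q + m)" by (rule BF(2))
    have form: "?z \<bullet> (?X *\<^sub>v ?z) = 2 * ((P1 *\<^sub>v y 0 + P2 *\<^sub>v ?eta) \<bullet> (?Om *\<^sub>v ?th))
      + 2 * (y 0 \<bullet> (P2 *\<^sub>v ?e) + ?eta \<bullet> (P3 *\<^sub>v ?e))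
      + 2 * (v \<bullet> (sup_Jt S *\<^sub>v z) - w \<bullet> (transpose_mat (sup_J2 S) *\<^sub>v z))
      + ?th \<bullet> (mat_Xi S Q R *\<^sub>v ?th) + v \<bullet> (sup_J1 S *\<^sub>v v)"
      using BF(3) unfolding mat_Phi_def Let_def z_def .
    have "dim_row (- ?X) = ?b + q + m" by (simp only: index_uminus_mat carrier_matD(1)[OF X])
    then have "c * (?z \<bullet> ?z) \<le> ?z \<bullet> (- ?X *\<^sub>v ?z)" by (intro c(2)) (simp only: zc)
    moreover have "?z \<bullet> (- ?X *\<^sub>v ?z) = - (?z \<bullet> (?X *\<^sub>v ?z))"
      by (rule scalar_prod_uminus_mat[OF X zc])
    moreover have "?z \<bullet> ?z = ?th \<bullet> ?th + v \<bullet> v" by (rule scalar_prod_append') auto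
    \<comment> \<open>Of the coercivity bound only the share of the history is kept.\<close>
    moreover have "0 \<le> c * (v \<bullet> v)" using c(1) scalar_prod_self_nonneg[of v] by simp
    ultimately have neg: "?z \<bullet> (?X *\<^sub>v ?z) \<le> - c * (?th \<bullet> ?th)" by (simp add: distrib_left)
    have Pe: "(PP *\<^sub>v ext y) \<bullet> ((?Om *\<^sub>v ?th) @\<^sub>v ?e) = (P1 *\<^sub>v y 0 + P2 *\<^sub>v ?eta) \<bullet> (?Om *\<^sub>v ?th)
      + (y 0 \<bullet> (P2 *\<^sub>v ?e) + ?eta \<bullet> (P3 *\<^sub>v ?e))"
    proof -
      note y0 = y0_carrier[OF y] and ec = eta_carrier(2)[of y] and etac = eta_carrier(1)[of y]
      have Omt: "?Om *\<^sub>v ?th \<in> carrier_vec n" using Omega_carrier th by auto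
      have P2t: "transpose_mat P2 \<in> carrier_mat dn n" using PQR(3) by simp
      have "PP *\<^sub>v ext y = (P1 *\<^sub>v y 0 + P2 *\<^sub>v ?eta) @\<^sub>v (transpose_mat P2 *\<^sub>v y 0 + P3 *\<^sub>v ?eta)"
        unfolding ext_append[OF y] by (rule four_block_mat_mult_vec[OF PQR(1) PQR(3) P2t PQR(4) y0 etac])
      then have "(PP *\<^sub>v ext y) \<bullet> ((?Om *\<^sub>v ?th) @\<^sub>v ?e) = (P1 *\<^sub>v y 0 + P2 *\<^sub>v ?eta) \<bullet> (?Om *\<^sub>v ?th) + (transpose_mat P2 *\<^sub>v y 0 + P3 *\<^sub>v ?eta) \<bullet> ?e"
        using PQR Omt Omega_carrier ec by (simp add: scalar_prod_append')
      also have "(transpose_mat P2 *\<^sub>v y 0 + P3 *\<^sub>v ?eta) \<bullet> ?e = (transpose_mat P2 *\<^sub>v y 0) \<bullet> ?e + (P3 *\<^sub>v ?eta) \<bullet> ?e"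
        by (rule add_scalar_prod_distrib) (use P2t PQR(4) y0 etac ec in auto)
      also have "(transpose_mat P2 *\<^sub>v y 0) \<bullet> ?e = y 0 \<bullet> (P2 *\<^sub>v ?e)"
        by (rule transpose_vec_mult_scalar[OF PQR(3) ec y0])
      also have "(P3 *\<^sub>v ?eta) \<bullet> ?e = ?eta \<bullet> (P3 *\<^sub>v ?e)"
        using transpose_vec_mult_scalar[OF PQR(4) ec etac] PQR(5) by simp
      finally show ?thesis .
    qed
    \<comment> \<open>Here Bessel's inequality enters, in the right direction: the energies carry a
      minus sign, so their lower bounds estimate the rate from above.\<close>
    have "(\<Sum>i = 1..nu. quad_int_deriv i (Q i) (R i) y) \<le> ?th \<bullet> (mat_Xi S Q R *\<^sub>v ?th) + w \<bullet> (sup_J3 S *\<^sub>v w)"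
    proof -
      have "(\<Sum>i = 1..nu. quad_int_deriv i (Q i) (R i) y) \<le> (\<Sum>i = 1..nu. y (- r (i - 1)) \<bullet> (Q i *\<^sub>v y (- r (i - 1))) + (r i - r (i - 1)) * (y (- r (i - 1)) \<bullet> (R i *\<^sub>v y (- r (i - 1))))
        - y (- r i) \<bullet> (Q i *\<^sub>v y (- r i))
        - intvec (ivl i) (dim_h S i) n (orth_h i) y \<bullet> ((1\<^sub>m (dim_h S i) \<otimes>\<^sub>k R i) *\<^sub>v intvec (ivl i) (dim_h S i) n (orth_h i) y)
        - intvec (ivl i) (dim_phi S i) n (orth_e i) y \<bullet> ((1\<^sub>m (dim_phi S i) \<otimes>\<^sub>k R i) *\<^sub>v intvec (ivl i) (dim_phi S i) n (orth_e i) y))"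
      proof (rule sum_mono)
        fix i assume i: "i \<in> {1..nu}"
        show "quad_int_deriv i (Q i) (R i) y \<le> y (- r (i - 1)) \<bullet> (Q i *\<^sub>v y (- r (i - 1))) + (r i - r (i - 1)) * (y (- r (i - 1)) \<bullet> (R i *\<^sub>v y (- r (i - 1))))
        - y (- r i) \<bullet> (Q i *\<^sub>v y (- r i))
        - intvec (ivl i) (dim_h S i) n (orth_h i) y \<bullet> ((1\<^sub>m (dim_h S i) \<otimes>\<^sub>k R i) *\<^sub>v intvec (ivl i) (dim_h S i) n (orth_h i) y)
        - intvec (ivl i) (dim_phi S i) n (orth_e i) y \<bullet> ((1\<^sub>m (dim_phi S i) \<otimes>\<^sub>k R i) *\<^sub>v intvec (ivl i) (dim_phi S i) n (orth_e i) y)"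
          unfolding quad_int_deriv_eq[OF i y QR(1)[OF i] QR(2)[OF i]]
          using bessel_h_e[OF i y QR(2)[OF i] R_nonneg[OF i]] by linarith
      qed
      then show ?thesis using mat_Xi_form(2)[of y w Q R] y w supplyD(6) QR by simp
    qed
    moreover have "supply_rate S z w = - (2 * (v \<bullet> (sup_Jt S *\<^sub>v z) - w \<bullet> (transpose_mat (sup_J2 S) *\<^sub>v z)) + v \<bullet> (sup_J1 S *\<^sub>v v) - w \<bullet> (sup_J3 S *\<^sub>v w))"
      unfolding schur(2) supply_rate_def by simp
    \<comment> \<open>The linear arithmetic of the combination, with the large terms abstracted; the
      contribution \<open>w'\<close> of the disturbance cancels.\<close>
    moreover have comb: "2 * pe + s - sr \<le> t" if "s \<le> x + w'" "sr = - (2 * v' + j - w')" "2 * a + 2 * b + 2 * v' + x + j \<le> t" "pe = a + b"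
      for pe s sr t x w' v' j a b :: real
      using that by simp
    ultimately have "2 * ((PP *\<^sub>v ext y) \<bullet> ((?Om *\<^sub>v ?th) @\<^sub>v ?e)) + (\<Sum>i = 1..nu. quad_int_deriv i (Q i) (R i) y)
       - supply_rate S z w \<le> - c * (?th \<bullet> ?th)"
      using comb[OF _ _ neg[unfolded form] Pe] by blast
    then show "2 * ((PP *\<^sub>v ext y) \<bullet> ((?Om *\<^sub>v ?th) @\<^sub>v ?e)) + (\<Sum>i = 1..nu. quad_int_deriv i (Q i) (R i) y)
       - supply_rate S (?Sg *\<^sub>v ?th) w \<le> - c * (?th \<bullet> ?th)"
      unfolding z_def .
  qed (use c in simp)
qed

end

section \<open>Smoothness of the functional\<close>

context delay_system
begin

abbreviation "CS \<equiv> C_space J n"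
abbreviation "snorm \<equiv> sup_norm J"

lemma J_eq: "J = {- r nu .. 0}"
  by (simp add: full_ivl_def)

lemma C_space_cont_seg: "\<phi> \<in> CS \<Longrightarrow> cont_seg \<phi>"
  by (auto simp: C_space_def cont_seg_def)

lemma vnorm_cont:
  assumes y: "cont_seg y"
  shows "continuous_on J (\<lambda>\<theta>. vnorm (y \<theta>))"
proof -
  have "continuous_on J (\<lambda>\<theta>. sqrt (\<Sum>c<n. y \<theta> $ c * y \<theta> $ c))"
    using y by (intro continuous_intros) (auto simp: cont_seg_def)
  then show ?thesis
    by (rule continuous_on_eq) (use carrier_vecD[OF cont_segD[OF y]] in \<open>simp add: vnorm_def scalar_prod_sum\<close>)
qed

lemma vnorm_le_snorm:
  assumes y: "cont_seg y" and t: "\<theta> \<in> J"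
  shows "vnorm (y \<theta>) \<le> snorm y"
proof -
  have "bdd_above ((\<lambda>\<theta>. vnorm (y \<theta>)) ` J)"
    using compact_imp_bounded[OF compact_continuous_image[OF vnorm_cont[OF y]]] unfolding J_eq
    by (auto intro: bounded_imp_bdd_above)
  then show ?thesis unfolding sup_norm_def by (rule cSUP_upper[OF t])
qed

lemma vnorm_nonneg: "0 \<le> vnorm v"
  by (simp add: vnorm_def scalar_prod_self_nonneg)

lemma vnorm_sq: "(vnorm v)\<^sup>2 = v \<bullet> v"
  by (simp add: vnorm_def scalar_prod_self_nonneg)

lemma snorm_nonneg: "cont_seg y \<Longrightarrow> 0 \<le> snorm y"
  using vnorm_le_snorm[OF _ zero_in_J] vnorm_nonneg order_trans by blast

lemma comp_le_snorm:
  assumes y: "cont_seg y" and t: "\<theta> \<in> J" and c: "c < n"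
  shows "\<bar>y \<theta> $ c\<bar> \<le> snorm y"
proof -
  have "(y \<theta> $ c)\<^sup>2 \<le> y \<theta> \<bullet> y \<theta>"
    using c carrier_vecD[OF cont_segD[OF y t]] by (intro sq_index_le_scalar_prod) simp
  then have "\<bar>y \<theta> $ c\<bar> \<le> vnorm (y \<theta>)"
    unfolding vnorm_def by (rule real_le_rsqrt[of "\<bar>_\<bar>", simplified])
  then show ?thesis using vnorm_le_snorm[OF y t] by linarith
qed

lemma C_add_index: "\<psi> \<in> CS \<Longrightarrow> \<theta> \<in> J \<Longrightarrow> c < n \<Longrightarrow> C_add J \<phi> \<psi> \<theta> $ c = \<phi> \<theta> $ c + \<psi> \<theta> $ c"
  using carrier_vecD[OF cont_segD[OF C_space_cont_seg]] by (simp add: C_add_def)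

lemma C_smult_index: "\<psi> \<in> CS \<Longrightarrow> \<theta> \<in> J \<Longrightarrow> c < n \<Longrightarrow> C_smult J a \<psi> \<theta> $ c = a * \<psi> \<theta> $ c"
  using carrier_vecD[OF cont_segD[OF C_space_cont_seg]] by (simp add: C_smult_def)

lemma C_add_closed:
  assumes "\<phi> \<in> CS" "\<psi> \<in> CS"
  shows "C_add J \<phi> \<psi> \<in> CS"
  unfolding C_space_def
proof (intro CollectI conjI allI impI)
  show "C_add J \<phi> \<psi> \<in> J \<rightarrow>\<^sub>E carrier_vec n" 
    unfolding C_add_def using add_carrier_vec[OF cont_segD[OF C_space_cont_seg[OF assms(1)]] cont_segD[OF C_space_cont_seg[OF assms(2)]]]
    by (intro restrict_PiE_iff[THEN iffD2] ballI)
  fix j assume "j < n"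
  then have "continuous_on J (\<lambda>\<theta>. \<phi> \<theta> $ j + \<psi> \<theta> $ j)"
    using assms by (intro continuous_intros) (auto simp: C_space_def)
  then show "continuous_on J (\<lambda>\<theta>. C_add J \<phi> \<psi> \<theta> $ j)"
    by (rule continuous_on_eq) (use C_add_index assms \<open>j < n\<close> in auto)
qed

lemma C_bounded_linear_eval:
  assumes "\<theta> \<in> J" "c < n"
  shows "C_bounded_linear J n (\<lambda>\<phi>. \<phi> \<theta> $ c)"
  unfolding C_bounded_linear_def
proof (intro conjI ballI allI)
  show "\<exists>b. \<forall>\<phi>\<in>CS. \<bar>\<phi> \<theta> $ c\<bar> \<le> b * snorm \<phi>"
    using comp_le_snorm[OF C_space_cont_seg] assms by (intro exI[of _ 1]) auto
qed (use assms C_add_index C_smult_index in auto)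

text \<open>The bound is the integral of the absolute value of \<open>g\<close>, so integrability of
  \<open>g\<close> suffices in the supremum norm.\<close>

lemma C_bounded_linear_integral:
  assumes i: "i \<in> {1..nu}" and c: "c < n" and g: "integrable (lebesgue_on (ivl i)) g"
    and gx: "\<And>\<phi>. \<phi> \<in> CS \<Longrightarrow> integrable (lebesgue_on (ivl i)) (\<lambda>\<tau>. g \<tau> * \<phi> \<tau> $ c)"
  shows "C_bounded_linear J n (\<lambda>\<phi>. \<integral>\<tau>. g \<tau> * \<phi> \<tau> $ c \<partial>lebesgue_on (ivl i))"
  unfolding C_bounded_linear_def
proof (intro conjI ballI allI)
  fix \<phi> \<psi> assume p: "\<phi> \<in> CS" "\<psi> \<in> CS"
  have "(\<integral>\<tau>. g \<tau> * C_add J \<phi> \<psi> \<tau> $ c \<partial>lebesgue_on (ivl i)) = (\<integral>\<tau>. g \<tau> * \<phi> \<tau> $ c + g \<tau> * \<psi> \<tau> $ c \<partial>lebesgue_on (ivl i))"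
    using ivl_subset[OF i] p c
    by (intro Bochner_Integration.integral_cong refl) (auto simp: C_add_index subset_iff distrib_left)
  then show "(\<integral>\<tau>. g \<tau> * C_add J \<phi> \<psi> \<tau> $ c \<partial>lebesgue_on (ivl i)) =
      (\<integral>\<tau>. g \<tau> * \<phi> \<tau> $ c \<partial>lebesgue_on (ivl i)) + (\<integral>\<tau>. g \<tau> * \<psi> \<tau> $ c \<partial>lebesgue_on (ivl i))"
    using gx[OF p(1)] gx[OF p(2)] by simp
next
  fix a \<phi> assume p: "\<phi> \<in> CS"
  have "(\<integral>\<tau>. g \<tau> * C_smult J a \<phi> \<tau> $ c \<partial>lebesgue_on (ivl i)) = (\<integral>\<tau>. a * (g \<tau> * \<phi> \<tau> $ c) \<partial>lebesgue_on (ivl i))"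
    using ivl_subset[OF i] p c
    by (intro Bochner_Integration.integral_cong refl) (auto simp: C_smult_index subset_iff)
  then show "(\<integral>\<tau>. g \<tau> * C_smult J a \<phi> \<tau> $ c \<partial>lebesgue_on (ivl i)) = a * (\<integral>\<tau>. g \<tau> * \<phi> \<tau> $ c \<partial>lebesgue_on (ivl i))"
    by simp
next
  show "\<exists>b. \<forall>\<phi>\<in>CS. \<bar>\<integral>\<tau>. g \<tau> * \<phi> \<tau> $ c \<partial>lebesgue_on (ivl i)\<bar> \<le> b * snorm \<phi>"
  proof (intro exI[of _ "\<integral>\<tau>. \<bar>g \<tau>\<bar> \<partial>lebesgue_on (ivl i)"] ballI)
    fix \<phi> assume p: "\<phi> \<in> CS"
    have "\<bar>\<integral>\<tau>. g \<tau> * \<phi> \<tau> $ c \<partial>lebesgue_on (ivl i)\<bar> \<le> snorm \<phi> * (\<integral>\<tau>. \<bar>g \<tau>\<bar> \<partial>lebesgue_on (ivl i))"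
      by (rule weighted_integral_bound[OF g _ gx[OF p]])
        (use comp_le_snorm[OF C_space_cont_seg[OF p]] ivl_subset[OF i] c in auto)
    then show "\<bar>\<integral>\<tau>. g \<tau> * \<phi> \<tau> $ c \<partial>lebesgue_on (ivl i)\<bar> \<le> (\<integral>\<tau>. \<bar>g \<tau>\<bar> \<partial>lebesgue_on (ivl i)) * snorm \<phi>"
      by (simp add: mult.commute)
  qed
qed

text \<open>The functional is the diagonal of such a form, and smoothness is inherited from
  bilinearity. Symmetry is not demanded, so each product in the functional can be split between the
  two arguments as it stands.\<close>

definition C_bilinear :: "((real \<Rightarrow> real vec) \<Rightarrow> (real \<Rightarrow> real vec) \<Rightarrow> real) \<Rightarrow> bool" where
  "C_bilinear b \<longleftrightarrow> (\<forall>\<phi>\<in>CS. C_bounded_linear J n (b \<phi>)) \<and> (\<forall>\<psi>\<in>CS. C_bounded_linear J n (\<lambda>\<phi>. b \<phi> \<psi>)) \<and>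
     (\<exists>B\<ge>0. \<forall>\<phi>\<in>CS. \<forall>\<psi>\<in>CS. \<bar>b \<phi> \<psi>\<bar> \<le> B * (snorm \<phi> * snorm \<psi>))"

lemma C_bounded_linear_add:
  assumes "C_bounded_linear J n f" "C_bounded_linear J n g"
  shows "C_bounded_linear J n (\<lambda>\<phi>. f \<phi> + g \<phi>)"
proof -
  obtain bf where bf: "\<And>\<phi>. \<phi> \<in> CS \<Longrightarrow> \<bar>f \<phi>\<bar> \<le> bf * snorm \<phi>"
    using assms(1) unfolding C_bounded_linear_def by blast
  obtain bg where bg: "\<And>\<phi>. \<phi> \<in> CS \<Longrightarrow> \<bar>g \<phi>\<bar> \<le> bg * snorm \<phi>"
    using assms(2) unfolding C_bounded_linear_def by blast
  have "\<bar>f \<phi> + g \<phi>\<bar> \<le> (bf + bg) * snorm \<phi>" if "\<phi> \<in> CS" for \<phi>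
    using bf[OF that] bg[OF that] by (simp add: distrib_right)
  then show ?thesis using assms unfolding C_bounded_linear_def by (auto simp: distrib_left)
qed

lemma C_bounded_linear_cmult:
  assumes "C_bounded_linear J n f"
  shows "C_bounded_linear J n (\<lambda>\<phi>. k * f \<phi>)"
proof -
  obtain bf where b: "\<And>\<phi>. \<phi> \<in> CS \<Longrightarrow> \<bar>f \<phi>\<bar> \<le> bf * snorm \<phi>"
    using assms unfolding C_bounded_linear_def by blast
  have "\<bar>k * f \<phi>\<bar> \<le> (\<bar>k\<bar> * bf) * snorm \<phi>" if "\<phi> \<in> CS" for \<phi>
    using mult_left_mono[OF b[OF that], of "\<bar>k\<bar>"] by (simp add: abs_mult mult.assoc)
  then show ?thesis using assms unfolding C_bounded_linear_def by (auto simp: distrib_left)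
qed

lemma C_bilinear_add:
  assumes "C_bilinear b" "C_bilinear b'"
  shows "C_bilinear (\<lambda>\<phi> \<psi>. b \<phi> \<psi> + b' \<phi> \<psi>)"
proof -
  obtain B where B: "B \<ge> 0" "\<And>\<phi> \<psi>. \<phi> \<in> CS \<Longrightarrow> \<psi> \<in> CS \<Longrightarrow> \<bar>b \<phi> \<psi>\<bar> \<le> B * (snorm \<phi> * snorm \<psi>)"
    using assms(1) unfolding C_bilinear_def by blast
  obtain B' where B': "B' \<ge> 0" "\<And>\<phi> \<psi>. \<phi> \<in> CS \<Longrightarrow> \<psi> \<in> CS \<Longrightarrow> \<bar>b' \<phi> \<psi>\<bar> \<le> B' * (snorm \<phi> * snorm \<psi>)"
    using assms(2) unfolding C_bilinear_def by blast
  have "\<bar>b \<phi> \<psi> + b' \<phi> \<psi>\<bar> \<le> (B + B') * (snorm \<phi> * snorm \<psi>)" if "\<phi> \<in> CS" "\<psi> \<in> CS" for \<phi> \<psi>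
    unfolding distrib_right by (rule order_trans[OF abs_triangle_ineq add_mono[OF B(2)[OF that] B'(2)[OF that]]])
  moreover have "B + B' \<ge> 0" using B(1) B'(1) by simp
  ultimately have "\<exists>B\<ge>0. \<forall>\<phi>\<in>CS. \<forall>\<psi>\<in>CS. \<bar>b \<phi> \<psi> + b' \<phi> \<psi>\<bar> \<le> B * (snorm \<phi> * snorm \<psi>)"
    by (intro exI[of _ "B + B'"]) simp
  moreover have "C_bounded_linear J n (\<lambda>\<psi>. b \<phi> \<psi> + b' \<phi> \<psi>)" "C_bounded_linear J n (\<lambda>\<psi>. b \<psi> \<phi> + b' \<psi> \<phi>)"
    if "\<phi> \<in> CS" for \<phi>
    using assms that unfolding C_bilinear_def by (auto intro: C_bounded_linear_add[of "b \<phi>" "b' \<phi>"]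
      C_bounded_linear_add[of "\<lambda>\<psi>. b \<psi> \<phi>" "\<lambda>\<psi>. b' \<psi> \<phi>"])
  ultimately show ?thesis unfolding C_bilinear_def by blast
qed

lemma C_bilinear_cmult:
  assumes "C_bilinear b"
  shows "C_bilinear (\<lambda>\<phi> \<psi>. k * b \<phi> \<psi>)"
proof -
  obtain B where B: "B \<ge> 0" "\<And>\<phi> \<psi>. \<phi> \<in> CS \<Longrightarrow> \<psi> \<in> CS \<Longrightarrow> \<bar>b \<phi> \<psi>\<bar> \<le> B * (snorm \<phi> * snorm \<psi>)"
    using assms unfolding C_bilinear_def by blast
  have "\<bar>k * b \<phi> \<psi>\<bar> \<le> (\<bar>k\<bar> * B) * (snorm \<phi> * snorm \<psi>)" if "\<phi> \<in> CS" "\<psi> \<in> CS" for \<phi> \<psi>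
    using mult_left_mono[OF B(2)[OF that], of "\<bar>k\<bar>"] by (simp add: abs_mult mult.assoc)
  moreover have "\<bar>k\<bar> * B \<ge> 0" using B(1) by simp
  ultimately have "\<exists>B\<ge>0. \<forall>\<phi>\<in>CS. \<forall>\<psi>\<in>CS. \<bar>k * b \<phi> \<psi>\<bar> \<le> B * (snorm \<phi> * snorm \<psi>)"
    by (intro exI[of _ "\<bar>k\<bar> * B"]) simp
  moreover have "C_bounded_linear J n (\<lambda>\<psi>. k * b \<phi> \<psi>)" "C_bounded_linear J n (\<lambda>\<psi>. k * b \<psi> \<phi>)"
    if "\<phi> \<in> CS" for \<phi>
    using assms that unfolding C_bilinear_def by (auto intro: C_bounded_linear_cmult[of "b \<phi>"]
      C_bounded_linear_cmult[of "\<lambda>\<psi>. b \<psi> \<phi>"])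
  ultimately show ?thesis unfolding C_bilinear_def by blast
qed

lemma C_bilinear_prod:
  assumes f: "C_bounded_linear J n f" and g: "C_bounded_linear J n g"
  shows "C_bilinear (\<lambda>\<phi> \<psi>. f \<phi> * g \<psi>)"
proof -
  obtain bf where bf: "\<And>\<phi>. \<phi> \<in> CS \<Longrightarrow> \<bar>f \<phi>\<bar> \<le> bf * snorm \<phi>"
    using assms(1) unfolding C_bounded_linear_def by blast
  obtain bg where bg: "\<And>\<phi>. \<phi> \<in> CS \<Longrightarrow> \<bar>g \<phi>\<bar> \<le> bg * snorm \<phi>"
    using assms(2) unfolding C_bounded_linear_def by blast
  have "\<bar>f \<phi> * g \<psi>\<bar> \<le> (\<bar>bf\<bar> * \<bar>bg\<bar>) * (snorm \<phi> * snorm \<psi>)" if p: "\<phi> \<in> CS" "\<psi> \<in> CS" for \<phi> \<psi>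
  proof -
    have s: "0 \<le> snorm \<phi>" "0 \<le> snorm \<psi>" using snorm_nonneg[OF C_space_cont_seg] p by auto
    have "\<bar>f \<phi>\<bar> \<le> \<bar>bf\<bar> * snorm \<phi>" "\<bar>g \<psi>\<bar> \<le> \<bar>bg\<bar> * snorm \<psi>"
      using bf[OF p(1)] bg[OF p(2)] mult_right_mono[OF abs_ge_self[of bf] s(1)] mult_right_mono[OF abs_ge_self[of bg] s(2)]
      by linarith+
    then have "\<bar>f \<phi>\<bar> * \<bar>g \<psi>\<bar> \<le> (\<bar>bf\<bar> * snorm \<phi>) * (\<bar>bg\<bar> * snorm \<psi>)" using s by (intro mult_mono) auto
    then show ?thesis by (simp add: abs_mult mult_ac)
  qed
  then have "\<exists>B\<ge>0. \<forall>\<phi>\<in>CS. \<forall>\<psi>\<in>CS. \<bar>f \<phi> * g \<psi>\<bar> \<le> B * (snorm \<phi> * snorm \<psi>)"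
    by (intro exI[of _ "\<bar>bf\<bar> * \<bar>bg\<bar>"]) auto
  moreover have "C_bounded_linear J n (\<lambda>\<phi>. f \<phi> * g \<psi>)" for \<psi>
    using C_bounded_linear_cmult[OF f, of "g \<psi>"] by (simp add: mult.commute)
  moreover have "C_bounded_linear J n (\<lambda>\<psi>. f \<phi> * g \<psi>)" for \<phi>
    by (rule C_bounded_linear_cmult[OF g])
  ultimately show ?thesis unfolding C_bilinear_def by blast
qed

lemma C_bilinear_zero: "C_bilinear (\<lambda>_ _. 0)"
  by (auto simp: C_bilinear_def C_bounded_linear_def intro!: exI[of _ 0])

lemma C_bilinear_sum:
  "finite I \<Longrightarrow> (\<And>i. i \<in> I \<Longrightarrow> C_bilinear (b i)) \<Longrightarrow> C_bilinear (\<lambda>\<phi> \<psi>. \<Sum>i\<in>I. b i \<phi> \<psi>)"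
  by (induction I rule: finite_induct) (auto intro: C_bilinear_zero C_bilinear_add)

lemma C_bilinear_integral:
  assumes i: "i \<in> {1..nu}" and c: "c < n" and d: "d < n" and w: "continuous_on (ivl i) w"
  shows "C_bilinear (\<lambda>\<phi> \<psi>. \<integral>\<tau>. w \<tau> * (\<phi> \<tau> $ c * \<psi> \<tau> $ d) \<partial>lebesgue_on (ivl i))"
proof -
  have cont: "continuous_on (ivl i) (\<lambda>\<tau>. \<phi> \<tau> $ k)" if "\<phi> \<in> CS" "k < n" for \<phi> k
    using C_space_cont_seg[OF that(1)] that(2) ivl_subset[OF i] unfolding cont_seg_def by (auto intro: continuous_on_subset)
  have int: "integrable (lebesgue_on (ivl i)) f" if "continuous_on (ivl i) f" for f :: "real \<Rightarrow> real"
    using that unfolding ivl_eq by (rule continuous_integrable_lebesgue_on)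
  have 1: "C_bounded_linear J n (\<lambda>\<psi>. \<integral>\<tau>. w \<tau> * (\<phi> \<tau> $ c * \<psi> \<tau> $ d) \<partial>lebesgue_on (ivl i))" if p: "\<phi> \<in> CS" for \<phi>
  proof -
    have "C_bounded_linear J n (\<lambda>\<psi>. \<integral>\<tau>. (w \<tau> * \<phi> \<tau> $ c) * \<psi> \<tau> $ d \<partial>lebesgue_on (ivl i))"
      by (rule C_bounded_linear_integral[OF i d]) (use p c d in \<open>auto intro!: int continuous_intros w cont\<close>)
    then show ?thesis by (simp add: mult_ac)
  qed
  have 2: "C_bounded_linear J n (\<lambda>\<phi>. \<integral>\<tau>. w \<tau> * (\<phi> \<tau> $ c * \<psi> \<tau> $ d) \<partial>lebesgue_on (ivl i))" if p: "\<psi> \<in> CS" for \<psi>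
  proof -
    have "C_bounded_linear J n (\<lambda>\<phi>. \<integral>\<tau>. (w \<tau> * \<psi> \<tau> $ d) * \<phi> \<tau> $ c \<partial>lebesgue_on (ivl i))"
      by (rule C_bounded_linear_integral[OF i c]) (use p c d in \<open>auto intro!: int continuous_intros w cont\<close>)
    then show ?thesis by (simp add: mult_ac)
  qed
  have "\<bar>\<integral>\<tau>. w \<tau> * (\<phi> \<tau> $ c * \<psi> \<tau> $ d) \<partial>lebesgue_on (ivl i)\<bar> \<le> (\<integral>\<tau>. \<bar>w \<tau>\<bar> \<partial>lebesgue_on (ivl i)) * (snorm \<phi> * snorm \<psi>)"
    if p: "\<phi> \<in> CS" "\<psi> \<in> CS" for \<phi> \<psi>
  proof -
    have "\<bar>\<phi> \<tau> $ c * \<psi> \<tau> $ d\<bar> \<le> snorm \<phi> * snorm \<psi>" if "\<tau> \<in> ivl i" for \<tau>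
      unfolding abs_mult using that ivl_subset[OF i] p c d
      by (intro mult_mono comp_le_snorm C_space_cont_seg snorm_nonneg) auto
    then have "\<bar>\<integral>\<tau>. w \<tau> * (\<phi> \<tau> $ c * \<psi> \<tau> $ d) \<partial>lebesgue_on (ivl i)\<bar> \<le> (snorm \<phi> * snorm \<psi>) * (\<integral>\<tau>. \<bar>w \<tau>\<bar> \<partial>lebesgue_on (ivl i))"
      by (intro weighted_integral_bound int w continuous_intros cont p c d)
    then show ?thesis by (simp add: mult.commute)
  qed
  then have "\<exists>B\<ge>0. \<forall>\<phi>\<in>CS. \<forall>\<psi>\<in>CS. \<bar>\<integral>\<tau>. w \<tau> * (\<phi> \<tau> $ c * \<psi> \<tau> $ d) \<partial>lebesgue_on (ivl i)\<bar> \<le> B * (snorm \<phi> * snorm \<psi>)"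
    by (intro exI[of _ "\<integral>\<tau>. \<bar>w \<tau>\<bar> \<partial>lebesgue_on (ivl i)"]) auto
  then show ?thesis unfolding C_bilinear_def using 1 2 by blast
qed

text \<open>The derivative at \<open>\<phi>\<close> is
  \<open>b \<phi> \<chi> + b \<chi> \<phi>\<close>, the remainder is \<open>b \<eta> \<eta>\<close>,
  and the derivative itself depends linearly on \<open>\<phi>\<close>; both conditions thus reduce
  to the bound on \<open>b\<close>.\<close>

lemma C1_functional_bilinear:
  assumes b: "C_bilinear b"
  shows "C1_functional J n (\<lambda>\<phi>. b \<phi> \<phi>)"
proof -
  obtain B where B: "B \<ge> 0" "\<And>\<phi> \<psi>. \<phi> \<in> CS \<Longrightarrow> \<psi> \<in> CS \<Longrightarrow> \<bar>b \<phi> \<psi>\<bar> \<le> B * (snorm \<phi> * snorm \<psi>)"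
    using b unfolding C_bilinear_def by blast
  have l: "\<And>\<phi>. \<phi> \<in> CS \<Longrightarrow> C_bounded_linear J n (b \<phi>)" "\<And>\<psi>. \<psi> \<in> CS \<Longrightarrow> C_bounded_linear J n (\<lambda>\<phi>. b \<phi> \<psi>)"
    using b unfolding C_bilinear_def by blast+
  have add: "b \<phi> (C_add J \<psi> \<chi>) = b \<phi> \<psi> + b \<phi> \<chi>" "b (C_add J \<psi> \<chi>) \<phi> = b \<psi> \<phi> + b \<chi> \<phi>"
    if "\<phi> \<in> CS" "\<psi> \<in> CS" "\<chi> \<in> CS" for \<phi> \<psi> \<chi>
    using l[OF that(1)] that unfolding C_bounded_linear_def by blast+
  \<comment> \<open>Half of \<open>e\<close> for each of the two terms of the derivative. The radius
    uses \<open>B + 1\<close> because \<open>B\<close> may be 0.\<close>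
  have small: "B * (snorm \<eta> * snorm \<chi>) \<le> e / 2 * snorm \<chi>"
    if "\<eta> \<in> CS" "\<chi> \<in> CS" "snorm \<eta> < e / (2 * (B + 1))" for \<eta> \<chi> and e :: real
  proof -
    have s: "0 \<le> snorm \<eta>" "0 \<le> snorm \<chi>" using snorm_nonneg[OF C_space_cont_seg] that by auto
    have "B * snorm \<eta> \<le> (B + 1) * snorm \<eta>" using s by (intro mult_right_mono) auto
    also have "\<dots> \<le> (B + 1) * (e / (2 * (B + 1)))" using that B(1) by (intro mult_left_mono) auto
    also have "\<dots> = e / 2" using B(1) by (simp add: field_simps)
    finally have "B * snorm \<eta> * snorm \<chi> \<le> e / 2 * snorm \<chi>" using s by (intro mult_right_mono)
    then show ?thesis by (simp add: mult.assoc)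
  qed
  show ?thesis unfolding C1_functional_def
  proof (intro exI[of _ "\<lambda>\<phi> \<chi>. b \<phi> \<chi> + b \<chi> \<phi>"] ballI conjI allI impI)
    fix \<phi> assume p: "\<phi> \<in> CS"
    show "C_bounded_linear J n (\<lambda>\<chi>. b \<phi> \<chi> + b \<chi> \<phi>)" by (intro C_bounded_linear_add l p)
    fix e :: real assume "e > 0"
    then have d: "e / (2 * (B + 1)) > 0" using B(1) by simp
    show "\<exists>\<delta>>0. \<forall>\<eta>\<in>CS. snorm \<eta> < \<delta> \<longrightarrow> \<bar>b (C_add J \<phi> \<eta>) (C_add J \<phi> \<eta>) - b \<phi> \<phi> - (b \<phi> \<eta> + b \<eta> \<phi>)\<bar> \<le> e * snorm \<eta>"
    proof (intro exI[of _ "e / (2 * (B + 1))"] conjI ballI impI d)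
      fix \<eta> assume h: "\<eta> \<in> CS" "snorm \<eta> < e / (2 * (B + 1))"
      have "b (C_add J \<phi> \<eta>) (C_add J \<phi> \<eta>) - b \<phi> \<phi> - (b \<phi> \<eta> + b \<eta> \<phi>) = b \<eta> \<eta>"
        using add[OF C_add_closed[OF p h(1)] p h(1)] add[OF p p h(1)] add[OF h(1) p h(1)] by simp
      moreover have "\<bar>b \<eta> \<eta>\<bar> \<le> e / 2 * snorm \<eta>" using B(2)[OF h(1) h(1)] small[OF h(1) h(1) h(2)] by linarith
      moreover have "0 \<le> e * snorm \<eta>" using \<open>e > 0\<close> snorm_nonneg[OF C_space_cont_seg[OF h(1)]] by simp
      ultimately show "\<bar>b (C_add J \<phi> \<eta>) (C_add J \<phi> \<eta>) - b \<phi> \<phi> - (b \<phi> \<eta> + b \<eta> \<phi>)\<bar> \<le> e * snorm \<eta>" by simp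
    qed
    show "\<exists>\<delta>>0. \<forall>\<eta>\<in>CS. snorm \<eta> < \<delta> \<longrightarrow> (\<forall>\<chi>\<in>CS. \<bar>b (C_add J \<phi> \<eta>) \<chi> + b \<chi> (C_add J \<phi> \<eta>) - (b \<phi> \<chi> + b \<chi> \<phi>)\<bar> \<le> e * snorm \<chi>)"
    proof (intro exI[of _ "e / (2 * (B + 1))"] conjI ballI impI d)
      fix \<eta> \<chi> assume h: "\<eta> \<in> CS" "snorm \<eta> < e / (2 * (B + 1))" and c: "\<chi> \<in> CS"
      have "b (C_add J \<phi> \<eta>) \<chi> + b \<chi> (C_add J \<phi> \<eta>) - (b \<phi> \<chi> + b \<chi> \<phi>) = b \<eta> \<chi> + b \<chi> \<eta>"
        using add[OF c p h(1)] by simp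
      moreover have "\<bar>b \<eta> \<chi>\<bar> \<le> e / 2 * snorm \<chi>" "\<bar>b \<chi> \<eta>\<bar> \<le> e / 2 * snorm \<chi>"
        using B(2)[OF h(1) c] B(2)[OF c h(1)] small[OF h(1) c h(2)] by (simp_all add: mult.commute mult.left_commute)
      ultimately show "\<bar>b (C_add J \<phi> \<eta>) \<chi> + b \<chi> (C_add J \<phi> \<eta>) - (b \<phi> \<chi> + b \<chi> \<phi>)\<bar> \<le> e * snorm \<chi>"
        by simp
    qed
  qed
qed

lemma ext_bounded_linear: "comps (\<lambda>f _. C_bounded_linear J n f) ext (0\<^sub>v (n + tot_f S * n))"
proof -
  have e0: "comps (\<lambda>f _. C_bounded_linear J n f) (\<lambda>y. vec n (\<lambda>c. y 0 $ c)) (0\<^sub>v n)"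
    using C_bounded_linear_eval[OF zero_in_J] by (auto simp: comps_def)
  \<comment> \<open>The last argument only supplies the dimension.\<close>
  have "comps (\<lambda>f _. C_bounded_linear J n f) eta (eta (\<lambda>_. 0\<^sub>v n))"
    unfolding eta_def intvec_def
  proof (intro comps_vstack comps_kvec)
    fix i a c assume "i \<in> set idx" and a: "a < dim_f S i" and c: "c < n"
    then have i: "i \<in> {1..nu}" by auto
    have L: "L2_on (ivl i) (\<lambda>\<tau>. orth_f i \<tau> $ a)" using L2_orth_f[OF i] a by (simp add: L2_vec_def)
    show "C_bounded_linear J n (\<lambda>y. \<integral>\<tau>. orth_f i \<tau> $ a * y \<tau> $ c \<partial>lebesgue_on (ivl i))"
    proof (rule C_bounded_linear_integral[OF i c])
      show "integrable (lebesgue_on (ivl i)) (\<lambda>\<tau>. orth_f i \<tau> $ a)"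
        using L unfolding ivl_eq by (rule L2_on_integrable)
      show "integrable (lebesgue_on (ivl i)) (\<lambda>\<tau>. orth_f i \<tau> $ a * \<phi> \<tau> $ c)" if "\<phi> \<in> CS" for \<phi>
        by (rule L2_on_mult_integrable[OF L cont_seg_L2[OF C_space_cont_seg[OF that] i c]])
    qed
  qed
  from comps_append[OF e0 this] show ?thesis unfolding ext_def comps_def by simp
qed

lemma lyap_C_bilinear:
  assumes P: "P \<in> carrier_mat (n + tot_f S * n) (n + tot_f S * n)"
  shows "\<exists>b. C_bilinear b \<and> lyap P Q R = (\<lambda>\<phi>. b \<phi> \<phi>)"
proof -
  let ?N = "n + tot_f S * n"
  have L: "C_bounded_linear J n (\<lambda>y. ext y $ j)" if "j < ?N" for j
    using ext_bounded_linear that by (auto simp: comps_def)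
  have ec: "ext y \<in> carrier_vec ?N" for y by (rule carrier_vecI) simp
  let ?b = "\<lambda>y z. (\<Sum>a<?N. \<Sum>b<?N. P $$ (a, b) * (ext y $ a * ext z $ b)) +
     (\<Sum>i = 1..nu. \<Sum>c<n. \<Sum>d<n. Q i $$ (c, d) * (\<integral>\<tau>. 1 * (y \<tau> $ c * z \<tau> $ d) \<partial>lebesgue_on (ivl i))
     + R i $$ (c, d) * (\<integral>\<tau>. (\<tau> + r i) * (y \<tau> $ c * z \<tau> $ d) \<partial>lebesgue_on (ivl i)))"
  have "lyap P Q R = (\<lambda>y. ?b y y)"
    unfolding lyap_def quad_int_def quadratic_form_sum[OF P ec ec] ..
  moreover have "C_bilinear ?b"
    by (intro C_bilinear_add C_bilinear_sum C_bilinear_cmult C_bilinear_prod L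
        C_bilinear_integral continuous_intros) auto
  ultimately show ?thesis by blast
qed

lemma lyap_C1:
  assumes "P \<in> carrier_mat (n + tot_f S * n) (n + tot_f S * n)"
  shows "C1_functional J n (lyap P Q R)"
  using lyap_C_bilinear[OF assms, of Q R] C1_functional_bilinear by auto

text \<open>Estimates the initial value of the functional by the supremum norm in which exponential
  stability is measured.\<close>

lemma lyap_snorm_bound:
  assumes "P \<in> carrier_mat (n + tot_f S * n) (n + tot_f S * n)"
  shows "\<exists>B\<ge>0. \<forall>\<phi>\<in>CS. \<bar>lyap P Q R \<phi>\<bar> \<le> B * (snorm \<phi>)\<^sup>2"
  using lyap_C_bilinear[OF assms, of Q R] unfolding C_bilinear_def power2_eq_square by metis

end

section \<open>Dissipativity\<close>

text \<open>Translates almost everywhere statements into the negligible sets of the gauge argument.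
  Completeness of Lebesgue measure dispenses with measurability of \<open>P\<close>.\<close>

lemma AE_lebesgue_on_iff_negligible:
  assumes "X \<in> sets lebesgue"
  shows "(AE t in lebesgue_on X. P t) \<longleftrightarrow> negligible {t \<in> X. \<not> P t}"
proof -
  have "(AE t in lebesgue_on X. P t) \<longleftrightarrow> (AE t in lebesgue. t \<in> X \<longrightarrow> P t)"
    using assms by (intro AE_restrict_space_iff) simp
  also have "\<dots> \<longleftrightarrow> {t \<in> X. \<not> P t} \<in> null_sets lebesgue"
    unfolding completion.AE_iff_null_sets by simp
  finally show ?thesis by (simp add: negligible_iff_null_sets)
qed

lemma abs_cont_on_cong:
  assumes fg: "\<And>s. s \<in> {a..b} \<Longrightarrow> f s = g s" and f: "abs_cont_on a b f"
  shows "abs_cont_on a b g"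
  unfolding abs_cont_on_def
proof (intro allI impI)
  fix e :: real assume "e > 0"
  then obtain \<delta> where \<delta>: "\<delta> > 0" "\<And>D. finite D \<Longrightarrow>
     (\<forall>(u, v) \<in> D. a \<le> u \<and> u \<le> v \<and> v \<le> b) \<Longrightarrow>
     pairwise (\<lambda>(u, v) (u', v'). v \<le> u' \<or> v' \<le> u) D \<Longrightarrow>
     (\<Sum>(u, v) \<in> D. v - u) < \<delta> \<Longrightarrow> (\<Sum>(u, v) \<in> D. \<bar>f v - f u\<bar>) < e"
    using f unfolding abs_cont_on_def by meson
  show "\<exists>\<delta>>0. \<forall>D. finite D \<and> (\<forall>(u, v)\<in>D. a \<le> u \<and> u \<le> v \<and> v \<le> b) \<and>
     pairwise (\<lambda>(u, v) (u', v'). v \<le> u' \<or> v' \<le> u) D \<and> (\<Sum>(u, v)\<in>D. v - u) < \<delta> \<longrightarrow>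
     (\<Sum>(u, v)\<in>D. \<bar>g v - g u\<bar>) < e"
  proof (intro exI[of _ \<delta>] conjI allI impI \<delta>(1))
    fix D assume D: "finite D \<and> (\<forall>(u, v)\<in>D. a \<le> u \<and> u \<le> v \<and> v \<le> b) \<and>
     pairwise (\<lambda>(u, v) (u', v'). v \<le> u' \<or> v' \<le> u) D \<and> (\<Sum>(u, v)\<in>D. v - u) < \<delta>"
    have "(\<Sum>(u, v) \<in> D. \<bar>g v - g u\<bar>) = (\<Sum>(u, v) \<in> D. \<bar>f v - f u\<bar>)"
      using D by (intro sum.cong refl) (auto simp: fg)
    also have "\<dots> < e" using D by (intro \<delta>(2)) auto
    finally show "(\<Sum>(u, v)\<in>D. \<bar>g v - g u\<bar>) < e" .
  qed
qed

context delay_system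
begin

abbreviation "t0 \<equiv> init_time S"

section \<open>Dependence on the history through its values on \<open>J\<close>\<close>

lemma intvec_ivl_cong:
  assumes "\<And>\<theta>. \<theta> \<in> J \<Longrightarrow> y \<theta> = y' \<theta>" "i \<in> {1..nu}"
  shows "intvec (ivl i) k n E y = intvec (ivl i) k n E y'"
  by (rule intvec_cong) (use assms ivl_subset in blast)+

lemma ext_cong:
  assumes y: "\<And>\<theta>. \<theta> \<in> J \<Longrightarrow> y \<theta> = y' \<theta>"
  shows "ext y = ext y'"
proof -
  have "eta y = eta y'" unfolding eta_def
    by (intro arg_cong[where f=vstack] map_cong refl intvec_ivl_cong y) auto
  then show ?thesis using y[OF zero_in_J] by (simp add: ext_def)
qed

lemma integral_ivl_cong:
  fixes f :: "real \<Rightarrow> real vec \<Rightarrow> real"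
  assumes "\<And>\<theta>. \<theta> \<in> J \<Longrightarrow> y \<theta> = y' \<theta>" "i \<in> {1..nu}"
  shows "(\<integral>\<tau>. f \<tau> (y \<tau>) \<partial>lebesgue_on (ivl i)) = (\<integral>\<tau>. f \<tau> (y' \<tau>) \<partial>lebesgue_on (ivl i))"
  using assms ivl_subset[OF assms(2)] by (intro Bochner_Integration.integral_cong refl) (auto simp: subset_iff)

lemma eta_deriv_cong:
  assumes y: "\<And>\<theta>. \<theta> \<in> J \<Longrightarrow> y \<theta> = y' \<theta>"
  shows "eta_deriv y = eta_deriv y'"
  unfolding eta_deriv_def
proof (intro arg_cong[where f=vstack] map_cong refl kvec_cong)
  fix i a c assume "i \<in> set idx"
  then have i: "i \<in> {1..nu}" by auto
  then have "y (- r (i - 1)) = y' (- r (i - 1))" "y (- r i) = y' (- r i)" by (auto intro!: y minus_r_in_J)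
  then show "orth_f i (- r (i - 1)) $ a * y (- r (i - 1)) $ c - orth_f i (- r i) $ a * y (- r i) $ c
     - (\<integral>\<tau>. (mat_N i *\<^sub>v orth_h i \<tau>) $ a * y \<tau> $ c \<partial>lebesgue_on (ivl i)) =
     orth_f i (- r (i - 1)) $ a * y' (- r (i - 1)) $ c - orth_f i (- r i) $ a * y' (- r i) $ c
     - (\<integral>\<tau>. (mat_N i *\<^sub>v orth_h i \<tau>) $ a * y' \<tau> $ c \<partial>lebesgue_on (ivl i))"
    using integral_ivl_cong[of y y' i "\<lambda>\<tau> v. (mat_N i *\<^sub>v orth_h i \<tau>) $ a * v $ c", OF y i] by simp
qed

lemma quad_int_deriv_cong:
  assumes i: "i \<in> {1..nu}" and y: "\<And>\<theta>. \<theta> \<in> J \<Longrightarrow> y \<theta> = y' \<theta>"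
  shows "quad_int_deriv i Q R y = quad_int_deriv i Q R y'"
proof -
  have "y (- r (i - 1)) = y' (- r (i - 1))" "y (- r i) = y' (- r i)" using i by (auto intro!: y minus_r_in_J)
  moreover have "(\<integral>\<tau>. y \<tau> $ c * y \<tau> $ d \<partial>lebesgue_on (ivl i)) = (\<integral>\<tau>. y' \<tau> $ c * y' \<tau> $ d \<partial>lebesgue_on (ivl i))" for c d
    by (rule integral_ivl_cong[where f="\<lambda>_ v. v $ c * v $ d", OF y i])
  ultimately show ?thesis unfolding quad_int_deriv_def by simp
qed

lemma lyap_cong:
  assumes y: "\<And>\<theta>. \<theta> \<in> J \<Longrightarrow> y \<theta> = y' \<theta>"
  shows "lyap P Q R y = lyap P Q R y'"
proof -
  have "quad_int i (Q i) (R i) y = quad_int i (Q i) (R i) y'" if "i \<in> {1..nu}" for i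
  proof -
    have "(\<integral>\<tau>. g \<tau> * (y \<tau> $ c * y \<tau> $ d) \<partial>lebesgue_on (ivl i)) = (\<integral>\<tau>. g \<tau> * (y' \<tau> $ c * y' \<tau> $ d) \<partial>lebesgue_on (ivl i))" for g c d
      by (rule integral_ivl_cong[where f="\<lambda>\<tau> v. g \<tau> * (v $ c * v $ d)", OF y that])
    then show ?thesis unfolding quad_int_def by (simp only:)
  qed
  then show ?thesis using ext_cong[of y y', OF y] unfolding lyap_def by simp
qed

lemma lyap_segment: "lyap P Q R (segment J x t) = lyap P Q R (\<lambda>\<tau>. x (t + \<tau>))"
  by (rule lyap_cong) (simp add: segment_def)

section \<open>Trajectories and their windows\<close>

lemma solution_carrier:
  assumes sol: "is_solution S U \<psi> w x" and t: "t0 - r nu \<le> t"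
  shows "x t \<in> carrier_vec n"
proof (cases "t0 \<le> t")
  case True
  then show ?thesis using sol by (simp add: is_solution_def)
next
  case False
  then have "t - t0 \<in> J" using t by (simp add: J_eq)
  then have "x (t0 + (t - t0)) = \<psi> (t - t0)" "\<psi> (t - t0) \<in> carrier_vec n"
    using sol cont_segD[OF C_space_cont_seg] unfolding is_solution_def by blast+
  then show ?thesis by simp
qed

text \<open>A trajectory is specified from \<open>t0 - r\<close> on only; it is continued by a constant to the left,
  because the functional is differentiated along functions continuous on the whole line.\<close>

lemma solution_continuous:
  assumes sol: "is_solution S U \<psi> w x" and c: "c < n"
  shows "continuous_on UNIV (\<lambda>s. x (max s (t0 - r nu)) $ c)"
proof -
  have "isCont (\<lambda>s. x (max s (t0 - r nu)) $ c) t" for t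
  proof -
    \<comment> \<open>Beyond \<open>t\<close>, so that \<open>t\<close> is interior, and beyond
      \<open>t0\<close>, so that the absolutely continuous piece is available up to
      \<open>T\<close>.\<close>
    define T where "T = max t t0 + 1"
    have T: "t < T" "t0 \<le> T" by (auto simp: T_def)
    have "continuous_on J (\<lambda>\<theta>. \<psi> \<theta> $ c)" using sol c by (simp add: is_solution_def C_space_def)
    then have "continuous_on {t0 - r nu..t0} (\<lambda>s. \<psi> (s - t0) $ c)"
      by (rule continuous_on_compose2[where f="\<lambda>s. s - t0"]) (auto simp: J_eq intro!: continuous_intros)
    moreover have "\<psi> (s - t0) = x s" if "s \<in> {t0 - r nu..t0}" for s
    proof -
      have "s - t0 \<in> J" using that by (simp add: J_eq)
      then have "x (t0 + (s - t0)) = \<psi> (s - t0)" using sol unfolding is_solution_def by blast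
      then show ?thesis by simp
    qed
    ultimately have 1: "continuous_on {t0 - r nu..t0} (\<lambda>s. x s $ c)" by (auto intro: continuous_on_eq)
    have "abs_cont_on t0 T (\<lambda>s. x s $ c)" using sol c T by (simp add: is_solution_def)
    then have 2: "continuous_on {t0..T} (\<lambda>s. x s $ c)" by (rule abs_cont_on_imp_continuous_on)
    \<comment> \<open>Two closed pieces sharing the point \<open>t0\<close>: on the left
      \<open>x\<close> is the initial function, on the right it is absolutely continuous.\<close>
    have "{t0 - r nu..T} = {t0 - r nu..t0} \<union> {t0..T}" using r_nu_pos T by auto
    then have "continuous_on {t0 - r nu..T} (\<lambda>s. x s $ c)" using continuous_on_closed_Un[OF _ _ 1 2] by simp
    then have "continuous_on {..T} (\<lambda>s. x (max s (t0 - r nu)) $ c)"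
      by (rule continuous_on_compose2[where f="\<lambda>s. max s (t0 - r nu)"]) (use T r_nu_pos in \<open>auto intro!: continuous_intros\<close>)
    moreover have "t \<in> interior {..T}" using T by simp
    ultimately show ?thesis by (rule continuous_on_interior)
  qed
  then show ?thesis by (simp add: continuous_at_imp_continuous_on)
qed

lemma solution_seg:
  assumes sol: "is_solution S U \<psi> w x" and t: "t0 \<le> t"
  shows "cont_seg (\<lambda>\<tau>. x (t + \<tau>))"
  unfolding cont_seg_def
proof (intro conjI ballI allI impI)
  fix \<theta> assume "\<theta> \<in> J"
  then show "x (t + \<theta>) \<in> carrier_vec n" using t by (intro solution_carrier[OF sol]) (simp add: J_eq)
next
  fix c assume "c < n"
  then have "continuous_on J (\<lambda>\<tau>. x (max (t + \<tau>) (t0 - r nu)) $ c)"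
    by (intro continuous_on_compose2[OF solution_continuous[OF sol]] continuous_intros) auto
  then show "continuous_on J (\<lambda>\<tau>. x (t + \<tau>) $ c)"
    by (rule continuous_on_eq) (use t in \<open>auto simp: J_eq max_def intro!: arg_cong[where f="\<lambda>s. x s $ c"]\<close>)
qed

text \<open>From \<open>t0\<close> on, a window never reaches left of \<open>t0 - r nu\<close>, so
  the functional does not see the constant continuation.\<close>

lemma lyap_clip:
  assumes "t0 \<le> t"
  shows "lyap P Q R (\<lambda>\<tau>. x (max (t + \<tau>) (t0 - r nu))) = lyap P Q R (\<lambda>\<tau>. x (t + \<tau>))"
  by (rule lyap_cong) (use assms in \<open>auto simp: J_eq max_def intro!: arg_cong[where f=x]\<close>)

lemma solution_abs_cont:
  assumes sol: "is_solution S U \<psi> w x" and P: "P \<in> sym_mats (n + tot_f S * n)" and T: "t0 \<le> T"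
  shows "abs_cont_on t0 T (\<lambda>s. lyap P Q R (\<lambda>\<tau>. x (max (s + \<tau>) (t0 - r nu))))"
proof (rule lyap_abs_cont[OF solution_continuous[OF sol] P])
  fix c assume "c < n"
  then have "abs_cont_on t0 T (\<lambda>s. x s $ c)" using sol T by (simp add: is_solution_def)
  then show "abs_cont_on t0 T (\<lambda>s. x (max s (t0 - r nu)) $ c)"
    by (rule abs_cont_on_cong[rotated]) (use r_nu_pos in simp)
qed

end

context dissipative_lmi
begin

text \<open>The right-hand side of the closed loop replaces the derivative of the state.
  \<open>R'\<close> is a parameter because stability uses the shifted weights while
  \<open>PP\<close> and \<open>Q\<close> stay the same.\<close>

abbreviation "lyap_rate R' y w \<equiv> 2 * ((PP *\<^sub>v ext y) \<bullet> ((mat_Omega S U *\<^sub>v hv y w) @\<^sub>v eta_deriv y)) + (\<Sum>i = 1..nu. quad_int_deriv i (Q i) (R' i) y)"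

text \<open>The exceptional set depends on the trajectory only, not on \<open>R'\<close>. The
  continued trajectory is the version fit for the monotonicity argument, the segment the one in the
  definition of dissipativity.\<close>

lemma solution_lyap_derivative:
  assumes sol: "is_solution S U \<psi> w x"
  shows "\<exists>N. negligible N \<and> (\<forall>t\<ge>t0. t \<notin> N \<longrightarrow> (\<forall>R'.
     ((\<lambda>s. lyap PP Q R' (\<lambda>\<tau>. x (max (s + \<tau>) (t0 - r nu)))) has_real_derivative lyap_rate R' (\<lambda>\<tau>. x (t + \<tau>)) (w t)) (at t) \<and>
     ((\<lambda>s. lyap PP Q R' (segment J x s)) has_real_derivative lyap_rate R' (\<lambda>\<tau>. x (t + \<tau>)) (w t)) (at t)))"
proof -
  let ?xe = "\<lambda>s. x (max s (t0 - r nu))"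
  \<comment> \<open>\<open>t0\<close> is excluded too: the functionals of \<open>x\<close> and of
    its continuation are known to agree only for times from \<open>t0\<close> on, which is a
    neighbourhood of \<open>t\<close> just for later \<open>t\<close>.\<close>
  let ?N = "insert t0 {t \<in> {t0..}. \<not> (\<forall>j<n. ((\<lambda>s. x s $ j) has_real_derivative state_rhs S U x w t $ j) (at t))}"
  have "AE t in lebesgue_on {t0..}. \<forall>j<n. ((\<lambda>s. x s $ j) has_real_derivative state_rhs S U x w t $ j) (at t)"
    using sol by (simp add: is_solution_def)
  then have N: "negligible ?N"
    by (subst (asm) AE_lebesgue_on_iff_negligible) (simp_all add: negligible_insert)
  have D: "((\<lambda>s. lyap PP Q R' (\<lambda>\<tau>. ?xe (s + \<tau>))) has_real_derivative lyap_rate R' (\<lambda>\<tau>. x (t + \<tau>)) (w t)) (at t)"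
    if "t0 \<le> t" "t \<notin> ?N" for t R'
  proof -
    have t: "t0 < t" using that by auto
    let ?y = "\<lambda>\<tau>. x (t + \<tau>)"
    have y: "cont_seg ?y" by (rule solution_seg[OF sol that(1)])
    have w: "w t \<in> carrier_vec q" using sol that(1) by (simp add: is_solution_def L2_vec_def)
    have rhs: "state_rhs S U x w t = mat_Omega S U *\<^sub>v hv ?y (w t)" by (rule rhs_eq(1)[of x t w, OF y w])
    have d: "((\<lambda>s. ?xe s $ j) has_real_derivative state_rhs S U x w t $ j) (at t)" if "j < n" for j
    proof -
      have "((\<lambda>s. x s $ j) has_real_derivative state_rhs S U x w t $ j) (at t)"
        using \<open>t \<notin> ?N\<close> t that by auto
      then show ?thesis
        by (rule has_field_derivative_transform_within_open[of _ _ _ "{t0<..}"]) (use t r_nu_pos in auto)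
    qed
    have dim: "dim_vec (state_rhs S U x w t) = n" unfolding rhs using Omega_carrier by simp
    have "((\<lambda>s. lyap PP Q R' (\<lambda>\<tau>. ?xe (s + \<tau>))) has_real_derivative
        2 * ((PP *\<^sub>v ext (\<lambda>\<tau>. ?xe (t + \<tau>))) \<bullet> (state_rhs S U x w t @\<^sub>v eta_deriv (\<lambda>\<tau>. ?xe (t + \<tau>)))) +
        (\<Sum>i = 1..nu. quad_int_deriv i (Q i) (R' i) (\<lambda>\<tau>. ?xe (t + \<tau>)))) (at t)"
      by (rule lyap_derivative[OF solution_continuous[OF sol] PP_sym dim d])
    moreover have Jeq: "?xe (t + \<theta>) = x (t + \<theta>)" if "\<theta> \<in> J" for \<theta>
      using t that by (auto simp: J_eq max_def intro!: arg_cong[where f=x])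
    ultimately show ?thesis
      unfolding rhs using ext_cong[OF Jeq] eta_deriv_cong[OF Jeq] quad_int_deriv_cong[OF _ Jeq] by simp
  qed
  show ?thesis
  proof (intro exI[of _ ?N] conjI allI impI N D)
    fix t R' assume t: "t0 \<le> t" "t \<notin> ?N"
    show "((\<lambda>s. lyap PP Q R' (segment J x s)) has_real_derivative lyap_rate R' (\<lambda>\<tau>. x (t + \<tau>)) (w t)) (at t)"
      by (rule has_field_derivative_transform_within_open[OF D[OF t], of "{t0<..}"])
        (use t lyap_clip in \<open>auto simp: lyap_segment\<close>)
  qed
qed

lemma dissipative: "dissipative S U"
  unfolding dissipative_def
proof (intro exI[of _ "lyap PP Q R"] conjI allI impI)
  show "C1_functional J n (lyap PP Q R)"
    by (rule lyap_C1) (use PP_sym in \<open>simp add: sym_mats_def\<close>)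
  fix \<psi> w x z assume A: "is_solution S U \<psi> w x \<and> is_output S U x w z"
  then have sol: "is_solution S U \<psi> w x" by blast
  obtain c where c: "c > 0" and ineq: "\<And>y w. cont_seg y \<Longrightarrow> w \<in> carrier_vec q \<Longrightarrow>
     lyap_rate R y w - supply_rate S (mat_Sigma S U *\<^sub>v hv y w) w \<le> - c * (hv y w \<bullet> hv y w)"
    using main_inequality by blast
  obtain N where N: "negligible N"
    and D: "\<And>t R'. t0 \<le> t \<Longrightarrow> t \<notin> N \<Longrightarrow> ((\<lambda>s. lyap PP Q R' (segment J x s)) has_real_derivative
       lyap_rate R' (\<lambda>\<tau>. x (t + \<tau>)) (w t)) (at t)"
    using solution_lyap_derivative[OF sol] by blast
  have "{t \<in> {t0..}. \<not> t \<notin> N} \<subseteq> N" by auto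
  then have "AE t in lebesgue_on {t0..}. t \<notin> N"
    by (subst AE_lebesgue_on_iff_negligible) (auto intro: negligible_subset[OF N])
  moreover have "AE t in lebesgue_on {t0..}. z t = output_rhs S U x w t" using A by (simp add: is_output_def)
  moreover have "AE t in lebesgue_on {t0..}. t \<in> {t0..}" by (rule AE_I2) simp
  ultimately show "AE t in lebesgue_on {t0..}. \<exists>D. ((\<lambda>s. lyap PP Q R (segment J x s)) has_real_derivative D) (at t) \<and> D - supply_rate S (z t) (w t) \<le> 0"
  proof eventually_elim
    case (elim t)
    let ?y = "\<lambda>\<tau>. x (t + \<tau>)"
    have t: "t0 \<le> t" using elim by simp
    have y: "cont_seg ?y" by (rule solution_seg[OF sol t])
    have w: "w t \<in> carrier_vec q" using sol t by (simp add: is_solution_def L2_vec_def)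
    \<comment> \<open>The output is prescribed almost everywhere only, so the times at which it
      fails join the exceptional ones.\<close>
    have z: "z t = mat_Sigma S U *\<^sub>v hv ?y (w t)" using elim rhs_eq(2)[of x t w, OF y w] by simp
    have "0 \<le> c * (hv ?y (w t) \<bullet> hv ?y (w t))" using c scalar_prod_self_nonneg by simp
    then have "lyap_rate R ?y (w t) - supply_rate S (z t) (w t) \<le> 0" using ineq[OF y w] unfolding z by linarith
    then show ?case using D[OF t elim(1)] by blast
  qed
qed

end

section \<open>Exponential stability\<close>

lemma one_kron_one: "1\<^sub>m k \<otimes>\<^sub>k 1\<^sub>m n = 1\<^sub>m (k * n)"
proof (rule eq_matI)
  fix i j assume "i < dim_row (1\<^sub>m (k * n) :: real mat)" "j < dim_col (1\<^sub>m (k * n) :: real mat)"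
  then have ij: "i < k * n" "j < k * n" by simp_all
  have "i = j \<longleftrightarrow> i div n = j div n \<and> i mod n = j mod n" by (metis div_mult_mod_eq)
  then show "(1\<^sub>m k \<otimes>\<^sub>k 1\<^sub>m n) $$ (i, j) = 1\<^sub>m (k * n) $$ (i, j)"
    using ij div_less_mult[OF ij(1)] mod_less_mult[OF ij(1)] div_less_mult[OF ij(2)] mod_less_mult[OF ij(2)]
    by (auto simp: kron_def)
qed (simp_all add: kron_def)

context delay_system
begin

definition energy :: "nat \<Rightarrow> (real \<Rightarrow> real vec) \<Rightarrow> real" where
  "energy i y = (\<Sum>c<n. \<integral>\<tau>. y \<tau> $ c * y \<tau> $ c \<partial>lebesgue_on (ivl i))"

lemma int_form_one: "int_form i (1\<^sub>m n) y = energy i y"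
  unfolding int_form_def energy_def by (intro sum.cong refl) (simp add: if_distrib[where f="\<lambda>x. x * _"] cong: if_cong)

lemma cont_seg_continuous: "cont_seg y \<Longrightarrow> i \<in> {1..nu} \<Longrightarrow> c < n \<Longrightarrow> continuous_on (ivl i) (\<lambda>\<tau>. y \<tau> $ c)"
  using ivl_subset[of i] by (auto simp: cont_seg_def intro: continuous_on_subset)

lemma ivl_integrable: "continuous_on (ivl i) f \<Longrightarrow> integrable (lebesgue_on (ivl i)) f" for f :: "real \<Rightarrow> real"
  unfolding ivl_eq by (rule continuous_integrable_lebesgue_on)

lemma comp_energy_le:
  assumes "c < n"
  shows "(\<integral>\<tau>. y \<tau> $ c * y \<tau> $ c \<partial>lebesgue_on (ivl i)) \<le> energy i y"
  unfolding energy_def by (rule member_le_sum) (use assms in auto)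

lemma energy_nonneg: "0 \<le> energy i y"
  unfolding energy_def by (intro sum_nonneg) simp

text \<open>A mixed product of components is at most the mean of their squares, so every entry of
  the quadratic integrals is controlled by the energy.\<close>

lemma weighted_product_le_energy:
  assumes i: "i \<in> {1..nu}" and y: "cont_seg y" and c: "c < n" and d: "d < n"
    and g: "continuous_on (ivl i) g" "\<And>\<tau>. \<tau> \<in> ivl i \<Longrightarrow> \<bar>g \<tau>\<bar> \<le> G" and G: "0 \<le> G"
  shows "\<bar>\<integral>\<tau>. g \<tau> * (y \<tau> $ c * y \<tau> $ d) \<partial>lebesgue_on (ivl i)\<bar> \<le> G * energy i y"
proof -
  let ?M = "lebesgue_on (ivl i)"
  note cont = cont_seg_continuous[OF y i c] cont_seg_continuous[OF y i d]
  have I: "integrable ?M (\<lambda>\<tau>. y \<tau> $ c * y \<tau> $ c)" "integrable ?M (\<lambda>\<tau>. y \<tau> $ d * y \<tau> $ d)"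
    by (intro ivl_integrable continuous_intros cont)+
  have "\<bar>\<integral>\<tau>. g \<tau> * (y \<tau> $ c * y \<tau> $ d) \<partial>?M\<bar> \<le> (\<integral>\<tau>. \<bar>g \<tau> * (y \<tau> $ c * y \<tau> $ d)\<bar> \<partial>?M)"
    by (rule integral_abs_bound)
  also have "\<dots> \<le> (\<integral>\<tau>. G * ((y \<tau> $ c * y \<tau> $ c + y \<tau> $ d * y \<tau> $ d) / 2) \<partial>?M)"
  proof (rule integral_mono)
    fix \<tau> assume "\<tau> \<in> space ?M"
    then have t: "\<tau> \<in> ivl i" by simp
    have "0 \<le> (\<bar>y \<tau> $ c\<bar> - \<bar>y \<tau> $ d\<bar>)\<^sup>2" by simp
    then have "\<bar>y \<tau> $ c * y \<tau> $ d\<bar> \<le> (y \<tau> $ c * y \<tau> $ c + y \<tau> $ d * y \<tau> $ d) / 2"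
      unfolding power2_diff abs_mult by (simp add: power2_eq_square)
    then show "\<bar>g \<tau> * (y \<tau> $ c * y \<tau> $ d)\<bar> \<le> G * ((y \<tau> $ c * y \<tau> $ c + y \<tau> $ d * y \<tau> $ d) / 2)"
      unfolding abs_mult[of "g \<tau>"] by (intro mult_mono g(2) t G) auto
  qed (intro ivl_integrable continuous_intros cont g(1); simp)+
  also have "\<dots> = G * (((\<integral>\<tau>. y \<tau> $ c * y \<tau> $ c \<partial>?M) + (\<integral>\<tau>. y \<tau> $ d * y \<tau> $ d \<partial>?M)) / 2)"
    using I by simp
  also have "\<dots> \<le> G * energy i y"
    using comp_energy_le[OF c, where i=i and y=y] comp_energy_le[OF d, where i=i and y=y] G by (intro mult_left_mono) auto
  finally show ?thesis .
qed

lemma quad_int_le_energy: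
  assumes i: "i \<in> {1..nu}"
  shows "\<exists>C\<ge>0. \<forall>y. cont_seg y \<longrightarrow> quad_int i Q R y \<le> C * energy i y"
proof (intro exI[of _ "\<Sum>c<n. \<Sum>d<n. \<bar>Q $$ (c, d)\<bar> + \<bar>R $$ (c, d)\<bar> * r i"] conjI allI impI)
  have ri: "0 \<le> r i" "0 \<le> r (i - 1)" using i by (auto intro!: r_nonneg)
  then show "0 \<le> (\<Sum>c<n. \<Sum>d<n. \<bar>Q $$ (c, d)\<bar> + \<bar>R $$ (c, d)\<bar> * r i)" by (intro sum_nonneg) simp
  fix y assume y: "cont_seg y"
  have le: "a * X \<le> \<bar>a\<bar> * Y" if "\<bar>X\<bar> \<le> Y" for a X Y :: real
    using mult_left_mono[OF that, of "\<bar>a\<bar>"] abs_ge_self[of "a * X"] by (simp add: abs_mult)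
  have "quad_int i Q R y \<le> (\<Sum>c<n. \<Sum>d<n. \<bar>Q $$ (c, d)\<bar> * (1 * energy i y) + \<bar>R $$ (c, d)\<bar> * (r i * energy i y))"
    unfolding quad_int_def using ri
    by (intro sum_mono add_mono le weighted_product_le_energy[OF i y] continuous_intros) (auto simp: ivl_eq)
  then show "quad_int i Q R y \<le> (\<Sum>c<n. \<Sum>d<n. \<bar>Q $$ (c, d)\<bar> + \<bar>R $$ (c, d)\<bar> * r i) * energy i y"
    by (simp add: sum_distrib_right distrib_right mult.assoc)
qed

text \<open>The weight \<open>\<tau> + r i\<close> is nonnegative on the interval, so the part with
  \<open>R\<close> may be dropped.\<close>

lemma quad_int_ge:
  assumes i: "i \<in> {1..nu}" and y: "cont_seg y" and R: "R \<in> carrier_mat n n"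
    and psd: "\<And>v. v \<in> carrier_vec n \<Longrightarrow> 0 \<le> v \<bullet> (R *\<^sub>v v)"
  shows "int_form i Q y \<le> quad_int i Q R y"
proof -
  let ?M = "lebesgue_on (ivl i)"
  have "0 \<le> (\<integral>\<tau>. (\<Sum>c<n. \<Sum>d<n. R $$ (c, d) * ((\<tau> + r i) * (y \<tau> $ c * y \<tau> $ d))) \<partial>?M)"
  proof (rule Bochner_Integration.integral_nonneg)
    fix \<tau> assume "\<tau> \<in> space ?M"
    then have "0 \<le> (\<tau> + r i) * (\<Sum>c<n. \<Sum>d<n. R $$ (c, d) * (y \<tau> $ c * y \<tau> $ d))"
      using psd_sum[OF R psd, of "\<lambda>c. y \<tau> $ c"] by (intro mult_nonneg_nonneg) (auto simp: ivl_eq)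
    also have "\<dots> = (\<Sum>c<n. \<Sum>d<n. R $$ (c, d) * ((\<tau> + r i) * (y \<tau> $ c * y \<tau> $ d)))"
      by (simp add: sum_distrib_left mult_ac)
    finally show "0 \<le> \<dots>" .
  qed
  also have "\<dots> = (\<Sum>c<n. \<Sum>d<n. R $$ (c, d) * (\<integral>\<tau>. (\<tau> + r i) * (y \<tau> $ c * y \<tau> $ d) \<partial>?M))"
    by (intro integral_double_sum ivl_integrable continuous_intros cont_seg_continuous[OF y i])
  finally show ?thesis unfolding int_form_def quad_int_def by (simp add: sum.distrib)
qed

lemma eta_sq: "eta y \<bullet> eta y = (\<Sum>i = 1..nu. intvec (ivl i) (dim_f S i) n (orth_f i) y \<bullet> intvec (ivl i) (dim_f S i) n (orth_f i) y)"
  unfolding eta_def by (subst vstack_scalar_prod) (simp_all add: sum_list_map_upt del: upt_Suc)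

lemma eta_le_energy:
  assumes y: "cont_seg y"
  shows "eta y \<bullet> eta y \<le> (\<Sum>i = 1..nu. energy i y)"
  unfolding eta_sq
proof (rule sum_mono)
  fix i assume i: "i \<in> {1..nu}"
  have "intvec (ivl i) (dim_f S i) n (orth_f i) y \<bullet> ((1\<^sub>m (dim_f S i) \<otimes>\<^sub>k 1\<^sub>m n) *\<^sub>v intvec (ivl i) (dim_f S i) n (orth_f i) y) \<le> int_form i (1\<^sub>m n) y"
    by (rule bessel_f[OF i y]) (auto simp: scalar_prod_self_nonneg)
  then show "intvec (ivl i) (dim_f S i) n (orth_f i) y \<bullet> intvec (ivl i) (dim_f S i) n (orth_f i) y \<le> energy i y"
    unfolding one_kron_one int_form_one by simp
qed

lemma lyap_upper:
  assumes P: "P \<in> carrier_mat (n + tot_f S * n) (n + tot_f S * n)"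
  shows "\<exists>C>0. \<forall>y. cont_seg y \<longrightarrow> lyap P Q R y \<le> C * (y 0 \<bullet> y 0 + (\<Sum>i = 1..nu. energy i y))"
proof -
  obtain C where C: "C \<ge> 0" "\<And>v. v \<in> carrier_vec (n + tot_f S * n) \<Longrightarrow> \<bar>v \<bullet> (P *\<^sub>v v)\<bar> \<le> C * (v \<bullet> v)"
    using quadratic_form_bound[OF P] by blast
  have "\<forall>i\<in>{1..nu}. \<exists>D\<ge>0. \<forall>y. cont_seg y \<longrightarrow> quad_int i (Q i) (R i) y \<le> D * energy i y"
    using quad_int_le_energy by blast
  then obtain D where D: "\<And>i. i \<in> {1..nu} \<Longrightarrow> 0 \<le> D i"
    "\<And>i y. i \<in> {1..nu} \<Longrightarrow> cont_seg y \<Longrightarrow> quad_int i (Q i) (R i) y \<le> D i * energy i y"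
    by metis
  let ?D = "\<Sum>i = 1..nu. D i"
  have D0: "0 \<le> ?D" by (intro sum_nonneg D)
  show ?thesis
  \<comment> \<open>The added 1 makes the constant positive; the decay rate is obtained by dividing
    by it.\<close>
  proof (intro exI[of _ "C + ?D + 1"] conjI allI impI)
    fix y assume y: "cont_seg y"
    let ?E = "\<Sum>i = 1..nu. energy i y"
    have E0: "0 \<le> ?E" by (intro sum_nonneg energy_nonneg)
    have "ext y \<bullet> (P *\<^sub>v ext y) \<le> C * (ext y \<bullet> ext y)"
      using C(2)[of "ext y"] by (simp add: carrier_vecI)
    also have "ext y \<bullet> ext y = y 0 \<bullet> y 0 + eta y \<bullet> eta y"
      unfolding ext_append[OF y] by (rule scalar_prod_append') simp_all
    also have "C * \<dots> \<le> C * (y 0 \<bullet> y 0 + ?E)" by (intro mult_left_mono add_left_mono eta_le_energy y C)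
    finally have 1: "ext y \<bullet> (P *\<^sub>v ext y) \<le> C * (y 0 \<bullet> y 0 + ?E)" .
    have "(\<Sum>i = 1..nu. quad_int i (Q i) (R i) y) \<le> (\<Sum>i = 1..nu. ?D * energy i y)"
    proof (rule sum_mono)
      fix i assume i: "i \<in> {1..nu}"
      have "D i \<le> ?D" by (rule member_le_sum[OF i]) (use D(1) in auto)
      then show "quad_int i (Q i) (R i) y \<le> ?D * energy i y"
        using D(2)[OF i y] mult_right_mono[OF _ energy_nonneg[of i y], of "D i" ?D] by linarith
    qed
    also have "\<dots> = ?D * ?E" by (simp only: sum_distrib_left)
    finally have 2: "(\<Sum>i = 1..nu. quad_int i (Q i) (R i) y) \<le> ?D * ?E" .
    have 3: "0 \<le> ?D * (y 0 \<bullet> y 0)" using D0 scalar_prod_self_nonneg[of "y 0"] by (rule mult_nonneg_nonneg)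
    have "lyap P Q R y \<le> C * (y 0 \<bullet> y 0 + ?E) + ?D * ?E" using 1 2 by (simp add: lyap_def)
    also have "\<dots> \<le> (C + ?D + 1) * (y 0 \<bullet> y 0 + ?E)"
      using 3 E0 scalar_prod_self_nonneg[of "y 0"] by (simp add: algebra_simps)
    finally show "lyap P Q R y \<le> (C + ?D + 1) * (y 0 \<bullet> y 0 + ?E)" .
  qed (use C(1) D0 in simp)
qed

text \<open>The states at the right ends are blocks of the history vector. Shifting \<open>R\<close>
  costs squares of precisely these states, so the margin in the matrix inequality can pay for
  them.\<close>

lemma hist_sq_ge:
  assumes y: "cont_seg y"
  shows "(\<Sum>i = 1..nu. y (- r (i - 1)) \<bullet> y (- r (i - 1))) \<le> vstack (hist y w) \<bullet> vstack (hist y w)"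
proof -
  have "(\<Sum>i = 1..nu. y (- r (i - 1)) \<bullet> y (- r (i - 1))) = x_prev y \<bullet> x_prev y"
    by (subst vstack_scalar_prod) (simp_all add: sum_list_map_upt del: upt_Suc)
  also have "\<dots> \<le> (x_prev y @\<^sub>v y (- r nu)) \<bullet> (x_prev y @\<^sub>v y (- r nu))"
    using scalar_prod_self_nonneg[of "y (- r nu)"] by (simp add: scalar_prod_append' del: dim_vstack)
  also have "\<dots> = y 0 \<bullet> y 0 + x_part y \<bullet> x_part y"
    unfolding x_prev_append[symmetric] by (rule scalar_prod_append') simp_all
  also have "\<dots> \<le> y 0 \<bullet> y 0 + (x_part y \<bullet> x_part y + (h_part y @\<^sub>v (e_part y @\<^sub>v w)) \<bullet> (h_part y @\<^sub>v (e_part y @\<^sub>v w)))"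
    using scalar_prod_self_nonneg by simp
  also have "\<dots> = vstack (hist y w) \<bullet> vstack (hist y w)"
    unfolding hist_eq by (simp only: scalar_prod_append'[OF refl refl])
  finally show ?thesis .
qed

end

lemma form_add_smult_one:
  fixes A :: "real mat"
  assumes A: "A \<in> carrier_mat k k" and v: "v \<in> carrier_vec k"
  shows "v \<bullet> ((A + e \<cdot>\<^sub>m 1\<^sub>m k) *\<^sub>v v) = v \<bullet> (A *\<^sub>v v) + e * (v \<bullet> v)"
proof -
  have "(e \<cdot>\<^sub>m 1\<^sub>m k) *\<^sub>v v = e \<cdot>\<^sub>v (1\<^sub>m k *\<^sub>v v)"
    using v by (intro eq_vecI) (auto simp: scalar_prod_def sum_distrib_left mult_ac mult_delta_right)
  moreover have "(A + e \<cdot>\<^sub>m 1\<^sub>m k) *\<^sub>v v = A *\<^sub>v v + (e \<cdot>\<^sub>m 1\<^sub>m k) *\<^sub>v v"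
    by (rule add_mult_distrib_mat_vec[of _ k k]) (use A v in auto)
  ultimately have "(A + e \<cdot>\<^sub>m 1\<^sub>m k) *\<^sub>v v = A *\<^sub>v v + e \<cdot>\<^sub>v v" using v by simp
  then show ?thesis using A v by (simp add: scalar_prod_add_distrib[of _ k] mult_mat_vec_carrier)
qed

context dissipative_lmi
begin

abbreviation "R_shift e \<equiv> \<lambda>i. R i + e \<cdot>\<^sub>m 1\<^sub>m n"

text \<open>The additional term is the derivative of \<open>e\<close> times the weighted energy: a
  cost at the right end of the interval and a gain of the whole energy.\<close>

lemma quad_int_deriv_shift:
  assumes i: "i \<in> {1..nu}" and y: "cont_seg y"
  shows "quad_int_deriv i (Q i) (R_shift e i) y = quad_int_deriv i (Q i) (R i) y +
    e * ((r i - r (i - 1)) * (y (- r (i - 1)) \<bullet> y (- r (i - 1))) - energy i y)"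
proof -
  have v: "y (- r (i - 1)) \<in> carrier_vec n" using i by (intro cont_segD[OF y] minus_r_in_J) auto
  have Re: "R_shift e i \<in> carrier_mat n n" using QR(2)[OF i] by auto
  have "int_form i (R_shift e i) y = int_form i (R i) y + e * int_form i (1\<^sub>m n) y"
  proof -
    have "int_form i (R_shift e i) y = (\<Sum>c<n. \<Sum>d<n. R i $$ (c, d) * (\<integral>\<tau>. y \<tau> $ c * y \<tau> $ d \<partial>lebesgue_on (ivl i))
        + e * (1\<^sub>m n $$ (c, d) * (\<integral>\<tau>. y \<tau> $ c * y \<tau> $ d \<partial>lebesgue_on (ivl i))))"
      unfolding int_form_def using QR(2)[OF i] by (intro sum.cong refl) (simp add: distrib_right)
    then show ?thesis unfolding int_form_def by (simp only: sum.distrib sum_distrib_left)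
  qed
  then show ?thesis
    unfolding quad_int_deriv_eq[OF i y QR(1)[OF i] QR(2)[OF i]] quad_int_deriv_eq[OF i y QR(1)[OF i] Re]
      form_add_smult_one[OF QR(2)[OF i] v] int_form_one
    by (simp add: algebra_simps)
qed

text \<open>Without disturbance only the first block of the supply rate remains, and that block is
  negative semidefinite; so the dissipation inequality turns into a decay estimate.\<close>

lemma supply_rate_zero:
  assumes z: "z \<in> carrier_vec m"
  shows "supply_rate S z (0\<^sub>v q) \<le> 0"
proof -
  let ?A = "transpose_mat (sup_Jt S) * minv (sup_J1 S) * sup_Jt S"
  have A: "?A \<in> carrier_mat m m" using supplyD(1,3) by auto
  have FB: "four_block_mat ?A (sup_J2 S) (transpose_mat (sup_J2 S)) (sup_J3 S) *\<^sub>v (z @\<^sub>v 0\<^sub>v q)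
    = (?A *\<^sub>v z + sup_J2 S *\<^sub>v 0\<^sub>v q) @\<^sub>v (transpose_mat (sup_J2 S) *\<^sub>v z + sup_J3 S *\<^sub>v 0\<^sub>v q)"
    by (rule four_block_mat_mult_vec[OF A supplyD(5) _ supplyD(6) z]) (use supplyD(5) in auto)
  have J20: "sup_J2 S *\<^sub>v 0\<^sub>v q = 0\<^sub>v m" using supplyD(5) by (intro eq_vecI) auto
  have Az: "?A *\<^sub>v z \<in> carrier_vec m" by (rule mult_mat_vec_carrier[OF A z])
  have "supply_rate S z (0\<^sub>v q) = z \<bullet> (?A *\<^sub>v z) + 0\<^sub>v q \<bullet> (transpose_mat (sup_J2 S) *\<^sub>v z + sup_J3 S *\<^sub>v 0\<^sub>v q)"
  proof -
    have "dim_vec z = dim_vec (?A *\<^sub>v z)" "dim_vec (0\<^sub>v q) = dim_vec (transpose_mat (sup_J2 S) *\<^sub>v z + sup_J3 S *\<^sub>v 0\<^sub>v q)"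
      using z supplyD(1,6) by simp_all
    note scalar_prod_append'[OF this]
    then show ?thesis unfolding supply_rate_def FB J20 using Az by simp
  qed
  also have "0\<^sub>v q \<bullet> (transpose_mat (sup_J2 S) *\<^sub>v z + sup_J3 S *\<^sub>v 0\<^sub>v q) = 0"
    using supplyD(5,6) z by (intro scalar_prod_left_zero add_carrier_vec) auto
  finally have "supply_rate S z (0\<^sub>v q) = z \<bullet> (?A *\<^sub>v z)" by simp
  moreover have "dim_row (- ?A) = m" by (simp only: index_uminus_mat carrier_matD[OF A])
  then have "0 \<le> z \<bullet> (- ?A *\<^sub>v z)" using supplyD(7) z unfolding pos_semidef_def by metis
  ultimately show ?thesis unfolding scalar_prod_uminus_mat[OF A z] by linarith
qed

text \<open>The margin in \<open>main_inequality\<close> sees only finitely many numbers of the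
  history, while the functional contains its energy. A small shift of \<open>R\<close> trades part
  of that margin for the energy.\<close>

lemma undisturbed_rate:
  "\<exists>e>0. \<exists>a>0. \<forall>y. cont_seg y \<longrightarrow> lyap_rate (R_shift e) y (0\<^sub>v q) \<le> - a * (y 0 \<bullet> y 0 + (\<Sum>i = 1..nu. energy i y))"
proof -
  obtain c where c: "c > 0" and ineq: "\<And>y w. cont_seg y \<Longrightarrow> w \<in> carrier_vec q \<Longrightarrow>
     lyap_rate R y w - supply_rate S (mat_Sigma S U *\<^sub>v hv y w) w \<le> - c * (hv y w \<bullet> hv y w)"
    using main_inequality by blast
  \<comment> \<open>The cost of the shift is at most \<open>e * r nu\<close> times the square of the
    history vector, hence half of the margin; the other half is left for the current state.\<close>
  define e where "e = c / (2 * r nu)"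
  have e: "e > 0" "e * r nu = c / 2" using c r_nu_pos by (simp_all add: e_def)
  show ?thesis
  proof (intro exI conjI allI impI)
    show "e > 0" "min e (c / 2) > 0" using c e by auto
    fix y assume y: "cont_seg y"
    let ?E = "\<Sum>i = 1..nu. energy i y" and ?H = "hv y (0\<^sub>v q) \<bullet> hv y (0\<^sub>v q)"
    let ?v = "\<lambda>i. y (- r (i - 1)) \<bullet> y (- r (i - 1))"
    have q: "0\<^sub>v q \<in> carrier_vec q" by simp
    have "mat_Sigma S U *\<^sub>v hv y (0\<^sub>v q) \<in> carrier_vec m"
      by (rule mult_mat_vec_carrier[OF Sigma_carrier hv_carrier[OF y q]])
    then have "lyap_rate R y (0\<^sub>v q) \<le> - c * ?H" using ineq[OF y q] supply_rate_zero by fastforce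
    moreover have "(\<Sum>i = 1..nu. quad_int_deriv i (Q i) (R_shift e i) y) = (\<Sum>i = 1..nu. quad_int_deriv i (Q i) (R i) y)
        + e * ((\<Sum>i = 1..nu. (r i - r (i - 1)) * ?v i) - ?E)"
      unfolding sum_subtractf[symmetric] sum_distrib_left sum.distrib[symmetric]
      by (rule sum.cong[OF refl quad_int_deriv_shift[OF _ y]])
    moreover have "(\<Sum>i = 1..nu. (r i - r (i - 1)) * ?v i) \<le> r nu * ?H"
    proof -
      have "(\<Sum>i = 1..nu. (r i - r (i - 1)) * ?v i) \<le> (\<Sum>i = 1..nu. r nu * ?v i)"
      proof (intro sum_mono mult_right_mono scalar_prod_self_nonneg)
        fix i assume "i \<in> {1..nu}"
        then have "r i \<le> r nu" "0 \<le> r (i - 1)" by (auto intro!: r_mono r_nonneg)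
        then show "r i - r (i - 1) \<le> r nu" by simp
      qed
      also have "\<dots> \<le> r nu * ?H"
        unfolding sum_distrib_left[symmetric] using r_nu_pos by (intro mult_left_mono hist_sq_ge y) simp
      finally show ?thesis .
    qed
    then have "e * (\<Sum>i = 1..nu. (r i - r (i - 1)) * ?v i) \<le> e * (r nu * ?H)" using e by (intro mult_left_mono) auto
    then have "e * (\<Sum>i = 1..nu. (r i - r (i - 1)) * ?v i) \<le> (c / 2) * ?H" using e(2) by (simp add: mult.assoc[symmetric])
    moreover have "y 0 \<bullet> y 0 \<le> ?H"
    proof -
      have "?v 1 \<le> (\<Sum>i = 1..nu. ?v i)" using nu_pos by (intro member_le_sum) (auto simp: scalar_prod_self_nonneg)
      then show ?thesis using hist_sq_ge[OF y, of "0\<^sub>v q"] r0 by simp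
    qed
    then have "(c / 2) * (y 0 \<bullet> y 0) \<le> (c / 2) * ?H" using c by (intro mult_left_mono) auto
    ultimately have "lyap_rate (R_shift e) y (0\<^sub>v q) \<le> - (c / 2) * (y 0 \<bullet> y 0) - e * ?E"
      by (simp add: right_diff_distrib)
    moreover have "min e (c / 2) * (y 0 \<bullet> y 0) \<le> (c / 2) * (y 0 \<bullet> y 0)" "min e (c / 2) * ?E \<le> e * ?E"
      by (intro mult_right_mono scalar_prod_self_nonneg sum_nonneg energy_nonneg; simp)+
    ultimately show "lyap_rate (R_shift e) y (0\<^sub>v q) \<le> - min e (c / 2) * (y 0 \<bullet> y 0 + ?E)"
      by (simp add: distrib_left)
  qed
qed

text \<open>By Bessel's inequality the \<open>Q\<close>-energies dominate the block diagonal
  correction in the first matrix inequality. The constant does not depend on \<open>e\<close>,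
  because the part with the shifted weights is nonnegative and is dropped.\<close>

lemma lyap_lower:
  "\<exists>l>0. \<forall>e\<ge>0. \<forall>y. cont_seg y \<longrightarrow> l * (y 0 \<bullet> y 0) \<le> lyap PP Q (R_shift e) y"
proof -
  let ?DQ = "diag_upto nu (\<lambda>i. 1\<^sub>m (dim_f S i) \<otimes>\<^sub>k Q i)"
  let ?B = "diag_block_mat [0\<^sub>m n n, ?DQ]"
  have kc: "1\<^sub>m (dim_f S i) \<otimes>\<^sub>k Q i \<in> carrier_mat (dim_f S i * n) (dim_f S i * n)" if "i \<in> {1..nu}" for i
    using QR(1)[OF that] by (simp add: kron_def)
  have "(\<Sum>i = 1..nu. dim_f S i * n) = dn" by (simp add: tot_f_def sum_distrib_right)
  then have DQ: "?DQ \<in> carrier_mat dn dn"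
    using diag_upto_carrier[of nu "\<lambda>i. 1\<^sub>m (dim_f S i) \<otimes>\<^sub>k Q i" "\<lambda>i. dim_f S i * n" "\<lambda>i. dim_f S i * n"] kc by simp
  have PPc: "PP \<in> carrier_mat (n + dn) (n + dn)" using PP_sym by (simp add: sym_mats_def)
  have Bc: "?B \<in> carrier_mat (n + dn) (n + dn)"
    by (rule carrier_matI) (use DQ in \<open>simp_all add: dim_diag_block_mat\<close>)
  obtain l where l: "l > 0" "\<And>v. v \<in> carrier_vec (dim_row (PP + ?B)) \<Longrightarrow> l * (v \<bullet> v) \<le> v \<bullet> ((PP + ?B) *\<^sub>v v)"
    using pos_def_coercive[OF lmi_P] by blast
  show ?thesis
  proof (intro exI[of _ l] conjI allI impI l(1))
    fix e :: real and y assume e: "0 \<le> e" and y: "cont_seg y"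
    have ec: "ext y \<in> carrier_vec (n + dn)" by (simp add: carrier_vecI)
    have dr: "dim_row (PP + ?B) = n + dn" by (simp only: index_add_mat carrier_matD[OF Bc])
    have B: "ext y \<bullet> (?B *\<^sub>v ext y) \<le> (\<Sum>i = 1..nu. quad_int i (Q i) (R_shift e i) y)"
    proof -
      have "ext y \<bullet> (?B *\<^sub>v ext y) = y 0 \<bullet> (0\<^sub>m n n *\<^sub>v y 0) + eta y \<bullet> (?DQ *\<^sub>v eta y)"
        using diag_block_form[of "[0\<^sub>m n n, ?DQ]" "[y 0, eta y]"] DQ carrier_vecD[OF y0_carrier[OF y]]
        by (simp add: ext_append[OF y])
      also have "y 0 \<bullet> (0\<^sub>m n n *\<^sub>v y 0) = 0" using y0_carrier[OF y] by (simp add: zero_mult_vec)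
      also have "eta y \<bullet> (?DQ *\<^sub>v eta y) = (\<Sum>i = 1..nu. intvec (ivl i) (dim_f S i) n (orth_f i) y \<bullet>
          ((1\<^sub>m (dim_f S i) \<otimes>\<^sub>k Q i) *\<^sub>v intvec (ivl i) (dim_f S i) n (orth_f i) y))"
        unfolding eta_def by (rule diag_upto_form[OF kc]) simp_all
      also have "\<dots> \<le> (\<Sum>i = 1..nu. quad_int i (Q i) (R_shift e i) y)"
      proof (rule sum_mono)
        fix i assume i: "i \<in> {1..nu}"
        have Re: "R_shift e i \<in> carrier_mat n n" using QR(2)[OF i] by auto
        have "0 \<le> v \<bullet> (R_shift e i *\<^sub>v v)" if v: "v \<in> carrier_vec n" for v
          unfolding form_add_smult_one[OF QR(2)[OF i] v] using R_nonneg[OF i v] e scalar_prod_self_nonneg[of v] by simp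
        from quad_int_ge[OF i y Re this, of "Q i"] bessel_f[OF i y QR(1)[OF i] Q_nonneg[OF i]]
        show "intvec (ivl i) (dim_f S i) n (orth_f i) y \<bullet>
          ((1\<^sub>m (dim_f S i) \<otimes>\<^sub>k Q i) *\<^sub>v intvec (ivl i) (dim_f S i) n (orth_f i) y) \<le> quad_int i (Q i) (R_shift e i) y" by linarith
      qed
      finally show ?thesis by simp
    qed
    have "l * (y 0 \<bullet> y 0) \<le> l * (ext y \<bullet> ext y)"
      using l(1) scalar_prod_self_nonneg[of "eta y"] by (simp add: ext_append[OF y] scalar_prod_append')
    also have "\<dots> \<le> ext y \<bullet> ((PP + ?B) *\<^sub>v ext y)" by (rule l(2)) (simp only: dr ec)
    also have "(PP + ?B) *\<^sub>v ext y = PP *\<^sub>v ext y + ?B *\<^sub>v ext y" by (rule add_mult_distrib_mat_vec[OF PPc Bc ec])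
    also have "ext y \<bullet> \<dots> = ext y \<bullet> (PP *\<^sub>v ext y) + ext y \<bullet> (?B *\<^sub>v ext y)"
      by (rule scalar_prod_add_distrib[OF ec mult_mat_vec_carrier[OF PPc ec] mult_mat_vec_carrier[OF Bc ec]])
    also have "\<dots> \<le> lyap PP Q (R_shift e) y" unfolding lyap_def using B by simp
    finally show "l * (y 0 \<bullet> y 0) \<le> lyap PP Q (R_shift e) y" .
  qed
qed

text \<open>The rate of the functional is bounded by a negative multiple of the functional itself,
  so multiplied by a growing exponential it does not increase. Its upper bound at \<open>t0\<close>
  and its lower bound at \<open>t\<close> then give the estimate.\<close>

lemma exp_stable: "exp_stable S U"
proof -
  obtain e a where e: "e > 0" and a: "a > 0"
    and rate: "\<And>y. cont_seg y \<Longrightarrow> lyap_rate (R_shift e) y (0\<^sub>v q) \<le> - a * (y 0 \<bullet> y 0 + (\<Sum>i = 1..nu. energy i y))"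
    using undisturbed_rate by blast
  have PPc: "PP \<in> carrier_mat (n + dn) (n + dn)" using PP_sym by (simp add: sym_mats_def)
  obtain C where C: "C > 0"
    and up: "\<And>y. cont_seg y \<Longrightarrow> lyap PP Q (R_shift e) y \<le> C * (y 0 \<bullet> y 0 + (\<Sum>i = 1..nu. energy i y))"
    using lyap_upper[OF PPc, of Q "R_shift e"] by blast
  obtain l where l: "l > 0" and low: "\<And>y. cont_seg y \<Longrightarrow> l * (y 0 \<bullet> y 0) \<le> lyap PP Q (R_shift e) y"
    using lyap_lower e by (meson less_imp_le)
  obtain B where B: "B \<ge> 0" "\<And>\<phi>. \<phi> \<in> CS \<Longrightarrow> \<bar>lyap PP Q (R_shift e) \<phi>\<bar> \<le> B * (snorm \<phi>)\<^sup>2"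
    using lyap_snorm_bound[OF PPc, of Q "R_shift e"] by blast
  \<comment> \<open>The functional decays at rate \<open>a / C\<close>; it dominates the square of
    the state, hence half of that for the state.\<close>
  define \<alpha> where "\<alpha> = a / (2 * C)"
  have \<alpha>: "\<alpha> > 0" "2 * \<alpha> * C = a" using a C by (simp_all add: \<alpha>_def)
  \<comment> \<open>\<open>B + 1\<close> instead of \<open>B\<close> keeps \<open>K\<close> positive
    when \<open>B\<close> is 0.\<close>
  define K where "K = sqrt ((B + 1) / l)"
  have K: "K > 0" "K\<^sup>2 = (B + 1) / l" using B(1) l by (simp_all add: K_def)
  show ?thesis unfolding exp_stable_def
  proof (rule exI[of _ K], rule conjI[OF K(1)], rule exI[of _ \<alpha>], rule conjI[OF \<alpha>(1)], intro allI impI)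
    fix \<psi> x t assume sol: "is_solution S U \<psi> (\<lambda>_. 0\<^sub>v q) x" and t: "t0 \<le> t"
    \<comment> \<open>The continued trajectory, for which absolute continuity of the functional is
      known.\<close>
    define W where "W s = lyap PP Q (R_shift e) (\<lambda>\<tau>. x (max (s + \<tau>) (t0 - r nu)))" for s
    have W: "W s = lyap PP Q (R_shift e) (\<lambda>\<tau>. x (s + \<tau>))" if "t0 \<le> s" for s unfolding W_def by (rule lyap_clip[OF that])
    obtain N where N: "negligible N" and D: "\<And>s. t0 \<le> s \<Longrightarrow> s \<notin> N \<Longrightarrow>
        (W has_real_derivative lyap_rate (R_shift e) (\<lambda>\<tau>. x (s + \<tau>)) (0\<^sub>v q)) (at s)"
      using solution_lyap_derivative[OF sol] unfolding W_def by blast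
    let ?E = "\<lambda>s. exp (2 * \<alpha> * (s - t0))"
    have E: "(?E has_real_derivative 2 * \<alpha> * ?E s) (at s)" for s
      by (auto intro!: derivative_eq_intros)
    have Wac: "abs_cont_on t0 t W" unfolding W_def by (rule solution_abs_cont[OF sol PP_sym t])
    have Eac: "abs_cont_on t0 t ?E" by (rule abs_cont_on_C1[OF E]) (intro continuous_intros)
    have "?E t * W t \<le> ?E t0 * W t0"
    proof (rule abs_cont_on_nonincreasing[OF _ t N])
      show "abs_cont_on t0 t (\<lambda>s. ?E s * W s)"
        by (intro abs_cont_on_mult Eac Wac abs_cont_on_imp_continuous_on)
      fix s assume s: "s \<in> {t0..t}" "s \<notin> N"
      let ?y = "\<lambda>\<tau>. x (s + \<tau>)"
      have y: "cont_seg ?y" using s by (intro solution_seg[OF sol]) auto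
      let ?F = "?y 0 \<bullet> ?y 0 + (\<Sum>i = 1..nu. energy i ?y)"
      have "2 * \<alpha> * W s \<le> 2 * \<alpha> * (C * ?F)" using up[OF y] W[of s] s \<alpha>(1) by (intro mult_left_mono) auto
      also have "\<dots> = a * ?F" using \<alpha>(2) by (simp add: mult.assoc[symmetric])
      finally have "2 * \<alpha> * W s + lyap_rate (R_shift e) ?y (0\<^sub>v q) \<le> 0" using rate[OF y] by linarith
      then have "?E s * (2 * \<alpha> * W s + lyap_rate (R_shift e) ?y (0\<^sub>v q)) \<le> 0" by (intro mult_nonneg_nonpos) auto
      moreover have "((\<lambda>s. ?E s * W s) has_real_derivative ?E s * (2 * \<alpha> * W s + lyap_rate (R_shift e) ?y (0\<^sub>v q))) (at s)"
        by (rule DERIV_cong[OF DERIV_mult[OF E D]]) (use s in \<open>simp_all add: algebra_simps\<close>)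
      ultimately show "\<exists>D\<le>0. ((\<lambda>s. ?E s * W s) has_real_derivative D) (at s)" by blast
    qed
    then have 1: "?E t * W t \<le> W t0" by simp
    have psi: "\<psi> \<in> CS" using sol by (simp add: is_solution_def)
    have "W t0 = lyap PP Q (R_shift e) \<psi>"
      unfolding W[OF order_refl] by (rule lyap_cong) (use sol in \<open>auto simp: is_solution_def\<close>)
    then have 2: "W t0 \<le> B * (snorm \<psi>)\<^sup>2" using B(2)[OF psi] by simp
    have "l * (vnorm (x t))\<^sup>2 \<le> W t" using low[OF solution_seg[OF sol t]] W[OF t] by (simp add: vnorm_sq)
    then have "?E t * (l * (vnorm (x t))\<^sup>2) \<le> ?E t * W t" by (intro mult_left_mono) auto
    also have "\<dots> \<le> (B + 1) * (snorm \<psi>)\<^sup>2" using 1 2 by (simp add: distrib_right add_increasing2)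
    also have "\<dots> = l * (K * snorm \<psi>)\<^sup>2" using l by (simp add: power_mult_distrib K(2))
    \<comment> \<open>The exponential factor is the inverse square of the decay factor, so inserting
      both changes nothing and the factor cancels against the left-hand side.\<close>
    also have "\<dots> = ?E t * (l * (K * exp (- \<alpha> * (t - t0)) * snorm \<psi>)\<^sup>2)"
      by (simp add: power_mult_distrib power2_eq_square exp_add[symmetric] algebra_simps flip: exp_add)
    finally have "(vnorm (x t))\<^sup>2 \<le> (K * exp (- \<alpha> * (t - t0)) * snorm \<psi>)\<^sup>2" using l by simp
    then show "vnorm (x t) \<le> K * exp (- \<alpha> * (t - t0)) * snorm \<psi>"
      by (rule power2_le_imp_le) (use K(1) snorm_nonneg[OF C_space_cont_seg[OF psi]] in simp)
  qed
qed

end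

theorem theorem3:
  fixes S :: system
  assumes "plant_data S" and "kernel_data S" and "supply_data S"
  shows "(\<forall>U \<in> carrier (unknowns_space S).
      pos_def (four_block_mat (par_P1 U) (par_P2 U) (transpose_mat (par_P2 U)) (par_P3 U) +
        diag_block_mat [0\<^sub>m (dim_x S) (dim_x S),
          diag_upto (num_del S) (\<lambda>i. 1\<^sub>m (dim_f S i) \<otimes>\<^sub>k par_Q U i)]) \<and>
      pos_def (diag_upto (num_del S) (par_Q U)) \<and>
      pos_def (diag_upto (num_del S) (par_R U)) \<and>
      neg_def (Sy (transpose_mat (big_P S U) * big_Pi S U) +
        mat_Phi S (par_P2 U) (par_P3 U) (par_Q U) (par_R U) (mat_Sigma S U)) \<longrightarrow>
      dissipative S U \<and> exp_stable S U)
    \<and> vectorspace class_ring (unknowns_space S)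
    \<and> vectorspace.fin_dim class_ring (unknowns_space S)
    \<and> real (vectorspace.dim class_ring (unknowns_space S)) =
        (0.5 * real (tot_f S) ^ 2 + real (tot_f S) + real (num_del S) + 0.5) * real (dim_x S) ^ 2 +
        (0.5 * real (tot_f S) + 0.5 + real (num_del S) + real (beta S) * real (dim_u S)) * real (dim_x S)"
proof -
  have "dissipative S U \<and> exp_stable S U"
    if "U \<in> carrier (unknowns_space S)"
      "pos_def (four_block_mat (par_P1 U) (par_P2 U) (transpose_mat (par_P2 U)) (par_P3 U) +
        diag_block_mat [0\<^sub>m (dim_x S) (dim_x S),
          diag_upto (num_del S) (\<lambda>i. 1\<^sub>m (dim_f S i) \<otimes>\<^sub>k par_Q U i)])"
      "pos_def (diag_upto (num_del S) (par_Q U))"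
      "pos_def (diag_upto (num_del S) (par_R U))"
      "neg_def (Sy (transpose_mat (big_P S U) * big_Pi S U) +
        mat_Phi S (par_P2 U) (par_P3 U) (par_Q U) (par_R U) (mat_Sigma S U))" for U
  proof -
    interpret dissipative_lmi S U
      by unfold_locales (rule assms that)+
    show ?thesis using dissipative exp_stable by blast
  qed
  then show ?thesis using unknowns_space_dim by blast
qed

end
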